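(* Let $L$ be a field and let $B$ be a central simple algebra with center $L$, of dimension $m^2$ over $L$. If $P$ is a Galois bimodule over $B$, then $P^{m^2}$ is a multiple of $B\otimes_{\mathcal{Z}(P)}B$, i.e. $P^{m^2}\cong (B\otimes_{\mathcal{Z}(P)}B)^r$ as $B$-bimodules for some positive integer $r$.
   Context: For a unital ring $B$, a Galois $B$-bimodule of rank $d\ge 1$ is a $B$-bimodule $P$ which is free of rank $d$ both as a left and as a right $B$-module, and such that $P\otimes_B P\cong P^d$ as $B$-bimodules. The center of $P$ is $\mathcal{Z}(P)=\{z\in B: zx=xz\text{ for all }x\in P\}$; it is contained in the center $L$ of $B$ and is a subfield of $L$. The $B$-bimodule structure on $B\otimes_{\mathcal{Z}(P)}B$ is by left multiplication on the first factor and right multiplication on the second. *)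

theory Defs
  imports "HOL-Algebra.Embedded_Algebras" "HOL-Algebra.Free_Abelian_Groups"
begin

section \<open>Central simple algebras\<close>

definition ring_center :: "('a, 'k) ring_scheme \<Rightarrow> 'a set" where
  "ring_center R = {z \<in> carrier R. \<forall>x \<in> carrier R. z \<otimes>\<^bsub>R\<^esub> x = x \<otimes>\<^bsub>R\<^esub> z}"

text \<open>\<^const>\<open>ideal\<close> is the library's predicate for two-sided ideals.\<close>

locale simple_ring = ring +
  assumes one_not_zero: "\<one> \<noteq> \<zero>"
    and ideal_trivial: "ideal I R \<Longrightarrow> I = {\<zero>} \<or> I = carrier R"

locale central_simple_algebra = simple_ring R for L and R (structure) +
  assumes center_eq: "ring_center R = L"
    and center_subfield: "subfield L R"
    and finite_dim: "finite_dimension L (carrier R)"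

section \<open>Bimodules\<close>

text \<open>The library's \<^locale>\<open>module\<close> is restricted to commutative rings; only its record is used here.
  The inherited components \<^const>\<open>monoid.mult\<close> and \<^const>\<open>one\<close> play no role.\<close>

record ('a, 'b) bimodule = "('a, 'b) module" +
  rsmult :: "'b \<Rightarrow> 'a \<Rightarrow> 'b" (infixl \<open>\<odot>\<^sup>r\<index>\<close> 70)

locale bimodule = R?: ring R + M?: abelian_group M
  for R :: "('a, 'k) ring_scheme" (structure) and M :: "('a, 'b) bimodule" (structure) +
  assumes lsmult_closed: "\<lbrakk>a \<in> carrier R; x \<in> carrier M\<rbrakk> \<Longrightarrow> a \<odot>\<^bsub>M\<^esub> x \<in> carrier M"
    and lsmult_distr_ring: "\<lbrakk>a \<in> carrier R; b \<in> carrier R; x \<in> carrier M\<rbrakk> \<Longrightarrow>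
      (a \<oplus>\<^bsub>R\<^esub> b) \<odot>\<^bsub>M\<^esub> x = a \<odot>\<^bsub>M\<^esub> x \<oplus>\<^bsub>M\<^esub> b \<odot>\<^bsub>M\<^esub> x"
    and lsmult_distr: "\<lbrakk>a \<in> carrier R; x \<in> carrier M; y \<in> carrier M\<rbrakk> \<Longrightarrow>
      a \<odot>\<^bsub>M\<^esub> (x \<oplus>\<^bsub>M\<^esub> y) = a \<odot>\<^bsub>M\<^esub> x \<oplus>\<^bsub>M\<^esub> a \<odot>\<^bsub>M\<^esub> y"
    and lsmult_assoc: "\<lbrakk>a \<in> carrier R; b \<in> carrier R; x \<in> carrier M\<rbrakk> \<Longrightarrow>
      (a \<otimes>\<^bsub>R\<^esub> b) \<odot>\<^bsub>M\<^esub> x = a \<odot>\<^bsub>M\<^esub> (b \<odot>\<^bsub>M\<^esub> x)"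
    and lsmult_one: "x \<in> carrier M \<Longrightarrow> \<one>\<^bsub>R\<^esub> \<odot>\<^bsub>M\<^esub> x = x"
    and rsmult_closed: "\<lbrakk>a \<in> carrier R; x \<in> carrier M\<rbrakk> \<Longrightarrow> x \<odot>\<^sup>r\<^bsub>M\<^esub> a \<in> carrier M"
    and rsmult_distr_ring: "\<lbrakk>a \<in> carrier R; b \<in> carrier R; x \<in> carrier M\<rbrakk> \<Longrightarrow>
      x \<odot>\<^sup>r\<^bsub>M\<^esub> (a \<oplus>\<^bsub>R\<^esub> b) = x \<odot>\<^sup>r\<^bsub>M\<^esub> a \<oplus>\<^bsub>M\<^esub> x \<odot>\<^sup>r\<^bsub>M\<^esub> b"
    and rsmult_distr: "\<lbrakk>a \<in> carrier R; x \<in> carrier M; y \<in> carrier M\<rbrakk> \<Longrightarrow>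
      (x \<oplus>\<^bsub>M\<^esub> y) \<odot>\<^sup>r\<^bsub>M\<^esub> a = x \<odot>\<^sup>r\<^bsub>M\<^esub> a \<oplus>\<^bsub>M\<^esub> y \<odot>\<^sup>r\<^bsub>M\<^esub> a"
    and rsmult_assoc: "\<lbrakk>a \<in> carrier R; b \<in> carrier R; x \<in> carrier M\<rbrakk> \<Longrightarrow>
      x \<odot>\<^sup>r\<^bsub>M\<^esub> (a \<otimes>\<^bsub>R\<^esub> b) = (x \<odot>\<^sup>r\<^bsub>M\<^esub> a) \<odot>\<^sup>r\<^bsub>M\<^esub> b"
    and rsmult_one: "x \<in> carrier M \<Longrightarrow> x \<odot>\<^sup>r\<^bsub>M\<^esub> \<one>\<^bsub>R\<^esub> = x"
    and lsmult_rsmult: "\<lbrakk>a \<in> carrier R; b \<in> carrier R; x \<in> carrier M\<rbrakk> \<Longrightarrow>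
      (a \<odot>\<^bsub>M\<^esub> x) \<odot>\<^sup>r\<^bsub>M\<^esub> b = a \<odot>\<^bsub>M\<^esub> (x \<odot>\<^sup>r\<^bsub>M\<^esub> b)"

definition additive_bij :: "('a, 'b) bimodule \<Rightarrow> ('a, 'c) bimodule \<Rightarrow> ('b \<Rightarrow> 'c) \<Rightarrow> bool" where
  "additive_bij M N h \<longleftrightarrow> bij_betw h (carrier M) (carrier N) \<and>
    (\<forall>x \<in> carrier M. \<forall>y \<in> carrier M. h (x \<oplus>\<^bsub>M\<^esub> y) = h x \<oplus>\<^bsub>N\<^esub> h y)"

definition left_linear ::
  "('a, 'k) ring_scheme \<Rightarrow> ('a, 'b) bimodule \<Rightarrow> ('a, 'c) bimodule \<Rightarrow> ('b \<Rightarrow> 'c) \<Rightarrow> bool" where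
  "left_linear R M N h \<longleftrightarrow>
    (\<forall>a \<in> carrier R. \<forall>x \<in> carrier M. h (a \<odot>\<^bsub>M\<^esub> x) = a \<odot>\<^bsub>N\<^esub> h x)"

definition right_linear ::
  "('a, 'k) ring_scheme \<Rightarrow> ('a, 'b) bimodule \<Rightarrow> ('a, 'c) bimodule \<Rightarrow> ('b \<Rightarrow> 'c) \<Rightarrow> bool" where
  "right_linear R M N h \<longleftrightarrow>
    (\<forall>a \<in> carrier R. \<forall>x \<in> carrier M. h (x \<odot>\<^sup>r\<^bsub>M\<^esub> a) = h x \<odot>\<^sup>r\<^bsub>N\<^esub> a)"

definition left_module_iso ::
  "('a, 'k) ring_scheme \<Rightarrow> ('a, 'b) bimodule \<Rightarrow> ('a, 'c) bimodule \<Rightarrow> bool" where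
  "left_module_iso R M N \<longleftrightarrow> (\<exists>h. additive_bij M N h \<and> left_linear R M N h)"

definition right_module_iso ::
  "('a, 'k) ring_scheme \<Rightarrow> ('a, 'b) bimodule \<Rightarrow> ('a, 'c) bimodule \<Rightarrow> bool" where
  "right_module_iso R M N \<longleftrightarrow> (\<exists>h. additive_bij M N h \<and> right_linear R M N h)"

definition bimodule_iso ::
  "('a, 'k) ring_scheme \<Rightarrow> ('a, 'b) bimodule \<Rightarrow> ('a, 'c) bimodule \<Rightarrow> bool" where
  "bimodule_iso R M N \<longleftrightarrow>
    (\<exists>h. additive_bij M N h \<and> left_linear R M N h \<and> right_linear R M N h)"

definition regular_bimodule :: "('a, 'k) ring_scheme \<Rightarrow> ('a, 'a) bimodule" where
  "regular_bimodule R = \<lparr>carrier = carrier R, monoid.mult = monoid.mult R, one = one R,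
    ring.zero = ring.zero R, add = add R, smult = monoid.mult R, rsmult = monoid.mult R\<rparr>"

text \<open>The direct sum of \<open>n\<close> copies of a bimodule: families indexed by \<open>{..<n}\<close>,
  extensional outside that index set.\<close>

definition bimodule_power :: "('a, 'b) bimodule \<Rightarrow> nat \<Rightarrow> ('a, nat \<Rightarrow> 'b) bimodule" where
  "bimodule_power M n = \<lparr>carrier = {..<n} \<rightarrow>\<^sub>E carrier M, monoid.mult = undefined, one = undefined,
    ring.zero = (\<lambda>i \<in> {..<n}. \<zero>\<^bsub>M\<^esub>), add = (\<lambda>f g. \<lambda>i \<in> {..<n}. f i \<oplus>\<^bsub>M\<^esub> g i),
    smult = (\<lambda>a f. \<lambda>i \<in> {..<n}. a \<odot>\<^bsub>M\<^esub> f i),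
    rsmult = (\<lambda>f a. \<lambda>i \<in> {..<n}. f i \<odot>\<^sup>r\<^bsub>M\<^esub> a)\<rparr>"

lemma (in ring) bimodule_regular: "bimodule R (regular_bimodule R)"
proof -
  have "abelian_group (regular_bimodule R)"
  proof (rule abelian_groupI, goal_cases)
    case (6 x)
    then show ?case by (intro bexI[of _ "\<ominus> x"]) (simp_all add: regular_bimodule_def l_neg)
  qed (simp_all add: regular_bimodule_def add.m_ac)
  then show ?thesis
    by (intro bimodule.intro bimodule_axioms.intro ring_axioms)
      (auto simp: regular_bimodule_def l_distr r_distr m_assoc)
qed

lemma (in bimodule) bimodule_bimodule_power: "bimodule R (bimodule_power M n)"
proof -
  let ?P = "bimodule_power M n"
  have mem: "f i \<in> carrier M" if "f \<in> carrier ?P" "i < n" for f i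
    using that by (auto simp: bimodule_power_def)
  have eqI: "f = g" if "f \<in> carrier ?P" "g \<in> carrier ?P" "\<And>i. i < n \<Longrightarrow> f i = g i" for f g
    using that by (auto simp: bimodule_power_def intro: PiE_ext)
  have add: "(f \<oplus>\<^bsub>?P\<^esub> g) i = f i \<oplus>\<^bsub>M\<^esub> g i" and zero: "\<zero>\<^bsub>?P\<^esub> i = \<zero>\<^bsub>M\<^esub>"
    and l: "(a \<odot>\<^bsub>?P\<^esub> f) i = a \<odot>\<^bsub>M\<^esub> f i" and r: "(f \<odot>\<^sup>r\<^bsub>?P\<^esub> a) i = f i \<odot>\<^sup>r\<^bsub>M\<^esub> a"
    if "i < n" for f g i a
    using that by (simp_all add: bimodule_power_def)
  have add_c: "f \<oplus>\<^bsub>?P\<^esub> g \<in> carrier ?P" if "f \<in> carrier ?P" "g \<in> carrier ?P" for f g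
    using mem[OF that(1)] mem[OF that(2)] by (simp add: bimodule_power_def)
  have zero_c: "\<zero>\<^bsub>?P\<^esub> \<in> carrier ?P" by (simp add: bimodule_power_def)
  have l_c: "a \<odot>\<^bsub>?P\<^esub> f \<in> carrier ?P" and r_c: "f \<odot>\<^sup>r\<^bsub>?P\<^esub> a \<in> carrier ?P"
    if "a \<in> carrier R" "f \<in> carrier ?P" for a f
    using mem[OF that(2)] that(1) by (simp_all add: bimodule_power_def lsmult_closed rsmult_closed)
  note [simp] = mem add zero l r add_c zero_c l_c r_c
  have "abelian_group ?P"
  proof (rule abelian_groupI, goal_cases)
    case (6 f)
    define g where "g = (\<lambda>i \<in> {..<n}. \<ominus>\<^bsub>M\<^esub> f i)"
    have g: "g \<in> carrier ?P" using mem[OF 6] by (simp add: g_def bimodule_power_def)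
    have "g \<oplus>\<^bsub>?P\<^esub> f = \<zero>\<^bsub>?P\<^esub>"
      by (rule eqI) (use 6 g in \<open>simp_all add: g_def M.l_neg\<close>)
    with g show ?case by blast
  qed (simp, simp, (rule eqI; simp add: M.add.m_ac)+)
  then show ?thesis
    by (intro bimodule.intro bimodule_axioms.intro R.ring_axioms)
      ((simp; fail) | rule eqI; simp add: lsmult_distr_ring lsmult_distr lsmult_assoc lsmult_one
        rsmult_distr_ring rsmult_distr rsmult_assoc rsmult_one lsmult_rsmult
        lsmult_closed rsmult_closed)+
qed

definition left_free :: "('a, 'k) ring_scheme \<Rightarrow> ('a, 'b) bimodule \<Rightarrow> nat \<Rightarrow> bool" where
  "left_free R M d \<longleftrightarrow> left_module_iso R (bimodule_power (regular_bimodule R) d) M"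

definition right_free :: "('a, 'k) ring_scheme \<Rightarrow> ('a, 'b) bimodule \<Rightarrow> nat \<Rightarrow> bool" where
  "right_free R M d \<longleftrightarrow> right_module_iso R (bimodule_power (regular_bimodule R) d) M"

section \<open>Tensor products\<close>

text \<open>\<open>M \<otimes>\<^sub>S N\<close> for a subring \<open>S\<close> of the ring acting on both sides of \<open>M\<close> and \<open>N\<close>:
  the free abelian group on pairs modulo biadditivity and
  \<open>x s \<otimes> y = x \<otimes> s y\<close> for \<open>s \<in> S\<close>. The outer actions remain those of the whole ring.\<close>

definition tensor_relations ::
  "'a set \<Rightarrow> ('a, 'b) bimodule \<Rightarrow> ('a, 'c) bimodule \<Rightarrow> ('b \<times> 'c \<Rightarrow>\<^sub>0 int) set" where
  "tensor_relations S M N =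
    {frag_of (x \<oplus>\<^bsub>M\<^esub> x', y) - frag_of (x, y) - frag_of (x', y) | x x' y.
      x \<in> carrier M \<and> x' \<in> carrier M \<and> y \<in> carrier N} \<union>
    {frag_of (x, y \<oplus>\<^bsub>N\<^esub> y') - frag_of (x, y) - frag_of (x, y') | x y y'.
      x \<in> carrier M \<and> y \<in> carrier N \<and> y' \<in> carrier N} \<union>
    {frag_of (x \<odot>\<^sup>r\<^bsub>M\<^esub> s, y) - frag_of (x, s \<odot>\<^bsub>N\<^esub> y) | x s y.
      x \<in> carrier M \<and> s \<in> S \<and> y \<in> carrier N}"

definition tensor_kernel ::
  "'a set \<Rightarrow> ('a, 'b) bimodule \<Rightarrow> ('a, 'c) bimodule \<Rightarrow> ('b \<times> 'c \<Rightarrow>\<^sub>0 int) set" where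
  "tensor_kernel S M N =
    generate (free_Abelian_group (carrier M \<times> carrier N)) (tensor_relations S M N)"

text \<open>The actions are those induced by \<open>a (x \<otimes> y) = a x \<otimes> y\<close> and \<open>(x \<otimes> y) a = x \<otimes> y a\<close>;
  the union ranges over the representatives of a coset, all of which give the same coset
  (see \<open>tensor_smult_coset\<close> and \<open>tensor_rsmult_coset\<close> below).\<close>

definition tensor ::
  "'a set \<Rightarrow> ('a, 'b) bimodule \<Rightarrow> ('a, 'c) bimodule \<Rightarrow> ('a, ('b \<times> 'c \<Rightarrow>\<^sub>0 int) set) bimodule" where
  "tensor S M N =
    (let F = free_Abelian_group (carrier M \<times> carrier N); K = tensor_kernel S M N in
     \<lparr>carrier = carrier (F Mod K), monoid.mult = undefined, one = undefined,
      ring.zero = one (F Mod K), add = monoid.mult (F Mod K),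
      smult = (\<lambda>a C. \<Union>c \<in> C. K #>\<^bsub>F\<^esub> frag_extend (\<lambda>(x, y). frag_of (a \<odot>\<^bsub>M\<^esub> x, y)) c),
      rsmult = (\<lambda>C a. \<Union>c \<in> C. K #>\<^bsub>F\<^esub> frag_extend (\<lambda>(x, y). frag_of (x, y \<odot>\<^sup>r\<^bsub>N\<^esub> a)) c)\<rparr>)"

lemma coset_map_union:
  fixes S :: "'c set" and g :: "('c \<Rightarrow>\<^sub>0 int) \<Rightarrow> ('c \<Rightarrow>\<^sub>0 int)"
  defines "F \<equiv> free_Abelian_group S"
  assumes K: "subgroup K F" and c: "c \<in> carrier F"
    and add: "\<And>x y. g (x + y) = g x + g y"
    and car: "\<And>x. x \<in> carrier F \<Longrightarrow> g x \<in> carrier F" and gK: "g ` K \<subseteq> K"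
  shows "(\<Union>x \<in> K #>\<^bsub>F\<^esub> c. K #>\<^bsub>F\<^esub> g x) = K #>\<^bsub>F\<^esub> g c"
proof -
  interpret F: comm_group F unfolding F_def by (rule abelian_free_Abelian_group)
  have "K #>\<^bsub>F\<^esub> g x = K #>\<^bsub>F\<^esub> g c" if x: "x \<in> K #>\<^bsub>F\<^esub> c" for x
  proof -
    obtain k where k: "k \<in> K" "x = k + c" using x by (auto simp: r_coset_def F_def)
    then have "g x = g k \<otimes>\<^bsub>F\<^esub> g c" by (simp add: add F_def)
    moreover have "g k \<in> K" using k gK by blast
    ultimately have "g x \<in> K #>\<^bsub>F\<^esub> g c" by (auto simp: r_coset_def)
    then show ?thesis using F.repr_independence[OF _ car[OF c] K] by simp
  qed
  moreover have "c \<in> K #>\<^bsub>F\<^esub> c" using F.rcos_self[OF c K] .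
  ultimately show ?thesis by blast
qed

lemma generate_image_subset:
  fixes g :: "('c \<Rightarrow>\<^sub>0 int) \<Rightarrow> ('c \<Rightarrow>\<^sub>0 int)"
  assumes T: "T \<subseteq> carrier (free_Abelian_group S)"
    and add: "\<And>x y. g (x + y) = g x + g y" and gT: "g ` T \<subseteq> T"
  shows "g ` generate (free_Abelian_group S) T \<subseteq> generate (free_Abelian_group S) T"
proof -
  have z: "g 0 = 0" using add[of 0 0] by simp
  have m: "g (- x) = - g x" for x using add[of x "- x"] z by (simp add: eq_neg_iff_add_eq_0 add.commute)
  have "g x \<in> generate (free_Abelian_group S) T" if "x \<in> generate (free_Abelian_group S) T" for x
    using that
  proof induction
    case one
    then show ?case using z generate.one[of "free_Abelian_group S" T] by simp
  next
    case (incl h)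
    then show ?case using gT by (auto intro: generate.incl)
  next
    case (inv h)
    then have "inv\<^bsub>free_Abelian_group S\<^esub> g h \<in> generate (free_Abelian_group S) T"
      using gT by (auto intro: generate.inv)
    moreover have "h \<in> carrier (free_Abelian_group S)" "g h \<in> carrier (free_Abelian_group S)"
      using inv T gT by blast+
    ultimately show ?case by (simp add: m)
  next
    case (eng h1 h2)
    then show ?case using generate.eng[OF eng(3,4)] by (simp add: add)
  qed
  then show ?thesis by blast
qed

locale bimodule_pair = M: bimodule R M + N: bimodule R N
  for R :: "('a, 'k) ring_scheme" and M :: "('a, 'b) bimodule" and N :: "('a, 'c) bimodule" +
  fixes S :: "'a set"
  assumes S: "S \<subseteq> carrier R"
begin

abbreviation F where "F \<equiv> free_Abelian_group (carrier M \<times> carrier N)"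
abbreviation K where "K \<equiv> tensor_kernel S M N"

definition lact :: "'a \<Rightarrow> ('b \<times> 'c \<Rightarrow>\<^sub>0 int) \<Rightarrow> ('b \<times> 'c \<Rightarrow>\<^sub>0 int)" where
  "lact a = frag_extend (\<lambda>(x, y). frag_of (a \<odot>\<^bsub>M\<^esub> x, y))"

definition ract :: "'a \<Rightarrow> ('b \<times> 'c \<Rightarrow>\<^sub>0 int) \<Rightarrow> ('b \<times> 'c \<Rightarrow>\<^sub>0 int)" where
  "ract a = frag_extend (\<lambda>(x, y). frag_of (x, y \<odot>\<^sup>r\<^bsub>N\<^esub> a))"

lemma relations_closed: "tensor_relations S M N \<subseteq> carrier F"
  using S by (auto simp: tensor_relations_def M.rsmult_closed N.lsmult_closed subset_iff
      dest!: subsetD[OF keys_diff])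

lemma kernel_subgroup: "subgroup K F"
  unfolding tensor_kernel_def
  by (rule group.generate_is_subgroup[OF group_free_Abelian_group relations_closed])

lemma lact_closed:
  assumes "a \<in> carrier R" "x \<in> carrier F" shows "lact a x \<in> carrier F"
  using assms keys_frag_extend[of "\<lambda>(x, y). frag_of (a \<odot>\<^bsub>M\<^esub> x, y)" x]
  by (force simp: lact_def M.lsmult_closed)

lemma ract_closed:
  assumes "a \<in> carrier R" "x \<in> carrier F" shows "ract a x \<in> carrier F"
  using assms keys_frag_extend[of "\<lambda>(x, y). frag_of (x, y \<odot>\<^sup>r\<^bsub>N\<^esub> a)" x]
  by (force simp: ract_def N.rsmult_closed)

lemma lact_relations:
  assumes a: "a \<in> carrier R" shows "lact a ` tensor_relations S M N \<subseteq> tensor_relations S M N"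
proof -
  have "lact a t \<in> tensor_relations S M N" if "t \<in> tensor_relations S M N" for t
    using that unfolding tensor_relations_def
  proof (elim UnE CollectE exE conjE, goal_cases)
    case (1 x x' y)
    then show ?case using a
      by (intro UnI1 CollectI exI[of _ "a \<odot>\<^bsub>M\<^esub> x"] exI[of _ "a \<odot>\<^bsub>M\<^esub> x'"] exI[of _ y])
        (simp add: lact_def frag_extend_diff M.lsmult_distr M.lsmult_closed)
  next
    case (2 x y y')
    then show ?case using a
      by (intro UnI1 UnI2 CollectI exI[of _ "a \<odot>\<^bsub>M\<^esub> x"] exI[of _ y] exI[of _ y'])
        (simp add: lact_def frag_extend_diff M.lsmult_closed)
  next
    case (3 x s y)
    then show ?case using a S
      by (intro UnI2 CollectI exI[of _ "a \<odot>\<^bsub>M\<^esub> x"] exI[of _ s] exI[of _ y])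
        (auto simp add: lact_def frag_extend_diff M.lsmult_closed M.lsmult_rsmult)
  qed
  then show ?thesis by blast
qed

lemma ract_relations:
  assumes a: "a \<in> carrier R" shows "ract a ` tensor_relations S M N \<subseteq> tensor_relations S M N"
proof -
  have "ract a t \<in> tensor_relations S M N" if "t \<in> tensor_relations S M N" for t
    using that unfolding tensor_relations_def
  proof (elim UnE CollectE exE conjE, goal_cases)
    case (1 x x' y)
    then show ?case using a
      by (intro UnI1 CollectI exI[of _ x] exI[of _ x'] exI[of _ "y \<odot>\<^sup>r\<^bsub>N\<^esub> a"])
        (simp add: ract_def frag_extend_diff N.rsmult_closed)
  next
    case (2 x y y')
    then show ?case using a
      by (intro UnI1 UnI2 CollectI exI[of _ x] exI[of _ "y \<odot>\<^sup>r\<^bsub>N\<^esub> a"] exI[of _ "y' \<odot>\<^sup>r\<^bsub>N\<^esub> a"])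
        (simp add: ract_def frag_extend_diff N.rsmult_closed N.rsmult_distr)
  next
    case (3 x s y)
    then show ?case using a S
      by (intro UnI2 CollectI exI[of _ x] exI[of _ s] exI[of _ "y \<odot>\<^sup>r\<^bsub>N\<^esub> a"])
        (auto simp add: ract_def frag_extend_diff N.rsmult_closed N.lsmult_rsmult)
  qed
  then show ?thesis by blast
qed

lemma tensor_smult_coset:
  assumes "a \<in> carrier R" "c \<in> carrier F"
  shows "a \<odot>\<^bsub>tensor S M N\<^esub> (K #>\<^bsub>F\<^esub> c) = K #>\<^bsub>F\<^esub> lact a c"
proof -
  have add: "lact a (x + y) = lact a x + lact a y" for x y by (simp add: lact_def frag_extend_add)
  have "lact a ` K \<subseteq> K" unfolding tensor_kernel_def
    by (rule generate_image_subset[OF relations_closed add lact_relations[OF assms(1)]])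
  from coset_map_union[OF kernel_subgroup assms(2) add lact_closed[OF assms(1)] this]
  show ?thesis by (simp add: tensor_def Let_def flip: lact_def)
qed

lemma tensor_rsmult_coset:
  assumes "a \<in> carrier R" "c \<in> carrier F"
  shows "(K #>\<^bsub>F\<^esub> c) \<odot>\<^sup>r\<^bsub>tensor S M N\<^esub> a = K #>\<^bsub>F\<^esub> ract a c"
proof -
  have add: "ract a (x + y) = ract a x + ract a y" for x y by (simp add: ract_def frag_extend_add)
  have "ract a ` K \<subseteq> K" unfolding tensor_kernel_def
    by (rule generate_image_subset[OF relations_closed add ract_relations[OF assms(1)]])
  from coset_map_union[OF kernel_subgroup assms(2) add ract_closed[OF assms(1)] this]
  show ?thesis by (simp add: tensor_def Let_def flip: ract_def)
qed

lemma coset_eqI: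
  assumes "x \<in> carrier F" "y \<in> carrier F" "x - y \<in> K"
  shows "K #>\<^bsub>F\<^esub> x = K #>\<^bsub>F\<^esub> y"
proof -
  have "(x - y) + y \<in> K #>\<^bsub>F\<^esub> y" using assms(3) by (force simp: r_coset_def)
  then have "x \<in> K #>\<^bsub>F\<^esub> y" by simp
  from group.repr_independence[OF group_free_Abelian_group this assms(2) kernel_subgroup]
  show ?thesis by simp
qed

lemma kernel_diff: "x \<in> K \<Longrightarrow> y \<in> K \<Longrightarrow> x - y \<in> K"
  using subgroup.m_closed[OF kernel_subgroup, of x "- y"]
    subgroup.m_inv_closed[OF kernel_subgroup, of y] subgroup.mem_carrier[OF kernel_subgroup, of y]
  by simp

lemma relation_in_kernel: "t \<in> tensor_relations S M N \<Longrightarrow> t \<in> K"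
  unfolding tensor_kernel_def by (rule generate.incl)

lemma lact_add_scalar:
  assumes a: "a \<in> carrier R" "b \<in> carrier R" and c: "c \<in> carrier F"
  shows "lact (a \<oplus>\<^bsub>R\<^esub> b) c - (lact a c + lact b c) \<in> K"
  using c[unfolded carrier_free_Abelian_group_iff]
proof (elim free_Abelian_group_induct[where x = c], goal_cases)
  case 1
  show ?case using subgroup.one_closed[OF kernel_subgroup] by (simp add: lact_def)
next
  case (2 x y)
  then show ?case using kernel_diff[OF 2(3,4)] by (simp add: lact_def frag_extend_diff algebra_simps)
next
  case (3 p)
  obtain x y where p: "p = (x, y)" by fastforce
  have "frag_of (a \<odot>\<^bsub>M\<^esub> x \<oplus>\<^bsub>M\<^esub> b \<odot>\<^bsub>M\<^esub> x, y) - frag_of (a \<odot>\<^bsub>M\<^esub> x, y) - frag_of (b \<odot>\<^bsub>M\<^esub> x, y)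
      \<in> tensor_relations S M N"
    using a 3 p unfolding tensor_relations_def
    by (intro UnI1 CollectI exI[of _ "a \<odot>\<^bsub>M\<^esub> x"] exI[of _ "b \<odot>\<^bsub>M\<^esub> x"] exI[of _ y])
      (simp add: M.lsmult_closed)
  from relation_in_kernel[OF this] show ?case
    using a 3 p by (simp add: lact_def M.lsmult_distr_ring diff_diff_eq)
qed

lemma ract_add_scalar:
  assumes a: "a \<in> carrier R" "b \<in> carrier R" and c: "c \<in> carrier F"
  shows "ract (a \<oplus>\<^bsub>R\<^esub> b) c - (ract a c + ract b c) \<in> K"
  using c[unfolded carrier_free_Abelian_group_iff]
proof (elim free_Abelian_group_induct[where x = c], goal_cases)
  case 1
  show ?case using subgroup.one_closed[OF kernel_subgroup] by (simp add: ract_def)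
next
  case (2 x y)
  then show ?case using kernel_diff[OF 2(3,4)] by (simp add: ract_def frag_extend_diff algebra_simps)
next
  case (3 p)
  obtain x y where p: "p = (x, y)" by fastforce
  have "frag_of (x, y \<odot>\<^sup>r\<^bsub>N\<^esub> a \<oplus>\<^bsub>N\<^esub> y \<odot>\<^sup>r\<^bsub>N\<^esub> b) - frag_of (x, y \<odot>\<^sup>r\<^bsub>N\<^esub> a) - frag_of (x, y \<odot>\<^sup>r\<^bsub>N\<^esub> b)
      \<in> tensor_relations S M N"
    using a 3 p unfolding tensor_relations_def
    by (intro UnI1 UnI2 CollectI exI[of _ x] exI[of _ "y \<odot>\<^sup>r\<^bsub>N\<^esub> a"] exI[of _ "y \<odot>\<^sup>r\<^bsub>N\<^esub> b"])
      (simp add: N.rsmult_closed)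
  from relation_in_kernel[OF this] show ?case
    using a 3 p by (simp add: ract_def N.rsmult_distr_ring diff_diff_eq)
qed

lemma extension_eq:
  fixes f g :: "('b \<times> 'c \<Rightarrow>\<^sub>0 int) \<Rightarrow> ('b \<times> 'c \<Rightarrow>\<^sub>0 int)"
  assumes c: "c \<in> carrier F" and "\<And>x y. f (x - y) = f x - f y" "\<And>x y. g (x - y) = g x - g y"
    and "\<And>x y. x \<in> carrier M \<Longrightarrow> y \<in> carrier N \<Longrightarrow> f (frag_of (x, y)) = g (frag_of (x, y))"
  shows "f c = g c"
  using c[unfolded carrier_free_Abelian_group_iff]
proof (elim free_Abelian_group_induct[where x = c], goal_cases)
  case 1
  show ?case using assms(2,3)[of 0 0] by simp
qed (auto simp: assms(2-4))

lemma act_eq: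
  assumes c: "c \<in> carrier F"
  shows "lact \<one>\<^bsub>R\<^esub> c = c" and "ract \<one>\<^bsub>R\<^esub> c = c"
    and "\<lbrakk>a \<in> carrier R; b \<in> carrier R\<rbrakk> \<Longrightarrow> lact (a \<otimes>\<^bsub>R\<^esub> b) c = lact a (lact b c)"
    and "\<lbrakk>a \<in> carrier R; b \<in> carrier R\<rbrakk> \<Longrightarrow> ract (a \<otimes>\<^bsub>R\<^esub> b) c = ract b (ract a c)"
    and "ract b (lact a c) = lact a (ract b c)"
  by (rule extension_eq[OF c]; simp add: lact_def ract_def frag_extend_diff M.lsmult_one
      N.rsmult_one M.lsmult_assoc N.rsmult_assoc)+

theorem bimodule_tensor: "bimodule R (tensor S M N)"
proof -
  let ?T = "tensor S M N" and ?q = "\<lambda>c. K #>\<^bsub>F\<^esub> c"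
  interpret F: comm_group F by (rule abelian_free_Abelian_group)
  interpret K: normal K F using F.normal_iff_subgroup kernel_subgroup by blast
  have carr: "carrier ?T = ?q ` carrier F"
    by (simp add: tensor_def Let_def carrier_FactGroup)
  have add: "?q x \<oplus>\<^bsub>?T\<^esub> ?q y = ?q (x + y)" if "x \<in> carrier F" "y \<in> carrier F" for x y
    using K.rcos_sum[OF that] by (simp add: tensor_def Let_def)
  have addc: "x + y \<in> carrier F" if "x \<in> carrier F" "y \<in> carrier F" for x y
    using F.m_closed[OF that] by simp
  note smult = tensor_smult_coset tensor_rsmult_coset
  have l_add: "lact a (x + y) = lact a x + lact a y" for a x y
    by (simp add: lact_def frag_extend_add)
  have r_add: "ract a (x + y) = ract a x + ract a y" for a x y
    by (simp add: ract_def frag_extend_add)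
  have grp: "comm_group (F Mod K)" by (rule F.abelian_FactGroup[OF kernel_subgroup])
  have T: "carrier ?T = carrier (F Mod K)" "add ?T = monoid.mult (F Mod K)"
      "\<zero>\<^bsub>?T\<^esub> = \<one>\<^bsub>F Mod K\<^esub>"
    by (simp_all add: tensor_def Let_def)
  interpret Q: comm_group "F Mod K" by (rule grp)
  have "abelian_group ?T"
  proof (rule abelian_groupI, goal_cases)
    case (6 x)
    then show ?case using Q.l_inv_ex[of x] unfolding T by blast
  qed (unfold T, (intro Q.m_closed Q.one_closed Q.m_assoc Q.m_comm Q.l_one; assumption)+)
  moreover have "?q (lact (a \<oplus>\<^bsub>R\<^esub> b) c) = ?q (lact a c + lact b c)"
      "?q (ract (a \<oplus>\<^bsub>R\<^esub> b) c) = ?q (ract a c + ract b c)"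
    if "a \<in> carrier R" "b \<in> carrier R" "c \<in> carrier F" for a b c
    by (intro coset_eqI lact_add_scalar ract_add_scalar lact_closed ract_closed addc
        M.R.add.m_closed that)+
  then have "bimodule_axioms R ?T"
    unfolding bimodule_axioms_def carr
    by (auto simp del: carrier_free_Abelian_group_iff
      simp: lact_closed ract_closed addc smult add act_eq l_add r_add)
  ultimately show ?thesis by (intro bimodule.intro M.R.ring_axioms)
qed

end

section \<open>Galois bimodules\<close>

definition bimodule_center :: "('a, 'k) ring_scheme \<Rightarrow> ('a, 'b) bimodule \<Rightarrow> 'a set" where
  "bimodule_center R M = {z \<in> carrier R. \<forall>x \<in> carrier M. z \<odot>\<^bsub>M\<^esub> x = x \<odot>\<^sup>r\<^bsub>M\<^esub> z}"

locale galois_bimodule = bimodule R M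
  for R :: "('a, 'k) ring_scheme" (structure) and M :: "('a, 'b) bimodule" (structure)
    and d :: nat +
  assumes rank_pos: "1 \<le> d"
    and left_free: "left_free R M d"
    and right_free: "right_free R M d"
    and tensor_self: "bimodule_iso R (tensor (carrier R) M M) (bimodule_power M d)"

end

theory Submission
  imports Defs
begin

text \<open>Let \<open>K\<close> be the center of the Galois bimodule \<open>P\<close> over the central simple algebra \<open>B\<close>, and let
  \<open>A = B \<otimes>\<^sub>K B\<close>. The idea is to show that \<open>P\<close> and \<open>A\<close> have the same indecomposable summands in the
  same proportions, and then to determine the proportion by counting bimodule maps to \<open>B\<close>.

  The matrix coefficients of \<open>P\<close> provide the link between \<open>P\<close> and \<open>K\<close>. They are the sums of maps
  \<open>y \<mapsto> \<xi> (p y)\<close> on \<open>B\<close> with \<open>p \<in> P\<close> and \<open>\<xi>\<close> a left linear map from \<open>P\<close> to \<open>B\<close>. Compositions of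
  coefficients are coefficients of the tensor product, so \<open>P \<otimes>\<^sub>B P \<cong> P\<^sup>d\<close> makes them closed under
  composition (\<open>coef_P_comp\<close>). Finitely many elements of \<open>B\<close> separate them
  (\<open>finite_separating_set\<close>), and a smallest set of such elements turns out to be a basis of \<open>B\<close>
  over \<open>K\<close> whose coordinate functions are coefficients (\<open>exists_dual_basis\<close>). In particular
  \<open>B\<close> has finite dimension over \<open>K\<close>.

  Next, let \<open>M\<close> be a bimodule on which \<open>K\<close> acts centrally and that has all these coordinate
  functions among its coefficients. A Casimir element \<open>\<Sum>\<^sub>x x \<otimes> v\<^sub>x\<close> of \<open>A\<close> turns each left linear \<open>\<xi>\<close>
  into a bimodule map \<open>p \<mapsto> \<Sum>\<^sub>x \<xi> (p x) \<otimes> v\<^sub>x\<close> from \<open>M\<close> to \<open>A\<close>, and since \<open>B\<close> is simple, the images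
  of such maps generate \<open>A\<close>. As endomorphism rings of indecomposables are local, every
  indecomposable summand of \<open>A\<close> is then a summand of \<open>M\<close> (\<open>indec_summand_of_coef\<close>). In particular
  this holds for \<open>M = P\<close>.

  Comparing multiplicities, one can write \<open>P\<^sup>v \<cong> A\<^sup>u \<oplus> Y\<close> with \<open>u, v > 0\<close> such that some
  indecomposable summand of \<open>A\<close> does not occur in \<open>Y\<close> (\<open>exists_exhausted_summand\<close>). Tensoring with \<open>P\<close>
  turns \<open>P\<^sup>v\<close> into \<open>P\<^sup>v\<^sup>d\<close> and \<open>A\<close> into \<open>A\<^sup>d\<close>, the latter because \<open>B \<otimes>\<^sub>K P \<cong> A\<^sup>d\<close> as \<open>P\<close> is right free.
  By cancellation \<open>Y \<otimes>\<^sub>B P \<cong> Y\<^sup>d\<close>. If \<open>Y\<close> were nonzero, some coefficient of \<open>Y\<close> would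
  fix \<open>1\<close>, so the coordinate functions would be coefficients of \<open>Y \<otimes>\<^sub>B P\<close>, and every indecomposable summand
  of \<open>A\<close> would occur in \<open>Y\<^sup>d\<close>, hence in \<open>Y\<close> (\<open>indec_summand_of_complement\<close>). So \<open>Y = 0\<close> and \<open>P\<^sup>v \<cong> A\<^sup>u\<close>.

  Finally, bimodule maps from \<open>A\<close> to \<open>B\<close> correspond to elements of \<open>B\<close>, of which there is an
  \<open>m\<^sup>2\<close>-dimensional space over \<open>L\<close>. Hence \<open>v\<close> times the dimension of the space of bimodule maps
  \<open>P \<rightarrow> B\<close> is \<open>u w\<close> with \<open>w = m\<^sup>2\<close>; let \<open>r\<close> be this dimension. So \<open>v r = u w\<close>, the \<open>v\<close>-th powers of
  \<open>P\<^sup>w\<close> and \<open>A\<^sup>r\<close> are isomorphic, and by the uniqueness of roots (\<open>dpow_root\<close>) so are \<open>P\<^sup>w\<close> and \<open>A\<^sup>r\<close>.\<close>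

section \<open>Abelian groups with operators\<close>

text \<open>Left modules, right modules, bimodules and vector spaces over a subring all use the same record
  and differ only in which scalars count as operators: \<open>Inl a\<close> acts from the left and
  \<open>Inr a\<close> from the right. Submodules, direct sums and the Krull--Schmidt theorem
  depend only on the additivity of the operators, so they are developed once for an arbitrary
  set \<open>\<Omega>\<close> of operators.\<close>

definition act :: "('a, 'b) bimodule \<Rightarrow> 'a + 'a \<Rightarrow> 'b \<Rightarrow> 'b" where
  "act M s x = (case s of Inl a \<Rightarrow> a \<odot>\<^bsub>M\<^esub> x | Inr a \<Rightarrow> x \<odot>\<^sup>r\<^bsub>M\<^esub> a)"

lemma act_simps [simp]: "act M (Inl a) x = a \<odot>\<^bsub>M\<^esub> x" "act M (Inr a) x = x \<odot>\<^sup>r\<^bsub>M\<^esub> a"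
  by (simp_all add: act_def)

locale opmod = abelian_group M for \<Omega> :: "('a + 'a) set" and M :: "('a, 'b) bimodule" (structure) +
  assumes act_closed [simp]: "s \<in> \<Omega> \<Longrightarrow> x \<in> carrier M \<Longrightarrow> act M s x \<in> carrier M"
    and act_add: "s \<in> \<Omega> \<Longrightarrow> x \<in> carrier M \<Longrightarrow> y \<in> carrier M \<Longrightarrow>
      act M s (x \<oplus> y) = act M s x \<oplus> act M s y"
begin

lemma act_zero: assumes "s \<in> \<Omega>" shows "act M s \<zero> = \<zero>"
proof -
  have "act M s \<zero> \<oplus> act M s \<zero> = act M s \<zero>" using act_add[OF assms, of \<zero> \<zero>] by simp
  then show ?thesis using act_closed[OF assms zero_closed] by simp
qed

lemma act_neg: assumes "s \<in> \<Omega>" "x \<in> carrier M" shows "act M s (\<ominus> x) = \<ominus> act M s x"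
proof -
  have "act M s (\<ominus> x) \<oplus> act M s x = \<zero>"
    using act_add[OF assms(1), of "\<ominus> x" x] assms by (simp add: l_neg act_zero)
  then show ?thesis using assms by (simp add: minus_equality)
qed

lemma diff_zero_iff: "x \<in> carrier M \<Longrightarrow> y \<in> carrier M \<Longrightarrow> x \<oplus> \<ominus> y = \<zero> \<longleftrightarrow> x = y"
  using add.inv_solve_right'[of \<zero> x y] by auto

lemma neg_add_cancel: "x \<in> carrier M \<Longrightarrow> y \<in> carrier M \<Longrightarrow> x \<oplus> \<ominus> y \<oplus> y = x"
  by (simp add: a_assoc l_neg)

lemma opmod_mono: "\<Omega>' \<subseteq> \<Omega> \<Longrightarrow> opmod \<Omega>' M"
  by unfold_locales (auto simp: act_add)

end

lemma opmodI:
  assumes "abelian_group M"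
    and "\<And>s x. s \<in> \<Omega> \<Longrightarrow> x \<in> carrier M \<Longrightarrow> act M s x \<in> carrier M"
    and "\<And>s x y. s \<in> \<Omega> \<Longrightarrow> x \<in> carrier M \<Longrightarrow> y \<in> carrier M \<Longrightarrow>
      act M s (x \<oplus>\<^bsub>M\<^esub> y) = act M s x \<oplus>\<^bsub>M\<^esub> act M s y"
  shows "opmod \<Omega> M"
  using assms by (simp add: opmod_def opmod_axioms_def)

lemma opmod_ab: "opmod \<Omega> M \<Longrightarrow> abelian_group M"
  by (simp add: opmod_def)

subsection \<open>Homomorphisms\<close>

definition mor :: "('a + 'a) set \<Rightarrow> ('a, 'b) bimodule \<Rightarrow> ('a, 'c) bimodule \<Rightarrow> ('b \<Rightarrow> 'c) \<Rightarrow> bool" where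
  "mor \<Omega> M N f \<longleftrightarrow> f \<in> carrier M \<rightarrow> carrier N \<and>
    (\<forall>x \<in> carrier M. \<forall>y \<in> carrier M. f (x \<oplus>\<^bsub>M\<^esub> y) = f x \<oplus>\<^bsub>N\<^esub> f y) \<and>
    (\<forall>s \<in> \<Omega>. \<forall>x \<in> carrier M. f (act M s x) = act N s (f x))"

definition mod_iso :: "('a, 'b) bimodule \<Rightarrow> ('a + 'a) set \<Rightarrow> ('a, 'c) bimodule \<Rightarrow> bool"
    (\<open>_ \<simeq>\<^bsub>_\<^esub> _\<close> [51, 0, 51] 50) where
  "M \<simeq>\<^bsub>\<Omega>\<^esub> N \<longleftrightarrow> (\<exists>f. mor \<Omega> M N f \<and> bij_betw f (carrier M) (carrier N))"

definition summand :: "('a, 'b) bimodule \<Rightarrow> ('a + 'a) set \<Rightarrow> ('a, 'c) bimodule \<Rightarrow> bool"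
    (\<open>_ \<unlhd>\<^bsub>_\<^esub> _\<close> [51, 0, 51] 50) where
  "M \<unlhd>\<^bsub>\<Omega>\<^esub> N \<longleftrightarrow> (\<exists>f g. mor \<Omega> M N f \<and> mor \<Omega> N M g \<and> (\<forall>x \<in> carrier M. g (f x) = x))"

lemma morI:
  assumes "\<And>x. x \<in> carrier M \<Longrightarrow> f x \<in> carrier N"
    and "\<And>x y. x \<in> carrier M \<Longrightarrow> y \<in> carrier M \<Longrightarrow> f (x \<oplus>\<^bsub>M\<^esub> y) = f x \<oplus>\<^bsub>N\<^esub> f y"
    and "\<And>s x. s \<in> \<Omega> \<Longrightarrow> x \<in> carrier M \<Longrightarrow> f (act M s x) = act N s (f x)"
  shows "mor \<Omega> M N f"
  using assms by (auto simp: mor_def)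

lemma
  assumes "mor \<Omega> M N f" "x \<in> carrier M"
  shows mor_closed: "f x \<in> carrier N"
    and mor_add: "y \<in> carrier M \<Longrightarrow> f (x \<oplus>\<^bsub>M\<^esub> y) = f x \<oplus>\<^bsub>N\<^esub> f y"
    and mor_act: "s \<in> \<Omega> \<Longrightarrow> f (act M s x) = act N s (f x)"
  using assms by (auto simp: mor_def)

lemma mor_zero:
  assumes "mor \<Omega> M N f" "abelian_group M" "abelian_group N" shows "f \<zero>\<^bsub>M\<^esub> = \<zero>\<^bsub>N\<^esub>"
proof -
  interpret M: abelian_group M by fact
  interpret N: abelian_group N by fact
  have "f \<zero>\<^bsub>M\<^esub> \<oplus>\<^bsub>N\<^esub> f \<zero>\<^bsub>M\<^esub> = f \<zero>\<^bsub>M\<^esub>" using mor_add[OF assms(1), of "\<zero>\<^bsub>M\<^esub>" "\<zero>\<^bsub>M\<^esub>"] by simp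
  then show ?thesis using mor_closed[OF assms(1) M.zero_closed] by simp
qed

lemma mor_neg:
  assumes "mor \<Omega> M N f" "abelian_group M" "abelian_group N" "x \<in> carrier M"
  shows "f (\<ominus>\<^bsub>M\<^esub> x) = \<ominus>\<^bsub>N\<^esub> f x"
proof -
  interpret M: abelian_group M by fact
  interpret N: abelian_group N by fact
  have "f (\<ominus>\<^bsub>M\<^esub> x) \<oplus>\<^bsub>N\<^esub> f x = \<zero>\<^bsub>N\<^esub>"
    using mor_add[OF assms(1), of "\<ominus>\<^bsub>M\<^esub> x" x] assms(4) mor_zero[OF assms(1-3)] by (simp add: M.l_neg)
  then show ?thesis using assms(4) mor_closed[OF assms(1)] by (simp add: N.minus_equality)
qed

lemma mor_finsum:
  assumes "mor \<Omega> M N f" "abelian_group M" "abelian_group N" "g \<in> I \<rightarrow> carrier M"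
  shows "f (finsum M g I) = finsum N (\<lambda>i. f (g i)) I"
proof -
  interpret M: abelian_group M by fact
  interpret N: abelian_group N by fact
  show ?thesis using assms(4)
  proof (induction I rule: infinite_finite_induct)
    case (insert i I)
    then have "g i \<in> carrier M" "g \<in> I \<rightarrow> carrier M" by auto
    moreover have "(\<lambda>i. f (g i)) \<in> I \<rightarrow> carrier N" "f (g i) \<in> carrier N"
      using insert.prems mor_closed[OF assms(1)] by auto
    ultimately show ?case using insert by (simp add: mor_add[OF assms(1)])
  qed (simp_all add: mor_zero[OF assms(1-3)] M.finsum_infinite N.finsum_infinite)
qed

lemma mor_id: "mor \<Omega> M M (\<lambda>x. x)"
  by (simp add: mor_def)

lemma mor_comp: "mor \<Omega> M N f \<Longrightarrow> mor \<Omega> N Q g \<Longrightarrow> mor \<Omega> M Q (\<lambda>x. g (f x))"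
  by (auto simp: mor_def Pi_iff)

lemma mor_mono: "mor \<Omega> M N f \<Longrightarrow> \<Omega>' \<subseteq> \<Omega> \<Longrightarrow> mor \<Omega>' M N f"
  by (auto simp: mor_def)

lemma mor_const_zero: assumes "opmod \<Omega> N" shows "mor \<Omega> M N (\<lambda>x. \<zero>\<^bsub>N\<^esub>)"
proof -
  interpret N: opmod \<Omega> N by fact
  show ?thesis by (rule morI) (simp_all add: N.act_zero)
qed

lemma mor_plus:
  assumes N: "opmod \<Omega> N" and f: "mor \<Omega> M N f" and g: "mor \<Omega> M N g"
  shows "mor \<Omega> M N (\<lambda>x. f x \<oplus>\<^bsub>N\<^esub> g x)"
proof -
  interpret N: opmod \<Omega> N by fact
  show ?thesis
  proof (rule morI, goal_cases)
    case (2 x y)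
    then show ?case using mor_closed[OF f] mor_closed[OF g]
      by (simp add: mor_add[OF f] mor_add[OF g] N.a_ac)
  qed (auto simp: mor_closed[OF f] mor_closed[OF g] mor_act[OF f] mor_act[OF g] N.act_add)
qed

lemma mor_uminus:
  assumes N: "opmod \<Omega> N" and f: "mor \<Omega> M N f"
  shows "mor \<Omega> M N (\<lambda>x. \<ominus>\<^bsub>N\<^esub> f x)"
proof -
  interpret N: opmod \<Omega> N by fact
  show ?thesis
    by (rule morI) (auto simp: mor_closed[OF f] mor_add[OF f] mor_act[OF f] N.act_neg N.minus_add)
qed

lemma mor_inv:
  assumes f: "mor \<Omega> M N f" "bij_betw f (carrier M) (carrier N)" and M: "opmod \<Omega> M"
  obtains g where "mor \<Omega> N M g" "bij_betw g (carrier N) (carrier M)"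
    "\<And>x. x \<in> carrier M \<Longrightarrow> g (f x) = x" "\<And>y. y \<in> carrier N \<Longrightarrow> f (g y) = y"
proof
  interpret M: opmod \<Omega> M by fact
  let ?g = "the_inv_into (carrier M) f"
  have inj: "inj_on f (carrier M)" and im: "f ` carrier M = carrier N"
    using f(2) by (auto simp: bij_betw_def)
  show gf: "?g (f x) = x" if "x \<in> carrier M" for x using inj that by (rule the_inv_into_f_f)
  show fg: "f (?g y) = y" if "y \<in> carrier N" for y using inj that im by (simp add: f_the_inv_into_f)
  show bij: "bij_betw ?g (carrier N) (carrier M)" using f(2) by (rule bij_betw_the_inv_into)
  then have gc: "?g y \<in> carrier M" if "y \<in> carrier N" for y using that by (auto simp: bij_betw_def)
  show "mor \<Omega> N M ?g"
  proof (rule morI, goal_cases)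
    case (2 x y)
    have "f (?g x \<oplus>\<^bsub>M\<^esub> ?g y) = x \<oplus>\<^bsub>N\<^esub> y" using 2 by (simp add: mor_add[OF f(1)] gc fg)
    then show ?case using gf[of "?g x \<oplus>\<^bsub>M\<^esub> ?g y"] 2 gc by simp
  next
    case (3 s y)
    have "f (act M s (?g y)) = act N s y" using 3 by (simp add: mor_act[OF f(1)] gc fg)
    then show ?case using gf[of "act M s (?g y)"] 3 gc by simp
  qed (rule gc)
qed

lemma bij_mor_witness:
  assumes f: "mor \<Omega> M N f" and g: "\<And>y. y \<in> carrier N \<Longrightarrow> g y \<in> carrier M"
    and "\<And>x. x \<in> carrier M \<Longrightarrow> g (f x) = x" "\<And>y. y \<in> carrier N \<Longrightarrow> f (g y) = y"
  shows "M \<simeq>\<^bsub>\<Omega>\<^esub> N"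
  unfolding mod_iso_def using assms mor_closed[OF f]
  by (intro exI[of _ f] conjI bij_betw_byWitness[where f' = g]) auto

lemma mor_bijI:
  assumes f: "mor \<Omega> M N f" and "abelian_group M" "abelian_group N"
    and inj: "\<And>x. x \<in> carrier M \<Longrightarrow> f x = \<zero>\<^bsub>N\<^esub> \<Longrightarrow> x = \<zero>\<^bsub>M\<^esub>"
    and surj: "\<And>y. y \<in> carrier N \<Longrightarrow> \<exists>x \<in> carrier M. f x = y"
  shows "bij_betw f (carrier M) (carrier N)"
proof -
  interpret M: abelian_group M by fact
  interpret N: abelian_group N by fact
  have "inj_on f (carrier M)"
  proof (rule inj_onI)
    fix x y assume xy: "x \<in> carrier M" "y \<in> carrier M" "f x = f y"
    then have "f (x \<oplus>\<^bsub>M\<^esub> \<ominus>\<^bsub>M\<^esub> y) = \<zero>\<^bsub>N\<^esub>"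
      using mor_closed[OF f] by (simp add: mor_add[OF f] mor_neg[OF f assms(2,3)] N.r_neg)
    then have "x \<oplus>\<^bsub>M\<^esub> \<ominus>\<^bsub>M\<^esub> y = \<zero>\<^bsub>M\<^esub>" using inj xy by simp
    then show "x = y" using xy M.add.inv_solve_right'[of "\<zero>\<^bsub>M\<^esub>" x y] by simp
  qed
  moreover have "f ` carrier M = carrier N" using mor_closed[OF f] surj by blast
  ultimately show ?thesis by (simp add: bij_betw_def)
qed

lemma iso_refl [simp]: "M \<simeq>\<^bsub>\<Omega>\<^esub> M"
  unfolding mod_iso_def using mor_id[of \<Omega> M] bij_betw_id[of "carrier M"] by (auto simp: id_def)

lemma iso_sym: "opmod \<Omega> M \<Longrightarrow> M \<simeq>\<^bsub>\<Omega>\<^esub> N \<Longrightarrow> N \<simeq>\<^bsub>\<Omega>\<^esub> M"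
  unfolding mod_iso_def by (elim exE conjE, rule mor_inv) blast+

lemma iso_trans [trans]:
  assumes "M \<simeq>\<^bsub>\<Omega>\<^esub> N" "N \<simeq>\<^bsub>\<Omega>\<^esub> Q" shows "M \<simeq>\<^bsub>\<Omega>\<^esub> Q"
proof -
  obtain f g where "mor \<Omega> M N f" "bij_betw f (carrier M) (carrier N)"
    "mor \<Omega> N Q g" "bij_betw g (carrier N) (carrier Q)"
    using assms unfolding mod_iso_def by blast
  then show ?thesis unfolding mod_iso_def
    by (intro exI[of _ "g \<circ> f"] conjI bij_betw_trans) (auto dest: mor_comp simp: comp_def)
qed

lemma summand_refl [simp]: "M \<unlhd>\<^bsub>\<Omega>\<^esub> M"
  unfolding summand_def using mor_id[of \<Omega> M] by auto

lemma summand_trans [trans]: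
  assumes "M \<unlhd>\<^bsub>\<Omega>\<^esub> N" "N \<unlhd>\<^bsub>\<Omega>\<^esub> Q" shows "M \<unlhd>\<^bsub>\<Omega>\<^esub> Q"
proof -
  obtain f g where fg: "mor \<Omega> M N f" "mor \<Omega> N M g" "\<forall>x \<in> carrier M. g (f x) = x"
    using assms(1) unfolding summand_def by blast
  obtain f' g' where fg': "mor \<Omega> N Q f'" "mor \<Omega> Q N g'" "\<forall>x \<in> carrier N. g' (f' x) = x"
    using assms(2) unfolding summand_def by blast
  show ?thesis unfolding summand_def
    by (rule exI[of _ "\<lambda>x. f' (f x)"], rule exI[of _ "\<lambda>x. g (g' x)"])
      (use fg fg' mor_closed[OF fg(1)] in \<open>auto intro: mor_comp\<close>)
qed

lemma iso_summand: "opmod \<Omega> M \<Longrightarrow> M \<simeq>\<^bsub>\<Omega>\<^esub> N \<Longrightarrow> M \<unlhd>\<^bsub>\<Omega>\<^esub> N"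
  unfolding mod_iso_def summand_def by (elim exE conjE, rule mor_inv) blast+

lemma iso_summand': "opmod \<Omega> M \<Longrightarrow> M \<simeq>\<^bsub>\<Omega>\<^esub> N \<Longrightarrow> N \<unlhd>\<^bsub>\<Omega>\<^esub> M"
  unfolding mod_iso_def summand_def by (elim exE conjE, rule mor_inv) blast+

subsection \<open>Submodules, direct sums and powers\<close>

definition submod :: "('a + 'a) set \<Rightarrow> ('a, 'b) bimodule \<Rightarrow> 'b set \<Rightarrow> bool" where
  "submod \<Omega> M U \<longleftrightarrow> U \<subseteq> carrier M \<and> \<zero>\<^bsub>M\<^esub> \<in> U \<and> (\<forall>x \<in> U. \<forall>y \<in> U. x \<oplus>\<^bsub>M\<^esub> y \<in> U) \<and>
    (\<forall>x \<in> U. \<ominus>\<^bsub>M\<^esub> x \<in> U) \<and> (\<forall>s \<in> \<Omega>. \<forall>x \<in> U. act M s x \<in> U)"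

definition sub :: "('a, 'b) bimodule \<Rightarrow> 'b set \<Rightarrow> ('a, 'b) bimodule" where
  "sub M U = M\<lparr>carrier := U\<rparr>"

lemma sub_simps [simp]: "carrier (sub M U) = U" "\<zero>\<^bsub>sub M U\<^esub> = \<zero>\<^bsub>M\<^esub>"
  "x \<oplus>\<^bsub>sub M U\<^esub> y = x \<oplus>\<^bsub>M\<^esub> y" "act (sub M U) s x = act M s x" "sub (sub M U) V = sub M V"
  "a \<odot>\<^bsub>sub M U\<^esub> x = a \<odot>\<^bsub>M\<^esub> x" "x \<odot>\<^sup>r\<^bsub>sub M U\<^esub> a = x \<odot>\<^sup>r\<^bsub>M\<^esub> a"
  "sub M (carrier M) = M"
  by (simp_all add: sub_def act_def split: sum.split)

lemma submodD:
  assumes "submod \<Omega> M U"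
  shows "x \<in> U \<Longrightarrow> x \<in> carrier M" "\<zero>\<^bsub>M\<^esub> \<in> U" "x \<in> U \<Longrightarrow> y \<in> U \<Longrightarrow> x \<oplus>\<^bsub>M\<^esub> y \<in> U"
    "x \<in> U \<Longrightarrow> \<ominus>\<^bsub>M\<^esub> x \<in> U" "s \<in> \<Omega> \<Longrightarrow> x \<in> U \<Longrightarrow> act M s x \<in> U"
  using assms by (auto simp: submod_def)

lemma sub_abelian_group:
  assumes "abelian_group M" "submod \<Omega> M U" shows "abelian_group (sub M U)"
proof -
  interpret M: abelian_group M by fact
  note D = submodD[OF assms(2)]
  show ?thesis
  proof (rule abelian_groupI, goal_cases)
    case (6 x)
    then show ?case using D by (intro bexI[of _ "\<ominus>\<^bsub>M\<^esub> x"]) (auto simp: M.l_neg)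
  qed (use D in \<open>auto simp: M.a_ac\<close>)
qed

lemma opmod_sub: assumes "opmod \<Omega> M" "submod \<Omega> M U" shows "opmod \<Omega> (sub M U)"
proof -
  interpret M: opmod \<Omega> M by fact
  show ?thesis using submodD[OF assms(2)]
    by (intro opmodI sub_abelian_group[OF opmod_ab[OF assms(1)] assms(2)]) (auto simp: M.act_add)
qed

lemma sub_neg:
  assumes "abelian_group M" "submod \<Omega> M U" "x \<in> U" shows "\<ominus>\<^bsub>sub M U\<^esub> x = \<ominus>\<^bsub>M\<^esub> x"
proof -
  interpret M: abelian_group M by fact
  interpret U: abelian_group "sub M U" by (rule sub_abelian_group[OF assms(1,2)])
  show ?thesis using submodD[OF assms(2)] assms(3) by (intro U.minus_equality) (auto simp: M.l_neg)
qed

lemma submod_sub_iff: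
  assumes "abelian_group M" "submod \<Omega> M U"
  shows "submod \<Omega> (sub M U) V \<longleftrightarrow> submod \<Omega> M V \<and> V \<subseteq> U"
  using sub_neg[OF assms] submodD(1)[OF assms(2)] unfolding submod_def by (auto simp: subset_iff)

lemma submod_carrier: "opmod \<Omega> M \<Longrightarrow> submod \<Omega> M (carrier M)"
proof -
  assume "opmod \<Omega> M" then interpret opmod \<Omega> M .
  show ?thesis by (auto simp: submod_def)
qed

lemma submod_zero: "opmod \<Omega> M \<Longrightarrow> submod \<Omega> M {\<zero>\<^bsub>M\<^esub>}"
proof -
  assume "opmod \<Omega> M" then interpret opmod \<Omega> M .
  show ?thesis by (auto simp: submod_def act_zero)
qed

lemma submod_image:
  assumes f: "mor \<Omega> M N f" and M: "opmod \<Omega> M" and N: "opmod \<Omega> N" and U: "submod \<Omega> M U"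
  shows "submod \<Omega> N (f ` U)"
proof -
  note D = submodD[OF U] and fz = mor_zero[OF f opmod_ab[OF M] opmod_ab[OF N]]
    and fn = mor_neg[OF f opmod_ab[OF M] opmod_ab[OF N]]
  have "f x \<oplus>\<^bsub>N\<^esub> f y \<in> f ` U" if "x \<in> U" "y \<in> U" for x y
    using that D mor_add[OF f, of x y] by (metis image_eqI)
  moreover have "\<ominus>\<^bsub>N\<^esub> f x \<in> f ` U" if "x \<in> U" for x using that D fn[of x] by (metis image_eqI)
  moreover have "act N s (f x) \<in> f ` U" if "x \<in> U" "s \<in> \<Omega>" for x s
    using that D mor_act[OF f, of x s] by (metis image_eqI)
  moreover have "\<zero>\<^bsub>N\<^esub> \<in> f ` U" using fz D(2) by (metis image_eqI)
  ultimately show ?thesis using D(1) mor_closed[OF f] by (auto simp: submod_def)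
qed

lemma submod_vimage:
  assumes f: "mor \<Omega> M N f" and M: "opmod \<Omega> M" and N: "opmod \<Omega> N" and U: "submod \<Omega> N U"
  shows "submod \<Omega> M {x \<in> carrier M. f x \<in> U}"
proof -
  interpret M: opmod \<Omega> M by fact
  note D = submodD[OF U] and fz = mor_zero[OF f opmod_ab[OF M] opmod_ab[OF N]]
    and fn = mor_neg[OF f opmod_ab[OF M] opmod_ab[OF N]]
  show ?thesis using D fz fn by (auto simp: submod_def mor_add[OF f] mor_act[OF f])
qed

lemma submod_ker:
  assumes "mor \<Omega> M N f" "opmod \<Omega> M" "opmod \<Omega> N"
  shows "submod \<Omega> M {x \<in> carrier M. f x = \<zero>\<^bsub>N\<^esub>}"
  using submod_vimage[OF assms submod_zero[OF assms(3)]] by simp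

lemma submod_Int:
  "submod \<Omega> M U \<Longrightarrow> submod \<Omega> M V \<Longrightarrow> submod \<Omega> M (U \<inter> V)"
  by (auto simp: submod_def)

definition dsum :: "('a, 'b) bimodule \<Rightarrow> ('a, 'c) bimodule \<Rightarrow> ('a, 'b \<times> 'c) bimodule"
    (infixr \<open>\<oplus>\<^sub>d\<close> 66) where
  "M \<oplus>\<^sub>d N = \<lparr>carrier = carrier M \<times> carrier N, monoid.mult = undefined, one = undefined,
    ring.zero = (\<zero>\<^bsub>M\<^esub>, \<zero>\<^bsub>N\<^esub>), add = (\<lambda>x y. (fst x \<oplus>\<^bsub>M\<^esub> fst y, snd x \<oplus>\<^bsub>N\<^esub> snd y)),
    smult = (\<lambda>a x. (a \<odot>\<^bsub>M\<^esub> fst x, a \<odot>\<^bsub>N\<^esub> snd x)),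
    rsmult = (\<lambda>x a. (fst x \<odot>\<^sup>r\<^bsub>M\<^esub> a, snd x \<odot>\<^sup>r\<^bsub>N\<^esub> a))\<rparr>"

lemma dsum_simps [simp]: "carrier (M \<oplus>\<^sub>d N) = carrier M \<times> carrier N"
  "\<zero>\<^bsub>M \<oplus>\<^sub>d N\<^esub> = (\<zero>\<^bsub>M\<^esub>, \<zero>\<^bsub>N\<^esub>)"
  "x \<oplus>\<^bsub>M \<oplus>\<^sub>d N\<^esub> y = (fst x \<oplus>\<^bsub>M\<^esub> fst y, snd x \<oplus>\<^bsub>N\<^esub> snd y)"
  "act (M \<oplus>\<^sub>d N) s x = (act M s (fst x), act N s (snd x))"
  by (simp_all add: dsum_def act_def split: sum.split)

lemma opmod_dsum: assumes "opmod \<Omega> M" "opmod \<Omega> N" shows "opmod \<Omega> (M \<oplus>\<^sub>d N)"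
proof -
  interpret M: opmod \<Omega> M by fact
  interpret N: opmod \<Omega> N by fact
  have "abelian_group (M \<oplus>\<^sub>d N)"
  proof (rule abelian_groupI, goal_cases)
    case (6 x)
    then show ?case
      by (intro bexI[of _ "(\<ominus>\<^bsub>M\<^esub> fst x, \<ominus>\<^bsub>N\<^esub> snd x)"]) (auto simp: M.l_neg N.l_neg)
  qed (auto simp: M.a_ac N.a_ac)
  then show ?thesis by (rule opmodI) (auto simp: M.act_add N.act_add)
qed

text \<open>The power over an arbitrary index set; for \<^term>\<open>{..<n::nat}\<close> it is \<^const>\<open>bimodule_power\<close>.
  Other index sets occur because bases are indexed by whatever sets are at hand.\<close>

definition ipow :: "('a, 'b) bimodule \<Rightarrow> 'i set \<Rightarrow> ('a, 'i \<Rightarrow> 'b) bimodule" where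
  "ipow M I = \<lparr>carrier = I \<rightarrow>\<^sub>E carrier M, monoid.mult = undefined, one = undefined,
    ring.zero = (\<lambda>i \<in> I. \<zero>\<^bsub>M\<^esub>), add = (\<lambda>f g. \<lambda>i \<in> I. f i \<oplus>\<^bsub>M\<^esub> g i),
    smult = (\<lambda>a f. \<lambda>i \<in> I. a \<odot>\<^bsub>M\<^esub> f i),
    rsmult = (\<lambda>f a. \<lambda>i \<in> I. f i \<odot>\<^sup>r\<^bsub>M\<^esub> a)\<rparr>"

lemma bimodule_power_eq: "bimodule_power M n = ipow M {..<n}"
  by (simp add: ipow_def bimodule_power_def)

lemma ipow_simps [simp]: "carrier (ipow M I) = I \<rightarrow>\<^sub>E carrier M"
  "\<zero>\<^bsub>ipow M I\<^esub> = (\<lambda>i \<in> I. \<zero>\<^bsub>M\<^esub>)"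
  "f \<oplus>\<^bsub>ipow M I\<^esub> g = (\<lambda>i \<in> I. f i \<oplus>\<^bsub>M\<^esub> g i)"
  "act (ipow M I) s f = (\<lambda>i \<in> I. act M s (f i))"
  by (simp_all add: ipow_def act_def split: sum.split)

lemma abelian_group_funs:
  assumes "abelian_group M" and "carrier Q = I \<rightarrow>\<^sub>E carrier M" "\<zero>\<^bsub>Q\<^esub> = (\<lambda>i \<in> I. \<zero>\<^bsub>M\<^esub>)"
    "\<And>f g. f \<oplus>\<^bsub>Q\<^esub> g = (\<lambda>i \<in> I. f i \<oplus>\<^bsub>M\<^esub> g i)"
  shows "abelian_group Q"
proof -
  interpret M: abelian_group M by fact
  have c: "f \<in> carrier Q \<Longrightarrow> i \<in> I \<Longrightarrow> f i \<in> carrier M" for f i using assms(2) by auto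
  have e: "f \<in> carrier Q \<Longrightarrow> (\<lambda>i \<in> I. f i) = f" for f
    using assms(2) by (auto intro: extensional_restrict PiE_ext)
  show ?thesis
  proof (rule abelian_groupI, goal_cases)
    case (6 f)
    then show ?case
      by (intro bexI[of _ "\<lambda>i \<in> I. \<ominus>\<^bsub>M\<^esub> f i"])
        (use c assms(2-4) in \<open>auto simp: M.l_neg intro!: restrict_ext\<close>)
  next
    case (5 f) then show ?case using c e[OF 5] by (simp add: assms(3,4) cong: restrict_cong)
  qed (use c assms(2-4) in \<open>auto simp: M.a_ac intro!: restrict_ext\<close>)
qed

lemma opmod_ipow: assumes "opmod \<Omega> M" shows "opmod \<Omega> (ipow M I)"
proof -
  interpret M: opmod \<Omega> M by fact
  have "abelian_group (ipow M I)"
    by (rule abelian_group_funs[OF opmod_ab[OF assms]]) simp_all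
  then show ?thesis by (rule opmodI) (auto simp: M.act_add PiE_iff intro!: restrict_ext)
qed

subsection \<open>The calculus of direct sums\<close>

lemma dsum_cong:
  assumes "M \<simeq>\<^bsub>\<Omega>\<^esub> M'" "N \<simeq>\<^bsub>\<Omega>\<^esub> N'" shows "M \<oplus>\<^sub>d N \<simeq>\<^bsub>\<Omega>\<^esub> M' \<oplus>\<^sub>d N'"
proof -
  obtain f g where f: "mor \<Omega> M M' f" "bij_betw f (carrier M) (carrier M')"
    and g: "mor \<Omega> N N' g" "bij_betw g (carrier N) (carrier N')"
    using assms unfolding mod_iso_def by blast
  have "mor \<Omega> (M \<oplus>\<^sub>d N) (M' \<oplus>\<^sub>d N') (map_prod f g)"
    by (rule morI) (auto simp: mor_closed[OF f(1)] mor_closed[OF g(1)] mor_add[OF f(1)]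
        mor_add[OF g(1)] mor_act[OF f(1)] mor_act[OF g(1)])
  moreover have "bij_betw (map_prod f g) (carrier (M \<oplus>\<^sub>d N)) (carrier (M' \<oplus>\<^sub>d N'))"
    using f(2) g(2) by (simp add: bij_betw_def map_prod_inj_on map_prod_surj_on)
  ultimately show ?thesis unfolding mod_iso_def by blast
qed

lemma dsum_comm: "M \<oplus>\<^sub>d N \<simeq>\<^bsub>\<Omega>\<^esub> N \<oplus>\<^sub>d M"
  by (rule bij_mor_witness[where f = prod.swap and g = prod.swap]) (auto intro!: morI)

lemma dsum_assoc: "(M \<oplus>\<^sub>d N) \<oplus>\<^sub>d Q \<simeq>\<^bsub>\<Omega>\<^esub> M \<oplus>\<^sub>d (N \<oplus>\<^sub>d Q)"
  by (rule bij_mor_witness[where f = "\<lambda>((x, y), z). (x, y, z)" and g = "\<lambda>(x, y, z). ((x, y), z)"])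
    (auto intro!: morI)

lemma dsum_zero:
  assumes "opmod \<Omega> M" "opmod \<Omega> N" "carrier M = {\<zero>\<^bsub>M\<^esub>}" shows "M \<oplus>\<^sub>d N \<simeq>\<^bsub>\<Omega>\<^esub> N"
proof -
  interpret M: opmod \<Omega> M by fact
  show ?thesis
    by (rule bij_mor_witness[where f = snd and g = "\<lambda>y. (\<zero>\<^bsub>M\<^esub>, y)"])
      (use assms(3) in \<open>auto intro!: morI\<close>)
qed

lemma dsum_shuffle:
  assumes "opmod \<Omega> M" "opmod \<Omega> N" "opmod \<Omega> Q" "opmod \<Omega> S"
  shows "(M \<oplus>\<^sub>d N) \<oplus>\<^sub>d (Q \<oplus>\<^sub>d S) \<simeq>\<^bsub>\<Omega>\<^esub> (M \<oplus>\<^sub>d Q) \<oplus>\<^sub>d (N \<oplus>\<^sub>d S)"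
  by (rule bij_mor_witness[where f = "\<lambda>((x, y), (z, w)). ((x, z), (y, w))"
        and g = "\<lambda>((x, y), (z, w)). ((x, z), (y, w))"]) (auto intro!: morI)

lemma ipow_cong: assumes "M \<simeq>\<^bsub>\<Omega>\<^esub> N" "opmod \<Omega> M" shows "ipow M I \<simeq>\<^bsub>\<Omega>\<^esub> ipow N I"
proof -
  interpret M: opmod \<Omega> M by fact
  obtain f where f: "mor \<Omega> M N f" "bij_betw f (carrier M) (carrier N)"
    using assms unfolding mod_iso_def by blast
  obtain g where g: "mor \<Omega> N M g" "\<And>x. x \<in> carrier M \<Longrightarrow> g (f x) = x" "\<And>y. y \<in> carrier N \<Longrightarrow> f (g y) = y"
    using mor_inv[OF f assms(2)] by metis
  note c = mor_closed[OF f(1)] mor_closed[OF g(1)]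
  show ?thesis
  proof (rule bij_mor_witness[where f = "\<lambda>x. \<lambda>i \<in> I. f (x i)" and g = "\<lambda>x. \<lambda>i \<in> I. g (x i)"], goal_cases)
    case 1
    show ?case
      by (rule morI)
        (auto simp: PiE_iff c mor_add[OF f(1)] mor_act[OF f(1)] intro!: restrict_ext)
  next
    case (2 y) then show ?case using c by auto
  next
    case (3 x) then show ?case using g(2) c by (intro PiE_ext[OF _ 3[simplified]]) (auto simp: PiE_iff)
  next
    case (4 y) then show ?case using g(3) c by (intro PiE_ext[OF _ 4[simplified]]) (auto simp: PiE_iff)
  qed
qed

lemma ipow_empty: "carrier (ipow M {}) = {\<zero>\<^bsub>ipow M {}\<^esub>}"
  by auto

lemma ipow_insert:
  assumes "i \<notin> I" shows "ipow M (insert i I) \<simeq>\<^bsub>\<Omega>\<^esub> M \<oplus>\<^sub>d ipow M I"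
proof (rule bij_mor_witness[where f = "\<lambda>f. (f i, restrict f I)" and g = "\<lambda>(x, f). f(i := x)"], goal_cases)
  case 1
  show ?case by (rule morI) (auto simp: assms intro!: restrict_ext)
next
  case (2 y) then show ?case by (auto simp: PiE_def extensional_def)
next
  case (3 f) then show ?case by (auto simp: PiE_def extensional_def fun_eq_iff)
next
  case (4 y) then show ?case using assms by (auto simp: PiE_def extensional_def fun_eq_iff)
qed

abbreviation dpow :: "('a, 'b) bimodule \<Rightarrow> nat \<Rightarrow> ('a, nat \<Rightarrow> 'b) bimodule"
    (infixr \<open>^\<^sub>d\<close> 80) where
  "M ^\<^sub>d n \<equiv> ipow M {..<n}"

lemma dpow_Suc: "M ^\<^sub>d Suc n \<simeq>\<^bsub>\<Omega>\<^esub> M \<oplus>\<^sub>d M ^\<^sub>d n"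
  using ipow_insert[of n "{..<n}"] by (simp add: lessThan_Suc)

lemma dpow_zero: "carrier (M ^\<^sub>d 0) = {\<zero>\<^bsub>M ^\<^sub>d 0\<^esub>}"
  using ipow_empty[of M] by (metis lessThan_0)

lemma zero_iso:
  assumes "opmod \<Omega> M" "opmod \<Omega> N" "carrier M = {\<zero>\<^bsub>M\<^esub>}" "carrier N = {\<zero>\<^bsub>N\<^esub>}"
  shows "M \<simeq>\<^bsub>\<Omega>\<^esub> N"
proof -
  interpret M: opmod \<Omega> M by fact
  interpret N: opmod \<Omega> N by fact
  show ?thesis
    by (rule bij_mor_witness[OF mor_const_zero[OF assms(2)], where g = "\<lambda>x. \<zero>\<^bsub>M\<^esub>"]) (use assms in auto)
qed

lemma dpow_add:
  assumes M: "opmod \<Omega> M" shows "M ^\<^sub>d (k + l) \<simeq>\<^bsub>\<Omega>\<^esub> M ^\<^sub>d k \<oplus>\<^sub>d M ^\<^sub>d l"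
proof (induction k)
  case 0
  have "M ^\<^sub>d 0 \<oplus>\<^sub>d M ^\<^sub>d l \<simeq>\<^bsub>\<Omega>\<^esub> M ^\<^sub>d l" by (rule dsum_zero[OF _ _ dpow_zero]) (rule opmod_ipow[OF M])+
  then have "M ^\<^sub>d l \<simeq>\<^bsub>\<Omega>\<^esub> M ^\<^sub>d 0 \<oplus>\<^sub>d M ^\<^sub>d l" by (rule iso_sym[rotated]) (intro opmod_dsum opmod_ipow M)
  then show ?case by simp
next
  case (Suc k)
  have "M ^\<^sub>d (Suc k + l) \<simeq>\<^bsub>\<Omega>\<^esub> M \<oplus>\<^sub>d M ^\<^sub>d (k + l)" using dpow_Suc by simp
  also have "\<dots> \<simeq>\<^bsub>\<Omega>\<^esub> M \<oplus>\<^sub>d (M ^\<^sub>d k \<oplus>\<^sub>d M ^\<^sub>d l)" by (rule dsum_cong[OF iso_refl Suc])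
  also have "\<dots> \<simeq>\<^bsub>\<Omega>\<^esub> (M \<oplus>\<^sub>d M ^\<^sub>d k) \<oplus>\<^sub>d M ^\<^sub>d l"
    by (rule iso_sym[OF _ dsum_assoc]) (intro opmod_dsum opmod_ipow M)
  also have "\<dots> \<simeq>\<^bsub>\<Omega>\<^esub> M ^\<^sub>d Suc k \<oplus>\<^sub>d M ^\<^sub>d l"
    by (rule dsum_cong[OF iso_sym[OF _ dpow_Suc] iso_refl]) (intro opmod_ipow M)
  finally show ?case .
qed

lemma dpow_mult:
  assumes M: "opmod \<Omega> M" shows "(M ^\<^sub>d k) ^\<^sub>d l \<simeq>\<^bsub>\<Omega>\<^esub> M ^\<^sub>d (l * k)"
proof (induction l)
  case 0
  have "(M ^\<^sub>d k) ^\<^sub>d 0 \<simeq>\<^bsub>\<Omega>\<^esub> M ^\<^sub>d 0"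
    by (rule zero_iso[OF _ _ dpow_zero dpow_zero]) (intro opmod_ipow M)+
  then show ?case by simp
next
  case (Suc l)
  have "(M ^\<^sub>d k) ^\<^sub>d Suc l \<simeq>\<^bsub>\<Omega>\<^esub> M ^\<^sub>d k \<oplus>\<^sub>d (M ^\<^sub>d k) ^\<^sub>d l" by (rule dpow_Suc)
  also have "\<dots> \<simeq>\<^bsub>\<Omega>\<^esub> M ^\<^sub>d k \<oplus>\<^sub>d M ^\<^sub>d (l * k)" by (rule dsum_cong[OF iso_refl Suc])
  also have "\<dots> \<simeq>\<^bsub>\<Omega>\<^esub> M ^\<^sub>d (k + l * k)"
    by (rule iso_sym[OF _ dpow_add[OF M]]) (rule opmod_ipow[OF M])
  finally show ?case by simp
qed

lemma dpow_dsum: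
  assumes M: "opmod \<Omega> M" and N: "opmod \<Omega> N"
  shows "(M \<oplus>\<^sub>d N) ^\<^sub>d k \<simeq>\<^bsub>\<Omega>\<^esub> M ^\<^sub>d k \<oplus>\<^sub>d N ^\<^sub>d k"
proof (induction k)
  case 0
  show ?case
    by (rule zero_iso) (use dpow_zero in \<open>auto intro!: opmod_dsum opmod_ipow M N\<close>)
next
  case (Suc k)
  have "(M \<oplus>\<^sub>d N) ^\<^sub>d Suc k \<simeq>\<^bsub>\<Omega>\<^esub> (M \<oplus>\<^sub>d N) \<oplus>\<^sub>d (M \<oplus>\<^sub>d N) ^\<^sub>d k" by (rule dpow_Suc)
  also have "\<dots> \<simeq>\<^bsub>\<Omega>\<^esub> (M \<oplus>\<^sub>d N) \<oplus>\<^sub>d (M ^\<^sub>d k \<oplus>\<^sub>d N ^\<^sub>d k)" by (rule dsum_cong[OF iso_refl Suc])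
  also have "\<dots> \<simeq>\<^bsub>\<Omega>\<^esub> (M \<oplus>\<^sub>d M ^\<^sub>d k) \<oplus>\<^sub>d (N \<oplus>\<^sub>d N ^\<^sub>d k)"
    by (rule dsum_shuffle) (intro opmod_ipow M N)+
  also have "\<dots> \<simeq>\<^bsub>\<Omega>\<^esub> M ^\<^sub>d Suc k \<oplus>\<^sub>d N ^\<^sub>d Suc k"
    by (intro dsum_cong iso_sym[OF _ dpow_Suc] opmod_ipow M N)
  finally show ?case .
qed

lemma summand_dsum: assumes "opmod \<Omega> M" "opmod \<Omega> N"
  shows "M \<unlhd>\<^bsub>\<Omega>\<^esub> M \<oplus>\<^sub>d N" "N \<unlhd>\<^bsub>\<Omega>\<^esub> M \<oplus>\<^sub>d N"
proof -
  interpret M: opmod \<Omega> M by fact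
  interpret N: opmod \<Omega> N by fact
  show "M \<unlhd>\<^bsub>\<Omega>\<^esub> M \<oplus>\<^sub>d N" unfolding summand_def
    by (intro exI[of _ "\<lambda>x. (x, \<zero>\<^bsub>N\<^esub>)"] exI[of _ fst]) (auto intro!: morI simp: N.act_zero)
  show "N \<unlhd>\<^bsub>\<Omega>\<^esub> M \<oplus>\<^sub>d N" unfolding summand_def
    by (intro exI[of _ "\<lambda>x. (\<zero>\<^bsub>M\<^esub>, x)"] exI[of _ snd]) (auto intro!: morI simp: M.act_zero)
qed

lemma summand_dsum_mono:
  assumes "M \<unlhd>\<^bsub>\<Omega>\<^esub> M'" "N \<unlhd>\<^bsub>\<Omega>\<^esub> N'" shows "M \<oplus>\<^sub>d N \<unlhd>\<^bsub>\<Omega>\<^esub> M' \<oplus>\<^sub>d N'"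
proof -
  obtain f g where f: "mor \<Omega> M M' f" "mor \<Omega> M' M g" "\<forall>x \<in> carrier M. g (f x) = x"
    using assms(1) unfolding summand_def by blast
  obtain f' g' where f': "mor \<Omega> N N' f'" "mor \<Omega> N' N g'" "\<forall>x \<in> carrier N. g' (f' x) = x"
    using assms(2) unfolding summand_def by blast
  have "mor \<Omega> (M \<oplus>\<^sub>d N) (M' \<oplus>\<^sub>d N') (map_prod f f')" "mor \<Omega> (M' \<oplus>\<^sub>d N') (M \<oplus>\<^sub>d N) (map_prod g g')"
    by (rule morI; use f f' in \<open>auto simp: mor_def\<close>)+
  then show ?thesis unfolding summand_def using f(3) f'(3)
    by (intro exI[of _ "map_prod f f'"] exI[of _ "map_prod g g'"]) auto
qed

lemma summand_complement:
  assumes "opmod \<Omega> M" "opmod \<Omega> N" and f: "mor \<Omega> M N f" and g: "mor \<Omega> N M g"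
    and gf: "\<And>x. x \<in> carrier M \<Longrightarrow> g (f x) = x"
  shows "N \<simeq>\<^bsub>\<Omega>\<^esub> M \<oplus>\<^sub>d sub N {x \<in> carrier N. g x = \<zero>\<^bsub>M\<^esub>}"
proof -
  interpret M: opmod \<Omega> M by fact
  interpret N: opmod \<Omega> N by fact
  define r where "r x = x \<oplus>\<^bsub>N\<^esub> \<ominus>\<^bsub>N\<^esub> f (g x)" for x
  have fg: "mor \<Omega> N N (\<lambda>x. f (g x))" by (rule mor_comp[OF g f])
  have r: "mor \<Omega> N N r" unfolding r_def by (rule mor_plus[OF assms(2) mor_id mor_uminus[OF assms(2) fg]])
  note c = mor_closed[OF f] mor_closed[OF g] mor_closed[OF r]
  have gr: "g (r x) = \<zero>\<^bsub>M\<^esub>" if "x \<in> carrier N" for x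
    using that by (simp add: r_def mor_add[OF g] c mor_neg[OF g N.abelian_group_axioms M.abelian_group_axioms] gf M.r_neg)
  show ?thesis
  proof (rule bij_mor_witness[where f = "\<lambda>x. (g x, r x)" and g = "\<lambda>(y, z). z \<oplus>\<^bsub>N\<^esub> f y"], goal_cases)
    case 1
    show ?case
      by (rule morI) (simp_all add: c gr mor_add[OF g] mor_add[OF r] mor_act[OF g] mor_act[OF r]
          del: act_simps)
  next
    case (4 y)
    then obtain a b where y: "y = (a, b)" "a \<in> carrier M" "b \<in> carrier N" "g b = \<zero>\<^bsub>M\<^esub>" by auto
    then show ?case by (simp add: r_def c mor_add[OF g] gf N.a_assoc N.r_neg)
  qed (auto simp: c, auto simp: r_def c N.neg_add_cancel)
qed

section \<open>The Krull--Schmidt theorem\<close>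

subsection \<open>Finite length\<close>

text \<open>Instead of composition series, the length of a module is bounded by any function on its
  submodules that is strictly monotone, as the length itself would be.\<close>

definition len_le :: "('a + 'a) set \<Rightarrow> ('a, 'b) bimodule \<Rightarrow> nat \<Rightarrow> bool" where
  "len_le \<Omega> M n \<longleftrightarrow> (\<exists>\<phi> :: 'b set \<Rightarrow> nat.
    (\<forall>U V. submod \<Omega> M U \<longrightarrow> submod \<Omega> M V \<longrightarrow> U \<subset> V \<longrightarrow> \<phi> U < \<phi> V) \<and> \<phi> (carrier M) \<le> n)"

definition finite_length :: "('a + 'a) set \<Rightarrow> ('a, 'b) bimodule \<Rightarrow> bool" where
  "finite_length \<Omega> M \<longleftrightarrow> (\<exists>n. len_le \<Omega> M n)"

lemma finite_length_iff: "finite_length \<Omega> M \<longleftrightarrow> (\<exists>\<phi> :: 'b set \<Rightarrow> nat.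
    \<forall>U V. submod \<Omega> M U \<longrightarrow> submod \<Omega> M V \<longrightarrow> U \<subset> V \<longrightarrow> \<phi> U < \<phi> V)"
  for M :: "('a, 'b) bimodule"
proof -
  have "(\<exists>n f. P f \<and> f (carrier M) \<le> n) \<longleftrightarrow> (\<exists>f. P f)" for P :: "('b set \<Rightarrow> nat) \<Rightarrow> bool"
    by (meson le_refl)
  then show ?thesis unfolding finite_length_def len_le_def .
qed

lemma finite_lengthI:
  fixes \<phi> :: "'b set \<Rightarrow> nat"
  assumes "\<And>U V. submod \<Omega> M U \<Longrightarrow> submod \<Omega> M V \<Longrightarrow> U \<subset> V \<Longrightarrow> \<phi> U < \<phi> V"
  shows "finite_length \<Omega> M"
  unfolding finite_length_iff using assms by (intro exI[of _ \<phi>] allI impI)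

lemma finite_lengthE:
  fixes M :: "('a, 'b) bimodule"
  assumes "finite_length \<Omega> M"
  obtains \<phi> :: "'b set \<Rightarrow> nat"
    where "\<And>U V. submod \<Omega> M U \<Longrightarrow> submod \<Omega> M V \<Longrightarrow> U \<subset> V \<Longrightarrow> \<phi> U < \<phi> V"
proof -
  obtain \<phi> :: "'b set \<Rightarrow> nat"
    where "\<forall>U V. submod \<Omega> M U \<longrightarrow> submod \<Omega> M V \<longrightarrow> U \<subset> V \<longrightarrow> \<phi> U < \<phi> V"
    using assms unfolding finite_length_iff ..
  then show thesis by (intro that[of \<phi>]) simp
qed

lemma strict_imp_mono: "(A \<subset> B \<Longrightarrow> \<phi> A < \<phi> B) \<Longrightarrow> A \<subseteq> B \<Longrightarrow> \<phi> A \<le> (\<phi> B :: nat)"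
  by (cases "A = B") (simp_all add: psubset_eq)

lemma finite_length_transfer:
  assumes "finite_length \<Omega>' N" "\<And>U. submod \<Omega> M U \<Longrightarrow> submod \<Omega>' N U"
  shows "finite_length \<Omega> M"
  using finite_lengthE[OF assms(1)] assms(2) finite_lengthI by metis

text \<open>The second part is what makes induction on the length possible: a proper submodule has a
  smaller bound.\<close>

lemma len_le_inj:
  assumes f: "mor \<Omega> M N f" and inj: "inj_on f (carrier M)" and M: "opmod \<Omega> M" and N: "opmod \<Omega> N"
    and len: "len_le \<Omega> N n"
  shows "len_le \<Omega> M n" and "f ` carrier M \<noteq> carrier N \<Longrightarrow> 0 < n \<and> len_le \<Omega> M (n - 1)"
proof -
  obtain \<phi> :: "'c set \<Rightarrow> nat" where \<phi>: "\<And>U V. submod \<Omega> N U \<Longrightarrow> submod \<Omega> N V \<Longrightarrow> U \<subset> V \<Longrightarrow> \<phi> U < \<phi> V"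
    and n: "\<phi> (carrier N) \<le> n"
    using len unfolding len_le_def by blast
  have im: "submod \<Omega> N (f ` carrier M)" "f ` carrier M \<subseteq> carrier N"
    using submod_image[OF f M N submod_carrier[OF M]] by (auto dest: submodD(1))
  have strict: "\<phi> (f ` U) < \<phi> (f ` V)" if "submod \<Omega> M U" "submod \<Omega> M V" "U \<subset> V" for U V
  proof (rule \<phi>)
    have "U \<subseteq> carrier M" "V \<subseteq> carrier M" using that(1,2) by (auto simp: submod_def)
    then show "f ` U \<subset> f ` V" using that(3) inj_on_image_eq_iff[OF inj, of U V] by auto
  qed (use that in \<open>auto intro: submod_image[OF f M N]\<close>)
  have le: "\<phi> (f ` carrier M) \<le> n"
  proof (cases "f ` carrier M = carrier N")
    case False
    then show ?thesis using \<phi>[OF im(1) submod_carrier[OF N]] im(2) n by force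
  qed (use n in simp)
  then show "len_le \<Omega> M n" unfolding len_le_def using strict by (intro exI[of _ "\<lambda>U. \<phi> (f ` U)"]) blast
  assume "f ` carrier M \<noteq> carrier N"
  then have "\<phi> (f ` carrier M) < n" using \<phi>[OF im(1) submod_carrier[OF N]] im(2) n by force
  then show "0 < n \<and> len_le \<Omega> M (n - 1)"
    unfolding len_le_def using strict by (intro conjI exI[of _ "\<lambda>U. \<phi> (f ` U)"]) auto
qed

lemma finite_length_inj:
  assumes "mor \<Omega> M N f" "inj_on f (carrier M)" "opmod \<Omega> M" "opmod \<Omega> N" "finite_length \<Omega> N"
  shows "finite_length \<Omega> M"
  using assms len_le_inj(1) unfolding finite_length_def by metis

lemma summand_mors:
  assumes "M \<unlhd>\<^bsub>\<Omega>\<^esub> N"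
  obtains f g where "mor \<Omega> M N f" "inj_on f (carrier M)" "mor \<Omega> N M g"
    "\<And>x. x \<in> carrier M \<Longrightarrow> g (f x) = x"
  using assms unfolding summand_def by (metis inj_on_inverseI)

lemma finite_length_summand:
  assumes "M \<unlhd>\<^bsub>\<Omega>\<^esub> N" "opmod \<Omega> M" "opmod \<Omega> N" "finite_length \<Omega> N" shows "finite_length \<Omega> M"
  using summand_mors[OF assms(1)] finite_length_inj[OF _ _ assms(2-4)] by metis

lemma finite_length_iso:
  "M \<simeq>\<^bsub>\<Omega>\<^esub> N \<Longrightarrow> opmod \<Omega> M \<Longrightarrow> opmod \<Omega> N \<Longrightarrow> finite_length \<Omega> N \<Longrightarrow> finite_length \<Omega> M"
  by (rule finite_length_summand[OF iso_summand])

text \<open>A submodule \<open>U\<close> of \<open>M \<oplus>\<^sub>d N\<close> is determined, among those comparable to it, by its projection to \<open>M\<close>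
  and its intersection with \<open>N\<close>, so that the sum of two bounds is a bound.\<close>

lemma finite_length_dsum:
  fixes M :: "('a, 'b) bimodule" and N :: "('a, 'c) bimodule"
  assumes M: "opmod \<Omega> M" and N: "opmod \<Omega> N" and "finite_length \<Omega> M" "finite_length \<Omega> N"
  shows "finite_length \<Omega> (M \<oplus>\<^sub>d N)"
proof -
  interpret M: opmod \<Omega> M by fact
  interpret N: opmod \<Omega> N by fact
  interpret S: opmod \<Omega> "M \<oplus>\<^sub>d N" by (rule opmod_dsum[OF M N])
  obtain \<phi> :: "'b set \<Rightarrow> nat" where \<phi>: "\<And>U V. submod \<Omega> M U \<Longrightarrow> submod \<Omega> M V \<Longrightarrow> U \<subset> V \<Longrightarrow> \<phi> U < \<phi> V"
    by (rule finite_lengthE[OF assms(3)]) (erule that)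
  obtain \<psi> :: "'c set \<Rightarrow> nat" where \<psi>: "\<And>U V. submod \<Omega> N U \<Longrightarrow> submod \<Omega> N V \<Longrightarrow> U \<subset> V \<Longrightarrow> \<psi> U < \<psi> V"
    by (rule finite_lengthE[OF assms(4)]) (erule that)
  let ?p = "\<lambda>U :: ('b \<times> 'c) set. fst ` U" and ?q = "\<lambda>U. {y \<in> carrier N. (\<zero>\<^bsub>M\<^esub>, y) \<in> U}"
  have p: "submod \<Omega> M (?p U)" if "submod \<Omega> (M \<oplus>\<^sub>d N) U" for U
    by (rule submod_image[OF _ S.opmod_axioms M that]) (rule morI, auto)
  have q: "submod \<Omega> N (?q U)" if "submod \<Omega> (M \<oplus>\<^sub>d N) U" for U
    by (rule submod_vimage[OF _ N S.opmod_axioms that]) (rule morI, auto simp: M.act_zero)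
  have "\<phi> (?p U) + \<psi> (?q U) < \<phi> (?p V) + \<psi> (?q V)"
    if U: "submod \<Omega> (M \<oplus>\<^sub>d N) U" and V: "submod \<Omega> (M \<oplus>\<^sub>d N) V" and UV: "U \<subset> V" for U V
  proof -
    have sub: "?p U \<subseteq> ?p V" "?q U \<subseteq> ?q V" using UV by auto
    have "?p U \<noteq> ?p V \<or> ?q U \<noteq> ?q V"
    proof (rule ccontr)
      assume "\<not> ?thesis"
      then have eq: "?p U = ?p V" "?q U = ?q V" by auto
      have "V \<subseteq> U"
      proof
        fix v assume v: "v \<in> V"
        then obtain u where u: "u \<in> U" "fst u = fst v" using eq(1) by (metis (no_types, lifting) imageE image_eqI)
        have c: "v \<in> carrier (M \<oplus>\<^sub>d N)" "u \<in> carrier (M \<oplus>\<^sub>d N)" using submodD(1)[OF V v] submodD(1)[OF U u(1)] .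
        let ?w = "v \<oplus>\<^bsub>M \<oplus>\<^sub>d N\<^esub> \<ominus>\<^bsub>M \<oplus>\<^sub>d N\<^esub> u"
        have w: "?w \<in> V" using v u UV submodD(3,4)[OF V] by (meson psubsetD)
        have "fst ?w \<oplus>\<^bsub>M\<^esub> fst u = fst v" using arg_cong[OF S.neg_add_cancel[OF c], of fst] by simp
        moreover obtain a b where ab: "?w = (a, b)" by (cases ?w)
        moreover have cw: "a \<in> carrier M" "b \<in> carrier N" using submodD(1)[OF V w] unfolding ab by auto
        ultimately have "a = \<zero>\<^bsub>M\<^esub>" using u(2) c by (auto simp: mem_Times_iff)
        then have "b \<in> ?q V" using w cw unfolding ab by simp
        then have "?w \<in> U" using eq(2) \<open>a = \<zero>\<^bsub>M\<^esub>\<close> unfolding ab by auto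
        then show "v \<in> U" using submodD(3)[OF U _ u(1)] S.neg_add_cancel[OF c] by metis
      qed
      then show False using UV by auto
    qed
    then have "?p U \<subset> ?p V \<or> ?q U \<subset> ?q V" using sub by auto
    moreover have "\<phi> (?p U) \<le> \<phi> (?p V)"
      by (rule strict_imp_mono[OF \<phi>[OF p[OF U] p[OF V]] sub(1)])
    moreover have "\<psi> (?q U) \<le> \<psi> (?q V)"
      by (rule strict_imp_mono[OF \<psi>[OF q[OF U] q[OF V]] sub(2)])
    ultimately show ?thesis using \<phi>[OF p[OF U] p[OF V]] \<psi>[OF q[OF U] q[OF V]] by linarith
  qed
  then show ?thesis by (rule finite_lengthI)
qed

lemma finite_length_zero:
  assumes "opmod \<Omega> M" "carrier M = {\<zero>\<^bsub>M\<^esub>}" shows "finite_length \<Omega> M"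
proof -
  have "U = {\<zero>\<^bsub>M\<^esub>}" if "submod \<Omega> M U" for U using that assms(2) by (auto simp: submod_def)
  then show ?thesis by (intro finite_lengthI[where \<phi> = "\<lambda>_. 0"]) blast
qed

lemma finite_length_ipow:
  assumes M: "opmod \<Omega> M" "finite_length \<Omega> M" and "finite I" shows "finite_length \<Omega> (ipow M I)"
  using assms(3)
proof induction
  case empty
  show ?case by (rule finite_length_zero[OF opmod_ipow[OF M(1)] ipow_empty])
next
  case (insert i I)
  show ?case
    by (rule finite_length_iso[OF ipow_insert[OF insert(2)]])
      (intro finite_length_dsum opmod_dsum opmod_ipow M insert.IH)+
qed

subsection \<open>Indecomposable modules\<close>

definition indec :: "('a + 'a) set \<Rightarrow> ('a, 'b) bimodule \<Rightarrow> bool" where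
  "indec \<Omega> Z \<longleftrightarrow> opmod \<Omega> Z \<and> finite_length \<Omega> Z \<and> carrier Z \<noteq> {\<zero>\<^bsub>Z\<^esub>} \<and>
    (\<forall>e. mor \<Omega> Z Z e \<longrightarrow> (\<forall>x \<in> carrier Z. e (e x) = e x) \<longrightarrow>
      (\<forall>x \<in> carrier Z. e x = \<zero>\<^bsub>Z\<^esub>) \<or> (\<forall>x \<in> carrier Z. e x = x))"

lemma mor_funpow: "mor \<Omega> Z Z f \<Longrightarrow> mor \<Omega> Z Z (f ^^ n)"
proof (induction n)
  case (Suc n)
  then show ?case using mor_comp[OF Suc.IH Suc.prems] by (simp add: comp_def Suc.prems)
qed (simp add: mor_id id_def)

text \<open>The images of the powers of \<open>f\<close> decrease and their kernels increase; in a module of finite length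
  both sequences become stationary.\<close>

lemma fitting:
  fixes Z :: "('a, 'b) bimodule"
  assumes Z: "opmod \<Omega> Z" and len: "finite_length \<Omega> Z" and f: "mor \<Omega> Z Z f"
  obtains n where "0 < n" "(f ^^ n) ` carrier Z = (f ^^ (n + n)) ` carrier Z"
    "\<And>x. x \<in> carrier Z \<Longrightarrow> (f ^^ (n + n)) x = \<zero>\<^bsub>Z\<^esub> \<Longrightarrow> (f ^^ n) x = \<zero>\<^bsub>Z\<^esub>"
proof -
  interpret Z: opmod \<Omega> Z by fact
  obtain \<phi> :: "'b set \<Rightarrow> nat" where \<phi>: "\<And>U V. submod \<Omega> Z U \<Longrightarrow> submod \<Omega> Z V \<Longrightarrow> U \<subset> V \<Longrightarrow> \<phi> U < \<phi> V"
    by (rule finite_lengthE[OF len]) (erule that)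
  note fp = mor_funpow[OF f]
  define im where "im n = (f ^^ n) ` carrier Z" for n
  define ke where "ke n = {x \<in> carrier Z. (f ^^ n) x = \<zero>\<^bsub>Z\<^esub>}" for n
  have im: "submod \<Omega> Z (im n)" for n
    unfolding im_def by (rule submod_image[OF fp Z Z submod_carrier[OF Z]])
  have ke: "submod \<Omega> Z (ke n)" for n unfolding ke_def by (rule submod_ker[OF fp Z Z])
  have im_mono: "im (k + n) \<subseteq> im n" for k n
  proof -
    have "(f ^^ (k + n)) x = (f ^^ n) ((f ^^ k) x)" for x
      using funpow_add[of n k f] by (simp add: add.commute)
    then show ?thesis using mor_closed[OF fp] by (auto simp: im_def)
  qed
  have ke_mono: "ke n \<subseteq> ke (k + n)" for k n
    unfolding ke_def using mor_zero[OF fp Z.abelian_group_axioms Z.abelian_group_axioms]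
    by (auto simp: funpow_add)
  obtain n1 where n1: "\<And>k. \<phi> (im n1) \<le> \<phi> (im k)"
    using ex_has_least_nat[of "\<lambda>_. True" 0 "\<lambda>n. \<phi> (im n)"] by auto
  have keb: "\<phi> (ke k) \<le> \<phi> (carrier Z)" for k
    using \<phi>[OF ke submod_carrier[OF Z], of k] ke[of k]
    by (cases "ke k = carrier Z") (auto simp: submod_def psubset_eq)
  obtain n2 where n2: "\<And>k. \<phi> (ke k) \<le> \<phi> (ke n2)"
    using ex_has_greatest_nat[of "\<lambda>_. True" 0 "\<lambda>n. \<phi> (ke n)" "Suc (\<phi> (carrier Z))"] keb
    by (auto simp: le_imp_less_Suc)
  have im_eq: "im (k + n1) = im n1" for k
    using im_mono[of k n1] \<phi>[OF im im, of "k + n1" n1] n1[of "k + n1"] by (cases "im (k + n1) = im n1") (auto simp: psubset_eq)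
  have ke_eq: "ke (k + n2) = ke n2" for k
    using ke_mono[of n2 k] \<phi>[OF ke ke, of n2 "k + n2"] n2[of "k + n2"] by (cases "ke n2 = ke (k + n2)") (auto simp: psubset_eq)
  let ?n = "Suc (n2 + n1)"
  show thesis
  proof (rule that[of ?n])
    have "im ?n = im (?n + ?n)"
      using im_eq[of "Suc n2"] im_eq[of "?n + Suc n2"] by (simp add: add.assoc)
    then show "(f ^^ ?n) ` carrier Z = (f ^^ (?n + ?n)) ` carrier Z" by (simp only: im_def)
    have "ke ?n = ke (?n + ?n)"
      using ke_eq[of "Suc n1"] ke_eq[of "?n + Suc n1"] by (simp add: ac_simps)
    then show "x \<in> carrier Z \<Longrightarrow> (f ^^ (?n + ?n)) x = \<zero>\<^bsub>Z\<^esub> \<Longrightarrow> (f ^^ ?n) x = \<zero>\<^bsub>Z\<^esub>" for x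
      unfolding ke_def by blast
  qed simp
qed

text \<open>For a suitable power \<open>F\<close> of \<open>f\<close>, the module is the direct sum of the image and the kernel of \<open>F\<close>.
  If it is indecomposable, one of them vanishes.\<close>

lemma indec_bij_or_nilpotent:
  assumes Z: "indec \<Omega> Z" and f: "mor \<Omega> Z Z f"
  shows "bij_betw f (carrier Z) (carrier Z) \<or> (\<exists>n. \<forall>x \<in> carrier Z. (f ^^ n) x = \<zero>\<^bsub>Z\<^esub>)"
proof -
  have Zm: "opmod \<Omega> Z" and len: "finite_length \<Omega> Z" using Z by (auto simp: indec_def)
  interpret Z: opmod \<Omega> Z by fact
  note ab = Z.abelian_group_axioms
  obtain n where n: "0 < n" "(f ^^ n) ` carrier Z = (f ^^ (n + n)) ` carrier Z"
    "\<And>x. x \<in> carrier Z \<Longrightarrow> (f ^^ (n + n)) x = \<zero>\<^bsub>Z\<^esub> \<Longrightarrow> (f ^^ n) x = \<zero>\<^bsub>Z\<^esub>"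
    by (rule fitting[OF Zm len f]) (rule that; blast)
  define F where "F = f ^^ n"
  have F: "mor \<Omega> Z Z F" unfolding F_def by (rule mor_funpow[OF f])
  note Fc = mor_closed[OF F] and Fz = mor_zero[OF F ab ab]
  have ff: "(f ^^ (n + n)) x = F (F x)" for x by (simp add: F_def funpow_add)
  have FF: "F ` carrier Z = F ` F ` carrier Z"
  proof -
    have "(f ^^ (n + n)) ` carrier Z = F ` F ` carrier Z" unfolding image_image ff ..
    then show ?thesis using n(2) by (simp add: F_def)
  qed
  have FF0: "F x = \<zero>\<^bsub>Z\<^esub>" if "x \<in> carrier Z" "F (F x) = \<zero>\<^bsub>Z\<^esub>" for x
    using n(3)[OF that(1)] that(2) by (simp only: F_def[symmetric] ff)
  let ?J = "F ` carrier Z"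
  have J: "submod \<Omega> Z ?J" by (rule submod_image[OF F Zm Zm submod_carrier[OF Zm]])
  interpret J: opmod \<Omega> "sub Z ?J" by (rule opmod_sub[OF Zm J])
  have FJ: "mor \<Omega> (sub Z ?J) (sub Z ?J) F"
    by (rule morI) (use submodD(1)[OF J] in \<open>auto simp: mor_add[OF F] mor_act[OF F] Fc\<close>)
  have bJ: "bij_betw F ?J ?J"
  proof -
    have "\<exists>x \<in> ?J. F x = y" if "y \<in> ?J" for y using that FF by (metis imageE)
    moreover have "x = \<zero>\<^bsub>Z\<^esub>" if "x \<in> ?J" "F x = \<zero>\<^bsub>Z\<^esub>" for x using that FF0 by auto
    ultimately show ?thesis
      using mor_bijI[OF FJ J.abelian_group_axioms J.abelian_group_axioms] by simp
  qed
  then obtain g where g: "mor \<Omega> (sub Z ?J) (sub Z ?J) g" "\<And>y. y \<in> ?J \<Longrightarrow> g (F y) = y"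
    "\<And>y. y \<in> ?J \<Longrightarrow> F (g y) = y"
    using mor_inv[OF FJ _ J.opmod_axioms] bJ unfolding sub_simps(1) by metis
  \<comment> \<open>\<open>g \<circ> F\<close> is the projection onto the image of \<open>F\<close> along its kernel\<close>
  have e: "mor \<Omega> Z Z (\<lambda>x. g (F x))"
    by (rule morI) (use mor_closed[OF g(1)] mor_add[OF g(1)] mor_act[OF g(1)] submodD(1)[OF J] in
        \<open>force simp: mor_add[OF F] mor_act[OF F]\<close>)+
  have gJ: "g (F x) \<in> ?J" if "x \<in> carrier Z" for x using mor_closed[OF g(1)] that by simp
  have "\<forall>x \<in> carrier Z. g (F (g (F x))) = g (F x)" using gJ g(2) by simp
  with Z e consider "\<forall>x \<in> carrier Z. g (F x) = \<zero>\<^bsub>Z\<^esub>" | "\<forall>x \<in> carrier Z. g (F x) = x"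
    unfolding indec_def by blast
  then show ?thesis
  proof cases
    case 1
    then have "F x = \<zero>\<^bsub>Z\<^esub>" if "x \<in> carrier Z" for x using g(3)[of "F x"] Fz that by auto
    then show ?thesis unfolding F_def by blast
  next
    case 2
    then have "x \<in> ?J" if "x \<in> carrier Z" for x using gJ[OF that] that by metis
    then have JZ: "?J = carrier Z" using J unfolding submod_def by blast
    have Ff: "F x = (f ^^ (n - 1)) (f x)" "F x = f ((f ^^ (n - 1)) x)" for x
      using n(1) by (cases n; simp add: F_def funpow_swap1)+
    have "bij_betw f (carrier Z) (carrier Z)"
    proof (rule mor_bijI[OF f ab ab])
      fix x assume x: "x \<in> carrier Z" "f x = \<zero>\<^bsub>Z\<^esub>"
      then have "F x = \<zero>\<^bsub>Z\<^esub>" using Ff mor_zero[OF mor_funpow[OF f] ab ab] by simp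
      then have "g (F x) = g (F \<zero>\<^bsub>Z\<^esub>)" using Fz by simp
      then show "x = \<zero>\<^bsub>Z\<^esub>" using 2 x by simp
    next
      fix y assume "y \<in> carrier Z"
      then obtain x where "x \<in> carrier Z" "y = F x" using JZ by blast
      then show "\<exists>x \<in> carrier Z. f x = y" using Ff(2) mor_closed[OF mor_funpow[OF f]] by metis
    qed
    then show ?thesis ..
  qed
qed

lemma indec_zero_ne: "indec \<Omega> Z \<Longrightarrow> \<exists>x \<in> carrier Z. x \<noteq> \<zero>\<^bsub>Z\<^esub>"
  unfolding indec_def opmod_def abelian_group_def abelian_monoid_def
  by (metis (no_types, opaque_lifting) abelian_monoid.zero_closed abelian_monoid_def empty_iff is_singletonI' is_singleton_def singletonD)

lemma indec_inj_bij:
  assumes Z: "indec \<Omega> Z" and f: "mor \<Omega> Z Z f" "inj_on f (carrier Z)"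
  shows "bij_betw f (carrier Z) (carrier Z)"
proof (rule ccontr)
  assume "\<not> ?thesis"
  then obtain n where n: "\<And>x. x \<in> carrier Z \<Longrightarrow> (f ^^ n) x = \<zero>\<^bsub>Z\<^esub>"
    using indec_bij_or_nilpotent[OF Z f(1)] by blast
  have "inj_on (f ^^ n) (carrier Z)"
  proof (induction n)
    case (Suc n)
    have "(f ^^ n) ` carrier Z \<subseteq> carrier Z" using mor_closed[OF mor_funpow[OF f(1)]] by auto
    then show ?case using comp_inj_on[OF Suc inj_on_subset[OF f(2)]] by (simp add: comp_def)
  qed simp
  moreover have "\<zero>\<^bsub>Z\<^esub> \<in> carrier Z" using Z submod_zero[of \<Omega> Z] by (auto simp: indec_def submod_def)
  ultimately have "x = \<zero>\<^bsub>Z\<^esub>" if "x \<in> carrier Z" for x using n that by (metis inj_onD)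
  then show False using indec_zero_ne[OF Z] by blast
qed

text \<open>The endomorphism ring is local: if \<open>f\<close> is not bijective then it is nilpotent, and then
  \<open>g = 1 - f\<close> is injective.\<close>

lemma indec_local_one:
  assumes Z: "indec \<Omega> Z" and f: "mor \<Omega> Z Z f" and g: "mor \<Omega> Z Z g"
    and fg: "\<And>x. x \<in> carrier Z \<Longrightarrow> f x \<oplus>\<^bsub>Z\<^esub> g x = x"
  shows "bij_betw f (carrier Z) (carrier Z) \<or> bij_betw g (carrier Z) (carrier Z)"
proof (cases "bij_betw f (carrier Z) (carrier Z)")
  case False
  interpret Z: opmod \<Omega> Z using Z by (simp add: indec_def)
  obtain n where n: "\<And>x. x \<in> carrier Z \<Longrightarrow> (f ^^ n) x = \<zero>\<^bsub>Z\<^esub>"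
    using indec_bij_or_nilpotent[OF Z f] False by blast
  have "x = \<zero>\<^bsub>Z\<^esub>" if x: "x \<in> carrier Z" "g x = \<zero>\<^bsub>Z\<^esub>" for x
  proof -
    have "f x = x" using fg[OF x(1)] x mor_closed[OF f] by simp
    then have "(f ^^ k) x = x" for k by (induction k) auto
    then show ?thesis using n[OF x(1)] by simp
  qed
  then have "inj_on g (carrier Z)"
    by (intro inj_onI) (metis Z.diff_zero_iff Z.a_inv_closed Z.add.m_closed mor_add[OF g] mor_closed[OF g]
        mor_neg[OF g Z.abelian_group_axioms Z.abelian_group_axioms])
  then show ?thesis using indec_inj_bij[OF Z g] by blast
qed simp

lemma indec_local:
  assumes Z: "indec \<Omega> Z" and f: "mor \<Omega> Z Z f" and g: "mor \<Omega> Z Z g"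
    and bij: "bij_betw (\<lambda>x. f x \<oplus>\<^bsub>Z\<^esub> g x) (carrier Z) (carrier Z)"
  shows "bij_betw f (carrier Z) (carrier Z) \<or> bij_betw g (carrier Z) (carrier Z)"
proof -
  interpret Z: opmod \<Omega> Z using Z by (simp add: indec_def)
  let ?s = "\<lambda>x. f x \<oplus>\<^bsub>Z\<^esub> g x"
  have s: "mor \<Omega> Z Z ?s" by (rule mor_plus[OF Z.opmod_axioms f g])
  obtain h where h: "mor \<Omega> Z Z h" "\<And>x. x \<in> carrier Z \<Longrightarrow> h (?s x) = x" "\<And>y. y \<in> carrier Z \<Longrightarrow> ?s (h y) = y"
    using mor_inv[OF s bij Z.opmod_axioms] by metis
  have bijI: "bij_betw k (carrier Z) (carrier Z)"
    if k: "mor \<Omega> Z Z k" and hk: "bij_betw (\<lambda>x. h (k x)) (carrier Z) (carrier Z)" for k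
  proof -
    have "bij_betw ((\<lambda>x. ?s x) \<circ> (\<lambda>x. h (k x))) (carrier Z) (carrier Z)" by (rule bij_betw_trans[OF hk bij])
    then show ?thesis
      by (rule iffD1[OF bij_betw_cong, rotated]) (simp only: comp_apply h(3) mor_closed[OF k])
  qed
  have "bij_betw (\<lambda>x. h (f x)) (carrier Z) (carrier Z) \<or> bij_betw (\<lambda>x. h (g x)) (carrier Z) (carrier Z)"
    by (rule indec_local_one[OF Z mor_comp[OF f h(1)] mor_comp[OF g h(1)]])
      (metis h(2) mor_add[OF h(1)] mor_closed[OF f] mor_closed[OF g])
  then show ?thesis using bijI f g by blast
qed

lemma summand_of_bij:
  assumes f: "mor \<Omega> Z M f" and g: "mor \<Omega> M Z g" and Z: "opmod \<Omega> Z"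
    and bij: "bij_betw (\<lambda>x. g (f x)) (carrier Z) (carrier Z)"
  shows "Z \<unlhd>\<^bsub>\<Omega>\<^esub> M"
proof -
  obtain h where "mor \<Omega> Z Z h" "\<And>x. x \<in> carrier Z \<Longrightarrow> h (g (f x)) = x"
    using mor_inv[OF mor_comp[OF f g] bij Z] by metis
  then show ?thesis unfolding summand_def using f mor_comp[OF g] by (intro exI conjI) auto
qed

text \<open>The identity of \<open>Z\<close> is the sum of its components through \<open>M\<close> and through \<open>N\<close>, one of which is
  bijective by locality.\<close>

lemma indec_summand_dsum:
  assumes Z: "indec \<Omega> Z" and M: "opmod \<Omega> M" and N: "opmod \<Omega> N" and "Z \<unlhd>\<^bsub>\<Omega>\<^esub> M \<oplus>\<^sub>d N"
  shows "Z \<unlhd>\<^bsub>\<Omega>\<^esub> M \<or> Z \<unlhd>\<^bsub>\<Omega>\<^esub> N"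
proof -
  interpret M: opmod \<Omega> M by fact
  interpret N: opmod \<Omega> N by fact
  have Zm: "opmod \<Omega> Z" using Z by (simp add: indec_def)
  obtain f g where f: "mor \<Omega> Z (M \<oplus>\<^sub>d N) f" and g: "mor \<Omega> (M \<oplus>\<^sub>d N) Z g"
    and gf: "\<And>x. x \<in> carrier Z \<Longrightarrow> g (f x) = x"
    using summand_mors[OF assms(4)] by metis
  have p: "mor \<Omega> Z M (\<lambda>x. fst (f x))" "mor \<Omega> Z N (\<lambda>x. snd (f x))"
    by (rule mor_comp[OF f], rule morI, auto)+
  have i: "mor \<Omega> M Z (\<lambda>x. g (x, \<zero>\<^bsub>N\<^esub>))" "mor \<Omega> N Z (\<lambda>y. g (\<zero>\<^bsub>M\<^esub>, y))"
    by (rule mor_comp[OF _ g], rule morI, auto simp: M.act_zero N.act_zero)+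
  have "g (fst (f x), \<zero>\<^bsub>N\<^esub>) \<oplus>\<^bsub>Z\<^esub> g (\<zero>\<^bsub>M\<^esub>, snd (f x)) = x" if x: "x \<in> carrier Z" for x
    using mor_closed[OF f x] mor_add[OF g, of "(fst (f x), \<zero>\<^bsub>N\<^esub>)" "(\<zero>\<^bsub>M\<^esub>, snd (f x))"] gf[OF x]
    by (auto simp: mem_Times_iff)
  then have "bij_betw (\<lambda>x. g (fst (f x), \<zero>\<^bsub>N\<^esub>)) (carrier Z) (carrier Z) \<or>
      bij_betw (\<lambda>x. g (\<zero>\<^bsub>M\<^esub>, snd (f x))) (carrier Z) (carrier Z)"
    by (rule indec_local_one[OF Z mor_comp[OF p(1) i(1)] mor_comp[OF p(2) i(2)]])
  then show ?thesis using summand_of_bij[OF p(1) i(1) Zm] summand_of_bij[OF p(2) i(2) Zm] by blast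
qed

lemma indec_not_summand_zero:
  assumes "indec \<Omega> Z" "opmod \<Omega> M" "carrier M = {\<zero>\<^bsub>M\<^esub>}" shows "\<not> Z \<unlhd>\<^bsub>\<Omega>\<^esub> M"
proof
  assume "Z \<unlhd>\<^bsub>\<Omega>\<^esub> M"
  then obtain f g where fg: "mor \<Omega> Z M f" "mor \<Omega> M Z g" "\<And>x. x \<in> carrier Z \<Longrightarrow> g (f x) = x"
    using summand_mors by metis
  have "x = \<zero>\<^bsub>Z\<^esub>" if "x \<in> carrier Z" for x
    using mor_closed[OF fg(1) that] fg(3)[OF that] mor_zero[OF fg(2)] assms(1-3)
    by (auto simp: indec_def opmod_ab)
  then show False using indec_zero_ne[OF assms(1)] by blast
qed

lemma indec_summand_dpow:
  assumes "indec \<Omega> Z" "opmod \<Omega> M" "Z \<unlhd>\<^bsub>\<Omega>\<^esub> M ^\<^sub>d k" shows "Z \<unlhd>\<^bsub>\<Omega>\<^esub> M"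
  using assms(3)
proof (induction k)
  case 0
  then show ?case using indec_not_summand_zero[OF assms(1) _ dpow_zero] opmod_ipow[OF assms(2)] by blast
next
  case (Suc k)
  have "Z \<unlhd>\<^bsub>\<Omega>\<^esub> M \<oplus>\<^sub>d M ^\<^sub>d k"
    by (rule summand_trans[OF Suc.prems iso_summand[OF _ dpow_Suc]]) (rule opmod_ipow[OF assms(2)])
  then show ?case using indec_summand_dsum[OF assms(1,2) opmod_ipow[OF assms(2)]] Suc.IH by blast
qed

text \<open>A module that is not indecomposable has a nontrivial idempotent endomorphism, whose image is
  a summand of smaller length.\<close>

lemma exists_indec_summand:
  assumes "opmod \<Omega> M" "len_le \<Omega> M n" "carrier M \<noteq> {\<zero>\<^bsub>M\<^esub>}"
  shows "\<exists>U. submod \<Omega> M U \<and> indec \<Omega> (sub M U) \<and> sub M U \<unlhd>\<^bsub>\<Omega>\<^esub> M"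
  using assms
proof (induction n arbitrary: M rule: less_induct)
  case (less n)
  show ?case
  proof (cases "indec \<Omega> M")
    case True
    then show ?thesis using submod_carrier[OF less.prems(1)] by (intro exI[of _ "carrier M"]) simp
  next
    case False
    interpret M: opmod \<Omega> M by fact
    obtain e where e: "mor \<Omega> M M e" "\<And>x. x \<in> carrier M \<Longrightarrow> e (e x) = e x"
      "\<exists>x \<in> carrier M. e x \<noteq> \<zero>\<^bsub>M\<^esub>" "\<exists>x \<in> carrier M. e x \<noteq> x"
      using False less.prems unfolding indec_def finite_length_def by blast
    let ?I = "e ` carrier M"
    have I: "submod \<Omega> M ?I" by (rule submod_image[OF e(1)]) (use less.prems submod_carrier in auto)
    have Im: "opmod \<Omega> (sub M ?I)" by (rule opmod_sub[OF less.prems(1) I])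
    have inc: "mor \<Omega> (sub M ?I) M (\<lambda>x. x)" by (rule morI) (use submodD(1)[OF I] in auto)
    have eI: "mor \<Omega> M (sub M ?I) e" by (rule morI) (auto simp: mor_add[OF e(1)] mor_act[OF e(1)])
    have ne: "?I \<noteq> carrier M" using e(2,4) by (metis (no_types, lifting) imageE)
    have len: "0 < n" "len_le \<Omega> (sub M ?I) (n - 1)"
      using len_le_inj(2)[OF inc _ Im less.prems(1,2)] ne by auto
    have "carrier (sub M ?I) \<noteq> {\<zero>\<^bsub>sub M ?I\<^esub>}" using e(3) by auto
    from less.IH[OF _ Im len(2) this] len(1) obtain U where
      U: "submod \<Omega> (sub M ?I) U" "indec \<Omega> (sub M U)" "sub M U \<unlhd>\<^bsub>\<Omega>\<^esub> sub M ?I"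
      by auto
    have "sub M ?I \<unlhd>\<^bsub>\<Omega>\<^esub> M" unfolding summand_def
      by (intro exI[of _ "\<lambda>x. x"] exI[of _ e]) (use inc eI e(2) in auto)
    then show ?thesis using U summand_trans submod_sub_iff[OF opmod_ab[OF less.prems(1)] I] by blast
  qed
qed

lemma indec_complement:
  assumes Z: "indec \<Omega> Z" and M: "opmod \<Omega> M" and len: "len_le \<Omega> M n" and ZM: "Z \<unlhd>\<^bsub>\<Omega>\<^esub> M"
  obtains X where "submod \<Omega> M X" "M \<simeq>\<^bsub>\<Omega>\<^esub> Z \<oplus>\<^sub>d sub M X" "0 < n" "len_le \<Omega> (sub M X) (n - 1)"
proof -
  have Zm: "opmod \<Omega> Z" using Z by (simp add: indec_def)
  obtain f g where fg: "mor \<Omega> Z M f" "mor \<Omega> M Z g" "\<And>x. x \<in> carrier Z \<Longrightarrow> g (f x) = x"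
    using summand_mors[OF ZM] by metis
  let ?X = "{x \<in> carrier M. g x = \<zero>\<^bsub>Z\<^esub>}"
  have X: "submod \<Omega> M ?X" by (rule submod_ker[OF fg(2) M Zm])
  obtain z where "z \<in> carrier Z" "z \<noteq> \<zero>\<^bsub>Z\<^esub>" using indec_zero_ne[OF Z] by blast
  then have "f z \<in> carrier M - ?X" using fg mor_closed by fastforce
  then have ne: "?X \<noteq> carrier M" by blast
  have "mor \<Omega> (sub M ?X) M (\<lambda>x. x)" by (rule morI) auto
  from len_le_inj(2)[OF this _ opmod_sub[OF M X] M len] ne
  have "0 < n" "len_le \<Omega> (sub M ?X) (n - 1)" by auto
  with that[OF X summand_complement[OF Zm M fg(1,2,3)]] show thesis by blast
qed

subsection \<open>Cancellation and multiplicities\<close>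

text \<open>Block elimination: if the component \<open>Z \<rightarrow> Z\<close> of an isomorphism is invertible, then the other
  diagonal block, corrected by the elimination of the \<open>Z\<close>-coordinate, is an isomorphism as well.\<close>

lemma schur_complement_iso:
  assumes Z: "opmod \<Omega> Z" and X: "opmod \<Omega> X" and Y: "opmod \<Omega> Y"
    and f: "mor \<Omega> (Z \<oplus>\<^sub>d X) (Z \<oplus>\<^sub>d Y) f"
    and bij: "bij_betw f (carrier (Z \<oplus>\<^sub>d X)) (carrier (Z \<oplus>\<^sub>d Y))"
    and a: "bij_betw (\<lambda>z. fst (f (z, \<zero>\<^bsub>X\<^esub>))) (carrier Z) (carrier Z)"
  shows "X \<simeq>\<^bsub>\<Omega>\<^esub> Y"
proof -
  interpret Z: opmod \<Omega> Z by fact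
  interpret X: opmod \<Omega> X by fact
  interpret Y: opmod \<Omega> Y by fact
  interpret ZX: opmod \<Omega> "Z \<oplus>\<^sub>d X" by (rule opmod_dsum[OF Z X])
  interpret ZY: opmod \<Omega> "Z \<oplus>\<^sub>d Y" by (rule opmod_dsum[OF Z Y])
  have i: "mor \<Omega> Z (Z \<oplus>\<^sub>d X) (\<lambda>z. (z, \<zero>\<^bsub>X\<^esub>))" "mor \<Omega> X (Z \<oplus>\<^sub>d X) (\<lambda>x. (\<zero>\<^bsub>Z\<^esub>, x))"
    by (rule morI, auto simp: X.act_zero Z.act_zero)+
  have p: "mor \<Omega> (Z \<oplus>\<^sub>d Y) Z fst" "mor \<Omega> (Z \<oplus>\<^sub>d Y) Y snd" by (rule morI, auto)+
  have mA: "mor \<Omega> Z Z (\<lambda>z. fst (f (z, \<zero>\<^bsub>X\<^esub>)))" by (rule mor_comp[OF mor_comp[OF i(1) f] p(1)])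
  have mB: "mor \<Omega> X Z (\<lambda>x. fst (f (\<zero>\<^bsub>Z\<^esub>, x)))" by (rule mor_comp[OF mor_comp[OF i(2) f] p(1)])
  obtain g where g: "mor \<Omega> Z Z g" "\<And>z. z \<in> carrier Z \<Longrightarrow> g (fst (f (z, \<zero>\<^bsub>X\<^esub>))) = z"
    "\<And>z. z \<in> carrier Z \<Longrightarrow> fst (f (g z, \<zero>\<^bsub>X\<^esub>)) = z"
    using mor_inv[OF mA a Z] by metis
  \<comment> \<open>\<open>u x\<close> is the element of the graph of a map \<open>X \<rightarrow> Z\<close> that \<open>f\<close> sends into \<open>Y\<close>.\<close>
  define k where "k x = \<ominus>\<^bsub>Z\<^esub> g (fst (f (\<zero>\<^bsub>Z\<^esub>, x)))" for x
  have k: "mor \<Omega> X Z k" unfolding k_def by (rule mor_uminus[OF Z mor_comp[OF mB g(1)]])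
  have u: "mor \<Omega> X (Z \<oplus>\<^sub>d X) (\<lambda>x. (k x, x))"
    by (rule morI) (auto simp: mor_closed[OF k] mor_add[OF k] mor_act[OF k])
  have split: "f (z, x) = f (z, \<zero>\<^bsub>X\<^esub>) \<oplus>\<^bsub>Z \<oplus>\<^sub>d Y\<^esub> f (\<zero>\<^bsub>Z\<^esub>, x)" if "z \<in> carrier Z" "x \<in> carrier X" for z x
    using mor_add[OF f, of "(z, \<zero>\<^bsub>X\<^esub>)" "(\<zero>\<^bsub>Z\<^esub>, x)"] that by simp
  note fA = mor_closed[OF mA] and fB = mor_closed[OF mB] and gc = mor_closed[OF g(1)] and kc = mor_closed[OF k]
  have ku: "fst (f (z, x)) = \<zero>\<^bsub>Z\<^esub> \<longleftrightarrow> z = k x" if zx: "z \<in> carrier Z" "x \<in> carrier X" for z x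
  proof -
    have "fst (f (z, x)) = fst (f (z, \<zero>\<^bsub>X\<^esub>)) \<oplus>\<^bsub>Z\<^esub> fst (f (\<zero>\<^bsub>Z\<^esub>, x))" using split[OF zx] by simp
    also have "\<dots> = \<zero>\<^bsub>Z\<^esub> \<longleftrightarrow> fst (f (z, \<zero>\<^bsub>X\<^esub>)) = \<ominus>\<^bsub>Z\<^esub> fst (f (\<zero>\<^bsub>Z\<^esub>, x))"
      using fA[OF zx(1)] fB[OF zx(2)] by (metis Z.minus_equality Z.l_neg)
    also have "\<dots> \<longleftrightarrow> z = g (\<ominus>\<^bsub>Z\<^esub> fst (f (\<zero>\<^bsub>Z\<^esub>, x)))"
      using g(2,3) zx fB[OF zx(2)] gc by (metis Z.a_inv_closed)
    also have "\<dots> \<longleftrightarrow> z = k x"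
      unfolding k_def using mor_neg[OF g(1) Z.abelian_group_axioms Z.abelian_group_axioms] fB[OF zx(2)] by simp
    finally show ?thesis .
  qed
  have h: "mor \<Omega> X Y (\<lambda>x. snd (f (k x, x)))" by (rule mor_comp[OF mor_comp[OF u f] p(2)])
  have "bij_betw (\<lambda>x. snd (f (k x, x))) (carrier X) (carrier Y)"
  proof (rule mor_bijI[OF h X.abelian_group_axioms Y.abelian_group_axioms])
    fix x assume x: "x \<in> carrier X" "snd (f (k x, x)) = \<zero>\<^bsub>Y\<^esub>"
    then have "f (k x, x) = f (\<zero>\<^bsub>Z\<^esub>, \<zero>\<^bsub>X\<^esub>)"
      using ku[of "k x" x] kc mor_zero[OF f ZX.abelian_group_axioms ZY.abelian_group_axioms]
      by (simp add: prod_eq_iff)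
    then show "x = \<zero>\<^bsub>X\<^esub>" using bij x kc unfolding bij_betw_def
      by (auto dest!: inj_onD[where x = "(k x, x)" and y = "(\<zero>\<^bsub>Z\<^esub>, \<zero>\<^bsub>X\<^esub>)"])
  next
    fix y assume y: "y \<in> carrier Y"
    then have "(\<zero>\<^bsub>Z\<^esub>, y) \<in> f ` carrier (Z \<oplus>\<^sub>d X)" using bij by (simp add: bij_betw_def)
    then obtain z x where zx: "z \<in> carrier Z" "x \<in> carrier X" "f (z, x) = (\<zero>\<^bsub>Z\<^esub>, y)" by force
    then have "z = k x" using ku[of z x] by simp
    then show "\<exists>x \<in> carrier X. snd (f (k x, x)) = y" using zx by (intro bexI[of _ x]) auto
  qed
  with h show ?thesis unfolding mod_iso_def by blast
qed

text \<open>An indecomposable summand cancels: the identity of \<open>Z\<close> is \<open>a' a + b' c\<close>, where \<open>a\<close> and \<open>c\<close>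
  are the components of the isomorphism on \<open>Z\<close>, so by locality \<open>a\<close> is bijective or can be
  made so by an elementary operation on the rows, and then the Schur complement of \<open>a\<close> is the
  required isomorphism.\<close>

lemma indec_cancel:
  assumes indec: "indec \<Omega> Z" and X: "opmod \<Omega> X" and Y: "opmod \<Omega> Y" and iso: "Z \<oplus>\<^sub>d X \<simeq>\<^bsub>\<Omega>\<^esub> Z \<oplus>\<^sub>d Y"
  shows "X \<simeq>\<^bsub>\<Omega>\<^esub> Y"
proof -
  have Z: "opmod \<Omega> Z" using indec by (simp add: indec_def)
  interpret Z: opmod \<Omega> Z by fact
  interpret X: opmod \<Omega> X by fact
  interpret Y: opmod \<Omega> Y by fact
  have ZX: "opmod \<Omega> (Z \<oplus>\<^sub>d X)" and ZY: "opmod \<Omega> (Z \<oplus>\<^sub>d Y)" by (intro opmod_dsum X Y Z)+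
  obtain f where f: "mor \<Omega> (Z \<oplus>\<^sub>d X) (Z \<oplus>\<^sub>d Y) f"
    and bij: "bij_betw f (carrier (Z \<oplus>\<^sub>d X)) (carrier (Z \<oplus>\<^sub>d Y))"
    using iso unfolding mod_iso_def by blast
  obtain g where g: "mor \<Omega> (Z \<oplus>\<^sub>d Y) (Z \<oplus>\<^sub>d X) g" "\<And>x. x \<in> carrier (Z \<oplus>\<^sub>d X) \<Longrightarrow> g (f x) = x"
    using mor_inv[OF f bij ZX] by metis
  have i: "mor \<Omega> Z (Z \<oplus>\<^sub>d X) (\<lambda>z. (z, \<zero>\<^bsub>X\<^esub>))" "mor \<Omega> Z (Z \<oplus>\<^sub>d Y) (\<lambda>z. (z, \<zero>\<^bsub>Y\<^esub>))"
    "mor \<Omega> Y (Z \<oplus>\<^sub>d Y) (\<lambda>y. (\<zero>\<^bsub>Z\<^esub>, y))"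
    by (rule morI, auto simp: X.act_zero Y.act_zero Z.act_zero)+
  have p: "mor \<Omega> (Z \<oplus>\<^sub>d Y) Z fst" "mor \<Omega> (Z \<oplus>\<^sub>d Y) Y snd" "mor \<Omega> (Z \<oplus>\<^sub>d X) Z fst" by (rule morI, auto)+
  let ?a = "\<lambda>z. fst (f (z, \<zero>\<^bsub>X\<^esub>))" and ?c = "\<lambda>z. snd (f (z, \<zero>\<^bsub>X\<^esub>))"
  let ?a' = "\<lambda>z. fst (g (z, \<zero>\<^bsub>Y\<^esub>))" and ?b' = "\<lambda>y. fst (g (\<zero>\<^bsub>Z\<^esub>, y))"
  have a: "mor \<Omega> Z Z ?a" and c: "mor \<Omega> Z Y ?c"
    using mor_comp[OF mor_comp[OF i(1) f] p(1)] mor_comp[OF mor_comp[OF i(1) f] p(2)] .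
  have a': "mor \<Omega> Z Z ?a'" and b': "mor \<Omega> Y Z ?b'"
    using mor_comp[OF mor_comp[OF i(2) g(1)] p(3)] mor_comp[OF mor_comp[OF i(3) g(1)] p(3)] .
  have one: "?a' (?a z) \<oplus>\<^bsub>Z\<^esub> ?b' (?c z) = z" if z: "z \<in> carrier Z" for z
  proof -
    have "g (?a z, ?c z) = g (?a z, \<zero>\<^bsub>Y\<^esub>) \<oplus>\<^bsub>Z \<oplus>\<^sub>d X\<^esub> g (\<zero>\<^bsub>Z\<^esub>, ?c z)"
      using mor_add[OF g(1), of "(?a z, \<zero>\<^bsub>Y\<^esub>)" "(\<zero>\<^bsub>Z\<^esub>, ?c z)"] mor_closed[OF a z] mor_closed[OF c z] by simp
    then show ?thesis using g(2)[of "(z, \<zero>\<^bsub>X\<^esub>)"] z by (simp add: prod_eq_iff)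
  qed
  consider "bij_betw (\<lambda>z. ?a' (?a z)) (carrier Z) (carrier Z)" | "bij_betw (\<lambda>z. ?b' (?c z)) (carrier Z) (carrier Z)"
    using indec_local_one[OF indec mor_comp[OF a a'] mor_comp[OF c b'] one] by blast
  then show ?thesis
  proof cases
    case 1
    then have "inj_on ?a (carrier Z)"
      using inj_on_imageI2[of ?a' ?a "carrier Z"] by (simp add: bij_betw_def comp_def)
    then have "bij_betw ?a (carrier Z) (carrier Z)" by (rule indec_inj_bij[OF indec a])
    then show ?thesis by (rule schur_complement_iso[OF Z X Y f bij])
  next
    case 2
    show ?thesis
    proof (cases "bij_betw ?a (carrier Z) (carrier Z)")
      case True
      then show ?thesis by (rule schur_complement_iso[OF Z X Y f bij])
    next
      case False
      let ?e = "\<lambda>w. (fst w \<oplus>\<^bsub>Z\<^esub> ?b' (snd w), snd w)"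
      have e: "mor \<Omega> (Z \<oplus>\<^sub>d Y) (Z \<oplus>\<^sub>d Y) ?e"
        by (rule morI) (auto simp: mor_closed[OF b'] mor_add[OF b'] mor_act[OF b'] Z.act_add Z.a_ac)
      have ebij: "bij_betw ?e (carrier (Z \<oplus>\<^sub>d Y)) (carrier (Z \<oplus>\<^sub>d Y))"
        by (rule bij_betw_byWitness[where f' = "\<lambda>w. (fst w \<oplus>\<^bsub>Z\<^esub> \<ominus>\<^bsub>Z\<^esub> ?b' (snd w), snd w)"])
          (auto simp: mor_closed[OF b'] Z.a_assoc Z.r_neg Z.l_neg)
      have ef: "mor \<Omega> (Z \<oplus>\<^sub>d X) (Z \<oplus>\<^sub>d Y) (\<lambda>w. ?e (f w))" by (rule mor_comp[OF f e])
      have efbij: "bij_betw (\<lambda>w. ?e (f w)) (carrier (Z \<oplus>\<^sub>d X)) (carrier (Z \<oplus>\<^sub>d Y))"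
        using bij_betw_trans[OF bij ebij] by (simp add: comp_def)
      let ?k = "\<lambda>z. ?a z \<oplus>\<^bsub>Z\<^esub> ?b' (?c z)" and ?na = "\<lambda>z. \<ominus>\<^bsub>Z\<^esub> ?a z"
      have na: "mor \<Omega> Z Z ?na" and k: "mor \<Omega> Z Z ?k"
        by (rule mor_uminus[OF Z a], rule mor_plus[OF Z a mor_comp[OF c b']])
      have "\<not> bij_betw ?na (carrier Z) (carrier Z)"
      proof
        assume b: "bij_betw ?na (carrier Z) (carrier Z)"
        have "inj_on ?a (carrier Z)"
          by (rule inj_onI) (metis b bij_betw_def inj_onD)
        then show False using indec_inj_bij[OF indec a] False by blast
      qed
      moreover have "bij_betw (\<lambda>z. ?k z \<oplus>\<^bsub>Z\<^esub> ?na z) (carrier Z) (carrier Z)"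
      proof (rule iffD2[OF bij_betw_cong 2])
        fix z assume "z \<in> carrier Z"
        then have "?a z \<in> carrier Z" "?b' (?c z) \<in> carrier Z"
          using mor_closed[OF a] mor_closed[OF mor_comp[OF c b']] by auto
        then show "?k z \<oplus>\<^bsub>Z\<^esub> ?na z = ?b' (?c z)" by (metis Z.a_comm Z.a_inv_closed Z.a_assoc Z.r_neg Z.r_zero)
      qed
      ultimately have "bij_betw ?k (carrier Z) (carrier Z)" using indec_local[OF indec k na] by blast
      then show ?thesis by (intro schur_complement_iso[OF Z X Y ef efbij]) simp
    qed
  qed
qed

text \<open>The indecomposable summands of \<open>W\<close> are cancelled one after the other.\<close>

lemma cancel_finite_length:
  assumes "opmod \<Omega> W" "len_le \<Omega> W n" "opmod \<Omega> X" "opmod \<Omega> Y" "W \<oplus>\<^sub>d X \<simeq>\<^bsub>\<Omega>\<^esub> W \<oplus>\<^sub>d Y"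
  shows "X \<simeq>\<^bsub>\<Omega>\<^esub> Y"
  using assms
proof (induction n arbitrary: W rule: less_induct)
  case (less n)
  note W = less.prems(1) and X = less.prems(3) and Y = less.prems(4)
  show ?case
  proof (cases "carrier W = {\<zero>\<^bsub>W\<^esub>}")
    case True
    have "X \<simeq>\<^bsub>\<Omega>\<^esub> W \<oplus>\<^sub>d X" using iso_sym[OF opmod_dsum dsum_zero[OF W X True]] W X by blast
    also note less.prems(5)
    also have "W \<oplus>\<^sub>d Y \<simeq>\<^bsub>\<Omega>\<^esub> Y" by (rule dsum_zero[OF W Y True])
    finally show ?thesis .
  next
    case False
    obtain U where U: "submod \<Omega> W U" "indec \<Omega> (sub W U)" "sub W U \<unlhd>\<^bsub>\<Omega>\<^esub> W"
      using exists_indec_summand[OF W less.prems(2) False] by blast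
    let ?Z = "sub W U"
    have Z: "opmod \<Omega> ?Z" using U(2) by (simp add: indec_def)
    obtain V where V: "submod \<Omega> W V" "W \<simeq>\<^bsub>\<Omega>\<^esub> ?Z \<oplus>\<^sub>d sub W V" "0 < n" "len_le \<Omega> (sub W V) (n - 1)"
      using indec_complement[OF U(2) W less.prems(2) U(3)] .
    let ?V = "sub W V"
    have Vm: "opmod \<Omega> ?V" by (rule opmod_sub[OF W V(1)])
    have "?Z \<oplus>\<^sub>d (?V \<oplus>\<^sub>d X) \<simeq>\<^bsub>\<Omega>\<^esub> W \<oplus>\<^sub>d X"
      by (rule iso_sym[OF _ iso_trans[OF dsum_cong[OF V(2) iso_refl] dsum_assoc]]) (intro opmod_dsum W X)
    also note less.prems(5)
    also have "W \<oplus>\<^sub>d Y \<simeq>\<^bsub>\<Omega>\<^esub> ?Z \<oplus>\<^sub>d (?V \<oplus>\<^sub>d Y)"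
      by (rule iso_trans[OF dsum_cong[OF V(2) iso_refl] dsum_assoc])
    finally have "?V \<oplus>\<^sub>d X \<simeq>\<^bsub>\<Omega>\<^esub> ?V \<oplus>\<^sub>d Y"
      by (rule indec_cancel[OF U(2), rotated 2]) (intro opmod_dsum Vm X Y)+
    then show ?thesis using less.IH[OF _ Vm V(4) X Y] V(3) by simp
  qed
qed

lemma cancel:
  assumes "finite_length \<Omega> W" "opmod \<Omega> W" "opmod \<Omega> X" "opmod \<Omega> Y" "W \<oplus>\<^sub>d X \<simeq>\<^bsub>\<Omega>\<^esub> W \<oplus>\<^sub>d Y"
  shows "X \<simeq>\<^bsub>\<Omega>\<^esub> Y"
  using assms cancel_finite_length unfolding finite_length_def by blast

text \<open>The multiplicity of \<open>Z\<close> in \<open>M\<close> is the largest \<open>k\<close> such that \<open>Z\<close> to the \<open>k\<close> is a summand. It is a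
  relation because the largest \<open>k\<close> exists only under finiteness conditions.\<close>

definition has_mult :: "('a + 'a) set \<Rightarrow> ('a, 'b) bimodule \<Rightarrow> ('a, 'c) bimodule \<Rightarrow> nat \<Rightarrow> bool" where
  "has_mult \<Omega> Z M k \<longleftrightarrow> Z ^\<^sub>d k \<unlhd>\<^bsub>\<Omega>\<^esub> M \<and> \<not> Z ^\<^sub>d Suc k \<unlhd>\<^bsub>\<Omega>\<^esub> M"

lemma dpow_summand_mono:
  assumes Z: "opmod \<Omega> Z" and "k \<le> l" shows "Z ^\<^sub>d k \<unlhd>\<^bsub>\<Omega>\<^esub> Z ^\<^sub>d l"
proof -
  have "Z ^\<^sub>d k \<oplus>\<^sub>d Z ^\<^sub>d (l - k) \<unlhd>\<^bsub>\<Omega>\<^esub> Z ^\<^sub>d l"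
    using iso_summand'[OF opmod_ipow[OF Z] dpow_add[OF Z, of k "l - k"]] assms(2) by simp
  then show ?thesis by (rule summand_trans[OF summand_dsum(1)[OF opmod_ipow[OF Z] opmod_ipow[OF Z]]])
qed

lemma mult_unique:
  assumes Z: "opmod \<Omega> Z" and "has_mult \<Omega> Z M k" "has_mult \<Omega> Z M l" shows "k = l"
  using assms dpow_summand_mono[OF Z, of "Suc k" l] dpow_summand_mono[OF Z, of "Suc l" k] summand_trans
  unfolding has_mult_def by (metis Suc_leI linorder_neqE_nat)

lemma mult_iso:
  assumes "opmod \<Omega> M" "M \<simeq>\<^bsub>\<Omega>\<^esub> N" shows "has_mult \<Omega> Z M k \<longleftrightarrow> has_mult \<Omega> Z N k"
  unfolding has_mult_def
  using summand_trans[OF _ iso_summand[OF assms]] summand_trans[OF _ iso_summand'[OF assms]] by blast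

lemma mult_complement:
  assumes indec: "indec \<Omega> Z" and M: "opmod \<Omega> M" and "has_mult \<Omega> Z M k"
  obtains X where "submod \<Omega> M X" "M \<simeq>\<^bsub>\<Omega>\<^esub> Z ^\<^sub>d k \<oplus>\<^sub>d sub M X" "\<not> Z \<unlhd>\<^bsub>\<Omega>\<^esub> sub M X"
proof -
  have Z: "opmod \<Omega> Z" using indec by (simp add: indec_def)
  note Zk = opmod_ipow[OF Z]
  obtain f g where fg: "mor \<Omega> (Z ^\<^sub>d k) M f" "mor \<Omega> M (Z ^\<^sub>d k) g" "\<And>x. x \<in> carrier (Z ^\<^sub>d k) \<Longrightarrow> g (f x) = x"
    using assms(3) summand_mors unfolding has_mult_def by metis
  let ?X = "{x \<in> carrier M. g x = \<zero>\<^bsub>Z ^\<^sub>d k\<^esub>}"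
  have X: "submod \<Omega> M ?X" by (rule submod_ker[OF fg(2) M Zk])
  note Xm = opmod_sub[OF M X]
  have iso: "M \<simeq>\<^bsub>\<Omega>\<^esub> Z ^\<^sub>d k \<oplus>\<^sub>d sub M ?X" by (rule summand_complement[OF Zk M fg(1,2,3)])
  have "\<not> Z \<unlhd>\<^bsub>\<Omega>\<^esub> sub M ?X"
  proof
    assume ZX: "Z \<unlhd>\<^bsub>\<Omega>\<^esub> sub M ?X"
    have "Z ^\<^sub>d Suc k \<unlhd>\<^bsub>\<Omega>\<^esub> Z \<oplus>\<^sub>d Z ^\<^sub>d k" by (rule iso_summand[OF Zk dpow_Suc])
    also have "\<dots> \<unlhd>\<^bsub>\<Omega>\<^esub> sub M ?X \<oplus>\<^sub>d Z ^\<^sub>d k" by (rule summand_dsum_mono[OF ZX summand_refl])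
    also have "\<dots> \<unlhd>\<^bsub>\<Omega>\<^esub> Z ^\<^sub>d k \<oplus>\<^sub>d sub M ?X" by (rule iso_summand[OF opmod_dsum[OF Xm Zk] dsum_comm])
    also have "\<dots> \<unlhd>\<^bsub>\<Omega>\<^esub> M" by (rule iso_summand'[OF M iso])
    finally show False using assms(3) unfolding has_mult_def by blast
  qed
  with X iso show thesis by (rule that)
qed

text \<open>If the multiplicity were larger than \<open>k\<close>, cancelling \<open>Z\<close> to the \<open>k\<close> would exhibit \<open>Z\<close> as a
  summand of \<open>X\<close>.\<close>

lemma multI:
  assumes indec: "indec \<Omega> Z" and M: "opmod \<Omega> M" and X: "opmod \<Omega> X"
    and iso: "M \<simeq>\<^bsub>\<Omega>\<^esub> Z ^\<^sub>d k \<oplus>\<^sub>d X" and ZX: "\<not> Z \<unlhd>\<^bsub>\<Omega>\<^esub> X"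
  shows "has_mult \<Omega> Z M k"
proof -
  have Z: "opmod \<Omega> Z" and Zl: "finite_length \<Omega> Z" using indec by (simp_all add: indec_def)
  note Zk = opmod_ipow[OF Z]
  have "Z ^\<^sub>d k \<unlhd>\<^bsub>\<Omega>\<^esub> M" by (rule summand_trans[OF summand_dsum(1)[OF Zk X] iso_summand'[OF M iso]])
  moreover have "\<not> Z ^\<^sub>d Suc k \<unlhd>\<^bsub>\<Omega>\<^esub> M"
  proof
    assume "Z ^\<^sub>d Suc k \<unlhd>\<^bsub>\<Omega>\<^esub> M"
    then obtain f g where fg: "mor \<Omega> (Z ^\<^sub>d Suc k) M f" "mor \<Omega> M (Z ^\<^sub>d Suc k) g"
      "\<And>x. x \<in> carrier (Z ^\<^sub>d Suc k) \<Longrightarrow> g (f x) = x"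
      using summand_mors by metis
    let ?Y = "sub M {x \<in> carrier M. g x = \<zero>\<^bsub>Z ^\<^sub>d Suc k\<^esub>}"
    have Y: "opmod \<Omega> ?Y" by (rule opmod_sub[OF M submod_ker[OF fg(2) M Zk]])
    have "Z ^\<^sub>d k \<oplus>\<^sub>d X \<simeq>\<^bsub>\<Omega>\<^esub> M" by (rule iso_sym[OF M iso])
    also have "M \<simeq>\<^bsub>\<Omega>\<^esub> Z ^\<^sub>d Suc k \<oplus>\<^sub>d ?Y" by (rule summand_complement[OF Zk M fg(1,2,3)])
    also have "\<dots> \<simeq>\<^bsub>\<Omega>\<^esub> (Z \<oplus>\<^sub>d Z ^\<^sub>d k) \<oplus>\<^sub>d ?Y" by (rule dsum_cong[OF dpow_Suc iso_refl])
    also have "\<dots> \<simeq>\<^bsub>\<Omega>\<^esub> (Z ^\<^sub>d k \<oplus>\<^sub>d Z) \<oplus>\<^sub>d ?Y" by (rule dsum_cong[OF dsum_comm iso_refl])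
    also have "\<dots> \<simeq>\<^bsub>\<Omega>\<^esub> Z ^\<^sub>d k \<oplus>\<^sub>d (Z \<oplus>\<^sub>d ?Y)" by (rule dsum_assoc)
    finally have "X \<simeq>\<^bsub>\<Omega>\<^esub> Z \<oplus>\<^sub>d ?Y"
      by (rule cancel[OF finite_length_ipow[OF Z Zl finite_lessThan] Zk X opmod_dsum[OF Z Y]])
    then show False using ZX summand_trans[OF summand_dsum(1)[OF Z Y] iso_summand'[OF X]] by blast
  qed
  ultimately show ?thesis unfolding has_mult_def ..
qed

lemma mult_dsum:
  assumes indec: "indec \<Omega> Z" and M: "opmod \<Omega> M" and N: "opmod \<Omega> N"
    and k: "has_mult \<Omega> Z M k" and l: "has_mult \<Omega> Z N l"
  shows "has_mult \<Omega> Z (M \<oplus>\<^sub>d N) (k + l)"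
proof -
  have Z: "opmod \<Omega> Z" using indec by (simp add: indec_def)
  note Zk = opmod_ipow[OF Z]
  obtain X where X: "submod \<Omega> M X" "M \<simeq>\<^bsub>\<Omega>\<^esub> Z ^\<^sub>d k \<oplus>\<^sub>d sub M X" "\<not> Z \<unlhd>\<^bsub>\<Omega>\<^esub> sub M X"
    using mult_complement[OF indec M k] .
  obtain Y where Y: "submod \<Omega> N Y" "N \<simeq>\<^bsub>\<Omega>\<^esub> Z ^\<^sub>d l \<oplus>\<^sub>d sub N Y" "\<not> Z \<unlhd>\<^bsub>\<Omega>\<^esub> sub N Y"
    using mult_complement[OF indec N l] .
  note Xm = opmod_sub[OF M X(1)] and Ym = opmod_sub[OF N Y(1)]
  have "M \<oplus>\<^sub>d N \<simeq>\<^bsub>\<Omega>\<^esub> (Z ^\<^sub>d k \<oplus>\<^sub>d sub M X) \<oplus>\<^sub>d (Z ^\<^sub>d l \<oplus>\<^sub>d sub N Y)" by (rule dsum_cong[OF X(2) Y(2)])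
  also have "\<dots> \<simeq>\<^bsub>\<Omega>\<^esub> (Z ^\<^sub>d k \<oplus>\<^sub>d Z ^\<^sub>d l) \<oplus>\<^sub>d (sub M X \<oplus>\<^sub>d sub N Y)"
    by (rule dsum_shuffle[OF Zk Xm Zk Ym])
  also have "\<dots> \<simeq>\<^bsub>\<Omega>\<^esub> Z ^\<^sub>d (k + l) \<oplus>\<^sub>d (sub M X \<oplus>\<^sub>d sub N Y)"
    by (rule dsum_cong[OF iso_sym[OF Zk dpow_add[OF Z]] iso_refl])
  finally show ?thesis
    by (rule multI[OF indec opmod_dsum[OF M N] opmod_dsum[OF Xm Ym]])
      (use X(3) Y(3) indec_summand_dsum[OF indec Xm Ym] in blast)
qed

lemma mult_zero_iff: "opmod \<Omega> Z \<Longrightarrow> opmod \<Omega> M \<Longrightarrow> has_mult \<Omega> Z M 0 \<longleftrightarrow> \<not> Z \<unlhd>\<^bsub>\<Omega>\<^esub> M"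
proof -
  assume Z: "opmod \<Omega> Z" and M: "opmod \<Omega> M"
  have "Z ^\<^sub>d Suc 0 \<simeq>\<^bsub>\<Omega>\<^esub> Z \<oplus>\<^sub>d Z ^\<^sub>d 0" by (rule dpow_Suc)
  also have "\<dots> \<simeq>\<^bsub>\<Omega>\<^esub> Z ^\<^sub>d 0 \<oplus>\<^sub>d Z" by (rule dsum_comm)
  also have "\<dots> \<simeq>\<^bsub>\<Omega>\<^esub> Z" by (rule dsum_zero[OF opmod_ipow[OF Z] Z dpow_zero])
  finally have 1: "Z ^\<^sub>d Suc 0 \<simeq>\<^bsub>\<Omega>\<^esub> Z" .
  interpret M: opmod \<Omega> M by fact
  interpret Z0: opmod \<Omega> "Z ^\<^sub>d 0" by (rule opmod_ipow[OF Z])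
  have "Z ^\<^sub>d 0 \<unlhd>\<^bsub>\<Omega>\<^esub> M" unfolding summand_def
    using mor_const_zero[OF M] mor_const_zero[OF Z0.opmod_axioms] by (intro exI conjI) (auto simp: dpow_zero)
  then show ?thesis unfolding has_mult_def
    using summand_trans[OF iso_summand[OF opmod_ipow[OF Z] 1]] summand_trans[OF iso_summand'[OF opmod_ipow[OF Z] 1]]
    by blast
qed

lemma mult_dpow:
  assumes indec: "indec \<Omega> Z" and M: "opmod \<Omega> M" and k: "has_mult \<Omega> Z M k"
  shows "has_mult \<Omega> Z (M ^\<^sub>d l) (l * k)"
proof (induction l)
  case 0
  have "opmod \<Omega> Z" using indec by (simp add: indec_def)
  then show ?case
    using mult_zero_iff[OF _ opmod_ipow[OF M]] indec_not_summand_zero[OF indec opmod_ipow[OF M] dpow_zero]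
    by (metis mult_0)
next
  case (Suc l)
  show ?case
    using mult_dsum[OF indec M opmod_ipow[OF M] k Suc]
      mult_iso[OF opmod_ipow[OF M] dpow_Suc, where k = "k + l * k" and Z = Z] by simp
qed

lemma mult_self: assumes "indec \<Omega> Z" shows "has_mult \<Omega> Z Z 1"
proof -
  have Z: "opmod \<Omega> Z" using assms by (simp add: indec_def)
  have "Z \<simeq>\<^bsub>\<Omega>\<^esub> Z ^\<^sub>d 0 \<oplus>\<^sub>d Z"
    by (rule iso_sym[OF _ dsum_zero[OF opmod_ipow[OF Z] Z dpow_zero]]) (intro opmod_dsum opmod_ipow Z)
  also have "\<dots> \<simeq>\<^bsub>\<Omega>\<^esub> Z \<oplus>\<^sub>d Z ^\<^sub>d 0" by (rule dsum_comm)
  also have "\<dots> \<simeq>\<^bsub>\<Omega>\<^esub> Z ^\<^sub>d 1"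
    using iso_sym[OF opmod_ipow[OF Z] dpow_Suc[of Z 0 \<Omega>]] by (simp only: One_nat_def)
  also have "\<dots> \<simeq>\<^bsub>\<Omega>\<^esub> Z ^\<^sub>d 0 \<oplus>\<^sub>d Z ^\<^sub>d 1"
    by (rule iso_sym[OF _ dsum_zero[OF opmod_ipow[OF Z] opmod_ipow[OF Z] dpow_zero]]) (intro opmod_dsum opmod_ipow Z)
  also have "\<dots> \<simeq>\<^bsub>\<Omega>\<^esub> Z ^\<^sub>d 1 \<oplus>\<^sub>d Z ^\<^sub>d 0" by (rule dsum_comm)
  finally show ?thesis
    by (rule multI[OF assms Z opmod_ipow[OF Z]]) (rule indec_not_summand_zero[OF assms opmod_ipow[OF Z] dpow_zero])
qed

lemma mult_exists:
  assumes "indec \<Omega> Z" "opmod \<Omega> M" "len_le \<Omega> M n" shows "\<exists>k \<le> n. has_mult \<Omega> Z M k"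
  using assms(2,3)
proof (induction n arbitrary: M rule: less_induct)
  case (less n)
  have Z: "opmod \<Omega> Z" using assms(1) by (simp add: indec_def)
  show ?case
  proof (cases "Z \<unlhd>\<^bsub>\<Omega>\<^esub> M")
    case False
    then show ?thesis using mult_zero_iff[OF Z less.prems(1)] by blast
  next
    case True
    obtain X where X: "submod \<Omega> M X" "M \<simeq>\<^bsub>\<Omega>\<^esub> Z \<oplus>\<^sub>d sub M X" "0 < n" "len_le \<Omega> (sub M X) (n - 1)"
      using indec_complement[OF assms(1) less.prems True] .
    note Xm = opmod_sub[OF less.prems(1) X(1)]
    obtain k where k: "k \<le> n - 1" "has_mult \<Omega> Z (sub M X) k" using less.IH[OF _ Xm X(4)] X(3) by auto
    have "has_mult \<Omega> Z M (1 + k)"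
      using mult_dsum[OF assms(1) Z Xm mult_self[OF assms(1)] k(2)] mult_iso[OF less.prems(1) X(2)] by blast
    then show ?thesis using k(1) X(3) by (intro exI[of _ "1 + k"]) auto
  qed
qed

text \<open>This is the form of the Krull--Schmidt theorem that is used below. An indecomposable summand
  of \<open>N\<close> is split off from both modules; since multiplicities are additive, the
  hypothesis passes to the complements.\<close>

lemma summand_of_mult_le:
  fixes N :: "('a, 'c) bimodule" and M :: "('a, 'b) bimodule"
  assumes "opmod \<Omega> N" "len_le \<Omega> N n" "opmod \<Omega> M" "finite_length \<Omega> M"
    and "\<And>(Z :: ('a, 'c) bimodule) i j. indec \<Omega> Z \<Longrightarrow> has_mult \<Omega> Z N i \<Longrightarrow> has_mult \<Omega> Z M j \<Longrightarrow> i \<le> j"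
  shows "N \<unlhd>\<^bsub>\<Omega>\<^esub> M"
  using assms
proof (induction n arbitrary: N M rule: less_induct)
  case (less n)
  note N = less.prems(1) and M = less.prems(3)
  interpret M: opmod \<Omega> M by fact
  interpret N: opmod \<Omega> N by fact
  show ?case
  proof (cases "carrier N = {\<zero>\<^bsub>N\<^esub>}")
    case True
    then show ?thesis unfolding summand_def
      using mor_const_zero[OF M] mor_const_zero[OF N] by (intro exI conjI) auto
  next
    case False
    obtain U where U: "submod \<Omega> N U" "indec \<Omega> (sub N U)" "sub N U \<unlhd>\<^bsub>\<Omega>\<^esub> N"
      using exists_indec_summand[OF N less.prems(2) False] by blast
    let ?Z = "sub N U"
    have Z: "opmod \<Omega> ?Z" using U(2) by (simp add: indec_def)
    obtain X where X: "submod \<Omega> N X" "N \<simeq>\<^bsub>\<Omega>\<^esub> ?Z \<oplus>\<^sub>d sub N X" "0 < n" "len_le \<Omega> (sub N X) (n - 1)"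
      using indec_complement[OF U(2) N less.prems(2) U(3)] .
    note Xm = opmod_sub[OF N X(1)]
    obtain l where Ml: "len_le \<Omega> M l" using less.prems(4) unfolding finite_length_def by blast
    obtain i j where ij: "has_mult \<Omega> ?Z N i" "has_mult \<Omega> ?Z M j"
      using mult_exists[OF U(2) N less.prems(2)] mult_exists[OF U(2) M Ml] by blast
    have "i \<noteq> 0" using ij(1) U(3) mult_zero_iff[OF Z N] by metis
    then have "j \<noteq> 0" using less.prems(5)[OF U(2) ij] by simp
    then have "\<not> has_mult \<Omega> ?Z M 0" using mult_unique[OF Z ij(2)] by blast
    then have "?Z \<unlhd>\<^bsub>\<Omega>\<^esub> M" using mult_zero_iff[OF Z M] by blast
    then obtain Y where Y: "submod \<Omega> M Y" "M \<simeq>\<^bsub>\<Omega>\<^esub> ?Z \<oplus>\<^sub>d sub M Y" "len_le \<Omega> (sub M Y) (l - 1)"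
      using indec_complement[OF U(2) M Ml] by metis
    note Ym = opmod_sub[OF M Y(1)]
    have "sub N X \<unlhd>\<^bsub>\<Omega>\<^esub> sub M Y"
    proof (rule less.IH[OF _ Xm X(4) Ym])
      show "finite_length \<Omega> (sub M Y)" using Y(3) unfolding finite_length_def by blast
      fix Z' :: "('a, 'c) bimodule" and i j
      assume Z': "indec \<Omega> Z'" and ij: "has_mult \<Omega> Z' (sub N X) i" "has_mult \<Omega> Z' (sub M Y) j"
      have len: "finite_length \<Omega> ?Z" using U(2) by (simp add: indec_def)
      then obtain e where e: "has_mult \<Omega> Z' ?Z e" using mult_exists[OF Z' Z] unfolding finite_length_def by blast
      have "has_mult \<Omega> Z' N (e + i)" "has_mult \<Omega> Z' M (e + j)"
        using mult_dsum[OF Z' Z Xm e ij(1)] mult_iso[OF N X(2)] mult_dsum[OF Z' Z Ym e ij(2)] mult_iso[OF M Y(2)]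
        by blast+
      then show "i \<le> j" using less.prems(5)[OF Z'] by fastforce
    qed (use X(3) in simp)
    then have "?Z \<oplus>\<^sub>d sub N X \<unlhd>\<^bsub>\<Omega>\<^esub> ?Z \<oplus>\<^sub>d sub M Y" by (rule summand_dsum_mono[OF summand_refl])
    then show ?thesis
      by (rule summand_trans[OF iso_summand[OF N X(2)] summand_trans[OF _ iso_summand'[OF M Y(2)]]])
  qed
qed

lemma dpow_eq_zero:
  assumes "opmod \<Omega> M" "0 < v" "carrier (M ^\<^sub>d v) = {\<zero>\<^bsub>M ^\<^sub>d v\<^esub>}" shows "carrier M = {\<zero>\<^bsub>M\<^esub>}"
proof -
  interpret M: opmod \<Omega> M by fact
  have "x = \<zero>\<^bsub>M\<^esub>" if "x \<in> carrier M" for x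
  proof -
    have "(\<lambda>i \<in> {..<v}. x) \<in> carrier (M ^\<^sub>d v)" using that by simp
    then have "(\<lambda>i \<in> {..<v}. x) = (\<lambda>i \<in> {..<v}. \<zero>\<^bsub>M\<^esub>)" unfolding assms(3) by simp
    then show ?thesis using assms(2) by (metis lessThan_iff restrict_apply')
  qed
  then show ?thesis by auto
qed

lemma iso_zero_carrier:
  assumes "M \<simeq>\<^bsub>\<Omega>\<^esub> N" "opmod \<Omega> M" "opmod \<Omega> N" "carrier M = {\<zero>\<^bsub>M\<^esub>}" shows "carrier N = {\<zero>\<^bsub>N\<^esub>}"
proof -
  obtain f where "mor \<Omega> M N f" "bij_betw f (carrier M) (carrier N)" using assms(1) unfolding mod_iso_def by blast
  then show ?thesis using assms(4) mor_zero[of \<Omega> M N f] opmod_ab[OF assms(2)] opmod_ab[OF assms(3)]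
    by (auto simp: bij_betw_def)
qed

text \<open>Passing to the \<open>v\<close>-th power multiplies all multiplicities by \<open>v\<close>, so \<open>M\<close> is a summand of \<open>N\<close>.
  By cancellation the \<open>v\<close>-th power of the complement vanishes, and hence the complement.\<close>

lemma dpow_root:
  assumes M: "opmod \<Omega> M" and N: "opmod \<Omega> N" and Ml: "finite_length \<Omega> M" and Nl: "finite_length \<Omega> N"
    and v: "0 < v" and iso: "M ^\<^sub>d v \<simeq>\<^bsub>\<Omega>\<^esub> N ^\<^sub>d v"
  shows "M \<simeq>\<^bsub>\<Omega>\<^esub> N"
proof -
  note Mv = opmod_ipow[OF M] and Nv = opmod_ipow[OF N]
  obtain n where n: "len_le \<Omega> M n" using Ml unfolding finite_length_def by blast
  have "M \<unlhd>\<^bsub>\<Omega>\<^esub> N"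
  proof (rule summand_of_mult_le[OF M n N Nl])
    fix Z :: "('a, 'b) bimodule" and i j
    assume Z: "indec \<Omega> Z" and ij: "has_mult \<Omega> Z M i" "has_mult \<Omega> Z N j"
    have "has_mult \<Omega> Z (N ^\<^sub>d v) (v * i)" using mult_dpow[OF Z M ij(1)] mult_iso[OF Mv iso] by blast
    then have "v * i = v * j"
      using mult_dpow[OF Z N ij(2)] mult_unique Z unfolding indec_def by blast
    then show "i \<le> j" using v by simp
  qed
  then obtain f g where fg: "mor \<Omega> M N f" "mor \<Omega> N M g" "\<And>x. x \<in> carrier M \<Longrightarrow> g (f x) = x"
    using summand_mors by metis
  let ?X = "{x \<in> carrier N. g x = \<zero>\<^bsub>M\<^esub>}"
  have X: "opmod \<Omega> (sub N ?X)" by (rule opmod_sub[OF N submod_ker[OF fg(2) N M]])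
  have NX: "N \<simeq>\<^bsub>\<Omega>\<^esub> M \<oplus>\<^sub>d sub N ?X" by (rule summand_complement[OF M N fg(1,2,3)])
  have "M ^\<^sub>d v \<oplus>\<^sub>d M ^\<^sub>d 0 \<simeq>\<^bsub>\<Omega>\<^esub> M ^\<^sub>d 0 \<oplus>\<^sub>d M ^\<^sub>d v" by (rule dsum_comm)
  also have "\<dots> \<simeq>\<^bsub>\<Omega>\<^esub> M ^\<^sub>d v" by (rule dsum_zero[OF Mv Mv dpow_zero])
  also note iso
  also have "N ^\<^sub>d v \<simeq>\<^bsub>\<Omega>\<^esub> (M \<oplus>\<^sub>d sub N ?X) ^\<^sub>d v" by (rule ipow_cong[OF NX N])
  also have "\<dots> \<simeq>\<^bsub>\<Omega>\<^esub> M ^\<^sub>d v \<oplus>\<^sub>d (sub N ?X) ^\<^sub>d v" by (rule dpow_dsum[OF M X])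
  finally have "M ^\<^sub>d 0 \<simeq>\<^bsub>\<Omega>\<^esub> (sub N ?X) ^\<^sub>d v"
    by (rule cancel[OF finite_length_ipow[OF M Ml finite_lessThan] Mv Mv opmod_ipow[OF X]])
  then have "carrier ((sub N ?X) ^\<^sub>d v) = {\<zero>\<^bsub>(sub N ?X) ^\<^sub>d v\<^esub>}"
    by (rule iso_zero_carrier[OF _ Mv opmod_ipow[OF X] dpow_zero])
  then have "carrier (sub N ?X) = {\<zero>\<^bsub>sub N ?X\<^esub>}" by (rule dpow_eq_zero[OF X v])
  then have "sub N ?X \<oplus>\<^sub>d M \<simeq>\<^bsub>\<Omega>\<^esub> M" by (rule dsum_zero[OF X M])
  then have "N \<simeq>\<^bsub>\<Omega>\<^esub> M" by (rule iso_trans[OF iso_trans[OF NX dsum_comm]])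
  then show ?thesis by (rule iso_sym[OF N])
qed

section \<open>Bimodules, bases and tensor products\<close>

abbreviation lops :: "'a set \<Rightarrow> ('a + 'a) set" where "lops S \<equiv> Inl ` S"
abbreviation rops :: "'a set \<Rightarrow> ('a + 'a) set" where "rops S \<equiv> Inr ` S"
abbreviation bops :: "('a, 'k) ring_scheme \<Rightarrow> ('a + 'a) set" where
  "bops R \<equiv> Inl ` carrier R \<union> Inr ` carrier R"

lemma left_module_iso_iff: "left_module_iso R M N \<longleftrightarrow> M \<simeq>\<^bsub>lops (carrier R)\<^esub> N"
  unfolding left_module_iso_def mod_iso_def additive_bij_def left_linear_def mor_def
  by (rule ex_cong1) (auto simp: bij_betw_def ball_Un)

lemma right_module_iso_iff: "right_module_iso R M N \<longleftrightarrow> M \<simeq>\<^bsub>rops (carrier R)\<^esub> N"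
  unfolding right_module_iso_def mod_iso_def additive_bij_def right_linear_def mor_def
  by (rule ex_cong1) (auto simp: bij_betw_def ball_Un)

lemma bimodule_iso_iff: "bimodule_iso R M N \<longleftrightarrow> M \<simeq>\<^bsub>bops R\<^esub> N"
  unfolding bimodule_iso_def mod_iso_def additive_bij_def left_linear_def right_linear_def mor_def
  by (rule ex_cong1) (auto simp: bij_betw_def ball_Un)

context bimodule
begin

lemma opmod_bops: "opmod (bops R) M"
  by (rule opmodI[OF M.abelian_group_axioms])
    (auto simp: lsmult_closed rsmult_closed lsmult_distr rsmult_distr)

lemma opmod_lops: "S \<subseteq> carrier R \<Longrightarrow> opmod (lops S) M"
  by (rule opmod.opmod_mono[OF opmod_bops]) auto

lemma opmod_rops: "S \<subseteq> carrier R \<Longrightarrow> opmod (rops S) M"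
  by (rule opmod.opmod_mono[OF opmod_bops]) auto

lemma smult_zero:
  assumes "a \<in> carrier R" shows "a \<odot>\<^bsub>M\<^esub> \<zero>\<^bsub>M\<^esub> = \<zero>\<^bsub>M\<^esub>" "\<zero>\<^bsub>M\<^esub> \<odot>\<^sup>r\<^bsub>M\<^esub> a = \<zero>\<^bsub>M\<^esub>"
proof -
  interpret opmod "bops R" M by (rule opmod_bops)
  show "a \<odot>\<^bsub>M\<^esub> \<zero>\<^bsub>M\<^esub> = \<zero>\<^bsub>M\<^esub>" "\<zero>\<^bsub>M\<^esub> \<odot>\<^sup>r\<^bsub>M\<^esub> a = \<zero>\<^bsub>M\<^esub>"
    using act_zero[of "Inl a"] act_zero[of "Inr a"] assms by auto
qed

end

lemma dsum_smult_simps [simp]: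
  "a \<odot>\<^bsub>M \<oplus>\<^sub>d N\<^esub> x = (a \<odot>\<^bsub>M\<^esub> fst x, a \<odot>\<^bsub>N\<^esub> snd x)"
  "x \<odot>\<^sup>r\<^bsub>M \<oplus>\<^sub>d N\<^esub> a = (fst x \<odot>\<^sup>r\<^bsub>M\<^esub> a, snd x \<odot>\<^sup>r\<^bsub>N\<^esub> a)"
  by (simp_all add: dsum_def)

lemma ipow_smult_simps [simp]:
  "a \<odot>\<^bsub>ipow M I\<^esub> f = (\<lambda>i \<in> I. a \<odot>\<^bsub>M\<^esub> f i)" "f \<odot>\<^sup>r\<^bsub>ipow M I\<^esub> a = (\<lambda>i \<in> I. f i \<odot>\<^sup>r\<^bsub>M\<^esub> a)"
  by (simp_all add: ipow_def)

lemma regular_simps [simp]: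
  "carrier (regular_bimodule R) = carrier R" "\<zero>\<^bsub>regular_bimodule R\<^esub> = \<zero>\<^bsub>R\<^esub>"
  "x \<oplus>\<^bsub>regular_bimodule R\<^esub> y = x \<oplus>\<^bsub>R\<^esub> y"
  "a \<odot>\<^bsub>regular_bimodule R\<^esub> x = a \<otimes>\<^bsub>R\<^esub> x" "x \<odot>\<^sup>r\<^bsub>regular_bimodule R\<^esub> a = x \<otimes>\<^bsub>R\<^esub> a"
  by (simp_all add: regular_bimodule_def)

lemma finsum_regular [simp]: "finsum (regular_bimodule R) f I = finsum R f I"
  by (simp add: finsum_def finprod_def regular_bimodule_def)

lemma regular_neg [simp]: "\<ominus>\<^bsub>regular_bimodule R\<^esub> x = \<ominus>\<^bsub>R\<^esub> x"
  by (simp add: a_inv_def m_inv_def regular_bimodule_def)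

context bimodule
begin

lemma mor_scalar_left: "x \<in> carrier M \<Longrightarrow> mor (lops (carrier R)) (regular_bimodule R) M (\<lambda>a. a \<odot>\<^bsub>M\<^esub> x)"
  by (rule morI) (auto simp: lsmult_closed lsmult_distr_ring lsmult_assoc)

lemma mor_scalar_right: "x \<in> carrier M \<Longrightarrow> mor (rops (carrier R)) (regular_bimodule R) M (\<lambda>a. x \<odot>\<^sup>r\<^bsub>M\<^esub> a)"
  by (rule morI) (auto simp: rsmult_closed rsmult_distr_ring rsmult_assoc)

lemma mor_act_left: "a \<in> carrier R \<Longrightarrow> mor (rops (carrier R)) M M (\<lambda>x. a \<odot>\<^bsub>M\<^esub> x)"
  by (rule morI) (auto simp: lsmult_closed lsmult_distr lsmult_rsmult)

lemma mor_act_right: "a \<in> carrier R \<Longrightarrow> mor (lops (carrier R)) M M (\<lambda>x. x \<odot>\<^sup>r\<^bsub>M\<^esub> a)"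
  by (rule morI) (auto simp: rsmult_closed rsmult_distr lsmult_rsmult)

lemma abelian_regular: "abelian_group (regular_bimodule R)"
  using R.bimodule_regular by (simp add: bimodule_def)

lemma smult_finsum_left:
  assumes "x \<in> carrier M" "f \<in> I \<rightarrow> carrier R"
  shows "finsum R f I \<odot>\<^bsub>M\<^esub> x = finsum M (\<lambda>i. f i \<odot>\<^bsub>M\<^esub> x) I"
  using mor_finsum[OF mor_scalar_left[OF assms(1)] abelian_regular M.abelian_group_axioms] assms(2) by simp

lemma rsmult_finsum_right:
  assumes "x \<in> carrier M" "f \<in> I \<rightarrow> carrier R"
  shows "x \<odot>\<^sup>r\<^bsub>M\<^esub> finsum R f I = finsum M (\<lambda>i. x \<odot>\<^sup>r\<^bsub>M\<^esub> f i) I"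
  using mor_finsum[OF mor_scalar_right[OF assms(1)] abelian_regular M.abelian_group_axioms] assms(2) by simp

lemma smult_finsum:
  assumes "a \<in> carrier R" "f \<in> I \<rightarrow> carrier M"
  shows "a \<odot>\<^bsub>M\<^esub> finsum M f I = finsum M (\<lambda>i. a \<odot>\<^bsub>M\<^esub> f i) I"
  by (rule mor_finsum[OF mor_act_left[OF assms(1)] M.abelian_group_axioms M.abelian_group_axioms assms(2)])

lemma rsmult_finsum:
  assumes "a \<in> carrier R" "f \<in> I \<rightarrow> carrier M"
  shows "finsum M f I \<odot>\<^sup>r\<^bsub>M\<^esub> a = finsum M (\<lambda>i. f i \<odot>\<^sup>r\<^bsub>M\<^esub> a) I"
  by (rule mor_finsum[OF mor_act_right[OF assms(1)] M.abelian_group_axioms M.abelian_group_axioms assms(2)])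

end

text \<open>A module with operators that is isomorphic to a bimodule is a bimodule. This yields the associativity
  of the right action on the coordinate form of a tensor product.\<close>

lemma bimodule_transport:
  assumes "bimodule R M" and iso: "M \<simeq>\<^bsub>bops R\<^esub> N" and N: "opmod (bops R) N"
  shows "bimodule R N"
proof -
  interpret M: bimodule R M by fact
  interpret N: opmod "bops R" N by fact
  obtain h where h: "mor (bops R) M N h" "bij_betw h (carrier M) (carrier N)"
    using iso unfolding mod_iso_def by blast
  have l: "h (a \<odot>\<^bsub>M\<^esub> x) = a \<odot>\<^bsub>N\<^esub> h x" and r: "h (x \<odot>\<^sup>r\<^bsub>M\<^esub> a) = h x \<odot>\<^sup>r\<^bsub>N\<^esub> a"
    if "a \<in> carrier R" "x \<in> carrier M" for a x
    using mor_act[OF h(1) that(2), of "Inl a"] mor_act[OF h(1) that(2), of "Inr a"] that by auto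
  have ex: "\<exists>x \<in> carrier M. y = h x" if "y \<in> carrier N" for y
    using that h(2) by (auto simp: bij_betw_def)
  note c = mor_closed[OF h(1)] M.lsmult_closed M.rsmult_closed
  have "bimodule_axioms R N"
  proof (unfold_locales, goal_cases)
    case (1 a x) then show ?case using N.act_closed[of "Inl a"] by auto
  next
    case (2 a b x)
    then obtain x' where "x' \<in> carrier M" "x = h x'" using ex by blast
    with 2 show ?case by (simp add: c M.lsmult_distr_ring mor_add[OF h(1)] flip: l)
  next
    case (3 a x y) then show ?case using N.act_add[of "Inl a"] by auto
  next
    case (4 a b x)
    then obtain x' where "x' \<in> carrier M" "x = h x'" using ex by blast
    with 4 show ?case by (simp add: c M.lsmult_assoc flip: l)
  next
    case (5 x)
    then obtain x' where "x' \<in> carrier M" "x = h x'" using ex by blast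
    then show ?case by (simp add: M.lsmult_one flip: l)
  next
    case (6 a x) then show ?case using N.act_closed[of "Inr a"] by auto
  next
    case (7 a b x)
    then obtain x' where "x' \<in> carrier M" "x = h x'" using ex by blast
    with 7 show ?case by (simp add: c M.rsmult_distr_ring mor_add[OF h(1)] flip: r)
  next
    case (8 a x y) then show ?case using N.act_add[of "Inr a"] by auto
  next
    case (9 a b x)
    then obtain x' where "x' \<in> carrier M" "x = h x'" using ex by blast
    with 9 show ?case by (simp add: c M.rsmult_assoc flip: r)
  next
    case (10 x)
    then obtain x' where "x' \<in> carrier M" "x = h x'" using ex by blast
    then show ?case by (simp add: M.rsmult_one flip: r)
  next
    case (11 a b x)
    then obtain x' where "x' \<in> carrier M" "x = h x'" using ex by blast
    with 11 show ?case by (simp add: c M.lsmult_rsmult flip: l r)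
  qed
  then show ?thesis by (intro bimodule.intro M.R.ring_axioms N.abelian_group_axioms)
qed

lemma bimodule_sub:
  assumes "bimodule R M" "submod (bops R) M U" shows "bimodule R (sub M U)"
proof -
  interpret M: bimodule R M by fact
  have a: "a \<odot>\<^bsub>M\<^esub> x \<in> U" "x \<odot>\<^sup>r\<^bsub>M\<^esub> a \<in> U" if "a \<in> carrier R" "x \<in> U" for a x
    using submodD(5)[OF assms(2), of "Inl a" x] submodD(5)[OF assms(2), of "Inr a" x] that by auto
  note D = submodD(1)[OF assms(2)]
  have "bimodule_axioms R (sub M U)"
    by unfold_locales (auto simp: a D M.lsmult_distr_ring M.lsmult_distr M.lsmult_assoc M.lsmult_one
        M.rsmult_distr_ring M.rsmult_distr M.rsmult_assoc M.rsmult_one M.lsmult_rsmult)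
  then show ?thesis
    by (intro bimodule.intro M.R.ring_axioms sub_abelian_group[OF M.M.abelian_group_axioms assms(2)])
qed

subsection \<open>Bases\<close>

text \<open>A left basis \<open>e\<close> with its coordinate functions \<open>c\<close>. For \<open>S = carrier R\<close> this describes a free
  left module over the ring, for a subfield \<open>S\<close> a vector space.\<close>

locale lbasis = bimodule R N for R :: "('a, 'k) ring_scheme" (structure) and N :: "('a, 'c) bimodule" +
  fixes S :: "'a set" and I :: "'i set" and e :: "'i \<Rightarrow> 'c" and c :: "'i \<Rightarrow> 'c \<Rightarrow> 'a"
  assumes S: "S \<subseteq> carrier R" and fin [simp]: "finite I"
    and e_closed [simp]: "i \<in> I \<Longrightarrow> e i \<in> carrier N"
    and c_in: "i \<in> I \<Longrightarrow> y \<in> carrier N \<Longrightarrow> c i y \<in> S"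
    and c_add: "i \<in> I \<Longrightarrow> y \<in> carrier N \<Longrightarrow> y' \<in> carrier N \<Longrightarrow> c i (y \<oplus>\<^bsub>N\<^esub> y') = c i y \<oplus> c i y'"
    and c_smult: "i \<in> I \<Longrightarrow> s \<in> S \<Longrightarrow> y \<in> carrier N \<Longrightarrow> c i (s \<odot>\<^bsub>N\<^esub> y) = s \<otimes> c i y"
    and c_e: "i \<in> I \<Longrightarrow> j \<in> I \<Longrightarrow> c i (e j) = (if i = j then \<one> else \<zero>)"
    and expand: "y \<in> carrier N \<Longrightarrow> finsum N (\<lambda>i. c i y \<odot>\<^bsub>N\<^esub> e i) I = y"
begin

lemma c_closed [simp]: "i \<in> I \<Longrightarrow> y \<in> carrier N \<Longrightarrow> c i y \<in> carrier R"
  using c_in S by blast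

lemma c_mor: "i \<in> I \<Longrightarrow> mor (lops S) N (regular_bimodule R) (c i)"
  by (rule morI) (auto simp: c_add c_smult)

lemma c_finsum:
  assumes "i \<in> I" "g \<in> J \<rightarrow> carrier N" shows "c i (finsum N g J) = finsum R (\<lambda>j. c i (g j)) J"
  using mor_finsum[OF c_mor[OF assms(1)] M.abelian_group_axioms abelian_regular assms(2)] by simp

lemma ext: assumes "x \<in> carrier N" "y \<in> carrier N" "\<And>i. i \<in> I \<Longrightarrow> c i x = c i y" shows "x = y"
proof -
  have "finsum N (\<lambda>i. c i x \<odot>\<^bsub>N\<^esub> e i) I = finsum N (\<lambda>i. c i y \<odot>\<^bsub>N\<^esub> e i) I"
    using assms by (intro M.finsum_cong') (auto intro: lsmult_closed)
  then show ?thesis using expand assms(1,2) by metis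
qed

end

lemma ipow_expand:
  assumes M: "opmod \<Omega> M" and I: "finite I" and f: "f \<in> carrier (ipow M I)"
  shows "finsum (ipow M I) (\<lambda>i. \<lambda>j \<in> I. if j = i then f i else \<zero>\<^bsub>M\<^esub>) I = f"
proof -
  interpret M: opmod \<Omega> M by fact
  interpret P: opmod \<Omega> "ipow M I" by (rule opmod_ipow[OF M])
  have fc: "f i \<in> carrier M" if "i \<in> I" for i using f that by auto
  let ?g = "\<lambda>i. \<lambda>j \<in> I. if j = i then f i else \<zero>\<^bsub>M\<^esub>"
  have g: "?g \<in> I \<rightarrow> carrier (ipow M I)" using fc by auto
  have "finsum (ipow M I) ?g I j = f j" if j: "j \<in> I" for j
  proof -
    have ev: "mor {} (ipow M I) M (\<lambda>f. f j)" by (rule morI) (use j in auto)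
    have "finsum (ipow M I) ?g I j = finsum M (\<lambda>i. ?g i j) I"
      by (rule mor_finsum[OF ev P.abelian_group_axioms M.abelian_group_axioms g])
    also have "\<dots> = finsum M (\<lambda>i. if j = i then f i else \<zero>\<^bsub>M\<^esub>) I"
      using j fc by (intro M.finsum_cong') auto
    also have "\<dots> = f j" by (rule M.finsum_singleton[OF j I]) (use fc in auto)
    finally show ?thesis .
  qed
  moreover have "finsum (ipow M I) ?g I \<in> carrier (ipow M I)" by (rule P.finsum_closed[OF g])
  ultimately show ?thesis using f by (auto intro: PiE_ext)
qed

lemma lbasis_of_iso:
  assumes N: "bimodule R N" and S: "subring S R" and I: "finite I"
    and iso: "ipow (sub (regular_bimodule R) S) I \<simeq>\<^bsub>lops S\<^esub> N"
  shows "\<exists>e c. lbasis R N S I e c"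
proof -
  interpret N: bimodule R N by fact
  note SE = subringE[OF S]
  let ?S = "sub (regular_bimodule R) S"
  have SR: "S \<subseteq> carrier R" by (rule SE(1))
  interpret reg: bimodule R "regular_bimodule R" by (rule N.R.bimodule_regular)
  have sS: "submod (lops S) (regular_bimodule R) S"
    using SE by (auto simp: submod_def)
  have Sm: "opmod (lops S) ?S" by (rule opmod_sub[OF reg.opmod_lops[OF SR] sS])
  interpret Sp: opmod "lops S" "ipow ?S I" by (rule opmod_ipow[OF Sm])
  obtain h where h: "mor (lops S) (ipow ?S I) N h" "bij_betw h (carrier (ipow ?S I)) (carrier N)"
    using iso unfolding mod_iso_def by blast
  obtain g where g: "mor (lops S) N (ipow ?S I) g" "\<And>x. x \<in> carrier (ipow ?S I) \<Longrightarrow> g (h x) = x"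
    "\<And>y. y \<in> carrier N \<Longrightarrow> h (g y) = y"
    using mor_inv[OF h Sp.opmod_axioms] by metis
  define \<delta> where "\<delta> i = (\<lambda>j \<in> I. if j = i then \<one>\<^bsub>R\<^esub> else \<zero>\<^bsub>R\<^esub>)" for i
  have \<delta>: "\<delta> i \<in> carrier (ipow ?S I)" for i
    unfolding \<delta>_def using SE by auto
  have gS: "g y i \<in> S" if "y \<in> carrier N" "i \<in> I" for y i using mor_closed[OF g(1) that(1)] that(2) by auto
  have "lbasis R N S I (\<lambda>i. h (\<delta> i)) (\<lambda>i y. g y i)"
  proof (unfold_locales, goal_cases)
    case 1 then show ?case by (rule SR)
  next
    case 2 then show ?case by (rule I)
  next
    case (3 i) show ?case by (rule mor_closed[OF h(1) \<delta>])
  next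
    case (4 i y) then show ?case by (intro gS)
  next
    case (5 i y y') then show ?case by (simp add: mor_add[OF g(1)])
  next
    case (6 i s y) then show ?case using mor_act[OF g(1), of y "Inl s"] by simp
  next
    case (7 i j) then show ?case using g(2)[OF \<delta>, of j] by (simp add: \<delta>_def)
  next
    case (8 y)
    have "y = h (g y)" using g(3)[OF 8] by simp
    also have "g y = finsum (ipow ?S I) (\<lambda>i. \<lambda>j \<in> I. if j = i then g y i else \<zero>\<^bsub>?S\<^esub>) I"
      by (rule ipow_expand[OF Sm I mor_closed[OF g(1) 8], symmetric])
    also have "\<dots> = finsum (ipow ?S I) (\<lambda>i. act (ipow ?S I) (Inl (g y i)) (\<delta> i)) I"
    proof (rule Sp.finsum_cong'[OF refl])
      show "(\<lambda>i. act (ipow ?S I) (Inl (g y i)) (\<delta> i)) \<in> I \<rightarrow> carrier (ipow ?S I)"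
        using gS[OF 8] \<delta> by (intro Pi_I Sp.act_closed) auto
      show "(\<lambda>j \<in> I. if j = i then g y i else \<zero>\<^bsub>?S\<^esub>) = act (ipow ?S I) (Inl (g y i)) (\<delta> i)" if "i \<in> I" for i
        using gS[OF 8 that] SR unfolding ipow_simps(4) by (intro restrict_ext) (auto simp: \<delta>_def)
    qed
    also have "h \<dots> = finsum N (\<lambda>i. h (act (ipow ?S I) (Inl (g y i)) (\<delta> i))) I"
      using gS[OF 8] \<delta>
      by (intro mor_finsum[OF h(1) Sp.abelian_group_axioms N.M.abelian_group_axioms] Pi_I Sp.act_closed) auto
    also have "\<dots> = finsum N (\<lambda>i. g y i \<odot>\<^bsub>N\<^esub> h (\<delta> i)) I"
    proof (rule N.M.finsum_cong'[OF refl])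
      show "(\<lambda>i. g y i \<odot>\<^bsub>N\<^esub> h (\<delta> i)) \<in> I \<rightarrow> carrier N"
        using gS[OF 8] SR mor_closed[OF h(1) \<delta>] by (auto intro: N.lsmult_closed)
      show "h (act (ipow ?S I) (Inl (g y i)) (\<delta> i)) = g y i \<odot>\<^bsub>N\<^esub> h (\<delta> i)" if "i \<in> I" for i
        using mor_act[OF h(1) \<delta>, of "Inl (g y i)"] gS[OF 8 that] by simp
    qed
    finally show ?case by simp
  qed
  then show ?thesis by blast
qed

lemma rbasis_of_iso:
  assumes N: "bimodule R N" and I: "finite I"
    and iso: "ipow (regular_bimodule R) I \<simeq>\<^bsub>rops (carrier R)\<^esub> N"
  obtains q \<beta> where "\<And>i. i \<in> I \<Longrightarrow> q i \<in> carrier N"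
    "\<And>i. i \<in> I \<Longrightarrow> mor (rops (carrier R)) N (regular_bimodule R) (\<beta> i)"
    "\<And>i j. i \<in> I \<Longrightarrow> j \<in> I \<Longrightarrow> \<beta> i (q j) = (if i = j then \<one>\<^bsub>R\<^esub> else \<zero>\<^bsub>R\<^esub>)"
    "\<And>y. y \<in> carrier N \<Longrightarrow> finsum N (\<lambda>i. q i \<odot>\<^sup>r\<^bsub>N\<^esub> \<beta> i y) I = y"
proof -
  interpret N: bimodule R N by fact
  let ?S = "regular_bimodule R" and ?\<Omega> = "rops (carrier R)"
  interpret reg: bimodule R ?S by (rule N.R.bimodule_regular)
  have Sm: "opmod ?\<Omega> ?S" by (rule reg.opmod_rops) simp
  interpret Sp: opmod ?\<Omega> "ipow ?S I" by (rule opmod_ipow[OF Sm])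
  obtain h where h: "mor ?\<Omega> (ipow ?S I) N h" "bij_betw h (carrier (ipow ?S I)) (carrier N)"
    using iso unfolding mod_iso_def by blast
  obtain g where g: "mor ?\<Omega> N (ipow ?S I) g" "\<And>x. x \<in> carrier (ipow ?S I) \<Longrightarrow> g (h x) = x"
    "\<And>y. y \<in> carrier N \<Longrightarrow> h (g y) = y"
    using mor_inv[OF h Sp.opmod_axioms] by metis
  define \<delta> where "\<delta> i = (\<lambda>j \<in> I. if j = i then \<one>\<^bsub>R\<^esub> else \<zero>\<^bsub>R\<^esub>)" for i
  have \<delta>: "\<delta> i \<in> carrier (ipow ?S I)" for i unfolding \<delta>_def by auto
  have gS: "g y i \<in> carrier R" if "y \<in> carrier N" "i \<in> I" for y i
    using mor_closed[OF g(1) that(1)] that(2) by auto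
  show thesis
  proof (rule that[of "\<lambda>i. h (\<delta> i)" "\<lambda>i y. g y i"], goal_cases)
    case (1 i) show ?case by (rule mor_closed[OF h(1) \<delta>])
  next
    case (2 i)
    show ?case
    proof (rule morI, goal_cases)
      case (3 s x) then show ?case using mor_act[OF g(1), of x s] 2 by simp
    qed (use 2 gS in \<open>simp_all add: mor_add[OF g(1)]\<close>)
  next
    case (3 i j) then show ?case using g(2)[OF \<delta>, of j] by (simp add: \<delta>_def)
  next
    case (4 y)
    have "y = h (g y)" using g(3)[OF 4] by simp
    also have "g y = finsum (ipow ?S I) (\<lambda>i. \<lambda>j \<in> I. if j = i then g y i else \<zero>\<^bsub>?S\<^esub>) I"
      by (rule ipow_expand[OF Sm I mor_closed[OF g(1) 4], symmetric])
    also have "\<dots> = finsum (ipow ?S I) (\<lambda>i. act (ipow ?S I) (Inr (g y i)) (\<delta> i)) I"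
    proof (rule Sp.finsum_cong'[OF refl])
      show "(\<lambda>i. act (ipow ?S I) (Inr (g y i)) (\<delta> i)) \<in> I \<rightarrow> carrier (ipow ?S I)"
        using gS[OF 4] \<delta> by (intro Pi_I Sp.act_closed) auto
      show "(\<lambda>j \<in> I. if j = i then g y i else \<zero>\<^bsub>?S\<^esub>) = act (ipow ?S I) (Inr (g y i)) (\<delta> i)" if "i \<in> I" for i
        using gS[OF 4 that] unfolding ipow_simps(4) by (intro restrict_ext) (auto simp: \<delta>_def)
    qed
    also have "h \<dots> = finsum N (\<lambda>i. h (act (ipow ?S I) (Inr (g y i)) (\<delta> i))) I"
      using gS[OF 4] \<delta>
      by (intro mor_finsum[OF h(1) Sp.abelian_group_axioms N.M.abelian_group_axioms] Pi_I Sp.act_closed) auto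
    also have "\<dots> = finsum N (\<lambda>i. h (\<delta> i) \<odot>\<^sup>r\<^bsub>N\<^esub> g y i) I"
    proof (rule N.M.finsum_cong'[OF refl])
      show "(\<lambda>i. h (\<delta> i) \<odot>\<^sup>r\<^bsub>N\<^esub> g y i) \<in> I \<rightarrow> carrier N"
        using gS[OF 4] mor_closed[OF h(1) \<delta>] by (auto intro: N.rsmult_closed)
      show "h (act (ipow ?S I) (Inr (g y i)) (\<delta> i)) = h (\<delta> i) \<odot>\<^sup>r\<^bsub>N\<^esub> g y i" if "i \<in> I" for i
        using mor_act[OF h(1) \<delta>, of "Inr (g y i)"] gS[OF 4 that] by simp
    qed
    finally show ?case by simp
  qed
qed

subsection \<open>Tensoring with a module that has a basis\<close>

text \<open>In a basis \<open>e\<close> of \<open>N\<close>, \<open>M \<otimes> N\<close> becomes a power of \<open>M\<close> on which \<open>b\<close> acts from the right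
  through the matrix \<open>\<Psi> b\<close> of \<open>y \<mapsto> y b\<close>, with rows \<open>e\<^sub>i b = \<Sum>\<^sub>j \<Psi> b i j e\<^sub>j\<close>.\<close>

definition tw :: "('a, 'b) bimodule \<Rightarrow> 'i set \<Rightarrow> ('a \<Rightarrow> 'i \<Rightarrow> 'i \<Rightarrow> 'a) \<Rightarrow> ('a, 'i \<Rightarrow> 'b) bimodule" where
  "tw M I \<Psi> = (ipow M I)\<lparr>rsmult := (\<lambda>f b. \<lambda>j \<in> I. \<Oplus>\<^bsub>M\<^esub>i \<in> I. f i \<odot>\<^sup>r\<^bsub>M\<^esub> \<Psi> b i j)\<rparr>"

lemma tw_simps [simp]: "carrier (tw M I \<Psi>) = I \<rightarrow>\<^sub>E carrier M"
  "\<zero>\<^bsub>tw M I \<Psi>\<^esub> = (\<lambda>i \<in> I. \<zero>\<^bsub>M\<^esub>)"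
  "f \<oplus>\<^bsub>tw M I \<Psi>\<^esub> g = (\<lambda>i \<in> I. f i \<oplus>\<^bsub>M\<^esub> g i)"
  "a \<odot>\<^bsub>tw M I \<Psi>\<^esub> f = (\<lambda>i \<in> I. a \<odot>\<^bsub>M\<^esub> f i)"
  "f \<odot>\<^sup>r\<^bsub>tw M I \<Psi>\<^esub> b = (\<lambda>j \<in> I. \<Oplus>\<^bsub>M\<^esub>i \<in> I. f i \<odot>\<^sup>r\<^bsub>M\<^esub> \<Psi> b i j)"
  by (simp_all add: tw_def ipow_def)

lemma finsum_ipow_tw: "finsum (tw M I \<Psi>) f J = finsum (ipow M I) f J"
  by (simp add: finsum_def finprod_def tw_def)

lemma opmod_tw:
  assumes "bimodule R M" and \<Psi>: "\<And>b i j. b \<in> carrier R \<Longrightarrow> i \<in> I \<Longrightarrow> j \<in> I \<Longrightarrow> \<Psi> b i j \<in> carrier R"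
  shows "opmod (bops R) (tw M I \<Psi>)"
proof -
  interpret M: bimodule R M by fact
  have "abelian_group (tw M I \<Psi>)"
    by (rule abelian_group_funs[OF M.M.abelian_group_axioms]) simp_all
  then show ?thesis
  proof (rule opmodI, goal_cases)
    case (1 s f)
    then show ?case using \<Psi>
      by (auto simp: PiE_iff M.lsmult_closed intro!: M.M.finsum_closed M.rsmult_closed)
  next
    case (2 s f g)
    show ?case
    proof (cases s)
      case (Inl a)
      then show ?thesis using 2 by (auto simp: PiE_iff M.lsmult_distr intro!: restrict_ext)
    next
      case (Inr b)
      have "(\<Oplus>\<^bsub>M\<^esub>i \<in> I. (\<lambda>i \<in> I. f i \<oplus>\<^bsub>M\<^esub> g i) i \<odot>\<^sup>r\<^bsub>M\<^esub> \<Psi> b i j) =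
          (\<Oplus>\<^bsub>M\<^esub>i \<in> I. f i \<odot>\<^sup>r\<^bsub>M\<^esub> \<Psi> b i j) \<oplus>\<^bsub>M\<^esub> (\<Oplus>\<^bsub>M\<^esub>i \<in> I. g i \<odot>\<^sup>r\<^bsub>M\<^esub> \<Psi> b i j)" if "j \<in> I" for j
        using 2 Inr \<Psi> that
        by (subst M.M.finsum_addf[symmetric])
          (auto simp: PiE_iff M.rsmult_distr M.rsmult_closed intro!: M.M.finsum_cong')
      then show ?thesis using Inr by (auto intro!: restrict_ext)
    qed
  qed
qed

lemma tw_cong_left:
  assumes M: "bimodule R M" and N: "bimodule R N" and iso: "M \<simeq>\<^bsub>bops R\<^esub> N" and I: "finite I"
    and \<Psi>: "\<And>b i j. b \<in> carrier R \<Longrightarrow> i \<in> I \<Longrightarrow> j \<in> I \<Longrightarrow> \<Psi> b i j \<in> carrier R"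
  shows "tw M I \<Psi> \<simeq>\<^bsub>bops R\<^esub> tw N I \<Psi>"
proof -
  interpret M: bimodule R M by fact
  interpret N: bimodule R N by fact
  obtain f where f: "mor (bops R) M N f" "bij_betw f (carrier M) (carrier N)"
    using iso unfolding mod_iso_def by blast
  obtain g where g: "mor (bops R) N M g" "\<And>x. x \<in> carrier M \<Longrightarrow> g (f x) = x" "\<And>y. y \<in> carrier N \<Longrightarrow> f (g y) = y"
    using mor_inv[OF f M.opmod_bops] by metis
  note c = mor_closed[OF f(1)] mor_closed[OF g(1)]
  show ?thesis
  proof (rule bij_mor_witness[where f = "\<lambda>x. \<lambda>i \<in> I. f (x i)" and g = "\<lambda>x. \<lambda>i \<in> I. g (x i)"], goal_cases)
    case 1
    show ?case
    proof (rule morI, goal_cases)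
      case (3 s x)
      show ?case
      proof (cases s)
        case (Inl a)
        then show ?thesis using 3 mor_act[OF f(1), of _ s]
          by (auto simp: PiE_iff intro!: restrict_ext)
      next
        case (Inr b)
        have b: "b \<in> carrier R" and x: "\<And>i. i \<in> I \<Longrightarrow> x i \<in> carrier M" using 3 Inr by auto
        have "f (\<Oplus>\<^bsub>M\<^esub>i \<in> I. x i \<odot>\<^sup>r\<^bsub>M\<^esub> \<Psi> b i j) = (\<Oplus>\<^bsub>N\<^esub>i \<in> I. (\<lambda>i \<in> I. f (x i)) i \<odot>\<^sup>r\<^bsub>N\<^esub> \<Psi> b i j)"
          if j: "j \<in> I" for j
        proof -
          have "f (\<Oplus>\<^bsub>M\<^esub>i \<in> I. x i \<odot>\<^sup>r\<^bsub>M\<^esub> \<Psi> b i j) = (\<Oplus>\<^bsub>N\<^esub>i \<in> I. f (x i \<odot>\<^sup>r\<^bsub>M\<^esub> \<Psi> b i j))"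
            by (rule mor_finsum[OF f(1) M.M.abelian_group_axioms N.M.abelian_group_axioms])
              (use x j \<Psi> b in \<open>auto intro: M.rsmult_closed\<close>)
          also have "\<dots> = (\<Oplus>\<^bsub>N\<^esub>i \<in> I. (\<lambda>i \<in> I. f (x i)) i \<odot>\<^sup>r\<^bsub>N\<^esub> \<Psi> b i j)"
            using mor_act[OF f(1) x, of _ "Inr (\<Psi> b _ j)"] \<Psi> b j
            by (intro N.M.finsum_cong') (auto intro!: N.rsmult_closed c x)
          finally show ?thesis .
        qed
        then show ?thesis using Inr by (auto intro!: restrict_ext)
      qed
    qed (auto simp: PiE_iff c mor_add[OF f(1)] intro!: restrict_ext)
  next
    case (2 y) then show ?case using c by auto
  next
    case (3 x) then show ?case using g(2) c by (intro PiE_ext[OF _ 3[simplified]]) (auto simp: PiE_iff)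
  next
    case (4 y) then show ?case using g(3) c by (intro PiE_ext[OF _ 4[simplified]]) (auto simp: PiE_iff)
  qed
qed

lemma bimodule_dsum: assumes "bimodule R M" "bimodule R N" shows "bimodule R (M \<oplus>\<^sub>d N)"
proof -
  interpret M: bimodule R M by fact
  interpret N: bimodule R N by fact
  have ab: "abelian_group (M \<oplus>\<^sub>d N)" by (rule opmod_ab[OF opmod_dsum[OF M.opmod_bops N.opmod_bops]])
  have "bimodule_axioms R (M \<oplus>\<^sub>d N)"
    by unfold_locales (auto simp: M.lsmult_closed M.rsmult_closed M.lsmult_distr_ring M.lsmult_distr M.lsmult_assoc M.lsmult_one
        M.rsmult_distr_ring M.rsmult_distr M.rsmult_assoc M.rsmult_one M.lsmult_rsmult
        N.lsmult_closed N.rsmult_closed N.lsmult_distr_ring N.lsmult_distr N.lsmult_assoc N.lsmult_one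
        N.rsmult_distr_ring N.rsmult_distr N.rsmult_assoc N.rsmult_one N.lsmult_rsmult)
  then show ?thesis using ab by (intro bimodule.intro M.R.ring_axioms)
qed

lemma bimodule_dpow: "bimodule R M \<Longrightarrow> bimodule R (M ^\<^sub>d n)"
  using bimodule.bimodule_bimodule_power[of R M n] by (simp add: bimodule_power_eq)

lemma finsum_pair:
  assumes "abelian_group M" "abelian_group N" "f \<in> I \<rightarrow> carrier M" "g \<in> I \<rightarrow> carrier N"
  shows "finsum (M \<oplus>\<^sub>d N) (\<lambda>i. (f i, g i)) I = (finsum M f I, finsum N g I)"
proof -
  interpret M: abelian_group M by fact
  interpret N: abelian_group N by fact
  have "opmod {} M" "opmod {} N" by (rule opmodI; simp add: assms)+
  then have ab: "abelian_group (M \<oplus>\<^sub>d N)" by (intro opmod_ab[OF opmod_dsum])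
  have c: "(\<lambda>i. (f i, g i)) \<in> I \<rightarrow> carrier (M \<oplus>\<^sub>d N)" using assms by auto
  have "mor {} (M \<oplus>\<^sub>d N) M fst" "mor {} (M \<oplus>\<^sub>d N) N snd" by (rule morI; auto)+
  from mor_finsum[OF this(1) ab assms(1) c] mor_finsum[OF this(2) ab assms(2) c]
  show ?thesis by (simp add: prod_eq_iff)
qed

lemma tw_dsum:
  assumes M: "bimodule R M" and N: "bimodule R N" and I: "finite I"
    and \<Psi>: "\<And>b i j. b \<in> carrier R \<Longrightarrow> i \<in> I \<Longrightarrow> j \<in> I \<Longrightarrow> \<Psi> b i j \<in> carrier R"
  shows "tw (M \<oplus>\<^sub>d N) I \<Psi> \<simeq>\<^bsub>bops R\<^esub> tw M I \<Psi> \<oplus>\<^sub>d tw N I \<Psi>"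
proof -
  interpret M: bimodule R M by fact
  interpret N: bimodule R N by fact
  have fs: "(\<Oplus>\<^bsub>M \<oplus>\<^sub>d N\<^esub>i \<in> I. (fst (f i) \<odot>\<^sup>r\<^bsub>M\<^esub> \<Psi> b i j, snd (f i) \<odot>\<^sup>r\<^bsub>N\<^esub> \<Psi> b i j)) =
      ((\<Oplus>\<^bsub>M\<^esub>i \<in> I. fst (f i) \<odot>\<^sup>r\<^bsub>M\<^esub> \<Psi> b i j), (\<Oplus>\<^bsub>N\<^esub>i \<in> I. snd (f i) \<odot>\<^sup>r\<^bsub>N\<^esub> \<Psi> b i j))"
    if "f \<in> I \<rightarrow>\<^sub>E carrier M \<times> carrier N" "b \<in> carrier R" "j \<in> I" for f b j
    by (rule finsum_pair[OF M.M.abelian_group_axioms N.M.abelian_group_axioms])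
      (use that \<Psi> in \<open>auto simp: PiE_iff mem_Times_iff intro!: M.rsmult_closed N.rsmult_closed\<close>)
  show ?thesis
  proof (rule bij_mor_witness[where f = "\<lambda>f. (\<lambda>i \<in> I. fst (f i), \<lambda>i \<in> I. snd (f i))"
        and g = "\<lambda>(f, g). \<lambda>i \<in> I. (f i, g i)"], goal_cases)
    case 1
    show ?case
    proof (rule morI, goal_cases)
      case (3 t f)
      show ?case
      proof (cases t)
        case (Inl a)
        then show ?thesis by (auto intro!: restrict_ext)
      next
        case (Inr b)
        then have b: "b \<in> carrier R" using 3 by auto
        have c1: "(\<Oplus>\<^bsub>M\<^esub>i \<in> I. (\<lambda>i \<in> I. fst (f i)) i \<odot>\<^sup>r\<^bsub>M\<^esub> \<Psi> b i j) = (\<Oplus>\<^bsub>M\<^esub>i \<in> I. fst (f i) \<odot>\<^sup>r\<^bsub>M\<^esub> \<Psi> b i j)"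
          and c2: "(\<Oplus>\<^bsub>N\<^esub>i \<in> I. (\<lambda>i \<in> I. snd (f i)) i \<odot>\<^sup>r\<^bsub>N\<^esub> \<Psi> b i j) = (\<Oplus>\<^bsub>N\<^esub>i \<in> I. snd (f i) \<odot>\<^sup>r\<^bsub>N\<^esub> \<Psi> b i j)"
          if "j \<in> I" for j
          using 3 \<Psi> b that by (auto intro!: M.M.finsum_cong' N.M.finsum_cong' M.rsmult_closed N.rsmult_closed
              simp: PiE_iff mem_Times_iff)
        show ?thesis using 3 Inr b fs[of f b] c1 c2 by (auto simp: fun_eq_iff)
      qed
    qed (auto simp: PiE_iff mem_Times_iff intro!: restrict_ext)
  next
    case (2 y) then show ?case by (auto simp: PiE_iff)
  next
    case (3 f) then show ?case by (auto simp: PiE_iff extensional_def fun_eq_iff)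
  next
    case (4 y) then show ?case by (auto simp: PiE_iff extensional_def fun_eq_iff)
  qed
qed

lemma tw_dpow:
  assumes M: "bimodule R M" and I: "finite I"
    and \<Psi>: "\<And>b i j. b \<in> carrier R \<Longrightarrow> i \<in> I \<Longrightarrow> j \<in> I \<Longrightarrow> \<Psi> b i j \<in> carrier R"
  shows "tw (M ^\<^sub>d n) I \<Psi> \<simeq>\<^bsub>bops R\<^esub> tw M I \<Psi> ^\<^sub>d n"
proof (induction n)
  case 0
  have "carrier (tw (M ^\<^sub>d 0) I \<Psi>) = {\<zero>\<^bsub>tw (M ^\<^sub>d 0) I \<Psi>\<^esub>}"
    using dpow_zero[of M] by (simp add: PiE_eq_singleton)
  moreover have "opmod (bops R) (tw (M ^\<^sub>d 0) I \<Psi>)" "opmod (bops R) (tw M I \<Psi> ^\<^sub>d 0)"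
    by (intro opmod_ipow opmod_tw bimodule_dpow M \<Psi>; assumption)+
  ultimately show ?case by (intro zero_iso[OF _ _ _ dpow_zero])
next
  case (Suc n)
  have "tw (M ^\<^sub>d Suc n) I \<Psi> \<simeq>\<^bsub>bops R\<^esub> tw (M \<oplus>\<^sub>d M ^\<^sub>d n) I \<Psi>"
    by (rule tw_cong_left[OF bimodule_dpow[OF M] bimodule_dsum[OF M bimodule_dpow[OF M]] dpow_Suc I \<Psi>])
  also have "\<dots> \<simeq>\<^bsub>bops R\<^esub> tw M I \<Psi> \<oplus>\<^sub>d tw (M ^\<^sub>d n) I \<Psi>"
    by (rule tw_dsum[OF M bimodule_dpow[OF M] I \<Psi>])
  also have "\<dots> \<simeq>\<^bsub>bops R\<^esub> tw M I \<Psi> \<oplus>\<^sub>d tw M I \<Psi> ^\<^sub>d n" by (rule dsum_cong[OF iso_refl Suc])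
  also have "\<dots> \<simeq>\<^bsub>bops R\<^esub> tw M I \<Psi> ^\<^sub>d Suc n"
    by (rule iso_sym[OF opmod_ipow[OF opmod_tw[OF M \<Psi>]] dpow_Suc])
  finally show ?case .
qed

locale tensor_basis = M: bimodule R M + lbasis R N S I e c
  for R :: "('a, 'k) ring_scheme" (structure) and M :: "('a, 'b) bimodule" and N :: "('a, 'c) bimodule"
    and S :: "'a set" and I :: "'i set" and e :: "'i \<Rightarrow> 'c" and c :: "'i \<Rightarrow> 'c \<Rightarrow> 'a"
begin

definition \<Psi> :: "'a \<Rightarrow> 'i \<Rightarrow> 'i \<Rightarrow> 'a" where
  "\<Psi> b i j = c j (e i \<odot>\<^sup>r\<^bsub>N\<^esub> b)"

abbreviation W :: "('a, 'i \<Rightarrow> 'b) bimodule" where "W \<equiv> tw M I \<Psi>"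

definition \<iota> :: "'b \<Rightarrow> 'c \<Rightarrow> 'i \<Rightarrow> 'b" where
  "\<iota> x y = (\<lambda>i \<in> I. x \<odot>\<^sup>r\<^bsub>M\<^esub> c i y)"

lemma \<Psi>_closed [simp]: "b \<in> carrier R \<Longrightarrow> i \<in> I \<Longrightarrow> j \<in> I \<Longrightarrow> \<Psi> b i j \<in> carrier R"
  unfolding \<Psi>_def by (intro c_closed rsmult_closed e_closed)

lemma opmod_W: "opmod (bops R) W"
  by (rule opmod_tw[OF M.bimodule_axioms \<Psi>_closed])

lemma \<iota>_closed [simp]: "x \<in> carrier M \<Longrightarrow> y \<in> carrier N \<Longrightarrow> \<iota> x y \<in> carrier W"
  by (auto simp: \<iota>_def M.rsmult_closed)

lemma \<iota>_add_left:
  "x \<in> carrier M \<Longrightarrow> x' \<in> carrier M \<Longrightarrow> y \<in> carrier N \<Longrightarrow> \<iota> (x \<oplus>\<^bsub>M\<^esub> x') y = \<iota> x y \<oplus>\<^bsub>W\<^esub> \<iota> x' y"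
  by (auto simp: \<iota>_def M.rsmult_distr intro!: restrict_ext)

lemma \<iota>_add_right:
  "x \<in> carrier M \<Longrightarrow> y \<in> carrier N \<Longrightarrow> y' \<in> carrier N \<Longrightarrow> \<iota> x (y \<oplus>\<^bsub>N\<^esub> y') = \<iota> x y \<oplus>\<^bsub>W\<^esub> \<iota> x y'"
  by (auto simp: \<iota>_def c_add M.rsmult_distr_ring intro!: restrict_ext)

lemma \<iota>_balanced:
  "x \<in> carrier M \<Longrightarrow> s \<in> S \<Longrightarrow> y \<in> carrier N \<Longrightarrow> \<iota> (x \<odot>\<^sup>r\<^bsub>M\<^esub> s) y = \<iota> x (s \<odot>\<^bsub>N\<^esub> y)"
  using S by (auto simp: \<iota>_def c_smult M.rsmult_assoc subset_iff intro!: restrict_ext)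

lemma \<iota>_left:
  "a \<in> carrier R \<Longrightarrow> x \<in> carrier M \<Longrightarrow> y \<in> carrier N \<Longrightarrow> a \<odot>\<^bsub>W\<^esub> \<iota> x y = \<iota> (a \<odot>\<^bsub>M\<^esub> x) y"
  by (auto simp: \<iota>_def M.lsmult_rsmult intro!: restrict_ext)

lemma \<iota>_right:
  assumes b: "b \<in> carrier R" and x: "x \<in> carrier M" and y: "y \<in> carrier N"
  shows "\<iota> x y \<odot>\<^sup>r\<^bsub>W\<^esub> b = \<iota> x (y \<odot>\<^sup>r\<^bsub>N\<^esub> b)"
proof -
  have "(\<Oplus>\<^bsub>M\<^esub>i \<in> I. (\<lambda>i \<in> I. x \<odot>\<^sup>r\<^bsub>M\<^esub> c i y) i \<odot>\<^sup>r\<^bsub>M\<^esub> \<Psi> b i j) = x \<odot>\<^sup>r\<^bsub>M\<^esub> c j (y \<odot>\<^sup>r\<^bsub>N\<^esub> b)" if j: "j \<in> I" for j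
  proof -
    have "(\<Oplus>\<^bsub>M\<^esub>i \<in> I. (\<lambda>i \<in> I. x \<odot>\<^sup>r\<^bsub>M\<^esub> c i y) i \<odot>\<^sup>r\<^bsub>M\<^esub> \<Psi> b i j) = (\<Oplus>\<^bsub>M\<^esub>i \<in> I. x \<odot>\<^sup>r\<^bsub>M\<^esub> (c i y \<otimes> \<Psi> b i j))"
      using b x y j by (intro M.M.finsum_cong') (auto simp: M.rsmult_assoc M.rsmult_closed)
    also have "\<dots> = x \<odot>\<^sup>r\<^bsub>M\<^esub> (\<Oplus>i \<in> I. c i y \<otimes> \<Psi> b i j)"
      using b x y j by (subst M.rsmult_finsum_right) auto
    also have "(\<Oplus>i \<in> I. c i y \<otimes> \<Psi> b i j) = (\<Oplus>i \<in> I. c j (c i y \<odot>\<^bsub>N\<^esub> (e i \<odot>\<^sup>r\<^bsub>N\<^esub> b)))"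
      using b y j by (intro M.R.finsum_cong') (auto simp: c_smult c_in rsmult_closed lsmult_closed \<Psi>_def)
    also have "\<dots> = c j (\<Oplus>\<^bsub>N\<^esub>i \<in> I. c i y \<odot>\<^bsub>N\<^esub> (e i \<odot>\<^sup>r\<^bsub>N\<^esub> b))"
      using b y j by (subst c_finsum) (auto simp: rsmult_closed lsmult_closed)
    also have "(\<Oplus>\<^bsub>N\<^esub>i \<in> I. c i y \<odot>\<^bsub>N\<^esub> (e i \<odot>\<^sup>r\<^bsub>N\<^esub> b)) = (\<Oplus>\<^bsub>N\<^esub>i \<in> I. c i y \<odot>\<^bsub>N\<^esub> e i) \<odot>\<^sup>r\<^bsub>N\<^esub> b"
      using b y by (subst rsmult_finsum)
        (auto simp: lsmult_rsmult lsmult_closed rsmult_closed intro!: M.finsum_cong')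
    also have "\<dots> = y \<odot>\<^sup>r\<^bsub>N\<^esub> b" using expand[OF y] by simp
    finally show ?thesis .
  qed
  then show ?thesis by (auto simp: \<iota>_def intro!: restrict_ext)
qed

lemma \<iota>_expand:
  assumes "f \<in> carrier W" shows "finsum W (\<lambda>i. \<iota> (f i) (e i)) I = f"
proof -
  have f: "f \<in> carrier (ipow M I)" "\<And>i. i \<in> I \<Longrightarrow> f i \<in> carrier M" using assms by auto
  have eq: "\<iota> (f i) (e i) = (\<lambda>j \<in> I. if j = i then f i else \<zero>\<^bsub>M\<^esub>)" if "i \<in> I" for i
  proof -
    interpret opmod "rops (carrier R)" M by (rule M.opmod_rops) simp
    have "f i \<odot>\<^sup>r\<^bsub>M\<^esub> \<zero> = \<zero>\<^bsub>M\<^esub>"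
      using mor_zero[OF M.mor_scalar_right[OF f(2)[OF that]] M.abelian_regular M.M.abelian_group_axioms] by simp
    then show ?thesis using that f(2)[OF that] by (auto simp: \<iota>_def c_e M.rsmult_one intro!: restrict_ext)
  qed
  interpret P: abelian_group "ipow M I" by (rule opmod_ab[OF opmod_ipow[OF M.opmod_bops]])
  have "finsum (ipow M I) (\<lambda>i. \<iota> (f i) (e i)) I =
      finsum (ipow M I) (\<lambda>i. \<lambda>j \<in> I. if j = i then f i else \<zero>\<^bsub>M\<^esub>) I"
    using eq f by (intro P.finsum_cong') auto
  then show ?thesis using ipow_expand[OF M.opmod_bops fin f(1)] by (simp add: finsum_ipow_tw)
qed

lemma \<iota>_mor_left: "y \<in> carrier N \<Longrightarrow> mor (lops (carrier R)) M W (\<lambda>x. \<iota> x y)"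
  by (rule morI) (auto simp: \<iota>_add_left \<iota>_left simp del: tw_simps)

lemma \<iota>_mor_right: "x \<in> carrier M \<Longrightarrow> mor (rops (carrier R)) N W (\<iota> x)"
  by (rule morI) (auto simp: \<iota>_add_right \<iota>_right simp del: tw_simps)

text \<open>The homomorphism \<open>u\<close> from the free abelian group that extends \<open>\<iota>\<close> vanishes on the relations;
  modulo the relations, \<open>x \<otimes> y\<close> is \<open>w (\<iota> x y)\<close>, so \<open>w\<close> induces the inverse isomorphism.\<close>

theorem tensor_iso_tw: "tensor S M N \<simeq>\<^bsub>bops R\<^esub> W"
proof -
  interpret T: bimodule_pair R M N S
    by (intro bimodule_pair.intro bimodule_pair_axioms.intro M.bimodule_axioms bimodule_axioms S)
  interpret W: opmod "bops R" W by (rule opmod_W)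
  interpret FF: comm_group T.F by (rule abelian_free_Abelian_group)
  let ?T = "tensor S M N" and ?q = "\<lambda>x. T.K #>\<^bsub>T.F\<^esub> x"
  interpret TT: bimodule R ?T by (rule T.bimodule_tensor)
  interpret KK: normal T.K T.F using FF.normal_iff_subgroup T.kernel_subgroup by blast
  obtain u where u: "u \<in> hom T.F (add_monoid W)"
    and u_of: "\<And>p. p \<in> carrier M \<times> carrier N \<Longrightarrow> u (frag_of p) = (case p of (x, y) \<Rightarrow> \<iota> x y)"
    by (rule comm_group.free_Abelian_group_universal[OF W.a_comm_group, of "\<lambda>p. case p of (x, y) \<Rightarrow> \<iota> x y" "carrier M \<times> carrier N"])
      (auto simp del: tw_simps)
  define inF where "inF x \<longleftrightarrow> x \<in> carrier T.F" for x
  have uc: "u x \<in> carrier W" if "inF x" for x using u that by (auto simp: hom_def inF_def)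
  have F_add: "inF (x + y)" if "inF x" "inF y" for x y
    using FF.m_closed[of x y] that by (simp add: inF_def)
  have F_neg: "inF (- x)" if "inF x" for x using FF.inv_closed[of x] that by (simp add: inF_def)
  have F_zero: "inF 0" using FF.one_closed by (simp add: inF_def)
  have F_of: "inF (frag_of (x, y))" if "x \<in> carrier M" "y \<in> carrier N" for x y
    using that by (simp add: inF_def)
  have F_diff: "inF (x - y)" if "inF x" "inF y" for x y using F_add[OF that(1) F_neg[OF that(2)]] by simp
  have u_add: "u (x + y) = u x \<oplus>\<^bsub>W\<^esub> u y" if "inF x" "inF y" for x y
    using hom_mult[OF u, of x y] that by (simp add: inF_def)
  have u_zero: "u 0 = \<zero>\<^bsub>W\<^esub>"
  proof -
    have "u 0 \<oplus>\<^bsub>W\<^esub> u 0 = u 0" using u_add[OF F_zero F_zero] by simp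
    then show ?thesis using uc[OF F_zero] by (metis W.add.r_cancel_one)
  qed
  have u_neg: "u (- x) = \<ominus>\<^bsub>W\<^esub> u x" if "inF x" for x
  proof -
    have "u (- x) \<oplus>\<^bsub>W\<^esub> u x = \<zero>\<^bsub>W\<^esub>" using u_add[OF F_neg[OF that] that] u_zero by simp
    then show ?thesis using W.minus_equality uc F_neg that by metis
  qed
  have u_diff: "u (x - y) = u x \<oplus>\<^bsub>W\<^esub> \<ominus>\<^bsub>W\<^esub> u y" if "inF x" "inF y" for x y
    using u_add[OF that(1) F_neg[OF that(2)]] u_neg[OF that(2)] by simp
  note u_pair = u_of[of "(_, _)", simplified]
  have cancel: "(a \<oplus>\<^bsub>W\<^esub> b) \<oplus>\<^bsub>W\<^esub> \<ominus>\<^bsub>W\<^esub> a \<oplus>\<^bsub>W\<^esub> \<ominus>\<^bsub>W\<^esub> b = \<zero>\<^bsub>W\<^esub>" if "a \<in> carrier W" "b \<in> carrier W" for a b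
  proof -
    have "(a \<oplus>\<^bsub>W\<^esub> b) \<oplus>\<^bsub>W\<^esub> \<ominus>\<^bsub>W\<^esub> a = b" using that by (metis W.a_comm W.a_closed W.a_inv_closed W.a_assoc W.r_neg W.r_zero)
    then show ?thesis using that W.r_neg by simp
  qed
  have u_rel: "u t = \<zero>\<^bsub>W\<^esub>" if "t \<in> tensor_relations S M N" for t
    using that unfolding tensor_relations_def
  proof (elim UnE CollectE exE conjE, goal_cases)
    case (1 x x' y)
    then show ?case using cancel[of "\<iota> x y" "\<iota> x' y"]
      by (simp add: u_diff F_diff F_of u_pair \<iota>_add_left del: tw_simps)
  next
    case (2 x y y')
    then show ?case using cancel[of "\<iota> x y" "\<iota> x y'"]
      by (simp add: u_diff F_diff F_of u_pair \<iota>_add_right del: tw_simps)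
  next
    case (3 x s y)
    then have "s \<in> carrier R" using S by blast
    with 3 show ?case
      by (simp add: u_diff F_of u_pair M.rsmult_closed lsmult_closed \<iota>_balanced W.r_neg del: tw_simps)
  qed
  have u_K: "u k = \<zero>\<^bsub>W\<^esub>" if "k \<in> T.K" for k
    using that unfolding tensor_kernel_def
  proof (induction k rule: generate.induct)
    case one then show ?case using u_zero by simp
  next
    case (incl k) then show ?case by (rule u_rel)
  next
    case (inv k)
    then have "inF k" using subsetD[OF T.relations_closed] unfolding inF_def by blast
    then show ?case using u_rel[OF inv] u_neg[of k] by (simp add: inF_def del: tw_simps)
  next
    case (eng k l)
    have "inF k" "inF l"
      using eng(1,2) FF.generate_in_carrier[OF T.relations_closed] by (auto simp: inF_def)
    then show ?case using eng u_add[of k l] by (simp del: tw_simps)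
  qed
  have u_q: "u x = u y" if "inF x" "inF y" "?q x = ?q y" for x y
  proof -
    have "x \<in> ?q y" using FF.rcos_self[OF _ T.kernel_subgroup, of x] that by (simp add: inF_def)
    then obtain k where "k \<in> T.K" "x = k + y" by (auto simp: r_coset_def)
    moreover from this have "inF k" using subgroup.mem_carrier[OF T.kernel_subgroup] by (auto simp: inF_def)
    ultimately show ?thesis using u_add[of k y] u_K[of k] that(2) uc[OF that(2)] by (simp del: tw_simps)
  qed
  have K_zero: "0 \<in> T.K" using subgroup.one_closed[OF T.kernel_subgroup] by simp
  have K_diff: "x - y \<in> T.K" if "x \<in> T.K" "y \<in> T.K" for x y by (rule T.kernel_diff[OF that])
  have K_neg: "- x \<in> T.K" if "x \<in> T.K" for x using K_diff[OF K_zero that] by simp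
  have K_add: "x + y \<in> T.K" if "x \<in> T.K" "y \<in> T.K" for x y using K_diff[OF that(1) K_neg[OF that(2)]] by simp
  have K_sum: "sum g J \<in> T.K" if "\<And>j. j \<in> J \<Longrightarrow> g j \<in> T.K" for g and J :: "'i set"
    using that by (induction J rule: infinite_finite_induct) (auto intro: K_add K_zero)
  note rel = T.relation_in_kernel
  have rel_l: "frag_of (x \<oplus>\<^bsub>M\<^esub> x', y) - frag_of (x, y) - frag_of (x', y) \<in> T.K"
    if "x \<in> carrier M" "x' \<in> carrier M" "y \<in> carrier N" for x x' y
    by (rule rel) (use that in \<open>auto simp: tensor_relations_def\<close>)
  have rel_r: "frag_of (x, y \<oplus>\<^bsub>N\<^esub> y') - frag_of (x, y) - frag_of (x, y') \<in> T.K"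
    if "x \<in> carrier M" "y \<in> carrier N" "y' \<in> carrier N" for x y y'
    by (rule rel) (use that in \<open>auto simp: tensor_relations_def\<close>)
  have rel_b: "frag_of (x \<odot>\<^sup>r\<^bsub>M\<^esub> s, y) - frag_of (x, s \<odot>\<^bsub>N\<^esub> y) \<in> T.K"
    if "x \<in> carrier M" "s \<in> S" "y \<in> carrier N" for x s y
    by (rule rel) (use that in \<open>auto simp: tensor_relations_def\<close>)
  have zero_l: "frag_of (\<zero>\<^bsub>M\<^esub>, y) \<in> T.K" if "y \<in> carrier N" for y
    using K_neg[OF rel_l[OF M.M.zero_closed M.M.zero_closed that]] by simp
  have zero_r: "frag_of (x, \<zero>\<^bsub>N\<^esub>) \<in> T.K" if "x \<in> carrier M" for x
    using K_neg[OF rel_r[OF that M.zero_closed M.zero_closed]] by simp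
  define w where "w f = (\<Sum>i \<in> I. frag_of (f i, e i))" for f :: "'i \<Rightarrow> 'b"
  have wF: "inF (w f)" if "f \<in> carrier W" for f
  proof -
    have "f i \<in> carrier M" if "i \<in> I" for i using \<open>f \<in> carrier W\<close> that by auto
    then show ?thesis unfolding w_def inF_def by (intro sum_closed_free_Abelian_group) simp
  qed
  have u_w: "u (w f) = f" if f: "f \<in> carrier W" for f
  proof -
    have fc: "f i \<in> carrier M" if "i \<in> I" for i using f that by auto
    have "u (\<Sum>i \<in> J. frag_of (f i, e i)) = finsum W (\<lambda>i. \<iota> (f i) (e i)) J" if "finite J" "J \<subseteq> I" for J
      using that
    proof (induction J)
      case empty then show ?case using u_zero by (simp del: tw_simps)
    next
      case (insert j J)
      have "inF (\<Sum>i \<in> J. frag_of (f i, e i))" unfolding inF_def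
        by (rule sum_closed_free_Abelian_group) (use insert.prems fc in auto)
      moreover have "(\<lambda>i. \<iota> (f i) (e i)) \<in> J \<rightarrow> carrier W" using insert.prems fc by (auto simp del: tw_simps)
      ultimately show ?case using insert fc by (simp add: u_add F_of u_pair del: tw_simps)
    qed
    from this[OF fin subset_refl] show ?thesis unfolding w_def using \<iota>_expand[OF f] by simp
  qed
  have w_add: "w (f \<oplus>\<^bsub>W\<^esub> g) - w f - w g \<in> T.K" if fg: "f \<in> carrier W" "g \<in> carrier W" for f g
  proof -
    have "w (f \<oplus>\<^bsub>W\<^esub> g) - w f - w g = (\<Sum>i \<in> I. frag_of (f i \<oplus>\<^bsub>M\<^esub> g i, e i) - frag_of (f i, e i) - frag_of (g i, e i))"
      by (simp add: w_def sum_subtractf)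
    also have "\<dots> \<in> T.K" using fg by (intro K_sum rel_l) auto
    finally show ?thesis .
  qed
  have w_u: "x - w (u x) \<in> T.K" if "inF x" for x
    using that[unfolded inF_def carrier_free_Abelian_group_iff]
  proof (induction x rule: free_Abelian_group_induct[consumes 1])
    case 1
    have "w \<zero>\<^bsub>W\<^esub> \<in> T.K" unfolding w_def by (rule K_sum) (use zero_l in auto)
    then show ?case using u_zero K_neg by (simp del: tw_simps)
  next
    case (2 x y)
    have F: "inF x" "inF y" using 2(1,2) by (simp_all add: inF_def)
    let ?d = "u x \<oplus>\<^bsub>W\<^esub> \<ominus>\<^bsub>W\<^esub> u y"
    have d: "?d \<in> carrier W" "?d \<oplus>\<^bsub>W\<^esub> u y = u x" using uc F W.neg_add_cancel by (auto simp del: tw_simps)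
    have "w (u x) - w ?d - w (u y) \<in> T.K" using w_add[OF d(1) uc[OF F(2)]] unfolding d(2) .
    then have "(x - w (u x)) - (y - w (u y)) + (w (u x) - w ?d - w (u y)) \<in> T.K"
      by (rule K_add[OF K_diff[OF 2(3,4)]])
    then show ?case using u_diff[OF F] by (simp add: algebra_simps del: tw_simps)
  next
    case (3 p)
    obtain x y where p: "p = (x, y)" "x \<in> carrier M" "y \<in> carrier N" using 3 by auto
    have sum_r: "frag_of (x, finsum N g J) - (\<Sum>j \<in> J. frag_of (x, g j)) \<in> T.K"
      if "finite J" "g \<in> J \<rightarrow> carrier N" for g and J :: "'i set"
      using that
    proof (induction J)
      case empty then show ?case using zero_r[OF p(2)] by simp
    next
      case (insert j J)
      then have g: "g j \<in> carrier N" "g \<in> J \<rightarrow> carrier N" by auto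
      have "frag_of (x, g j \<oplus>\<^bsub>N\<^esub> finsum N g J) - frag_of (x, g j) - frag_of (x, finsum N g J)
          + (frag_of (x, finsum N g J) - (\<Sum>j \<in> J. frag_of (x, g j))) \<in> T.K"
        by (intro K_add rel_r p insert.IH g M.finsum_closed)
      then show ?case using insert g by (simp add: algebra_simps)
    qed
    have g: "(\<lambda>i. c i y \<odot>\<^bsub>N\<^esub> e i) \<in> I \<rightarrow> carrier N" using p by (auto intro: lsmult_closed)
    have "w (\<iota> x y) = (\<Sum>i \<in> I. frag_of (x \<odot>\<^sup>r\<^bsub>M\<^esub> c i y, e i))" by (simp add: w_def \<iota>_def)
    then have "frag_of (x, y) - w (\<iota> x y) = (frag_of (x, y) - (\<Sum>i \<in> I. frag_of (x, c i y \<odot>\<^bsub>N\<^esub> e i)))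
        - (\<Sum>i \<in> I. frag_of (x \<odot>\<^sup>r\<^bsub>M\<^esub> c i y, e i) - frag_of (x, c i y \<odot>\<^bsub>N\<^esub> e i))"
      by (simp add: sum_subtractf)
    also have "\<dots> \<in> T.K"
    proof (rule K_diff)
      show "frag_of (x, y) - (\<Sum>i \<in> I. frag_of (x, c i y \<odot>\<^bsub>N\<^esub> e i)) \<in> T.K"
        using sum_r[OF fin g] expand[OF p(3)] by simp
      show "(\<Sum>i \<in> I. frag_of (x \<odot>\<^sup>r\<^bsub>M\<^esub> c i y, e i) - frag_of (x, c i y \<odot>\<^bsub>N\<^esub> e i)) \<in> T.K"
        by (rule K_sum[OF rel_b]) (use p in \<open>auto simp: c_in\<close>)
    qed
    finally show ?case using p by (simp add: u_pair)
  qed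
  have q_w_u: "?q x = ?q (w (u x))" if "inF x" for x
    by (rule T.coset_eqI) (use that wF uc w_u in \<open>auto simp: inF_def simp del: tw_simps carrier_free_Abelian_group_iff\<close>)
  have Tc: "carrier ?T = ?q ` carrier T.F" by (simp add: tensor_def Let_def carrier_FactGroup)
  have Tadd: "?q x \<oplus>\<^bsub>?T\<^esub> ?q y = ?q (x + y)" if "inF x" "inF y" for x y
    using KK.rcos_sum[of x y] that by (simp add: tensor_def Let_def inF_def)
  have u_lact: "u (T.lact a x) = a \<odot>\<^bsub>W\<^esub> u x" if a: "a \<in> carrier R" and "inF x" for a x
    using that(2)[unfolded inF_def carrier_free_Abelian_group_iff]
  proof (induction x rule: free_Abelian_group_induct[consumes 1])
    case 1 then show ?case using u_zero W.act_zero[of "Inl a"] a by (simp add: T.lact_def del: tw_simps)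
  next
    case (2 x y)
    have F: "inF x" "inF y" "inF (T.lact a x)" "inF (T.lact a y)"
      using 2(1,2) T.lact_closed[OF a, of x] T.lact_closed[OF a, of y] by (simp_all add: inF_def)
    have "T.lact a (x - y) = T.lact a x - T.lact a y" by (simp add: T.lact_def frag_extend_diff)
    then show ?case
      using 2(3,4) F W.act_add[of "Inl a" "u x" "\<ominus>\<^bsub>W\<^esub> u y"] W.act_neg[of "Inl a" "u y"] a uc
      by (simp add: u_diff del: tw_simps)
  next
    case (3 p)
    then obtain x y where p: "p = (x, y)" "x \<in> carrier M" "y \<in> carrier N" by auto
    then show ?case using a by (simp add: T.lact_def u_pair M.lsmult_closed \<iota>_left del: tw_simps)
  qed
  have u_ract: "u (T.ract a x) = u x \<odot>\<^sup>r\<^bsub>W\<^esub> a" if a: "a \<in> carrier R" and "inF x" for a x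
    using that(2)[unfolded inF_def carrier_free_Abelian_group_iff]
  proof (induction x rule: free_Abelian_group_induct[consumes 1])
    case 1 then show ?case using u_zero W.act_zero[of "Inr a"] a by (simp add: T.ract_def del: tw_simps)
  next
    case (2 x y)
    have F: "inF x" "inF y" "inF (T.ract a x)" "inF (T.ract a y)"
      using 2(1,2) T.ract_closed[OF a, of x] T.ract_closed[OF a, of y] by (simp_all add: inF_def)
    have "T.ract a (x - y) = T.ract a x - T.ract a y" by (simp add: T.ract_def frag_extend_diff)
    then show ?case
      using 2(3,4) F W.act_add[of "Inr a" "u x" "\<ominus>\<^bsub>W\<^esub> u y"] W.act_neg[of "Inr a" "u y"] a uc
      by (simp add: u_diff del: tw_simps)
  next
    case (3 p)
    then obtain x y where p: "p = (x, y)" "x \<in> carrier M" "y \<in> carrier N" by auto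
    then show ?case using a by (simp add: T.ract_def u_pair rsmult_closed \<iota>_right del: tw_simps)
  qed
  have "W \<simeq>\<^bsub>bops R\<^esub> ?T"
  proof (rule bij_mor_witness[where f = "\<lambda>f. ?q (w f)" and g = "\<lambda>t. u (SOME x. inF x \<and> ?q x = t)"], goal_cases)
    case 1
    show ?case
    proof (rule morI, goal_cases)
      case (1 f) then show ?case using wF[OF 1] unfolding Tc inF_def by blast
    next
      case (2 f g)
      have F: "inF (w f)" "inF (w g)" using wF 2 by blast+
      show ?case using Tadd[OF F] q_w_u[OF F_add[OF F]] u_add[OF F] u_w 2 by simp
    next
      case (3 s f)
      have F: "inF (w f)" by (rule wF[OF 3(2)])
      show ?case
      proof (cases s)
        case (Inl a)
        then have a: "a \<in> carrier R" using 3 by auto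
        have "inF (T.lact a (w f))" using T.lact_closed[OF a] F by (simp add: inF_def)
        from q_w_u[OF this] have "?q (T.lact a (w f)) = ?q (w (act W s f))"
          unfolding u_lact[OF a F] u_w[OF 3(2)] Inl act_simps .
        then show ?thesis using T.tensor_smult_coset[OF a, of "w f"] F Inl by (simp add: inF_def del: tw_simps)
      next
        case (Inr a)
        then have a: "a \<in> carrier R" using 3 by auto
        have "inF (T.ract a (w f))" using T.ract_closed[OF a] F by (simp add: inF_def)
        from q_w_u[OF this] have "?q (T.ract a (w f)) = ?q (w (act W s f))"
          unfolding u_ract[OF a F] u_w[OF 3(2)] Inr act_simps .
        then show ?thesis using T.tensor_rsmult_coset[OF a, of "w f"] F Inr by (simp add: inF_def del: tw_simps)
      qed
    qed
  next
    case (2 t)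
    then have "\<exists>x. inF x \<and> ?q x = t" unfolding Tc inF_def by blast
    from someI_ex[OF this] show ?case using uc by blast
  next
    case (3 f)
    have "\<exists>x. inF x \<and> ?q x = ?q (w f)" using wF[OF 3] by blast
    from someI_ex[OF this] have "u (SOME x. inF x \<and> ?q x = ?q (w f)) = u (w f)"
      by (intro u_q wF[OF 3]) simp_all
    then show ?case using u_w[OF 3] by simp
  next
    case (4 t)
    then have "\<exists>x. inF x \<and> ?q x = t" unfolding Tc inF_def by blast
    from someI_ex[OF this] have "inF (SOME x. inF x \<and> ?q x = t)" "?q (SOME x. inF x \<and> ?q x = t) = t"
      by simp_all
    then show ?case using q_w_u[of "SOME x. inF x \<and> ?q x = t"] by simp
  qed
  then show ?thesis by (rule iso_sym[OF opmod_W])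
qed

lemma bimodule_W: "bimodule R W"
proof -
  interpret T: bimodule_pair R M N S
    by (intro bimodule_pair.intro bimodule_pair_axioms.intro M.bimodule_axioms bimodule_axioms S)
  show ?thesis by (rule bimodule_transport[OF T.bimodule_tensor tensor_iso_tw opmod_W])
qed

end

section \<open>Simple algebras\<close>

text \<open>Simplicity in the form in which it is used: it suffices to check closure under sums and
  under multiplication from both sides.\<close>

lemma (in simple_ring) two_sided_full:
  assumes J: "J \<subseteq> carrier R" "x \<in> J" "x \<noteq> \<zero>"
    and add: "\<And>a b. a \<in> J \<Longrightarrow> b \<in> J \<Longrightarrow> a \<oplus> b \<in> J"
    and l: "\<And>a b. a \<in> carrier R \<Longrightarrow> b \<in> J \<Longrightarrow> a \<otimes> b \<in> J"
    and r: "\<And>a b. a \<in> carrier R \<Longrightarrow> b \<in> J \<Longrightarrow> b \<otimes> a \<in> J"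
  shows "J = carrier R"
proof -
  have neg: "\<ominus> a \<in> J" if "a \<in> J" for a
    using l[of "\<ominus> \<one>" a] that J(1) l_minus[of \<one> a] by auto
  have "subgroup J (add_monoid R)"
    by (rule add.subgroupI) (use J add neg in \<open>auto simp: a_inv_def\<close>)
  then have "ideal J R" by (rule idealI[OF ring_axioms]) (use l r in auto)
  then show ?thesis using ideal_trivial J(2,3) by blast
qed

text \<open>The inductive \<^const>\<open>ring.dimension\<close> adds one line at a time, and each
  line is a free direct summand of dimension one.\<close>

lemma (in ring) dimension_iso:
  assumes K: "subfield K R" and dim: "dimension n K E"
  shows "submod (lops K) (regular_bimodule R) E \<and>
    sub (regular_bimodule R) K ^\<^sub>d n \<simeq>\<^bsub>lops K\<^esub> sub (regular_bimodule R) E"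
proof -
  let ?B = "regular_bimodule R"
  interpret reg: bimodule R ?B by (rule bimodule_regular)
  show ?thesis using dim K
  proof (induction n K E rule: dimension.induct)
    case (zero_dim K)
    let ?K = "sub ?B K" and ?\<Omega> = "lops K"
    note SE = subringE[OF subfieldE(1)[OF zero_dim]]
    have reg: "opmod ?\<Omega> ?B" by (rule reg.opmod_lops[OF SE(1)])
    have Km: "opmod ?\<Omega> ?K" by (rule opmod_sub[OF reg]) (use SE in \<open>auto simp: submod_def\<close>)
    have z: "submod ?\<Omega> ?B {\<zero>}" using submod_zero[OF reg] by simp
    show ?case
      by (intro conjI z zero_iso[OF opmod_ipow[OF Km] opmod_sub[OF reg z] dpow_zero]) simp
  next
    case (Suc_dim v E n K)
    let ?K = "sub ?B K" and ?\<Omega> = "lops K" and ?V = "line_extension K v E"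
    note K = Suc_dim.prems
    note SE = subringE[OF subfieldE(1)[OF K]]
    have reg: "opmod ?\<Omega> ?B" by (rule reg.opmod_lops[OF SE(1)])
    have Km: "opmod ?\<Omega> ?K" by (rule opmod_sub[OF reg]) (use SE in \<open>auto simp: submod_def\<close>)
    have E: "submod ?\<Omega> ?B E" and iso: "?K ^\<^sub>d n \<simeq>\<^bsub>?\<Omega>\<^esub> sub ?B E" using Suc_dim.IH[OF K] by auto
    note Em = opmod_sub[OF reg E]
    have v: "v \<in> carrier R" "v \<notin> E" by fact+
    have KE: "opmod ?\<Omega> (?K \<oplus>\<^sub>d sub ?B E)" by (rule opmod_dsum[OF Km Em])
    have EC: "x \<in> carrier R" if "x \<in> E" for x using submodD(1)[OF E that] by simp
    have KC: "x \<in> carrier R" if "x \<in> K" for x using SE(1) that by blast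
    let ?h = "\<lambda>w. fst w \<otimes> v \<oplus> snd w"
    have h: "mor ?\<Omega> (?K \<oplus>\<^sub>d sub ?B E) ?B ?h"
      by (rule morI) (use v EC KC in \<open>auto simp: l_distr r_distr m_assoc a_ac\<close>)
    have im: "?h ` carrier (?K \<oplus>\<^sub>d sub ?B E) = ?V" by (force simp: line_extension_mem_iff)
    have V: "submod ?\<Omega> ?B ?V" using submod_image[OF h KE reg submod_carrier[OF KE]] im by simp
    have h': "mor ?\<Omega> (?K \<oplus>\<^sub>d sub ?B E) (sub ?B ?V) ?h"
      using h im unfolding mor_def by (auto simp del: dsum_simps(1))
    have "bij_betw ?h (carrier (?K \<oplus>\<^sub>d sub ?B E)) (carrier (sub ?B ?V))"
    proof (rule mor_bijI[OF h' opmod_ab[OF KE] opmod_ab[OF opmod_sub[OF reg V]]])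
      fix w assume w: "w \<in> carrier (?K \<oplus>\<^sub>d sub ?B E)" "?h w = \<zero>\<^bsub>sub ?B ?V\<^esub>"
      then obtain k x where kx: "w = (k, x)" "k \<in> K" "x \<in> E" "k \<otimes> v \<oplus> x = \<zero>" by auto
      have "k = \<zero>"
      proof (rule ccontr)
        assume k: "k \<noteq> \<zero>"
        then have ik: "inv k \<in> K" "inv k \<otimes> k = \<one>" using subfield_m_inv[OF K] kx(2) by auto
        have "k \<otimes> v = \<ominus> x" using minus_equality[of "k \<otimes> v" x] kx v EC KC by simp
        then have "k \<otimes> v \<in> E" using submodD(4)[OF E kx(3)] by simp
        then have "inv k \<otimes> (k \<otimes> v) \<in> E" using submodD(5)[OF E, of "Inl (inv k)"] ik by simp
        then show False using ik v kx(2) KC by (simp flip: m_assoc)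
      qed
      then show "w = \<zero>\<^bsub>?K \<oplus>\<^sub>d sub ?B E\<^esub>" using kx v EC by simp
    next
      fix y assume "y \<in> carrier (sub ?B ?V)"
      then have "y \<in> ?h ` carrier (?K \<oplus>\<^sub>d sub ?B E)" by (simp only: im sub_simps)
      then show "\<exists>w \<in> carrier (?K \<oplus>\<^sub>d sub ?B E). ?h w = y" by blast
    qed
    then have "?K \<oplus>\<^sub>d sub ?B E \<simeq>\<^bsub>?\<Omega>\<^esub> sub ?B ?V" using h' unfolding mod_iso_def by blast
    with iso_trans[OF dpow_Suc dsum_cong[OF iso_refl iso]] have "?K ^\<^sub>d Suc n \<simeq>\<^bsub>?\<Omega>\<^esub> sub ?B ?V"
      by (rule iso_trans)
    with V show ?case by blast
  qed
qed

subsection \<open>Matrix coefficients\<close>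

text \<open>For a bimodule \<open>M\<close> these are the additive maps \<open>y \<mapsto> \<Sum>\<^sub>i \<xi>\<^sub>i (p\<^sub>i y)\<close> on the ring with
  \<open>p\<^sub>i\<close> in \<open>M\<close> and \<open>\<xi>\<^sub>i\<close> left linear. The closure under \<open>ext\<close> disregards values outside the ring.\<close>

inductive_set coef :: "('a, 'k) ring_scheme \<Rightarrow> ('a, 'b) bimodule \<Rightarrow> ('a \<Rightarrow> 'a) set"
  for R :: "('a, 'k) ring_scheme" and M :: "('a, 'b) bimodule" where
  basic: "mor (lops (carrier R)) M (regular_bimodule R) \<xi> \<Longrightarrow> p \<in> carrier M \<Longrightarrow>
    (\<lambda>y. \<xi> (p \<odot>\<^sup>r\<^bsub>M\<^esub> y)) \<in> coef R M"
| add: "s \<in> coef R M \<Longrightarrow> t \<in> coef R M \<Longrightarrow> (\<lambda>y. s y \<oplus>\<^bsub>R\<^esub> t y) \<in> coef R M"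
| ext: "s \<in> coef R M \<Longrightarrow> (\<And>y. y \<in> carrier R \<Longrightarrow> t y = s y) \<Longrightarrow> t \<in> coef R M"

context bimodule
begin

lemma mor_regular_right: "b \<in> carrier R \<Longrightarrow>
    mor (lops (carrier R)) (regular_bimodule R) (regular_bimodule R) (\<lambda>x. x \<otimes> b)"
  by (rule morI) (auto simp: R.l_distr R.m_assoc)

lemma coef_closed: "s \<in> coef R M \<Longrightarrow> y \<in> carrier R \<Longrightarrow> s y \<in> carrier R"
proof (induction rule: coef.induct)
  case (basic \<xi> p)
  then show ?case using mor_closed[OF basic(1)] by (simp add: rsmult_closed)
qed auto

lemma coef_additive:
  "s \<in> coef R M \<Longrightarrow> y \<in> carrier R \<Longrightarrow> z \<in> carrier R \<Longrightarrow> s (y \<oplus> z) = s y \<oplus> s z"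
proof (induction rule: coef.induct)
  case (basic \<xi> p)
  then show ?case using mor_add[OF basic(1)] by (simp add: rsmult_closed rsmult_distr_ring)
next
  case (add s t)
  then show ?case using coef_closed[OF add(1)] coef_closed[OF add(2)] by (simp add: R.a_ac)
qed auto

lemma coef_mor: "s \<in> coef R M \<Longrightarrow> mor {} (regular_bimodule R) (regular_bimodule R) s"
  by (rule morI) (auto simp: coef_closed coef_additive)

lemma coef_left: "s \<in> coef R M \<Longrightarrow> b \<in> carrier R \<Longrightarrow> (\<lambda>y. b \<otimes> s y) \<in> coef R M"
proof (induction rule: coef.induct)
  case (basic \<xi> p)
  show ?case
  proof (rule coef.ext[OF coef.basic[OF basic(1), of "b \<odot>\<^bsub>M\<^esub> p"]])
    fix y assume "y \<in> carrier R"
    then show "b \<otimes> \<xi> (p \<odot>\<^sup>r\<^bsub>M\<^esub> y) = \<xi> (b \<odot>\<^bsub>M\<^esub> p \<odot>\<^sup>r\<^bsub>M\<^esub> y)"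
      using mor_act[OF basic(1), of "p \<odot>\<^sup>r\<^bsub>M\<^esub> y" "Inl b"] basic(2,3) by (simp add: rsmult_closed lsmult_rsmult)
  qed (use basic in \<open>simp add: lsmult_closed\<close>)
next
  case (add s t)
  show ?case
    by (rule coef.ext[OF coef.add[OF add(3,4)]])
      (use add coef_closed[OF add(1)] coef_closed[OF add(2)] in \<open>simp_all add: R.r_distr\<close>)
next
  case (ext s t)
  show ?case by (rule coef.ext[OF ext(3)]) (use ext in simp_all)
qed

lemma coef_right: "s \<in> coef R M \<Longrightarrow> b \<in> carrier R \<Longrightarrow> (\<lambda>y. s y \<otimes> b) \<in> coef R M"
proof (induction rule: coef.induct)
  case (basic \<xi> p)
  show ?case using coef.basic[OF mor_comp[OF basic(1) mor_regular_right[OF basic(3)]] basic(2)] .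
next
  case (add s t)
  show ?case
    by (rule coef.ext[OF coef.add[OF add(3,4)]])
      (use add coef_closed[OF add(1)] coef_closed[OF add(2)] in \<open>simp_all add: R.l_distr\<close>)
next
  case (ext s t)
  show ?case by (rule coef.ext[OF ext(3)]) (use ext in simp_all)
qed

lemma coef_pre: "s \<in> coef R M \<Longrightarrow> b \<in> carrier R \<Longrightarrow> (\<lambda>y. s (b \<otimes> y)) \<in> coef R M"
proof (induction rule: coef.induct)
  case (basic \<xi> p)
  show ?case
    by (rule coef.ext[OF coef.basic[OF basic(1), of "p \<odot>\<^sup>r\<^bsub>M\<^esub> b"]])
      (use basic in \<open>simp_all add: rsmult_closed rsmult_assoc\<close>)
next
  case (add s t)
  show ?case by (rule coef.add[OF add(3,4)]) (use add in simp_all)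
next
  case (ext s t)
  show ?case by (rule coef.ext[OF ext(3)]) (use ext in simp_all)
qed

lemma coef_zero: "(\<lambda>y. \<zero>) \<in> coef R M"
  by (rule coef.ext[OF coef.basic[OF mor_const_zero[where N = "regular_bimodule R"] M.zero_closed]])
    (use bimodule.opmod_lops[OF R.bimodule_regular] in auto)

lemma coef_finsum:
  assumes "\<And>i. i \<in> I \<Longrightarrow> s i \<in> coef R M" and "finite I"
  shows "(\<lambda>y. \<Oplus>i \<in> I. s i y) \<in> coef R M"
  using assms(2,1)
proof induction
  case empty
  show ?case using coef_zero by simp
next
  case (insert i I)
  show ?case
    by (rule coef.ext[OF coef.add[OF insert.prems insert.IH]])
      (use insert coef_closed in \<open>auto intro!: R.finsum_insert\<close>)
qed

end

lemma coef_trans: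
  assumes M: "bimodule R M" and N: "bimodule R N" and f: "mor (bops R) N M f"
    and \<xi>: "\<And>\<xi>. mor (lops (carrier R)) N (regular_bimodule R) \<xi> \<Longrightarrow>
      \<exists>\<zeta>. mor (lops (carrier R)) M (regular_bimodule R) \<zeta> \<and> (\<forall>x \<in> carrier N. \<zeta> (f x) = \<xi> x)"
    and s: "s \<in> coef R N"
  shows "s \<in> coef R M"
proof -
  interpret N: bimodule R N by fact
  show ?thesis using s
  proof (induction rule: coef.induct)
    case (basic \<xi> p)
    obtain \<zeta> where \<zeta>: "mor (lops (carrier R)) M (regular_bimodule R) \<zeta>" "\<And>x. x \<in> carrier N \<Longrightarrow> \<zeta> (f x) = \<xi> x"
      using assms(4)[OF basic(1)] by blast
    show ?case
    proof (rule coef.ext[OF coef.basic[OF \<zeta>(1) mor_closed[OF f basic(2)]]])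
      fix y assume "y \<in> carrier R"
      then show "\<xi> (p \<odot>\<^sup>r\<^bsub>N\<^esub> y) = \<zeta> (f p \<odot>\<^sup>r\<^bsub>M\<^esub> y)"
        using \<zeta>(2)[of "p \<odot>\<^sup>r\<^bsub>N\<^esub> y"] mor_act[OF f basic(2), of "Inr y"] basic(2) by (simp add: N.rsmult_closed)
    qed
  qed (auto intro: coef.add coef.ext)
qed

lemma coef_iso:
  assumes M: "bimodule R M" and N: "bimodule R N" and iso: "N \<simeq>\<^bsub>bops R\<^esub> M" and s: "s \<in> coef R N"
  shows "s \<in> coef R M"
proof -
  interpret M: bimodule R M by fact
  interpret N: bimodule R N by fact
  obtain f where f: "mor (bops R) N M f" "bij_betw f (carrier N) (carrier M)"
    using iso unfolding mod_iso_def by blast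
  obtain g where g: "mor (bops R) M N g" "\<And>x. x \<in> carrier N \<Longrightarrow> g (f x) = x"
    using mor_inv[OF f N.opmod_bops] by metis
  have gl: "mor (lops (carrier R)) M N g" by (rule mor_mono[OF g(1)]) simp
  show ?thesis
  proof (rule coef_trans[OF M N f(1) _ s])
    fix \<xi> assume "mor (lops (carrier R)) N (regular_bimodule R) \<xi>"
    then show "\<exists>\<zeta>. mor (lops (carrier R)) M (regular_bimodule R) \<zeta> \<and> (\<forall>x \<in> carrier N. \<zeta> (f x) = \<xi> x)"
      using mor_comp[OF gl] g(2) by (intro exI[of _ "\<lambda>x. \<xi> (g x)"]) simp
  qed
qed

lemma coef_dsum:
  assumes M: "bimodule R M" and N: "bimodule R N" and s: "s \<in> coef R (M \<oplus>\<^sub>d N)"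
    and MC: "coef R M \<subseteq> coef R Q" and NC: "coef R N \<subseteq> coef R Q"
  shows "s \<in> coef R Q"
  using s
proof (induction rule: coef.induct)
  interpret M: bimodule R M by fact
  interpret N: bimodule R N by fact
  case (basic \<xi> p)
  interpret Ml: opmod "lops (carrier R)" M by (rule M.opmod_lops) simp
  interpret Nl: opmod "lops (carrier R)" N by (rule N.opmod_lops) simp
  have i: "mor (lops (carrier R)) M (M \<oplus>\<^sub>d N) (\<lambda>x. (x, \<zero>\<^bsub>N\<^esub>))" "mor (lops (carrier R)) N (M \<oplus>\<^sub>d N) (\<lambda>y. (\<zero>\<^bsub>M\<^esub>, y))"
    by (rule morI, auto simp: M.smult_zero N.smult_zero)+
  have p: "fst p \<in> carrier M" "snd p \<in> carrier N" using basic(2) by auto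
  have "(\<lambda>y. \<xi> (fst p \<odot>\<^sup>r\<^bsub>M\<^esub> y, \<zero>\<^bsub>N\<^esub>)) \<in> coef R Q" "(\<lambda>y. \<xi> (\<zero>\<^bsub>M\<^esub>, snd p \<odot>\<^sup>r\<^bsub>N\<^esub> y)) \<in> coef R Q"
    using coef.basic[OF mor_comp[OF i(1) basic(1)] p(1)] coef.basic[OF mor_comp[OF i(2) basic(1)] p(2)] MC NC
    by blast+
  from coef.add[OF this] show ?case
  proof (rule coef.ext)
    fix y assume "y \<in> carrier R"
    then show "\<xi> (p \<odot>\<^sup>r\<^bsub>M \<oplus>\<^sub>d N\<^esub> y) = \<xi> (fst p \<odot>\<^sup>r\<^bsub>M\<^esub> y, \<zero>\<^bsub>N\<^esub>) \<oplus>\<^bsub>R\<^esub> \<xi> (\<zero>\<^bsub>M\<^esub>, snd p \<odot>\<^sup>r\<^bsub>N\<^esub> y)"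
      using mor_add[OF basic(1), of "(fst p \<odot>\<^sup>r\<^bsub>M\<^esub> y, \<zero>\<^bsub>N\<^esub>)" "(\<zero>\<^bsub>M\<^esub>, snd p \<odot>\<^sup>r\<^bsub>N\<^esub> y)"] p
      by (simp add: M.rsmult_closed N.rsmult_closed)
  qed
qed (auto intro: coef.add coef.ext)

lemma coef_dpow:
  assumes M: "bimodule R M" shows "coef R (M ^\<^sub>d n) \<subseteq> coef R M"
proof (induction n)
  case 0
  interpret M: bimodule R M by fact
  interpret M0: bimodule R "M ^\<^sub>d 0" by (rule bimodule_dpow[OF M])
  interpret reg: bimodule R "regular_bimodule R" by (rule M.R.bimodule_regular)
  have "s \<in> coef R M" if "s \<in> coef R (M ^\<^sub>d 0)" for s
    using that
  proof (induction rule: coef.induct)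
    case (basic \<xi> p)
    show ?case
    proof (rule coef.ext[OF M.coef_zero])
      fix y assume "y \<in> carrier R"
      then have "p \<odot>\<^sup>r\<^bsub>M ^\<^sub>d 0\<^esub> y \<in> carrier (M ^\<^sub>d 0)" using basic(2) by (intro M0.rsmult_closed)
      then have "p \<odot>\<^sup>r\<^bsub>M ^\<^sub>d 0\<^esub> y = \<zero>\<^bsub>M ^\<^sub>d 0\<^esub>" using dpow_zero[of M] by blast
      then show "\<xi> (p \<odot>\<^sup>r\<^bsub>M ^\<^sub>d 0\<^esub> y) = \<zero>\<^bsub>R\<^esub>"
        using mor_zero[OF basic(1) M0.M.abelian_group_axioms reg.M.abelian_group_axioms] by simp
    qed
  qed (auto intro: coef.add coef.ext)
  then show ?case by blast
next
  case (Suc n)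
  have "s \<in> coef R M" if "s \<in> coef R (M ^\<^sub>d Suc n)" for s
    using coef_iso[OF bimodule_dsum[OF M bimodule_dpow[OF M]] bimodule_dpow[OF M] dpow_Suc that]
      coef_dsum[OF M bimodule_dpow[OF M] _ subset_refl Suc] by blast
  then show ?case by blast
qed

text \<open>For \<open>s = \<xi> (p -)\<close> and \<open>t = \<zeta> (q -)\<close> the composition is the coefficient of the element
  \<open>p \<otimes> q\<close> and the left linear map \<open>x \<otimes> y \<mapsto> \<xi> (x \<zeta>(y))\<close>, which in coordinates is
  \<open>\<eta> f = \<Sum>\<^sub>i \<xi> (f\<^sub>i \<zeta>(e\<^sub>i))\<close>.\<close>

lemma (in tensor_basis) coef_comp:
  assumes S: "S = carrier R" and s: "s \<in> coef R M" and t: "t \<in> coef R N"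
  shows "(\<lambda>y. s (t y)) \<in> coef R W"
proof -
  interpret WW: bimodule R W by (rule bimodule_W)
  interpret reg: bimodule R "regular_bimodule R" by (rule M.R.bimodule_regular)
  interpret Ml: opmod "lops (carrier R)" M by (rule M.opmod_lops) simp
  interpret Wl: opmod "lops (carrier R)" W by (rule WW.opmod_lops) simp
  have lin: "(\<lambda>y. \<xi> (p \<odot>\<^sup>r\<^bsub>M\<^esub> \<zeta> (q \<odot>\<^sup>r\<^bsub>N\<^esub> y))) \<in> coef R W"
    if \<xi>: "mor (lops (carrier R)) M (regular_bimodule R) \<xi>" and p: "p \<in> carrier M"
      and \<zeta>: "mor (lops (carrier R)) N (regular_bimodule R) \<zeta>" and q: "q \<in> carrier N" for \<xi> p \<zeta> q
  proof -
    note \<zeta>e = mor_closed[OF \<zeta> e_closed, simplified]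
    define \<eta> where "\<eta> f = (\<Oplus>i \<in> I. \<xi> (f i \<odot>\<^sup>r\<^bsub>M\<^esub> \<zeta> (e i)))" for f
    have \<xi>c: "\<xi> (f i \<odot>\<^sup>r\<^bsub>M\<^esub> \<zeta> (e i)) \<in> carrier R" if "f \<in> carrier W" "i \<in> I" for f i
      using that mor_closed[OF \<xi>] \<zeta>e by (auto simp: PiE_iff M.rsmult_closed)
    have \<eta>: "mor (lops (carrier R)) W (regular_bimodule R) \<eta>"
    proof (rule morI, goal_cases)
      case (1 f)
      then show ?case unfolding \<eta>_def using \<xi>c by (auto simp del: tw_simps intro!: M.R.finsum_closed)
    next
      case (2 f g)
      have "\<eta> (f \<oplus>\<^bsub>W\<^esub> g) = (\<Oplus>i \<in> I. \<xi> (f i \<odot>\<^sup>r\<^bsub>M\<^esub> \<zeta> (e i)) \<oplus> \<xi> (g i \<odot>\<^sup>r\<^bsub>M\<^esub> \<zeta> (e i)))"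
        unfolding \<eta>_def using 2 \<xi>c[OF 2(1)] \<xi>c[OF 2(2)]
        by (intro M.R.finsum_cong')
          (auto simp: PiE_iff M.rsmult_distr M.rsmult_closed \<zeta>e mor_add[OF \<xi>] mor_closed[OF \<xi>, simplified])
      then show ?case unfolding \<eta>_def using \<xi>c[OF 2(1)] \<xi>c[OF 2(2)] by (simp add: M.R.finsum_addf Pi_iff)
    next
      case (3 s f)
      then obtain a where a: "s = Inl a" "a \<in> carrier R" by auto
      have "\<eta> (a \<odot>\<^bsub>W\<^esub> f) = (\<Oplus>i \<in> I. a \<otimes> \<xi> (f i \<odot>\<^sup>r\<^bsub>M\<^esub> \<zeta> (e i)))"
        unfolding \<eta>_def
      proof (rule M.R.finsum_cong'[OF refl])
        fix i assume i: "i \<in> I"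
        then have fi: "f i \<in> carrier M" using 3 by auto
        then show "\<xi> ((a \<odot>\<^bsub>W\<^esub> f) i \<odot>\<^sup>r\<^bsub>M\<^esub> \<zeta> (e i)) = a \<otimes> \<xi> (f i \<odot>\<^sup>r\<^bsub>M\<^esub> \<zeta> (e i))"
          using i a mor_act[OF \<xi>, of "f i \<odot>\<^sup>r\<^bsub>M\<^esub> \<zeta> (e i)" "Inl a"] \<zeta>e[OF i]
          by (simp add: M.lsmult_rsmult M.rsmult_closed)
      qed (use \<xi>c[OF 3(2)] a in auto)
      then show ?case unfolding \<eta>_def using a \<xi>c[OF 3(2)] by (simp add: M.R.finsum_rdistr Pi_iff del: tw_simps)
    qed
    show ?thesis
    proof (rule coef.ext[OF coef.basic[OF \<eta> \<iota>_closed[OF p q]]])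
      fix y assume y: "y \<in> carrier R"
      have qy: "q \<odot>\<^sup>r\<^bsub>N\<^esub> y \<in> carrier N" using q y by (rule rsmult_closed[rotated])
      note cq = c_closed[OF _ qy]
      have "\<zeta> (q \<odot>\<^sup>r\<^bsub>N\<^esub> y) = \<zeta> (finsum N (\<lambda>i. c i (q \<odot>\<^sup>r\<^bsub>N\<^esub> y) \<odot>\<^bsub>N\<^esub> e i) I)" using expand[OF qy] by simp
      also have "\<dots> = finsum R (\<lambda>i. \<zeta> (c i (q \<odot>\<^sup>r\<^bsub>N\<^esub> y) \<odot>\<^bsub>N\<^esub> e i)) I"
        using mor_finsum[OF \<zeta> M.abelian_group_axioms reg.M.abelian_group_axioms, of "\<lambda>i. c i (q \<odot>\<^sup>r\<^bsub>N\<^esub> y) \<odot>\<^bsub>N\<^esub> e i" I]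
          cq by (simp add: Pi_iff lsmult_closed)
      also have "\<dots> = finsum R (\<lambda>i. c i (q \<odot>\<^sup>r\<^bsub>N\<^esub> y) \<otimes> \<zeta> (e i)) I"
        using cq \<zeta>e mor_act[OF \<zeta> e_closed, of _ "Inl (c _ (q \<odot>\<^sup>r\<^bsub>N\<^esub> y))"]
        by (intro M.R.finsum_cong') auto
      finally have z: "\<zeta> (q \<odot>\<^sup>r\<^bsub>N\<^esub> y) = finsum R (\<lambda>i. c i (q \<odot>\<^sup>r\<^bsub>N\<^esub> y) \<otimes> \<zeta> (e i)) I" .
      have "\<xi> (p \<odot>\<^sup>r\<^bsub>M\<^esub> \<zeta> (q \<odot>\<^sup>r\<^bsub>N\<^esub> y)) = \<xi> (finsum M (\<lambda>i. p \<odot>\<^sup>r\<^bsub>M\<^esub> (c i (q \<odot>\<^sup>r\<^bsub>N\<^esub> y) \<otimes> \<zeta> (e i))) I)"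
        using p cq \<zeta>e unfolding z by (subst M.rsmult_finsum_right) auto
      also have "\<dots> = finsum R (\<lambda>i. \<xi> (p \<odot>\<^sup>r\<^bsub>M\<^esub> (c i (q \<odot>\<^sup>r\<^bsub>N\<^esub> y) \<otimes> \<zeta> (e i)))) I"
        using mor_finsum[OF \<xi> M.M.abelian_group_axioms reg.M.abelian_group_axioms,
            of "\<lambda>i. p \<odot>\<^sup>r\<^bsub>M\<^esub> (c i (q \<odot>\<^sup>r\<^bsub>N\<^esub> y) \<otimes> \<zeta> (e i))" I] p cq \<zeta>e
        by (simp add: Pi_iff M.rsmult_closed)
      also have "\<dots> = \<eta> (\<iota> p (q \<odot>\<^sup>r\<^bsub>N\<^esub> y))"
        unfolding \<eta>_def using p cq \<zeta>e mor_closed[OF \<xi>]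
        by (intro M.R.finsum_cong') (auto simp: \<iota>_def M.rsmult_assoc M.rsmult_closed)
      finally show "\<xi> (p \<odot>\<^sup>r\<^bsub>M\<^esub> \<zeta> (q \<odot>\<^sup>r\<^bsub>N\<^esub> y)) = \<eta> (\<iota> p q \<odot>\<^sup>r\<^bsub>W\<^esub> y)"
        using \<iota>_right[OF y p q] by simp
    qed
  qed
  have step: "(\<lambda>y. \<xi> (p \<odot>\<^sup>r\<^bsub>M\<^esub> t y)) \<in> coef R W"
    if \<xi>: "mor (lops (carrier R)) M (regular_bimodule R) \<xi>" and p: "p \<in> carrier M" for \<xi> p
    using t
  proof (induction rule: coef.induct)
    case (basic \<zeta> q)
    show ?case by (rule lin[OF \<xi> p basic])
  next
    case (add t t')
    show ?case
      by (rule coef.ext[OF coef.add[OF add(3,4)]])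
        (use p coef_closed[OF add(1)] coef_closed[OF add(2)] in
          \<open>simp add: M.rsmult_distr_ring M.rsmult_closed mor_add[OF \<xi>]\<close>)
  next
    case (ext t t')
    show ?case by (rule coef.ext[OF ext(3)]) (use ext in simp)
  qed
  show ?thesis using s
  proof (induction rule: coef.induct)
    case (basic \<xi> p)
    then show ?case by (rule step)
  next
    case (add s s')
    show ?case by (rule coef.add[OF add(3,4)])
  next
    case (ext s s')
    show ?case by (rule coef.ext[OF ext(3)]) (use ext coef_closed[OF t] in simp)
  qed
qed

section \<open>The center of a Galois bimodule\<close>

text \<open>The only subspaces of a one-dimensional space are the two trivial ones.\<close>

lemma (in ring) subfield_finite_length:
  assumes K: "subfield K R" shows "finite_length (lops K) (sub (regular_bimodule R) K)"
proof (rule finite_lengthI[where \<phi> = "\<lambda>U. if U = {\<zero>} then 0 else 1"])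
  fix U V assume U: "submod (lops K) (sub (regular_bimodule R) K) U"
    and V: "submod (lops K) (sub (regular_bimodule R) K) V" and UV: "U \<subset> V"
  have "U = K" if ne: "U \<noteq> {\<zero>}"
  proof -
    obtain k where k: "k \<in> U" "k \<noteq> \<zero>" using ne submodD(2)[OF U] by auto
    have "k \<in> K" using submodD(1)[OF U k(1)] by simp
    then have ik: "inv k \<in> K" "inv k \<otimes> k = \<one>" using subfield_m_inv[OF K] k(2) by auto
    have "x \<in> U" if x: "x \<in> K" for x
    proof -
      have "(x \<otimes> inv k) \<otimes> k \<in> U"
        using submodD(5)[OF U _ k(1), of "Inl (x \<otimes> inv k)"] x ik(1) subringE(6)[OF subfieldE(1)[OF K]] by auto
      moreover have "x \<in> carrier R" "k \<in> carrier R" "inv k \<in> carrier R"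
        using x ik(1) \<open>k \<in> K\<close> subfieldE(3)[OF K] by blast+
      ultimately show ?thesis using ik(2) by (simp add: m_assoc)
    qed
    then show ?thesis using U by (auto simp: submod_def)
  qed
  moreover have "V \<subseteq> K" using V by (auto simp: submod_def)
  moreover have "V \<noteq> {\<zero>}" using UV submodD(2)[OF U] by auto
  ultimately show "(if U = {\<zero>} then 0 else 1) < (if V = {\<zero>} then 0 else 1 :: nat)" using UV by auto
qed

lemma (in ring) regular_finite_length:
  assumes K: "subfield K R" and dim: "dimension n K (carrier R)"
  shows "finite_length (lops K) (regular_bimodule R)"
proof -
  interpret reg: bimodule R "regular_bimodule R" by (rule bimodule_regular)
  note SE = subringE[OF subfieldE(1)[OF K]]
  have reg: "opmod (lops K) (regular_bimodule R)" by (rule reg.opmod_lops[OF SE(1)])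
  have Km: "opmod (lops K) (sub (regular_bimodule R) K)"
    by (rule opmod_sub[OF reg]) (use SE in \<open>auto simp: submod_def\<close>)
  have iso: "sub (regular_bimodule R) K ^\<^sub>d n \<simeq>\<^bsub>lops K\<^esub> sub (regular_bimodule R) (carrier R)"
    using dimension_iso[OF K dim] by simp
  have "sub (regular_bimodule R) (carrier R) = regular_bimodule R"
    using sub_simps(8)[of "regular_bimodule R"] by simp
  then have "regular_bimodule R \<simeq>\<^bsub>lops K\<^esub> sub (regular_bimodule R) K ^\<^sub>d n"
    using iso_sym[OF opmod_ipow[OF Km] iso] by simp
  then show ?thesis
    by (rule finite_length_iso[OF _ reg opmod_ipow[OF Km]])
      (rule finite_length_ipow[OF Km subfield_finite_length[OF K] finite_lessThan])
qed

lemma submod_ops_mono: "submod \<Omega> M U \<Longrightarrow> \<Omega>' \<subseteq> \<Omega> \<Longrightarrow> submod \<Omega>' M U"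
  by (auto simp: submod_def)

lemma finite_length_ops_mono: "finite_length \<Omega>' M \<Longrightarrow> \<Omega>' \<subseteq> \<Omega> \<Longrightarrow> finite_length \<Omega> M"
  by (erule finite_length_transfer) (erule submod_ops_mono)

text \<open>Coordinates on a Galois bimodule: a left basis \<open>e\<close> with coordinates \<open>c\<close> and a right basis \<open>q\<close>
  with coordinates \<open>\<beta>\<close>. In the left basis the square of \<open>P\<close> is a twisted power of \<open>P\<close>.\<close>

locale galois_coords = csa: central_simple_algebra L R + lbasis R P "carrier R" "{..<d}" e c
  for L :: "'a set" and R :: "('a, 'k) ring_scheme" (structure) and P :: "('a, 'b) bimodule"
    and d :: nat and e :: "nat \<Rightarrow> 'b" and c :: "nat \<Rightarrow> 'b \<Rightarrow> 'a" +
  fixes q :: "nat \<Rightarrow> 'b" and \<beta> :: "nat \<Rightarrow> 'b \<Rightarrow> 'a" and w :: nat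
  assumes d_pos: "0 < d"
    and q_closed: "i < d \<Longrightarrow> q i \<in> carrier P"
    and \<beta>_mor: "i < d \<Longrightarrow> mor (rops (carrier R)) P (regular_bimodule R) (\<beta> i)"
    and \<beta>_q: "i < d \<Longrightarrow> j < d \<Longrightarrow> \<beta> i (q j) = (if i = j then \<one> else \<zero>)"
    and \<beta>_expand: "y \<in> carrier P \<Longrightarrow> finsum P (\<lambda>i. q i \<odot>\<^sup>r\<^bsub>P\<^esub> \<beta> i y) {..<d} = y"
    and square: "tw P {..<d} (\<lambda>b i j. c j (e i \<odot>\<^sup>r\<^bsub>P\<^esub> b)) \<simeq>\<^bsub>bops R\<^esub> P ^\<^sub>d d"
    and dim: "csa.dimension w L (carrier R)"
begin

abbreviation K :: "'a set" where "K \<equiv> bimodule_center R P"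
abbreviation B :: "('a, 'a) bimodule" where "B \<equiv> regular_bimodule R"

sublocale PP: tensor_basis R P P "carrier R" "{..<d}" e c
  by unfold_locales

sublocale B: bimodule R B
  by (rule csa.bimodule_regular)

lemma center_act: "z \<in> K \<Longrightarrow> x \<in> carrier P \<Longrightarrow> z \<odot>\<^bsub>P\<^esub> x = x \<odot>\<^sup>r\<^bsub>P\<^esub> z"
  by (simp add: bimodule_center_def)

lemma center_closed: "z \<in> K \<Longrightarrow> z \<in> carrier R"
  by (simp add: bimodule_center_def)

text \<open>Both \<open>z b\<close> and \<open>b z\<close> have the same product with a basis vector of \<open>P\<close>.\<close>

lemma center_comm:
  assumes z: "z \<in> K" and b: "b \<in> carrier R" shows "z \<otimes> b = b \<otimes> z"
proof -
  have e0: "e 0 \<in> carrier P" using d_pos by simp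
  have c0: "c 0 (a \<odot>\<^bsub>P\<^esub> e 0) = a" if "a \<in> carrier R" for a
    using c_smult[of 0 a "e 0"] c_e[of 0 0] d_pos that by simp
  note zc = center_closed[OF z]
  have "(z \<otimes> b) \<odot>\<^bsub>P\<^esub> e 0 = (b \<odot>\<^bsub>P\<^esub> e 0) \<odot>\<^sup>r\<^bsub>P\<^esub> z"
    using zc b e0 center_act[OF z, of "b \<odot>\<^bsub>P\<^esub> e 0"] by (simp add: lsmult_assoc lsmult_closed)
  also have "\<dots> = (b \<otimes> z) \<odot>\<^bsub>P\<^esub> e 0"
    using zc b e0 center_act[OF z e0] by (simp add: lsmult_rsmult lsmult_assoc)
  finally show ?thesis using c0 zc b by (metis csa.m_closed)
qed

lemma center_subset: "K \<subseteq> L"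
  using center_closed center_comm csa.center_eq by (auto simp: ring_center_def)

lemma L_comm: "z \<in> L \<Longrightarrow> b \<in> carrier R \<Longrightarrow> z \<otimes> b = b \<otimes> z"
  using csa.center_eq by (auto simp: ring_center_def)

lemma center_subring: "subring K R"
proof (rule csa.subringI)
  interpret opmod "bops R" P by (rule opmod_bops)
  show "K \<subseteq> carrier R" using center_closed by blast
  show "\<one> \<in> K" by (simp add: bimodule_center_def lsmult_one rsmult_one)
  fix z y assume z: "z \<in> K"
  have "(\<ominus> z) \<odot>\<^bsub>P\<^esub> x = x \<odot>\<^sup>r\<^bsub>P\<^esub> (\<ominus> z)" if x: "x \<in> carrier P" for x
    using mor_neg[OF mor_scalar_left[OF x] abelian_regular M.abelian_group_axioms, of z]
      mor_neg[OF mor_scalar_right[OF x] abelian_regular M.abelian_group_axioms, of z]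
      center_act[OF z x] center_closed[OF z] by simp
  then show "\<ominus> z \<in> K" using center_closed[OF z] by (simp add: bimodule_center_def)
  assume y: "y \<in> K"
  note zy = center_closed[OF z] center_closed[OF y]
  show "z \<otimes> y \<in> K"
    using zy center_act[OF z] center_act[OF y] center_comm[OF z zy(2)]
    by (simp add: bimodule_center_def lsmult_assoc rsmult_assoc lsmult_closed rsmult_closed
        flip: lsmult_rsmult)
  show "z \<oplus> y \<in> K"
    using zy center_act[OF z] center_act[OF y]
    by (simp add: bimodule_center_def lsmult_distr_ring rsmult_distr_ring)
qed

lemma center_subfield: "subfield K R"
proof -
  note SE = subringE[OF center_subring]
  have inv: "inv z \<in> K" "z \<otimes> inv z = \<one>" if z: "z \<in> K" "z \<noteq> \<zero>" for z
  proof -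
    have zL: "z \<in> L - {\<zero>}" using z center_subset by auto
    note iz = csa.subfield_m_inv[OF csa.center_subfield zL]
    have izc: "inv z \<in> carrier R" using iz(1) subfieldE(3)[OF csa.center_subfield] by blast
    note zc = center_closed[OF z(1)]
    have "inv z \<odot>\<^bsub>P\<^esub> x = x \<odot>\<^sup>r\<^bsub>P\<^esub> inv z" if x: "x \<in> carrier P" for x
    proof -
      have "inv z \<odot>\<^bsub>P\<^esub> x = inv z \<odot>\<^bsub>P\<^esub> ((x \<odot>\<^sup>r\<^bsub>P\<^esub> inv z) \<odot>\<^sup>r\<^bsub>P\<^esub> z)"
        using x izc zc iz(3) by (simp add: rsmult_one flip: rsmult_assoc)
      also have "\<dots> = inv z \<odot>\<^bsub>P\<^esub> (z \<odot>\<^bsub>P\<^esub> (x \<odot>\<^sup>r\<^bsub>P\<^esub> inv z))"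
        using center_act[OF z(1)] x izc by (simp add: rsmult_closed)
      also have "\<dots> = x \<odot>\<^sup>r\<^bsub>P\<^esub> inv z"
        using x izc zc iz(3) by (simp add: lsmult_one rsmult_closed flip: lsmult_assoc)
      finally show ?thesis .
    qed
    then show "inv z \<in> K" "z \<otimes> inv z = \<one>" using izc iz(2) by (auto simp: bimodule_center_def)
  qed
  have cring: "subcring K R"
    by (rule csa.subcringI[OF center_subring]) (use center_comm center_closed in blast)
  show ?thesis
  proof (rule csa.subfieldI[OF cring])
    have "z \<in> Units (R\<lparr>carrier := K\<rparr>)" if "z \<in> K" "z \<noteq> \<zero>" for z
      using inv[OF that] that center_comm[OF that(1), of "inv z"] center_closed unfolding Units_def by force
    moreover have "\<zero> \<notin> Units (R\<lparr>carrier := K\<rparr>)"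
      using csa.one_not_zero SE(1) center_closed by (auto simp: Units_def)
    moreover have "Units (R\<lparr>carrier := K\<rparr>) \<subseteq> K" by (auto simp: Units_def)
    ultimately show "Units (R\<lparr>carrier := K\<rparr>) = K - {\<zero>}" by auto
  qed
qed

subsection \<open>Matrix coefficients and a basis over the center\<close>

lemma coef_center_linear:
  assumes "s \<in> coef R P" "z \<in> K" "y \<in> carrier R" shows "s (z \<otimes> y) = z \<otimes> s y"
  using assms(1)
proof (induction rule: coef.induct)
  case (basic \<xi> p)
  note zc = center_closed[OF assms(2)]
  have "p \<odot>\<^sup>r\<^bsub>P\<^esub> (z \<otimes> y) = z \<odot>\<^bsub>P\<^esub> (p \<odot>\<^sup>r\<^bsub>P\<^esub> y)"
    using basic(2) zc assms(2,3) center_act[OF assms(2) basic(2)]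
    by (simp add: rsmult_assoc flip: lsmult_rsmult)
  then show ?case using mor_act[OF basic(1), of "p \<odot>\<^sup>r\<^bsub>P\<^esub> y" "Inl z"] basic(2) zc assms(3) by (simp add: rsmult_closed)
next
  case (add s t)
  then show ?case
    using coef_closed[OF add(1) assms(3)] coef_closed[OF add(2) assms(3)] center_closed[OF assms(2)]
    by (simp add: csa.r_distr)
next
  case (ext s t)
  then show ?case using center_closed[OF assms(2)] assms(3) by simp
qed

lemma coef_P_comp: "s \<in> coef R P \<Longrightarrow> t \<in> coef R P \<Longrightarrow> (\<lambda>y. s (t y)) \<in> coef R P"
proof -
  assume st: "s \<in> coef R P" "t \<in> coef R P"
  have W: "PP.W = tw P {..<d} (\<lambda>b i j. c j (e i \<odot>\<^sup>r\<^bsub>P\<^esub> b))"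
    by (intro arg_cong[where f = "tw P {..<d}"] HOL.ext) (simp add: PP.\<Psi>_def)
  have "(\<lambda>y. s (t y)) \<in> coef R PP.W" by (rule PP.coef_comp[OF refl st])
  then have "(\<lambda>y. s (t y)) \<in> coef R (P ^\<^sub>d d)"
    by (rule coef_iso[OF bimodule_dpow[OF bimodule_axioms] PP.bimodule_W, rotated]) (use square W in simp)
  then show ?thesis using coef_dpow[OF bimodule_axioms] by blast
qed

lemma coef_c: "i < d \<Longrightarrow> p \<in> carrier P \<Longrightarrow> (\<lambda>y. c i (p \<odot>\<^sup>r\<^bsub>P\<^esub> y)) \<in> coef R P"
  by (rule coef.basic[OF c_mor]) simp_all

text \<open>If all coordinates of \<open>q\<^sub>0 y\<close> vanish, then \<open>q\<^sub>0 y = 0\<close>, and \<open>q\<^sub>0\<close> belongs to a right basis.\<close>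

lemma coef_separates:
  assumes y: "y \<in> carrier R" and s: "\<And>s. s \<in> coef R P \<Longrightarrow> s y = \<zero>" shows "y = \<zero>"
proof -
  interpret opmod "bops R" P by (rule opmod_bops)
  note q0 = q_closed[OF d_pos]
  have c0: "c i \<zero>\<^bsub>P\<^esub> = \<zero>" if "i < d" for i
    using mor_zero[OF c_mor M.abelian_group_axioms abelian_regular, of i] that by simp
  have "q 0 \<odot>\<^sup>r\<^bsub>P\<^esub> y = \<zero>\<^bsub>P\<^esub>"
    by (rule lbasis.ext[OF lbasis_axioms]) (use q0 y s[OF coef_c[OF _ q0]] c0 in \<open>auto simp: rsmult_closed\<close>)
  then have "\<beta> 0 (q 0) \<otimes> y = \<beta> 0 \<zero>\<^bsub>P\<^esub>" using mor_act[OF \<beta>_mor[OF d_pos] q0, of "Inr y"] y by simp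
  then show ?thesis
    using \<beta>_q[OF d_pos d_pos] mor_zero[OF \<beta>_mor[OF d_pos] M.abelian_group_axioms abelian_regular] y by simp
qed

lemma coef_diff: "s \<in> coef R P \<Longrightarrow> t \<in> coef R P \<Longrightarrow> (\<lambda>y. s y \<oplus> \<ominus> t y) \<in> coef R P"
proof -
  assume st: "s \<in> coef R P" "t \<in> coef R P"
  show ?thesis
    by (rule coef.ext[OF coef.add[OF st(1) coef_left[OF st(2), of "\<ominus> \<one>"]]])
      (use coef_closed[OF st(2)] in \<open>simp_all add: csa.l_minus\<close>)
qed

text \<open>Applied to the coefficients \<open>y \<mapsto> c\<^sub>i (x y)\<close>, the hypothesis says that \<open>x z\<close> and \<open>z x\<close> have the
  same left coordinates.\<close>

lemma center_criterion:
  assumes z: "z \<in> L" and s: "\<And>s. s \<in> coef R P \<Longrightarrow> s z = s \<one> \<otimes> z" shows "z \<in> K"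
proof -
  have zc: "z \<in> carrier R" using z subfieldE(3)[OF csa.center_subfield] by blast
  have "z \<odot>\<^bsub>P\<^esub> x = x \<odot>\<^sup>r\<^bsub>P\<^esub> z" if x: "x \<in> carrier P" for x
  proof (rule lbasis.ext[OF lbasis_axioms])
    fix i assume i: "i \<in> {..<d}"
    have "c i (x \<odot>\<^sup>r\<^bsub>P\<^esub> z) = c i (x \<odot>\<^sup>r\<^bsub>P\<^esub> \<one>) \<otimes> z" using s[OF coef_c[of i x]] i x by simp
    then show "c i (z \<odot>\<^bsub>P\<^esub> x) = c i (x \<odot>\<^sup>r\<^bsub>P\<^esub> z)" using L_comm[OF z, of "c i x"] i x zc by (simp add: rsmult_one c_smult)
  qed (use x zc in \<open>auto simp: rsmult_closed lsmult_closed\<close>)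
  then show ?thesis using zc by (simp add: bimodule_center_def)
qed

lemma finite_length_P: "finite_length (lops (carrier R)) P"
proof -
  have "finite_length (lops (carrier R)) B"
    by (rule finite_length_ops_mono[OF csa.regular_finite_length[OF csa.center_subfield dim]])
      (use subfieldE(3)[OF csa.center_subfield] in auto)
  then have fl: "finite_length (lops (carrier R)) (ipow B {..<d})"
    by (intro finite_length_ipow B.opmod_lops subset_refl finite_lessThan)
  have inj: "inj_on (\<lambda>x. \<lambda>i \<in> {..<d}. c i x) (carrier P)"
  proof (rule inj_onI)
    fix x y assume xy: "x \<in> carrier P" "y \<in> carrier P" "(\<lambda>i \<in> {..<d}. c i x) = (\<lambda>i \<in> {..<d}. c i y)"
    show "x = y" by (rule lbasis.ext[OF lbasis_axioms xy(1,2)]) (use fun_cong[OF xy(3)] in \<open>metis restrict_apply'\<close>)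
  qed
  have "mor (lops (carrier R)) P (ipow B {..<d}) (\<lambda>x. \<lambda>i \<in> {..<d}. c i x)"
    by (rule morI) (auto simp: c_add c_smult intro!: restrict_ext)
  from finite_length_inj[OF this inj opmod_lops opmod_ipow[OF B.opmod_lops] fl] show ?thesis by simp
qed

text \<open>As \<open>B\<close> has finite dimension over \<open>L\<close>, all coefficients come from elements of one left module
  of finite length. The elements whose coefficient vanishes on a set \<open>X\<close> form a submodule, and
  a finite \<open>X\<close> for which this submodule is as small as possible separates.\<close>

lemma finite_separating_set:
  "\<exists>X. finite X \<and> X \<subseteq> carrier R \<and>
    (\<forall>s \<in> coef R P. (\<forall>x \<in> X. s x = \<zero>) \<longrightarrow> (\<forall>y \<in> carrier R. s y = \<zero>))"
proof -
  note LE = subringE[OF subfieldE(1)[OF csa.center_subfield]]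
  have "sub B L ^\<^sub>d w \<simeq>\<^bsub>lops L\<^esub> sub B (carrier B)"
    using csa.dimension_iso[OF csa.center_subfield dim] by simp
  then have "ipow (sub B L) {..<w} \<simeq>\<^bsub>lops L\<^esub> B" by (simp only: sub_simps)
  from lbasis_of_iso[OF B.bimodule_axioms subfieldE(1)[OF csa.center_subfield] finite_lessThan this]
  obtain f l where fl: "lbasis R B L {..<w} f l" by blast
  interpret fl: lbasis R B L "{..<w}" f l by (rule fl)
  \<comment> \<open>every matrix coefficient is \<open>y \<mapsto> \<Xi> (p y)\<close> for the single functional \<open>\<Xi>\<close> on a power of \<open>P\<close>\<close>
  let ?M = "(P ^\<^sub>d w) ^\<^sub>d d"
  interpret Pw: bimodule R "P ^\<^sub>d w" by (rule bimodule_dpow[OF bimodule_axioms])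
  interpret MM: bimodule R ?M by (rule bimodule_dpow[OF Pw.bimodule_axioms])
  define \<Xi> where "\<Xi> p = (\<Oplus>k \<in> {..<d}. \<Oplus>j \<in> {..<w}. c k (p k j) \<otimes> f j)" for p
  have fc: "f j \<in> carrier R" if "j < w" for j using fl.e_closed[of j] that by simp
  have pc: "p k j \<in> carrier P" if "p \<in> carrier ?M" "k < d" "j < w" for p k j
    using that by (auto simp: PiE_iff)
  have in_c: "(\<Oplus>j \<in> {..<w}. c k (p k j) \<otimes> f j) \<in> carrier R" if "p \<in> carrier ?M" "k < d" for p k
    using that by (intro csa.finsum_closed Pi_I) (simp add: pc fc del: ipow_simps)
  have \<Xi>: "mor (lops (carrier R)) ?M B \<Xi>"
  proof (rule morI, goal_cases)
    case (1 p)
    then show ?case unfolding \<Xi>_def regular_simps by (intro csa.finsum_closed Pi_I in_c) simp_all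
  next
    case (2 p p')
    have "\<Xi> (p \<oplus>\<^bsub>?M\<^esub> p') = (\<Oplus>k \<in> {..<d}. (\<Oplus>j \<in> {..<w}. c k (p k j) \<otimes> f j) \<oplus> (\<Oplus>j \<in> {..<w}. c k (p' k j) \<otimes> f j))"
      unfolding \<Xi>_def
    proof (rule csa.finsum_cong'[OF refl])
      fix k assume k: "k \<in> {..<d}"
      have "(\<Oplus>j \<in> {..<w}. c k ((p \<oplus>\<^bsub>?M\<^esub> p') k j) \<otimes> f j) =
          (\<Oplus>j \<in> {..<w}. c k (p k j) \<otimes> f j \<oplus> c k (p' k j) \<otimes> f j)"
        using k pc[OF 2(1)] pc[OF 2(2)] fc by (intro csa.finsum_cong') (auto simp: c_add csa.l_distr)
      then show "(\<Oplus>j \<in> {..<w}. c k ((p \<oplus>\<^bsub>?M\<^esub> p') k j) \<otimes> f j) =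
          (\<Oplus>j \<in> {..<w}. c k (p k j) \<otimes> f j) \<oplus> (\<Oplus>j \<in> {..<w}. c k (p' k j) \<otimes> f j)"
        using k pc[OF 2(1)] pc[OF 2(2)] fc by (simp add: csa.finsum_addf Pi_iff)
    qed (use in_c[OF 2(1)] in_c[OF 2(2)] in simp)
    then show ?case unfolding \<Xi>_def using in_c[OF 2(1)] in_c[OF 2(2)] by (simp add: csa.finsum_addf Pi_iff)
  next
    case (3 s p)
    then obtain a where a: "s = Inl a" "a \<in> carrier R" by auto
    have "\<Xi> (a \<odot>\<^bsub>?M\<^esub> p) = (\<Oplus>k \<in> {..<d}. a \<otimes> (\<Oplus>j \<in> {..<w}. c k (p k j) \<otimes> f j))"
      unfolding \<Xi>_def
    proof (rule csa.finsum_cong'[OF refl])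
      fix k assume k: "k \<in> {..<d}"
      have "(\<Oplus>j \<in> {..<w}. c k ((a \<odot>\<^bsub>?M\<^esub> p) k j) \<otimes> f j) = (\<Oplus>j \<in> {..<w}. a \<otimes> (c k (p k j) \<otimes> f j))"
        using k pc[OF 3(2)] fc a by (intro csa.finsum_cong') (auto simp: c_smult csa.m_assoc)
      then show "(\<Oplus>j \<in> {..<w}. c k ((a \<odot>\<^bsub>?M\<^esub> p) k j) \<otimes> f j) = a \<otimes> (\<Oplus>j \<in> {..<w}. c k (p k j) \<otimes> f j)"
        using k pc[OF 3(2)] fc a by (simp add: csa.finsum_rdistr Pi_iff)
    qed (use in_c[OF 3(2)] a in simp)
    then show ?case unfolding \<Xi>_def using a in_c[OF 3(2)] by (simp add: csa.finsum_rdistr Pi_iff)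
  qed
  have surj: "\<exists>p \<in> carrier ?M. \<forall>y \<in> carrier R. s y = \<Xi> (p \<odot>\<^sup>r\<^bsub>?M\<^esub> y)" if "s \<in> coef R P" for s
    using that
  proof (induction rule: coef.induct)
    case (basic \<xi> p)
    define p' where "p' = (\<lambda>k \<in> {..<d}. \<lambda>j \<in> {..<w}. l j (\<xi> (e k)) \<odot>\<^bsub>P\<^esub> p)"
    have \<xi>e: "\<xi> (e k) \<in> carrier R" if "k < d" for k using mor_closed[OF basic(1) e_closed, of k] that by simp
    have lL: "l j (\<xi> (e k)) \<in> L" if "k < d" "j < w" for k j using fl.c_in[of j "\<xi> (e k)"] that \<xi>e by simp
    have lc: "l j (\<xi> (e k)) \<in> carrier R" if "k < d" "j < w" for k j using lL[OF that] LE(1) by blast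
    have "p' \<in> carrier ?M" unfolding p'_def using lc basic(2) by (auto simp: lsmult_closed)
    moreover have "\<xi> (p \<odot>\<^sup>r\<^bsub>P\<^esub> y) = \<Xi> (p' \<odot>\<^sup>r\<^bsub>?M\<^esub> y)" if y: "y \<in> carrier R" for y
    proof -
      define x where "x = p \<odot>\<^sup>r\<^bsub>P\<^esub> y"
      have x: "x \<in> carrier P" using basic(2) y by (simp add: x_def rsmult_closed)
      have "\<xi> x = \<xi> (finsum P (\<lambda>k. c k x \<odot>\<^bsub>P\<^esub> e k) {..<d})" using expand[OF x] by simp
      also have "\<dots> = finsum R (\<lambda>k. \<xi> (c k x \<odot>\<^bsub>P\<^esub> e k)) {..<d}"
        using mor_finsum[OF basic(1) M.abelian_group_axioms abelian_regular, of "\<lambda>k. c k x \<odot>\<^bsub>P\<^esub> e k" "{..<d}"] x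
        by (simp add: Pi_iff lsmult_closed)
      also have "\<dots> = \<Xi> (p' \<odot>\<^sup>r\<^bsub>?M\<^esub> y)"
        unfolding \<Xi>_def
      proof (rule csa.finsum_cong'[OF refl])
        fix k assume k: "k \<in> {..<d}"
        have "\<xi> (c k x \<odot>\<^bsub>P\<^esub> e k) = c k x \<otimes> \<xi> (e k)"
          using mor_act[OF basic(1), of "e k" "Inl (c k x)"] k x by simp
        also have "\<dots> = c k x \<otimes> (\<Oplus>j \<in> {..<w}. l j (\<xi> (e k)) \<otimes> f j)"
          using fl.expand[of "\<xi> (e k)"] \<xi>e k by simp
        also have "\<dots> = (\<Oplus>j \<in> {..<w}. c k x \<otimes> (l j (\<xi> (e k)) \<otimes> f j))"
          using k x lc fc by (intro csa.finsum_rdistr) auto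
        also have "\<dots> = (\<Oplus>j \<in> {..<w}. c k ((p' \<odot>\<^sup>r\<^bsub>?M\<^esub> y) k j) \<otimes> f j)"
        proof (rule csa.finsum_cong'[OF refl])
          fix j assume j: "j \<in> {..<w}"
          have "(p' \<odot>\<^sup>r\<^bsub>?M\<^esub> y) k j = l j (\<xi> (e k)) \<odot>\<^bsub>P\<^esub> x"
            using j k y basic(2) lc by (simp add: p'_def x_def lsmult_rsmult)
          then have "c k ((p' \<odot>\<^sup>r\<^bsub>?M\<^esub> y) k j) = c k x \<otimes> l j (\<xi> (e k))"
            using j k x lc L_comm[OF lL, of k j "c k x"] by (simp add: c_smult)
          then show "c k x \<otimes> (l j (\<xi> (e k)) \<otimes> f j) = c k ((p' \<odot>\<^sup>r\<^bsub>?M\<^esub> y) k j) \<otimes> f j"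
            using j k x lc fc by (simp add: csa.m_assoc)
        qed (use k y \<open>p' \<in> carrier ?M\<close> fc MM.rsmult_closed[of y p'] in \<open>auto intro!: csa.m_closed c_closed pc simp del: ipow_smult_simps\<close>)
        finally show "\<xi> (c k x \<odot>\<^bsub>P\<^esub> e k) = (\<Oplus>j \<in> {..<w}. c k ((p' \<odot>\<^sup>r\<^bsub>?M\<^esub> y) k j) \<otimes> f j)" .
      qed (use y \<open>p' \<in> carrier ?M\<close> MM.rsmult_closed[of y p'] in \<open>auto intro!: in_c simp del: ipow_smult_simps\<close>)
      finally show ?thesis by (simp only: x_def)
    qed
    ultimately show ?case by blast
  next
    case (add s t)
    then obtain p p' where p: "p \<in> carrier ?M" "\<forall>y \<in> carrier R. s y = \<Xi> (p \<odot>\<^sup>r\<^bsub>?M\<^esub> y)"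
      and p': "p' \<in> carrier ?M" "\<forall>y \<in> carrier R. t y = \<Xi> (p' \<odot>\<^sup>r\<^bsub>?M\<^esub> y)" by blast
    show ?case
    proof (rule bexI[of _ "p \<oplus>\<^bsub>?M\<^esub> p'"], rule ballI)
      fix y assume y: "y \<in> carrier R"
      show "s y \<oplus> t y = \<Xi> ((p \<oplus>\<^bsub>?M\<^esub> p') \<odot>\<^sup>r\<^bsub>?M\<^esub> y)"
        unfolding MM.rsmult_distr[OF y p(1) p'(1)]
        using mor_add[OF \<Xi> MM.rsmult_closed[OF y p(1)] MM.rsmult_closed[OF y p'(1)]] p(2) p'(2) y
        by (simp only: regular_simps)
    qed (rule MM.M.add.m_closed[OF p(1) p'(1)])
  next
    case (ext s t)
    then show ?case by auto
  qed
  obtain \<phi> :: "(nat \<Rightarrow> nat \<Rightarrow> 'b) set \<Rightarrow> nat" where \<phi>: "\<And>U V. submod (lops (carrier R)) ?M U \<Longrightarrow>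
      submod (lops (carrier R)) ?M V \<Longrightarrow> U \<subset> V \<Longrightarrow> \<phi> U < \<phi> V"
  proof -
    have "finite_length (lops (carrier R)) ?M"
      by (intro finite_length_ipow opmod_ipow opmod_lops finite_length_P subset_refl finite_lessThan)
    then show thesis by (rule finite_lengthE) (erule that)
  qed
  define N where "N X = {p \<in> carrier ?M. \<forall>x \<in> X. \<Xi> (p \<odot>\<^sup>r\<^bsub>?M\<^esub> x) = \<zero>}" for X
  have Ml: "opmod (lops (carrier R)) ?M" and Bl: "opmod (lops (carrier R)) B"
    by (rule MM.opmod_lops[OF subset_refl], rule B.opmod_lops[OF subset_refl])
  have N1: "submod (lops (carrier R)) ?M (N X)" if "X \<subseteq> carrier R" for X
  proof -
    have "submod (lops (carrier R)) ?M {p \<in> carrier ?M. \<Xi> (p \<odot>\<^sup>r\<^bsub>?M\<^esub> x) = \<zero>}" if "x \<in> carrier R" for x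
      using submod_ker[OF mor_comp[OF MM.mor_act_right[OF that] \<Xi>] Ml Bl] by (simp only: regular_simps)
    moreover have "submod (lops (carrier R)) ?M (carrier ?M)" by (rule submod_carrier[OF Ml])
    ultimately show ?thesis using that unfolding N_def submod_def by (simp add: subset_iff del: ipow_simps ipow_smult_simps act_simps)
  qed
  obtain X where X: "finite X" "X \<subseteq> carrier R" "\<And>Y. finite Y \<Longrightarrow> Y \<subseteq> carrier R \<Longrightarrow> \<phi> (N X) \<le> \<phi> (N Y)"
    using ex_has_least_nat[of "\<lambda>X. finite X \<and> X \<subseteq> carrier R" "{}" "\<lambda>X. \<phi> (N X)"] by auto
  have "s y = \<zero>" if s: "s \<in> coef R P" "\<forall>x \<in> X. s x = \<zero>" and y: "y \<in> carrier R" for s y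
  proof -
    obtain p where p: "p \<in> carrier ?M" "\<And>y. y \<in> carrier R \<Longrightarrow> s y = \<Xi> (p \<odot>\<^sup>r\<^bsub>?M\<^esub> y)" using surj[OF s(1)] by blast
    have "N (insert y X) \<subseteq> N X" unfolding N_def by blast
    moreover have "\<not> N (insert y X) \<subset> N X"
      using \<phi>[OF N1 N1, of "insert y X" X] X(3)[of "insert y X"] X(1,2) y by auto
    ultimately have NX: "N (insert y X) = N X" by blast
    have "p \<in> N X"
      unfolding N_def by (intro CollectI conjI ballI p(1)) (metis p(2) s(2) X(2) subsetD)
    then have "p \<in> N (insert y X)" unfolding NX .
    then have "\<Xi> (p \<odot>\<^sup>r\<^bsub>?M\<^esub> y) = \<zero>" unfolding N_def by blast
    then show ?thesis unfolding p(2)[OF y] .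
  qed
  then show ?thesis using X(1,2) by blast
qed

text \<open>A separating set of least size is a basis over the center. Given \<open>x\<close> in it, the values at \<open>x\<close>
  of the coefficients that vanish on the rest form a nonzero two-sided ideal, which contains \<open>1\<close>;
  the resulting dual functions have central values because two coefficients that agree on the
  basis are equal.\<close>

lemma exists_dual_basis:
  obtains X s where "lbasis R B K X (\<lambda>x. x) s" "\<And>x. x \<in> X \<Longrightarrow> s x \<in> coef R P"
proof -
  define sep where "sep X \<longleftrightarrow> finite X \<and> X \<subseteq> carrier R \<and>
    (\<forall>s \<in> coef R P. (\<forall>x \<in> X. s x = \<zero>) \<longrightarrow> (\<forall>y \<in> carrier R. s y = \<zero>))" for X
  obtain X0 where "sep X0" using finite_separating_set unfolding sep_def by blast
  from ex_has_least_nat[of sep, OF this, of card]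
  obtain X where X: "sep X" "\<And>Y. sep Y \<Longrightarrow> card X \<le> card Y" by blast
  have Xf: "finite X" and Xc: "\<And>x. x \<in> X \<Longrightarrow> x \<in> carrier R"
    and Xs: "\<And>s y. s \<in> coef R P \<Longrightarrow> (\<And>x. x \<in> X \<Longrightarrow> s x = \<zero>) \<Longrightarrow> y \<in> carrier R \<Longrightarrow> s y = \<zero>"
    using X(1) unfolding sep_def by blast+
  have "\<exists>s \<in> coef R P. \<forall>x' \<in> X. s x' = (if x = x' then \<one> else \<zero>)" if x: "x \<in> X" for x
  proof -
    define J where "J = {s x | s. s \<in> coef R P \<and> (\<forall>x' \<in> X - {x}. s x' = \<zero>)}"
    have "\<not> sep (X - {x})" using X(2)[of "X - {x}"] x Xf by (metis card_Diff1_less leD)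
    then obtain s y where s: "s \<in> coef R P" "\<And>x'. x' \<in> X - {x} \<Longrightarrow> s x' = \<zero>" "y \<in> carrier R" "s y \<noteq> \<zero>"
      using X(1) unfolding sep_def by blast
    have "s x \<noteq> \<zero>" using Xs[OF s(1) _ s(3)] s(2,4) x by (metis insertE insert_Diff)
    moreover have "s x \<in> J" unfolding J_def using s(1,2) by blast
    moreover have "J \<subseteq> carrier R" unfolding J_def using coef_closed Xc[OF x] by blast
    moreover have "a \<oplus> b \<in> J" if ab: "a \<in> J" "b \<in> J" for a b
    proof -
      obtain t u where "t \<in> coef R P" "\<forall>x' \<in> X - {x}. t x' = \<zero>" "a = t x"
        "u \<in> coef R P" "\<forall>x' \<in> X - {x}. u x' = \<zero>" "b = u x" using ab unfolding J_def by blast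
      then show ?thesis unfolding J_def
        using coef.add[of t R P u] by (intro CollectI exI[of _ "\<lambda>y. t y \<oplus> u y"]) simp
    qed
    moreover have "a \<otimes> b \<in> J" "b \<otimes> a \<in> J" if a: "a \<in> carrier R" and b: "b \<in> J" for a b
    proof -
      obtain t where t: "t \<in> coef R P" "\<forall>x' \<in> X - {x}. t x' = \<zero>" "b = t x" using b unfolding J_def by blast
      show "a \<otimes> b \<in> J" unfolding J_def
        using coef_left[OF t(1) a] t a by (intro CollectI exI[of _ "\<lambda>y. a \<otimes> t y"]) simp
      show "b \<otimes> a \<in> J" unfolding J_def
        using coef_right[OF t(1) a] t a by (intro CollectI exI[of _ "\<lambda>y. t y \<otimes> a"]) simp
    qed
    ultimately have "J = carrier R" by (intro csa.two_sided_full)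
    then have "\<one> \<in> J" by simp
    then obtain t where "t \<in> coef R P" "\<forall>x' \<in> X - {x}. t x' = \<zero>" "t x = \<one>" unfolding J_def by force
    then show ?thesis by (intro bexI[of _ t]) auto
  qed
  then obtain s where s: "\<And>x. x \<in> X \<Longrightarrow> s x \<in> coef R P"
    and s_dual: "\<And>x x'. x \<in> X \<Longrightarrow> x' \<in> X \<Longrightarrow> s x x' = (if x = x' then \<one> else \<zero>)"
    by metis
  have sc: "s x y \<in> carrier R" if "x \<in> X" "y \<in> carrier R" for x y using coef_closed[OF s] that by blast
  have eq: "t y = u y" if "t \<in> coef R P" "u \<in> coef R P" "\<And>x. x \<in> X \<Longrightarrow> t x = u x" "y \<in> carrier R" for t u y
  proof -
    have "t y \<oplus> \<ominus> u y = \<zero>"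
      by (rule Xs[OF coef_diff[OF that(1,2)] _ that(4)])
        (use that(3) coef_closed[OF that(2) Xc] in \<open>simp add: csa.r_neg\<close>)
    then show ?thesis
      using coef_closed[OF that(1,4)] coef_closed[OF that(2,4)] csa.add.inv_solve_right'[of \<zero> "t y" "u y"] by simp
  qed
  have sL: "s x y \<in> L" if x: "x \<in> X" and y: "y \<in> carrier R" for x y
  proof -
    have "s x y \<otimes> b = b \<otimes> s x y" if b: "b \<in> carrier R" for b
      by (rule eq[OF coef_right[OF s[OF x] b] coef_left[OF s[OF x] b] _ y]) (use s_dual[OF x] b in simp)
    then show ?thesis using csa.center_eq sc[OF x y] by (auto simp: ring_center_def)
  qed
  have sK: "s x y \<in> K" if x: "x \<in> X" and y: "y \<in> carrier R" for x y
  proof (rule center_criterion[OF sL[OF x y]])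
    fix t assume t: "t \<in> coef R P"
    have t1: "t \<one> \<in> carrier R" using coef_closed[OF t] by simp
    have t0: "t \<zero> = \<zero>" using mor_zero[OF coef_mor[OF t] abelian_regular abelian_regular] by simp
    show "t (s x y) = t \<one> \<otimes> s x y"
      by (rule eq[OF coef_P_comp[OF t s[OF x]] coef_left[OF s[OF x] t1] _ y]) (use s_dual[OF x] t1 t0 in simp)
  qed
  have exp: "finsum R (\<lambda>x. s x y \<otimes> x) X = y" if y: "y \<in> carrier R" for y
  proof -
    let ?y = "finsum R (\<lambda>x. s x y \<otimes> x) X"
    have yc: "?y \<in> carrier R" using sc Xc y by auto
    have ty: "t ?y = t y" if t: "t \<in> coef R P" for t
    proof -
      have tX: "t x \<in> carrier R" if "x \<in> X" for x using coef_closed[OF t Xc[OF that]] .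
      have "t ?y = finsum R (\<lambda>x. t (s x y \<otimes> x)) X"
        using mor_finsum[OF coef_mor[OF t] abelian_regular abelian_regular, of "\<lambda>x. s x y \<otimes> x" X] sc Xc y
        by (simp add: Pi_iff)
      also have "\<dots> = finsum R (\<lambda>x. s x y \<otimes> t x) X"
        using coef_center_linear[OF t sK Xc] sc tX y by (intro csa.finsum_cong') auto
      also have "\<dots> = t y"
      proof (rule eq[OF coef_finsum[OF coef_right[OF s tX] Xf] t _ y])
        fix x' assume x': "x' \<in> X"
        have "finsum R (\<lambda>x. s x x' \<otimes> t x) X = finsum R (\<lambda>x. if x' = x then t x else \<zero>) X"
          using s_dual x' tX by (intro csa.finsum_cong') auto
        also have "\<dots> = t x'" by (rule csa.finsum_singleton[OF x' Xf]) (use tX in auto)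
        finally show "finsum R (\<lambda>x. s x x' \<otimes> t x) X = t x'" .
      qed
      finally show ?thesis .
    qed
    have "?y \<oplus> \<ominus> y = \<zero>"
    proof (rule coef_separates)
      fix t assume t: "t \<in> coef R P"
      have "t (?y \<oplus> \<ominus> y) = t ?y \<oplus> \<ominus> t y"
        using coef_additive[OF t yc, of "\<ominus> y"] mor_neg[OF coef_mor[OF t] abelian_regular abelian_regular, of y] y by simp
      then show "t (?y \<oplus> \<ominus> y) = \<zero>" using ty[OF t] coef_closed[OF t y] by (simp add: csa.r_neg)
    qed (use yc y in simp)
    then show ?thesis using csa.add.inv_solve_right'[of \<zero> ?y y] yc y by simp
  qed
  show thesis
  proof (rule that[of X s])
    show "lbasis R B K X (\<lambda>x. x) s"
    proof (intro lbasis.intro lbasis_axioms.intro B.bimodule_axioms, goal_cases)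
      case 1 show ?case using center_closed by blast
    next
      case 2 show ?case by (rule Xf)
    next
      case (3 x) then show ?case using Xc by simp
    next
      case (4 x y) then show ?case using sK by simp
    next
      case (5 x y y') then show ?case using coef_additive[OF s] by simp
    next
      case (6 x z y) then show ?case using coef_center_linear[OF s] by simp
    next
      case (7 x x') then show ?case by (rule s_dual)
    next
      case (8 y) then show ?case using exp by simp
    qed
  qed (rule s)
qed

end

section \<open>Summands of the tensor square of the algebra\<close>

lemma (in abelian_group) finsum_swap:
  assumes "finite I" "finite J" "\<And>i j. i \<in> I \<Longrightarrow> j \<in> J \<Longrightarrow> f i j \<in> carrier G"
  shows "(\<Oplus>i \<in> I. \<Oplus>j \<in> J. f i j) = (\<Oplus>j \<in> J. \<Oplus>i \<in> I. f i j)"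
  using assms(1,3)
proof (induction I)
  case empty
  then show ?case by simp
next
  case (insert i I)
  have "(\<Oplus>i \<in> insert i I. \<Oplus>j \<in> J. f i j) = (\<Oplus>j \<in> J. f i j) \<oplus> (\<Oplus>i \<in> I. \<Oplus>j \<in> J. f i j)"
    using insert by (intro finsum_insert) (auto intro!: finsum_closed)
  also have "\<dots> = (\<Oplus>j \<in> J. f i j) \<oplus> (\<Oplus>j \<in> J. \<Oplus>i \<in> I. f i j)" using insert by simp
  also have "\<dots> = (\<Oplus>j \<in> J. f i j \<oplus> (\<Oplus>i \<in> I. f i j))"
    using insert.prems by (intro finsum_addf[symmetric]) (auto intro!: finsum_closed)
  also have "\<dots> = (\<Oplus>j \<in> J. \<Oplus>i \<in> insert i I. f i j)"
    using insert by (intro finsum_cong') (auto intro!: finsum_closed finsum_insert[symmetric])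
  finally show ?case .
qed

lemma mor_cong:
  assumes M: "opmod \<Omega> M" and f: "mor \<Omega> M N f" and eq: "\<And>x. x \<in> carrier M \<Longrightarrow> g x = f x"
  shows "mor \<Omega> M N g"
proof -
  interpret M: opmod \<Omega> M by fact
  show ?thesis using f by (auto simp: mor_def eq Pi_iff)
qed

lemma mor_finsum_fun:
  assumes M: "opmod \<Omega> M" and N: "opmod \<Omega> N" and f: "\<And>i. i \<in> I \<Longrightarrow> mor \<Omega> M N (f i)" and I: "finite I"
  shows "mor \<Omega> M N (\<lambda>x. \<Oplus>\<^bsub>N\<^esub>i \<in> I. f i x)"
  using I f
proof induction
  case empty
  interpret N: opmod \<Omega> N by fact
  show ?case using mor_const_zero[OF N] by simp
next
  case (insert i I)
  interpret N: opmod \<Omega> N by fact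
  have i: "mor \<Omega> M N (f i)" and J: "\<And>j. j \<in> I \<Longrightarrow> mor \<Omega> M N (f j)" using insert.prems by auto
  show ?case
  proof (rule mor_cong[OF M mor_plus[OF N i insert.IH[OF J]]])
    fix x assume x: "x \<in> carrier M"
    show "(\<Oplus>\<^bsub>N\<^esub>i \<in> insert i I. f i x) = f i x \<oplus>\<^bsub>N\<^esub> (\<Oplus>\<^bsub>N\<^esub>i \<in> I. f i x)"
      using insert.hyps mor_closed[OF i x] mor_closed[OF J x] by (intro N.finsum_insert) auto
  qed
qed

text \<open>Up to isomorphism a simple Artinian ring has a single simple right module, which is both a quotient of
  \<open>M\<close> and a right ideal. Concretely, let \<open>U\<close> be a maximal submodule of \<open>M\<close> and \<open>I\<close> a
  minimal right ideal. By simplicity \<open>M I\<close> is not contained in \<open>U\<close>, so \<open>y I\<close> is not for some \<open>y\<close>, and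
  \<open>M\<close> is the direct sum of \<open>U\<close> and \<open>y I \<cong> I\<close>.\<close>

lemma (in simple_ring) exists_right_linear:
  fixes M :: "('a, 'c) bimodule"
  assumes M: "opmod (rops (carrier R)) M" and Ml: "finite_length (rops (carrier R)) M"
    and Rl: "finite_length (rops (carrier R)) (regular_bimodule R)"
    and assoc: "\<And>x a b. x \<in> carrier M \<Longrightarrow> a \<in> carrier R \<Longrightarrow> b \<in> carrier R \<Longrightarrow>
      x \<odot>\<^sup>r\<^bsub>M\<^esub> (a \<otimes> b) = (x \<odot>\<^sup>r\<^bsub>M\<^esub> a) \<odot>\<^sup>r\<^bsub>M\<^esub> b"
    and distr: "\<And>x a b. x \<in> carrier M \<Longrightarrow> a \<in> carrier R \<Longrightarrow> b \<in> carrier R \<Longrightarrow>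
      x \<odot>\<^sup>r\<^bsub>M\<^esub> (a \<oplus> b) = x \<odot>\<^sup>r\<^bsub>M\<^esub> a \<oplus>\<^bsub>M\<^esub> x \<odot>\<^sup>r\<^bsub>M\<^esub> b"
    and one: "\<And>x. x \<in> carrier M \<Longrightarrow> x \<odot>\<^sup>r\<^bsub>M\<^esub> \<one> = x"
    and nz: "carrier M \<noteq> {\<zero>\<^bsub>M\<^esub>}"
  shows "\<exists>\<tau>. mor (rops (carrier R)) M (regular_bimodule R) \<tau> \<and> (\<exists>x \<in> carrier M. \<tau> x \<noteq> \<zero>)"
proof -
  let ?B = "regular_bimodule R" and ?\<Omega> = "rops (carrier R)"
  interpret M: opmod ?\<Omega> M by fact
  interpret B: bimodule R ?B by (rule bimodule_regular)
  have Bm: "opmod ?\<Omega> ?B" by (rule B.opmod_rops) simp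
  obtain \<phi> :: "'c set \<Rightarrow> nat" where \<phi>: "\<And>U V. submod ?\<Omega> M U \<Longrightarrow> submod ?\<Omega> M V \<Longrightarrow> U \<subset> V \<Longrightarrow> \<phi> U < \<phi> V"
    by (rule finite_lengthE[OF Ml]) (erule that)
  obtain \<psi> :: "'a set \<Rightarrow> nat" where \<psi>: "\<And>U V. submod ?\<Omega> ?B U \<Longrightarrow> submod ?\<Omega> ?B V \<Longrightarrow> U \<subset> V \<Longrightarrow> \<psi> U < \<psi> V"
    by (rule finite_lengthE[OF Rl]) (erule that)
  \<comment> \<open>a maximal submodule \<open>U\<close> of \<open>M\<close> and a minimal right ideal \<open>I\<close>\<close>
  have zero: "submod ?\<Omega> M {\<zero>\<^bsub>M\<^esub>} \<and> {\<zero>\<^bsub>M\<^esub>} \<noteq> carrier M" using submod_zero[OF M] nz by auto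
  have "\<phi> U < Suc (\<phi> (carrier M))" if "submod ?\<Omega> M U \<and> U \<noteq> carrier M" for U
  proof -
    have "U \<subset> carrier M" using that by (auto simp: submod_def)
    then show ?thesis using \<phi>[OF _ submod_carrier[OF M], of U] that by simp
  qed
  then have "\<forall>U. submod ?\<Omega> M U \<and> U \<noteq> carrier M \<longrightarrow> \<phi> U < Suc (\<phi> (carrier M))" by blast
  from ex_has_greatest_nat[of "\<lambda>U. submod ?\<Omega> M U \<and> U \<noteq> carrier M", OF zero this]
  obtain U where U: "submod ?\<Omega> M U" "U \<noteq> carrier M"
    and U_max: "\<And>V. submod ?\<Omega> M V \<Longrightarrow> V \<noteq> carrier M \<Longrightarrow> \<phi> V \<le> \<phi> U"
    by blast
  have "submod ?\<Omega> ?B (carrier ?B) \<and> carrier ?B \<noteq> {\<zero>}"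
    using submod_carrier[OF Bm] one_not_zero by force
  from ex_has_least_nat[of "\<lambda>I. submod ?\<Omega> ?B I \<and> I \<noteq> {\<zero>}", OF this, of \<psi>]
  obtain I where I: "submod ?\<Omega> ?B I" "I \<noteq> {\<zero>}"
    and I_min: "\<And>V. submod ?\<Omega> ?B V \<Longrightarrow> V \<noteq> {\<zero>} \<Longrightarrow> \<psi> I \<le> \<psi> V" by blast
  have Ic: "a \<in> carrier R" if "a \<in> I" for a using submodD(1)[OF I(1) that] by simp
  have act: "x \<odot>\<^sup>r\<^bsub>M\<^esub> a \<in> carrier M" if "x \<in> carrier M" "a \<in> carrier R" for x a
    using M.act_closed[of "Inr a" x] that by simp
  have Uact: "x \<odot>\<^sup>r\<^bsub>M\<^esub> a \<in> U" if "x \<in> U" "a \<in> carrier R" for x a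
    using submodD(5)[OF U(1) _ that(1), of "Inr a"] that(2) by simp
  define J where "J = {b \<in> carrier R. \<forall>y \<in> carrier M. y \<odot>\<^sup>r\<^bsub>M\<^esub> b \<in> U}"
  have "\<not> I \<subseteq> J"
  proof
    assume IJ: "I \<subseteq> J"
    obtain x where x: "x \<in> I" "x \<noteq> \<zero>" using I submodD(2)[OF I(1)] by auto
    have "J = carrier R"
    proof (rule two_sided_full[of J x])
      show "a \<oplus> b \<in> J" if "a \<in> J" "b \<in> J" for a b
        using that submodD(3)[OF U(1)] by (auto simp: J_def distr)
      show "a \<otimes> b \<in> J" "b \<otimes> a \<in> J" if "a \<in> carrier R" "b \<in> J" for a b
        using that act Uact by (auto simp: J_def assoc)
    qed (use x IJ in \<open>auto simp: J_def\<close>)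
    then have "\<one> \<in> J" by simp
    then have "carrier M \<subseteq> U" using one by (force simp: J_def)
    then show False using U by (auto simp: submod_def)
  qed
  then obtain a y where ay: "a \<in> I" "y \<in> carrier M" "y \<odot>\<^sup>r\<^bsub>M\<^esub> a \<notin> U" using Ic by (auto simp: J_def)
  have sy: "mor ?\<Omega> ?B M (\<lambda>b. y \<odot>\<^sup>r\<^bsub>M\<^esub> b)" by (rule morI) (use ay act in \<open>auto simp: distr assoc\<close>)
  have I0: "b = \<zero>" if b: "b \<in> I" "y \<odot>\<^sup>r\<^bsub>M\<^esub> b \<in> U" for b
  proof (rule ccontr)
    assume "b \<noteq> \<zero>"
    let ?I = "I \<inter> {b \<in> carrier ?B. y \<odot>\<^sup>r\<^bsub>M\<^esub> b \<in> U}"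
    have s: "submod ?\<Omega> ?B ?I" by (rule submod_Int[OF I(1) submod_vimage[OF sy Bm M U(1)]])
    have "?I \<subset> I" using ay by auto
    then have "\<psi> ?I < \<psi> I" by (rule \<psi>[OF s I(1)])
    moreover have "b \<in> ?I" using b Ic by simp
    moreover from this have "?I \<noteq> {\<zero>}" using \<open>b \<noteq> \<zero>\<close> by blast
    ultimately show False using I_min[OF s] by simp
  qed
  let ?S = "sub M U \<oplus>\<^sub>d sub ?B I"
  have S: "opmod ?\<Omega> ?S" by (intro opmod_dsum opmod_sub M Bm U(1) I(1))
  let ?h = "\<lambda>p. fst p \<oplus>\<^bsub>M\<^esub> y \<odot>\<^sup>r\<^bsub>M\<^esub> snd p"
  have Ud: "x \<in> carrier M" if "x \<in> U" for x using submodD(1)[OF U(1) that] .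
  have h: "mor ?\<Omega> ?S M ?h"
  proof -
    have "mor ?\<Omega> ?S M fst" "mor ?\<Omega> ?S ?B snd" by (rule morI; use Ud Ic in auto)+
    from mor_plus[OF M this(1) mor_comp[OF this(2) sy]] show ?thesis .
  qed
  let ?V = "?h ` carrier ?S"
  have V: "submod ?\<Omega> M ?V" by (rule submod_image[OF h S M submod_carrier[OF S]])
  have UV: "U \<subset> ?V"
  proof
    have z: "y \<odot>\<^sup>r\<^bsub>M\<^esub> \<zero> = \<zero>\<^bsub>M\<^esub>" using mor_zero[OF sy B.abelian_regular M.abelian_group_axioms] by simp
    show "U \<subseteq> ?V"
    proof
      fix x assume x: "x \<in> U"
      show "x \<in> ?V"
      proof (rule image_eqI)
        show "x = ?h (x, \<zero>)" using z Ud[OF x] by simp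
        show "(x, \<zero>) \<in> carrier ?S" using x submodD(2)[OF I(1)] by simp
      qed
    qed
    have "y \<odot>\<^sup>r\<^bsub>M\<^esub> a \<in> ?V"
    proof (rule image_eqI)
      show "y \<odot>\<^sup>r\<^bsub>M\<^esub> a = ?h (\<zero>\<^bsub>M\<^esub>, a)" using act[OF ay(2) Ic[OF ay(1)]] by simp
      show "(\<zero>\<^bsub>M\<^esub>, a) \<in> carrier ?S" using ay submodD(2)[OF U(1)] by simp
    qed
    then show "U \<noteq> ?V" using ay(3) by blast
  qed
  have VM: "?V = carrier M" using U_max[OF V] \<phi>[OF U(1) V UV] by (meson leD)
  have bij: "bij_betw ?h (carrier ?S) (carrier M)"
  proof (rule mor_bijI[OF h opmod_ab[OF S] M.abelian_group_axioms])
    fix p assume "p \<in> carrier ?S" "?h p = \<zero>\<^bsub>M\<^esub>"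
    then obtain u b where ub: "p = (u, b)" "u \<in> U" "b \<in> I" "u \<oplus>\<^bsub>M\<^esub> y \<odot>\<^sup>r\<^bsub>M\<^esub> b = \<zero>\<^bsub>M\<^esub>" by auto
    have yb: "y \<odot>\<^sup>r\<^bsub>M\<^esub> b \<in> carrier M" using act ay(2) Ic ub(3) by blast
    have "y \<odot>\<^sup>r\<^bsub>M\<^esub> b = \<ominus>\<^bsub>M\<^esub> u"
      using M.minus_equality[of "y \<odot>\<^sup>r\<^bsub>M\<^esub> b" u] ub(4) yb Ud[OF ub(2)] by (simp add: M.a_comm)
    then have "b = \<zero>" using I0[OF ub(3)] submodD(4)[OF U(1) ub(2)] by simp
    then show "p = \<zero>\<^bsub>?S\<^esub>"
      using ub Ud mor_zero[OF sy B.abelian_regular M.abelian_group_axioms] by simp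
  next
    fix x assume "x \<in> carrier M"
    then show "\<exists>p \<in> carrier ?S. ?h p = x" unfolding VM[symmetric] by blast
  qed
  obtain g where g: "mor ?\<Omega> M ?S g" "\<And>p. p \<in> carrier ?S \<Longrightarrow> g (?h p) = p"
    using mor_inv[OF h bij S] by metis
  have snd: "mor ?\<Omega> ?S ?B snd" by (rule morI) (use Ic in auto)
  have "snd (g (y \<odot>\<^sup>r\<^bsub>M\<^esub> a)) = a"
    using g(2)[of "(\<zero>\<^bsub>M\<^esub>, a)"] ay act[OF ay(2) Ic[OF ay(1)]] submodD(2)[OF U(1)] by simp
  moreover have "a \<noteq> \<zero>"
    using ay submodD(2)[OF U(1)] mor_zero[OF sy B.abelian_regular M.abelian_group_axioms] by auto
  ultimately show ?thesis
    using mor_comp[OF g(1) snd] act[OF ay(2) Ic[OF ay(1)]] by (intro exI[of _ "\<lambda>x. snd (g x)"] conjI bexI[of _ "y \<odot>\<^sup>r\<^bsub>M\<^esub> a"]) simp_all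
qed

text \<open>A basis \<open>X\<close> of the algebra over the center of \<open>P\<close> whose coordinate functions \<open>\<sigma>\<close> are matrix
  coefficients of \<open>P\<close>.\<close>

locale galois_dual = galois_coords L R P d e c q \<beta> w + D: lbasis R "regular_bimodule R" "bimodule_center R P" X "\<lambda>x. x" \<sigma>
  for L :: "'a set" and R :: "('a, 'k) ring_scheme" (structure) and P :: "('a, 'b) bimodule"
    and d e c q \<beta> w and X :: "'a set" and \<sigma> :: "'a \<Rightarrow> 'a \<Rightarrow> 'a" +
  assumes \<sigma>_coef: "x \<in> X \<Longrightarrow> \<sigma> x \<in> coef R P"
begin

sublocale BB: tensor_basis R B B K X "\<lambda>x. x" \<sigma>
  by unfold_locales

lemma X_closed: "x \<in> X \<Longrightarrow> x \<in> carrier R"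
  using D.e_closed by simp

lemma \<sigma>_in: "x \<in> X \<Longrightarrow> y \<in> carrier R \<Longrightarrow> \<sigma> x y \<in> K"
  using D.c_in by simp

lemma \<sigma>_closed: "x \<in> X \<Longrightarrow> y \<in> carrier R \<Longrightarrow> \<sigma> x y \<in> carrier R"
  using \<sigma>_in center_closed by blast

lemma \<sigma>_expand: "y \<in> carrier R \<Longrightarrow> (\<Oplus>x \<in> X. \<sigma> x y \<otimes> x) = y"
  using D.expand by simp

lemma \<sigma>_dual: "x \<in> X \<Longrightarrow> x' \<in> X \<Longrightarrow> \<sigma> x x' = (if x = x' then \<one> else \<zero>)"
  using D.c_e by simp

text \<open>The condition expresses that \<open>\<Sum>\<^sub>x x \<otimes> v\<^sub>x\<close> is a Casimir element of the tensor square over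
  the center, that is, \<open>\<Sum>\<^sub>x b x \<otimes> v\<^sub>x = \<Sum>\<^sub>x x \<otimes> v\<^sub>x b\<close> for all \<open>b\<close>.\<close>

definition casimir :: "('a \<Rightarrow> 'a) \<Rightarrow> bool" where
  "casimir v \<longleftrightarrow> (\<forall>x \<in> X. v x \<in> carrier R) \<and>
    (\<forall>x \<in> X. \<forall>b \<in> carrier R. v x \<otimes> b = (\<Oplus>y \<in> X. \<sigma> x (b \<otimes> y) \<otimes> v y))"

text \<open>The center-linear functionals on the algebra as a right module. The left action is a
  placeholder.\<close>

definition dual :: "('a, 'a \<Rightarrow> 'a) bimodule" where
  "dual = \<lparr>carrier = {f \<in> carrier R \<rightarrow>\<^sub>E K. mor (lops K) B B f}, monoid.mult = undefined, one = undefined,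
    ring.zero = (\<lambda>y \<in> carrier R. \<zero>), add = (\<lambda>f g. \<lambda>y \<in> carrier R. f y \<oplus> g y),
    smult = (\<lambda>a f. f), rsmult = (\<lambda>f b. \<lambda>y \<in> carrier R. f (b \<otimes> y))\<rparr>"

lemma dual_simps:
  "carrier dual = {f \<in> carrier R \<rightarrow>\<^sub>E K. mor (lops K) B B f}"
  "\<zero>\<^bsub>dual\<^esub> = (\<lambda>y \<in> carrier R. \<zero>)" "f \<oplus>\<^bsub>dual\<^esub> g = (\<lambda>y \<in> carrier R. f y \<oplus> g y)"
  "f \<odot>\<^sup>r\<^bsub>dual\<^esub> b = (\<lambda>y \<in> carrier R. f (b \<otimes> y))"
  by (simp_all add: dual_def)

lemma dualI:
  assumes "\<And>y. y \<in> carrier R \<Longrightarrow> f y \<in> K"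
    and "\<And>y z. y \<in> carrier R \<Longrightarrow> z \<in> carrier R \<Longrightarrow> f (y \<oplus> z) = f y \<oplus> f z"
    and "\<And>z y. z \<in> K \<Longrightarrow> y \<in> carrier R \<Longrightarrow> f (z \<otimes> y) = z \<otimes> f y"
  shows "(\<lambda>y \<in> carrier R. f y) \<in> carrier dual"
  using assms center_closed by (auto simp: dual_simps intro!: morI)

lemma dualD:
  assumes "f \<in> carrier dual"
  shows "y \<in> carrier R \<Longrightarrow> f y \<in> K" "y \<in> carrier R \<Longrightarrow> f y \<in> carrier R"
    "y \<in> carrier R \<Longrightarrow> z \<in> carrier R \<Longrightarrow> f (y \<oplus> z) = f y \<oplus> f z"
    "t \<in> K \<Longrightarrow> y \<in> carrier R \<Longrightarrow> f (t \<otimes> y) = t \<otimes> f y"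
    "f = (\<lambda>y \<in> carrier R. f y)" "mor (lops K) B B f"
  using assms center_closed mor_add[of "lops K" B B f y z] mor_act[of "lops K" B B f y "Inl t"]
  by (auto simp: dual_simps PiE_iff extensional_restrict)

lemma dual_eqI:
  assumes "f \<in> carrier dual" "g \<in> carrier dual" "\<And>y. y \<in> carrier R \<Longrightarrow> f y = g y" shows "f = g"
  using assms by (auto simp: dual_simps intro: PiE_ext)

lemma opmod_dual: "opmod (rops (carrier R)) dual"
proof -
  note KE = subringE[OF center_subring]
  have "abelian_group dual"
  proof (rule abelian_groupI, goal_cases)
    case (1 f g)
    show ?case unfolding dual_simps(3)
      by (rule dualI) (use dualD[OF 1(1)] dualD[OF 1(2)] KE(7) center_closed in \<open>auto simp: csa.a_ac csa.r_distr\<close>)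
  next
    case 2
    show ?case unfolding dual_simps(2) by (rule dualI) (use KE(2) center_closed in auto)
  next
    case (3 f g h)
    show ?case using dualD(2)[OF 3(1)] dualD(2)[OF 3(2)] dualD(2)[OF 3(3)]
      unfolding dual_simps(3) by (intro restrict_ext) (simp add: csa.a_assoc)
  next
    case (4 f g)
    show ?case using dualD(2)[OF 4(1)] dualD(2)[OF 4(2)]
      unfolding dual_simps(3) by (intro restrict_ext) (simp add: csa.a_comm)
  next
    case (5 f)
    have "(\<lambda>y \<in> carrier R. (\<lambda>y \<in> carrier R. \<zero>) y \<oplus> f y) = (\<lambda>y \<in> carrier R. f y)"
      using dualD(2)[OF 5] by (intro restrict_ext) simp
    then show ?case using dualD(5)[OF 5] unfolding dual_simps(2,3) by simp
  next
    case (6 f)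
    have "(\<lambda>y \<in> carrier R. \<ominus> f y) \<in> carrier dual"
      by (rule dualI) (use dualD[OF 6] KE(5) center_closed in \<open>auto simp: csa.minus_add csa.r_minus\<close>)
    moreover have "(\<lambda>y \<in> carrier R. \<ominus> f y) \<oplus>\<^bsub>dual\<^esub> f = \<zero>\<^bsub>dual\<^esub>"
      using dualD(2)[OF 6] unfolding dual_simps(2,3) by (intro restrict_ext) (simp add: csa.l_neg)
    ultimately show ?case by blast
  qed
  then show ?thesis
  proof (rule opmodI, goal_cases)
    case (1 t f)
    then obtain b where b: "t = Inr b" "b \<in> carrier R" by auto
    have "(\<lambda>y \<in> carrier R. f (b \<otimes> y)) \<in> carrier dual"
    proof (rule dualI)
      fix z y assume zy: "z \<in> K" "y \<in> carrier R"
      have "b \<otimes> (z \<otimes> y) = z \<otimes> (b \<otimes> y)"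
        using zy b center_closed center_comm[OF zy(1) b(2)] by (simp flip: csa.m_assoc)
      then show "f (b \<otimes> (z \<otimes> y)) = z \<otimes> f (b \<otimes> y)" using dualD(4)[OF 1(2) zy(1)] zy b by simp
    qed (use dualD[OF 1(2)] b in \<open>auto simp: csa.r_distr\<close>)
    then show ?case using b by (simp add: dual_simps(4))
  next
    case (2 t f g)
    then show ?case using dualD(2) by (auto simp: dual_simps(3,4) intro!: restrict_ext)
  qed
qed

lemma finite_length_center: "finite_length (rops K) (sub B K)"
proof (rule finite_length_transfer[OF csa.subfield_finite_length[OF center_subfield]])
  fix U assume U: "submod (rops K) (sub B K) U"
  have "z \<otimes> x \<in> U" if "z \<in> K" "x \<in> U" for z x
    using submodD(5)[OF U _ that(2), of "Inr z"] submodD(1)[OF U that(2)] that(1) center_comm[OF that(1)] center_closed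
    by auto
  then show "submod (lops K) (sub B K) U" using U unfolding submod_def by auto
qed

lemma finite_length_dual: "finite_length (rops (carrier R)) dual"
proof -
  note KE = subringE[OF center_subring]
  interpret dual: opmod "rops (carrier R)" dual by (rule opmod_dual)
  have KR: "rops K \<subseteq> rops (carrier R)" using center_closed by auto
  have Kreg: "opmod (rops K) (sub B K)"
    by (rule opmod_sub[OF opmod.opmod_mono[OF B.opmod_rops[OF subset_refl] KR]])
      (use KE in \<open>auto simp: submod_def\<close>)
  let ?h = "\<lambda>f. \<lambda>x \<in> X. f x"
  have h: "mor (rops K) dual (ipow (sub B K) X) ?h"
  proof (rule morI, goal_cases)
    case (3 t f)
    then obtain z where z: "t = Inr z" "z \<in> K" by auto
    have "f (z \<otimes> x) = f x \<otimes> z" if "x \<in> X" for x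
      using dualD(4)[OF 3(2) z(2) X_closed[OF that]] center_comm[OF z(2) dualD(2)[OF 3(2) X_closed[OF that]]]
      by simp
    then show ?case using z X_closed by (auto simp: dual_simps(4) intro!: restrict_ext)
  qed (use dualD X_closed in \<open>auto simp: dual_simps(3) intro!: restrict_ext\<close>)
  have "inj_on ?h (carrier dual)"
  proof (rule inj_onI)
    fix f g assume f: "f \<in> carrier dual" and g: "g \<in> carrier dual" and eq: "?h f = ?h g"
    have val: "f' y = (\<Oplus>x \<in> X. \<sigma> x y \<otimes> f' x)" if f': "f' \<in> carrier dual" and y: "y \<in> carrier R" for f' y
    proof -
      have "f' y = f' (\<Oplus>x \<in> X. \<sigma> x y \<otimes> x)" using \<sigma>_expand[OF y] by simp
      also have "\<dots> = (\<Oplus>x \<in> X. f' (\<sigma> x y \<otimes> x))"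
        using mor_finsum[OF dualD(6)[OF f'] abelian_regular abelian_regular, of "\<lambda>x. \<sigma> x y \<otimes> x" X] \<sigma>_closed X_closed y
        by (simp add: Pi_iff)
      also have "\<dots> = (\<Oplus>x \<in> X. \<sigma> x y \<otimes> f' x)"
        using \<sigma>_in \<sigma>_closed X_closed y dualD(2,4)[OF f'] by (intro csa.finsum_cong') auto
      finally show ?thesis .
    qed
    have fg: "f x = g x" if "x \<in> X" for x using fun_cong[OF eq, of x] that by simp
    show "f = g"
    proof (rule dual_eqI[OF f g])
      fix y assume y: "y \<in> carrier R"
      show "f y = g y" unfolding val[OF f y] val[OF g y]
        using fg \<sigma>_closed y dualD(2)[OF g X_closed] by (intro csa.finsum_cong') auto
    qed
  qed
  from finite_length_inj[OF h this dual.opmod_mono[OF KR] opmod_ipow[OF Kreg]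
      finite_length_ipow[OF Kreg finite_length_center D.fin]]
  show ?thesis by (rule finite_length_ops_mono[OF _ KR])
qed

lemma finite_length_right: "finite_length (rops (carrier R)) B"
proof (rule finite_length_transfer[OF csa.regular_finite_length[OF csa.center_subfield dim]])
  fix U assume U: "submod (rops (carrier R)) B U"
  have "z \<otimes> x \<in> U" if "z \<in> L" "x \<in> U" for z x
    using submodD(5)[OF U _ that(2), of "Inr z"] submodD(1)[OF U that(2)] that(1) L_comm[OF that(1)]
      subfieldE(3)[OF csa.center_subfield] by auto
  then show "submod (lops L) B U" using U unfolding submod_def by auto
qed

text \<open>The coordinate functions \<open>\<sigma>\<close> satisfy the Casimir relation in the dual of the algebra. A nonzero
  right linear map from the dual to the algebra carries them to a Casimir family, which is nonzero
  because they generate the dual.\<close>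

lemma exists_casimir: "\<exists>v. casimir v \<and> (\<exists>x \<in> X. v x \<noteq> \<zero>)"
proof -
  interpret dual: opmod "rops (carrier R)" dual by (rule opmod_dual)
  define \<delta> where "\<delta> x = (\<lambda>y \<in> carrier R. \<sigma> x y)" for x
  have \<delta>: "\<delta> x \<in> carrier dual" if "x \<in> X" for x
    unfolding \<delta>_def
    by (rule dualI) (use that \<sigma>_in D.c_add[OF that] D.c_smult[OF that] in auto)
  have dact: "f \<odot>\<^sup>r\<^bsub>dual\<^esub> b \<in> carrier dual" if "f \<in> carrier dual" "b \<in> carrier R" for f b
    using dual.act_closed[of "Inr b" f] that by simp
  have exp: "f = finsum dual (\<lambda>x. \<delta> x \<odot>\<^sup>r\<^bsub>dual\<^esub> f x) X" if f: "f \<in> carrier dual" for f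
  proof (rule dual_eqI[OF f])
    have fX: "f x \<in> K" "f x \<in> carrier R" if "x \<in> X" for x using dualD(1,2)[OF f X_closed[OF that]] .
    have mem: "(\<lambda>x. \<delta> x \<odot>\<^sup>r\<^bsub>dual\<^esub> f x) \<in> X \<rightarrow> carrier dual" using dact \<delta> fX by auto
    then show "finsum dual (\<lambda>x. \<delta> x \<odot>\<^sup>r\<^bsub>dual\<^esub> f x) X \<in> carrier dual" by (rule dual.finsum_closed)
    fix y assume y: "y \<in> carrier R"
    have ev: "mor {} dual B (\<lambda>f. f y)"
      by (rule morI) (use y dualD(2) in \<open>auto simp: dual_simps(3)\<close>)
    have "f y = f (\<Oplus>x \<in> X. \<sigma> x y \<otimes> x)" using \<sigma>_expand[OF y] by simp
    also have "\<dots> = (\<Oplus>x \<in> X. f (\<sigma> x y \<otimes> x))"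
      using mor_finsum[OF dualD(6)[OF f] abelian_regular abelian_regular, of "\<lambda>x. \<sigma> x y \<otimes> x" X] \<sigma>_closed X_closed y
      by (simp add: Pi_iff)
    also have "\<dots> = (\<Oplus>x \<in> X. (\<delta> x \<odot>\<^sup>r\<^bsub>dual\<^esub> f x) y)"
    proof (rule csa.finsum_cong'[OF refl])
      show "(\<lambda>x. (\<delta> x \<odot>\<^sup>r\<^bsub>dual\<^esub> f x) y) \<in> X \<rightarrow> carrier R" using mem dualD(2) y by (auto simp: Pi_iff)
      fix x assume x: "x \<in> X"
      have "f (\<sigma> x y \<otimes> x) = \<sigma> x y \<otimes> f x" using dualD(4)[OF f \<sigma>_in[OF x y] X_closed[OF x]] .
      also have "\<dots> = \<sigma> x (f x \<otimes> y)"
        using D.c_smult[OF x fX(1)[OF x]] y center_comm[OF fX(1)[OF x] \<sigma>_closed[OF x y]] by simp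
      finally show "f (\<sigma> x y \<otimes> x) = (\<delta> x \<odot>\<^sup>r\<^bsub>dual\<^esub> f x) y" using y fX(2)[OF x] by (simp add: dual_simps(4) \<delta>_def)
    qed
    also have "\<dots> = finsum dual (\<lambda>x. \<delta> x \<odot>\<^sup>r\<^bsub>dual\<^esub> f x) X y"
      using mor_finsum[OF ev dual.abelian_group_axioms abelian_regular mem] by simp
    finally show "f y = finsum dual (\<lambda>x. \<delta> x \<odot>\<^sup>r\<^bsub>dual\<^esub> f x) X y" .
  qed
  have "X \<noteq> {}" using \<sigma>_expand[OF csa.one_closed] csa.one_not_zero by auto
  then obtain x0 where x0: "x0 \<in> X" by blast
  have "\<delta> x0 x0 \<noteq> \<zero>\<^bsub>dual\<^esub> x0" using \<sigma>_dual[OF x0 x0] X_closed[OF x0] csa.one_not_zero by (simp add: \<delta>_def dual_simps(2))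
  then have "carrier dual \<noteq> {\<zero>\<^bsub>dual\<^esub>}" using \<delta>[OF x0] by force
  then obtain \<tau> where \<tau>: "mor (rops (carrier R)) dual B \<tau>" and \<tau>0: "\<exists>f \<in> carrier dual. \<tau> f \<noteq> \<zero>"
    using csa.exists_right_linear[OF opmod_dual finite_length_dual finite_length_right]
      dualD by (auto simp: dual_simps(3,4) csa.m_assoc csa.l_distr cong: restrict_cong)
  have val: "\<tau> f = (\<Oplus>x \<in> X. f x \<otimes> \<tau> (\<delta> x))" if f: "f \<in> carrier dual" for f
  proof -
    have fX: "f x \<in> K" "f x \<in> carrier R" if "x \<in> X" for x using dualD(1,2)[OF f X_closed[OF that]] .
    have "\<tau> f = \<tau> (finsum dual (\<lambda>x. \<delta> x \<odot>\<^sup>r\<^bsub>dual\<^esub> f x) X)" using exp[OF f] by simp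
    also have "\<dots> = (\<Oplus>x \<in> X. \<tau> (\<delta> x \<odot>\<^sup>r\<^bsub>dual\<^esub> f x))"
      using mor_finsum[OF \<tau> dual.abelian_group_axioms abelian_regular, of "\<lambda>x. \<delta> x \<odot>\<^sup>r\<^bsub>dual\<^esub> f x" X] dact \<delta> fX
      by (simp add: Pi_iff)
    also have "\<dots> = (\<Oplus>x \<in> X. f x \<otimes> \<tau> (\<delta> x))"
    proof (rule csa.finsum_cong'[OF refl])
      fix x assume x: "x \<in> X"
      have "\<tau> (\<delta> x \<odot>\<^sup>r\<^bsub>dual\<^esub> f x) = \<tau> (\<delta> x) \<otimes> f x"
        using mor_act[OF \<tau> \<delta>[OF x], of "Inr (f x)"] fX(2)[OF x] by simp
      then show "\<tau> (\<delta> x \<odot>\<^sup>r\<^bsub>dual\<^esub> f x) = f x \<otimes> \<tau> (\<delta> x)"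
        using center_comm[OF fX(1)[OF x]] mor_closed[OF \<tau> \<delta>[OF x]] by simp
    qed (use fX mor_closed[OF \<tau> \<delta>] in auto)
    finally show ?thesis .
  qed
  have "casimir (\<lambda>x. \<tau> (\<delta> x))"
    unfolding casimir_def
  proof (intro conjI ballI)
    fix x b assume x: "x \<in> X" and b: "b \<in> carrier R"
    have "\<tau> (\<delta> x) \<otimes> b = \<tau> (\<delta> x \<odot>\<^sup>r\<^bsub>dual\<^esub> b)" using mor_act[OF \<tau> \<delta>[OF x], of "Inr b"] b by simp
    also have "\<dots> = (\<Oplus>y \<in> X. (\<delta> x \<odot>\<^sup>r\<^bsub>dual\<^esub> b) y \<otimes> \<tau> (\<delta> y))" by (rule val[OF dact[OF \<delta>[OF x] b]])
    also have "\<dots> = (\<Oplus>y \<in> X. \<sigma> x (b \<otimes> y) \<otimes> \<tau> (\<delta> y))"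
      using X_closed b x \<sigma>_closed mor_closed[OF \<tau> \<delta>]
      by (intro csa.finsum_cong') (auto simp: dual_simps(4) \<delta>_def[of x])
    finally show "\<tau> (\<delta> x) \<otimes> b = (\<Oplus>y \<in> X. \<sigma> x (b \<otimes> y) \<otimes> \<tau> (\<delta> y))" .
  qed (use mor_closed[OF \<tau> \<delta>] in auto)
  moreover have "\<exists>x \<in> X. \<tau> (\<delta> x) \<noteq> \<zero>"
  proof (rule ccontr)
    assume "\<not> ?thesis"
    then have "\<tau> f = \<zero>" if f: "f \<in> carrier dual" for f
      unfolding val[OF f] using dualD(2)[OF f X_closed] by (intro csa.add.finprod_one_eqI) simp
    then show False using \<tau>0 by blast
  qed
  ultimately show ?thesis by blast
qed

subsection \<open>The trace ideal of a bimodule in the tensor square\<close>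

text \<open>The tensor square of the algebra over the center of \<open>P\<close>, in coordinates with respect to
  the second factor.\<close>

abbreviation A :: "('a, 'a \<Rightarrow> 'a) bimodule" where "A \<equiv> BB.W"

definition central :: "('a, 'e) bimodule \<Rightarrow> bool" where
  "central M \<longleftrightarrow> (\<forall>z \<in> K. \<forall>x \<in> carrier M. z \<odot>\<^bsub>M\<^esub> x = x \<odot>\<^sup>r\<^bsub>M\<^esub> z)"

lemma central_P: "central P"
  by (simp add: central_def center_act)

lemma central_B: "central B"
  using center_comm by (auto simp: central_def)

text \<open>The bimodule map \<open>b \<otimes> y \<mapsto> b p y\<close> that \<open>p\<close> induces on the tensor square.\<close>

definition gen_map :: "('a, 'e) bimodule \<Rightarrow> 'e \<Rightarrow> ('a \<Rightarrow> 'a) \<Rightarrow> 'e" where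
  "gen_map M p a = (\<Oplus>\<^bsub>M\<^esub>x \<in> X. a x \<odot>\<^bsub>M\<^esub> (p \<odot>\<^sup>r\<^bsub>M\<^esub> x))"

lemma gen_map_\<iota>:
  assumes M: "bimodule R M" "central M" and p: "p \<in> carrier M" and b: "b \<in> carrier R" and y: "y \<in> carrier R"
  shows "gen_map M p (BB.\<iota> b y) = b \<odot>\<^bsub>M\<^esub> (p \<odot>\<^sup>r\<^bsub>M\<^esub> y)"
proof -
  interpret N: bimodule R M by (rule M(1))
  have "gen_map M p (BB.\<iota> b y) = (\<Oplus>\<^bsub>M\<^esub>x \<in> X. b \<odot>\<^bsub>M\<^esub> (p \<odot>\<^sup>r\<^bsub>M\<^esub> (\<sigma> x y \<otimes> x)))"
    unfolding gen_map_def
  proof (rule N.M.finsum_cong'[OF refl])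
    fix x assume x: "x \<in> X"
    note xs = X_closed[OF x] \<sigma>_closed[OF x y]
    have "(b \<otimes> \<sigma> x y) \<odot>\<^bsub>M\<^esub> (p \<odot>\<^sup>r\<^bsub>M\<^esub> x) = b \<odot>\<^bsub>M\<^esub> ((\<sigma> x y \<odot>\<^bsub>M\<^esub> p) \<odot>\<^sup>r\<^bsub>M\<^esub> x)"
      using xs b p by (simp add: N.lsmult_assoc N.rsmult_closed N.lsmult_rsmult)
    also have "\<sigma> x y \<odot>\<^bsub>M\<^esub> p = p \<odot>\<^sup>r\<^bsub>M\<^esub> \<sigma> x y" using M(2) \<sigma>_in[OF x y] p unfolding central_def by blast
    finally show "BB.\<iota> b y x \<odot>\<^bsub>M\<^esub> (p \<odot>\<^sup>r\<^bsub>M\<^esub> x) = b \<odot>\<^bsub>M\<^esub> (p \<odot>\<^sup>r\<^bsub>M\<^esub> (\<sigma> x y \<otimes> x))"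
      using x xs p by (simp add: BB.\<iota>_def N.rsmult_assoc)
  qed (use X_closed \<sigma>_closed b p y in \<open>auto intro!: N.lsmult_closed N.rsmult_closed csa.m_closed\<close>)
  also have "\<dots> = b \<odot>\<^bsub>M\<^esub> (\<Oplus>\<^bsub>M\<^esub>x \<in> X. p \<odot>\<^sup>r\<^bsub>M\<^esub> (\<sigma> x y \<otimes> x))"
    using X_closed \<sigma>_closed b p y by (intro N.smult_finsum[symmetric]) (auto intro!: N.rsmult_closed csa.m_closed)
  also have "(\<Oplus>\<^bsub>M\<^esub>x \<in> X. p \<odot>\<^sup>r\<^bsub>M\<^esub> (\<sigma> x y \<otimes> x)) = p \<odot>\<^sup>r\<^bsub>M\<^esub> (\<Oplus>x \<in> X. \<sigma> x y \<otimes> x)"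
    using X_closed \<sigma>_closed p y by (intro N.rsmult_finsum_right[symmetric]) auto
  finally show ?thesis using \<sigma>_expand[OF y] by simp
qed

lemma A_closed: "a \<in> carrier A \<Longrightarrow> x \<in> X \<Longrightarrow> a x \<in> carrier R"
  by (auto simp: PiE_iff)

lemma gen_map_mor:
  assumes M: "bimodule R M" "central M" and p: "p \<in> carrier M"
  shows "mor (bops R) A M (gen_map M p)"
proof -
  interpret N: bimodule R M by (rule M(1))
  interpret AA: bimodule R A by (rule BB.bimodule_W)
  have px: "p \<odot>\<^sup>r\<^bsub>M\<^esub> x \<in> carrier M" if "x \<in> X" for x using p X_closed[OF that] by (intro N.rsmult_closed)
  have "mor (lops (carrier R)) A M (\<lambda>a. a x \<odot>\<^bsub>M\<^esub> (p \<odot>\<^sup>r\<^bsub>M\<^esub> x))" if x: "x \<in> X" for x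
    by (rule mor_comp[OF _ N.mor_scalar_left[OF px[OF x]]], rule morI) (use x in auto)
  then have left: "mor (lops (carrier R)) A M (gen_map M p)"
    unfolding gen_map_def
    by (intro mor_finsum_fun AA.opmod_lops N.opmod_lops subset_refl D.fin)
  show ?thesis
  proof (rule morI)
    fix t a assume t: "t \<in> bops R" and a: "a \<in> carrier A"
    show "gen_map M p (act A t a) = act M t (gen_map M p a)"
    proof (cases t)
      case (Inl b)
      then have "t \<in> lops (carrier R)" using t by auto
      then show ?thesis by (rule mor_act[OF left a])
    next
      case (Inr b)
      then have b: "b \<in> carrier R" using t by auto
      note ax = A_closed[OF a]
      have "act A t a = (\<Oplus>\<^bsub>A\<^esub>x \<in> X. BB.\<iota> (a x) x) \<odot>\<^sup>r\<^bsub>A\<^esub> b"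
        unfolding BB.\<iota>_expand[OF a] Inr act_simps ..
      also have "\<dots> = (\<Oplus>\<^bsub>A\<^esub>x \<in> X. BB.\<iota> (a x) x \<odot>\<^sup>r\<^bsub>A\<^esub> b)"
        using ax X_closed by (intro AA.rsmult_finsum[OF b] Pi_I BB.\<iota>_closed) simp_all
      also have "\<dots> = (\<Oplus>\<^bsub>A\<^esub>x \<in> X. BB.\<iota> (a x) (x \<otimes> b))"
      proof (rule AA.M.finsum_cong'[OF refl])
        show "(\<lambda>x. BB.\<iota> (a x) (x \<otimes> b)) \<in> X \<rightarrow> carrier A"
          using ax X_closed b by (intro Pi_I BB.\<iota>_closed) simp_all
        show "BB.\<iota> (a x) x \<odot>\<^sup>r\<^bsub>A\<^esub> b = BB.\<iota> (a x) (x \<otimes> b)" if "x \<in> X" for x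
          using BB.\<iota>_right[OF b, of "a x" x] ax[OF that] X_closed[OF that] by (simp del: tw_simps)
      qed
      finally have "gen_map M p (act A t a) = gen_map M p (\<Oplus>\<^bsub>A\<^esub>x \<in> X. BB.\<iota> (a x) (x \<otimes> b))"
        by (rule arg_cong)
      also have "\<dots> = (\<Oplus>\<^bsub>M\<^esub>x \<in> X. gen_map M p (BB.\<iota> (a x) (x \<otimes> b)))"
        using ax X_closed b
        by (intro mor_finsum[OF left AA.M.abelian_group_axioms N.M.abelian_group_axioms] Pi_I BB.\<iota>_closed) simp_all
      also have "\<dots> = (\<Oplus>\<^bsub>M\<^esub>x \<in> X. (a x \<odot>\<^bsub>M\<^esub> (p \<odot>\<^sup>r\<^bsub>M\<^esub> x)) \<odot>\<^sup>r\<^bsub>M\<^esub> b)"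
        using ax X_closed b p gen_map_\<iota>[OF M p]
        by (intro N.M.finsum_cong')
          (auto simp: N.lsmult_rsmult N.rsmult_assoc N.rsmult_closed N.lsmult_closed simp del: tw_simps)
      also have "\<dots> = gen_map M p a \<odot>\<^sup>r\<^bsub>M\<^esub> b"
        unfolding gen_map_def using ax px by (intro N.rsmult_finsum[OF b, symmetric] Pi_I N.lsmult_closed)
      finally show ?thesis using Inr by simp
    qed
  qed (use mor_closed[OF left] mor_add[OF left] in auto)
qed

end

lemma (in tensor_basis) W_central:
  assumes z: "z \<in> S" and M: "\<And>x. x \<in> carrier M \<Longrightarrow> z \<odot>\<^bsub>M\<^esub> x = x \<odot>\<^sup>r\<^bsub>M\<^esub> z"
    and N: "\<And>y. y \<in> carrier N \<Longrightarrow> z \<odot>\<^bsub>N\<^esub> y = y \<odot>\<^sup>r\<^bsub>N\<^esub> z" and f: "f \<in> carrier W"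
  shows "z \<odot>\<^bsub>W\<^esub> f = f \<odot>\<^sup>r\<^bsub>W\<^esub> z"
proof -
  interpret WW: bimodule R W by (rule bimodule_W)
  have zc: "z \<in> carrier R" using z S by blast
  have fi: "f i \<in> carrier M" if "i \<in> I" for i using f that by auto
  have mem: "(\<lambda>i. \<iota> (f i) (e i)) \<in> I \<rightarrow> carrier W" using fi by (intro Pi_I \<iota>_closed) auto
  have eq: "z \<odot>\<^bsub>W\<^esub> \<iota> (f i) (e i) = \<iota> (f i) (e i) \<odot>\<^sup>r\<^bsub>W\<^esub> z" if i: "i \<in> I" for i
  proof -
    have "z \<odot>\<^bsub>W\<^esub> \<iota> (f i) (e i) = \<iota> (z \<odot>\<^bsub>M\<^esub> f i) (e i)" by (rule \<iota>_left[OF zc fi[OF i] e_closed[OF i]])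
    also have "\<dots> = \<iota> (f i) (z \<odot>\<^bsub>N\<^esub> e i)" unfolding M[OF fi[OF i]] by (rule \<iota>_balanced[OF fi[OF i] z e_closed[OF i]])
    also have "\<dots> = \<iota> (f i) (e i) \<odot>\<^sup>r\<^bsub>W\<^esub> z"
      unfolding N[OF e_closed[OF i]] by (rule \<iota>_right[OF zc fi[OF i] e_closed[OF i], symmetric])
    finally show ?thesis .
  qed
  have "z \<odot>\<^bsub>W\<^esub> f = z \<odot>\<^bsub>W\<^esub> finsum W (\<lambda>i. \<iota> (f i) (e i)) I" unfolding \<iota>_expand[OF f] ..
  also have "\<dots> = finsum W (\<lambda>i. z \<odot>\<^bsub>W\<^esub> \<iota> (f i) (e i)) I" by (rule WW.smult_finsum[OF zc mem])
  also have "\<dots> = finsum W (\<lambda>i. \<iota> (f i) (e i) \<odot>\<^sup>r\<^bsub>W\<^esub> z) I"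
    using mem by (intro WW.M.finsum_cong' refl eq Pi_I WW.rsmult_closed zc) (auto simp: Pi_iff)
  also have "\<dots> = finsum W (\<lambda>i. \<iota> (f i) (e i)) I \<odot>\<^sup>r\<^bsub>W\<^esub> z" by (rule WW.rsmult_finsum[OF zc mem, symmetric])
  finally show ?thesis unfolding \<iota>_expand[OF f] .
qed

context galois_dual
begin

lemma gen_map_natural:
  assumes M: "bimodule R M" and N: "bimodule R N" and g: "mor (bops R) M N g" and p: "p \<in> carrier M"
    and a: "a \<in> carrier A"
  shows "gen_map N (g p) a = g (gen_map M p a)"
proof -
  interpret M: bimodule R M by (rule M)
  interpret N: bimodule R N by (rule N)
  have px: "p \<odot>\<^sup>r\<^bsub>M\<^esub> x \<in> carrier M" if "x \<in> X" for x using p X_closed[OF that] by (intro M.rsmult_closed)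
  have "g (gen_map M p a) = (\<Oplus>\<^bsub>N\<^esub>x \<in> X. g (a x \<odot>\<^bsub>M\<^esub> (p \<odot>\<^sup>r\<^bsub>M\<^esub> x)))"
    unfolding gen_map_def
    by (intro mor_finsum[OF g M.M.abelian_group_axioms N.M.abelian_group_axioms] Pi_I M.lsmult_closed A_closed[OF a] px)
  also have "\<dots> = gen_map N (g p) a"
    unfolding gen_map_def
  proof (rule N.M.finsum_cong'[OF refl])
    fix x assume x: "x \<in> X"
    show "g (a x \<odot>\<^bsub>M\<^esub> (p \<odot>\<^sup>r\<^bsub>M\<^esub> x)) = a x \<odot>\<^bsub>N\<^esub> (g p \<odot>\<^sup>r\<^bsub>N\<^esub> x)"
      using mor_act[OF g px[OF x], of "Inl (a x)"] mor_act[OF g p, of "Inr x"] A_closed[OF a x] X_closed[OF x]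
      by simp
  qed (intro Pi_I N.lsmult_closed N.rsmult_closed A_closed[OF a] X_closed mor_closed[OF g p])
  finally show ?thesis ..
qed

lemma gen_map_one:
  assumes a: "a \<in> carrier A" shows "gen_map A (BB.\<iota> \<one> \<one>) a = a"
proof -
  interpret AA: bimodule R A by (rule BB.bimodule_W)
  have "gen_map A (BB.\<iota> \<one> \<one>) a = (\<Oplus>\<^bsub>A\<^esub>y \<in> X. BB.\<iota> (a y) y)"
    unfolding gen_map_def
  proof (rule AA.M.finsum_cong'[OF refl])
    fix y assume y: "y \<in> X"
    show "a y \<odot>\<^bsub>A\<^esub> (BB.\<iota> \<one> \<one> \<odot>\<^sup>r\<^bsub>A\<^esub> y) = BB.\<iota> (a y) y"
      using BB.\<iota>_right[OF X_closed[OF y], of \<one> \<one>] BB.\<iota>_left[OF A_closed[OF a y], of \<one> y]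
        A_closed[OF a y] X_closed[OF y] by (simp del: tw_simps)
  qed (use A_closed[OF a] X_closed in \<open>auto simp del: tw_simps\<close>)
  also have "\<dots> = a" by (rule BB.\<iota>_expand[OF a])
  finally show ?thesis .
qed

lemma central_A: "central A"
  unfolding central_def by (intro ballI BB.W_central) (use center_comm in auto)

text \<open>An element \<open>v\<close> of \<open>A\<close> induces the endomorphism \<open>a \<otimes> b \<mapsto> a v b\<close> of \<open>A\<close>, and by restriction and
  projection an endomorphism of the summand \<open>Z\<close>. By locality, the elements that do not
  induce an automorphism of \<open>Z\<close> are closed under addition. Assume that \<open>Z\<close> is not a summand of \<open>M\<close>. Then the images of all
  bimodule maps from \<open>M\<close> to \<open>A\<close> consist of such elements, because what they induce factors through \<open>M\<close>. Casimir
  families provide so many of these maps that the bad elements include \<open>1 \<otimes> 1\<close>, which however induces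
  the identity.\<close>

lemma indec_summand_of_coef:
  fixes M :: "('a, 'e) bimodule" and Z :: "('a, 'f) bimodule"
  assumes M: "bimodule R M" "central M" and coef: "\<And>x. x \<in> X \<Longrightarrow> \<sigma> x \<in> coef R M"
    and Z: "indec (bops R) Z" and ZA: "Z \<unlhd>\<^bsub>bops R\<^esub> A"
  shows "Z \<unlhd>\<^bsub>bops R\<^esub> M"
proof (rule ccontr)
  assume ZM: "\<not> Z \<unlhd>\<^bsub>bops R\<^esub> M"
  interpret N: bimodule R M by (rule M(1))
  interpret AA: bimodule R A by (rule BB.bimodule_W)
  have Zm: "opmod (bops R) Z" using Z by (simp add: indec_def)
  interpret Zo: opmod "bops R" Z by (rule Zm)
  obtain i \<pi> where i: "mor (bops R) Z A i" and \<pi>: "mor (bops R) A Z \<pi>"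
    and \<pi>i: "\<And>x. x \<in> carrier Z \<Longrightarrow> \<pi> (i x) = x"
    using summand_mors[OF ZA] by metis
  note gA = gen_map_mor[OF BB.bimodule_W central_A]
  define k where "k v x = \<pi> (gen_map A v (i x))" for v x
  have k: "mor (bops R) Z Z (k v)" if "v \<in> carrier A" for v
    unfolding k_def by (rule mor_comp[OF mor_comp[OF i gA[OF that]] \<pi>])
  \<comment> \<open>the elements of \<open>A\<close> whose left-right multiplication does not induce an automorphism of \<open>Z\<close>\<close>
  define N where "N = {v \<in> carrier A. \<not> bij_betw (k v) (carrier Z) (carrier Z)}"
  have N_add: "v \<oplus>\<^bsub>A\<^esub> v' \<in> N" if v: "v \<in> N" and v': "v' \<in> N" for v v'
  proof -
    have c: "v \<in> carrier A" "v' \<in> carrier A" using v v' unfolding N_def by auto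
    have eq: "k (v \<oplus>\<^bsub>A\<^esub> v') x = k v x \<oplus>\<^bsub>Z\<^esub> k v' x" if x: "x \<in> carrier Z" for x
    proof -
      note ix = mor_closed[OF i x]
      have t: "v \<odot>\<^sup>r\<^bsub>A\<^esub> y \<in> carrier A" "v' \<odot>\<^sup>r\<^bsub>A\<^esub> y \<in> carrier A" if "y \<in> X" for y
        using c X_closed[OF that] by (intro AA.rsmult_closed; simp)+
      have "gen_map A (v \<oplus>\<^bsub>A\<^esub> v') (i x) =
          (\<Oplus>\<^bsub>A\<^esub>y \<in> X. i x y \<odot>\<^bsub>A\<^esub> (v \<odot>\<^sup>r\<^bsub>A\<^esub> y) \<oplus>\<^bsub>A\<^esub> i x y \<odot>\<^bsub>A\<^esub> (v' \<odot>\<^sup>r\<^bsub>A\<^esub> y))"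
        unfolding gen_map_def
      proof (rule AA.M.finsum_cong'[OF refl])
        fix y assume y: "y \<in> X"
        show "i x y \<odot>\<^bsub>A\<^esub> ((v \<oplus>\<^bsub>A\<^esub> v') \<odot>\<^sup>r\<^bsub>A\<^esub> y) = i x y \<odot>\<^bsub>A\<^esub> (v \<odot>\<^sup>r\<^bsub>A\<^esub> y) \<oplus>\<^bsub>A\<^esub> i x y \<odot>\<^bsub>A\<^esub> (v' \<odot>\<^sup>r\<^bsub>A\<^esub> y)"
          unfolding AA.rsmult_distr[OF X_closed[OF y] c] by (rule AA.lsmult_distr[OF A_closed[OF ix y] t[OF y]])
      qed (intro Pi_I AA.M.add.m_closed AA.lsmult_closed A_closed[OF ix] t)
      also have "\<dots> = gen_map A v (i x) \<oplus>\<^bsub>A\<^esub> gen_map A v' (i x)"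
        unfolding gen_map_def by (intro AA.M.finsum_addf Pi_I AA.lsmult_closed A_closed[OF ix] t)
      finally show ?thesis
        unfolding k_def using mor_add[OF \<pi> mor_closed[OF gA[OF c(1)] ix] mor_closed[OF gA[OF c(2)] ix]] by simp
    qed
    have "\<not> bij_betw (k (v \<oplus>\<^bsub>A\<^esub> v')) (carrier Z) (carrier Z)"
    proof
      assume "bij_betw (k (v \<oplus>\<^bsub>A\<^esub> v')) (carrier Z) (carrier Z)"
      then have "bij_betw (\<lambda>x. k v x \<oplus>\<^bsub>Z\<^esub> k v' x) (carrier Z) (carrier Z)"
        by (rule iffD1[OF bij_betw_cong, rotated]) (rule eq)
      then show False using indec_local[OF Z k[OF c(1)] k[OF c(2)]] v v' unfolding N_def by blast
    qed
    then show ?thesis unfolding N_def using AA.M.add.m_closed[OF c] by blast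
  qed
  have N_mor: "g p \<in> N" if g: "mor (bops R) M A g" and p: "p \<in> carrier M" for g p
  proof -
    have eq: "gen_map A (g p) a = g (gen_map M p a)" if a: "a \<in> carrier A" for a
      by (rule gen_map_natural[OF M(1) BB.bimodule_W g p a])
    have "\<not> bij_betw (k (g p)) (carrier Z) (carrier Z)"
    proof
      assume "bij_betw (k (g p)) (carrier Z) (carrier Z)"
      then have "bij_betw (\<lambda>x. \<pi> (g (gen_map M p (i x)))) (carrier Z) (carrier Z)"
        by (rule iffD1[OF bij_betw_cong, rotated]) (simp only: k_def eq mor_closed[OF i])
      then show False
        using summand_of_bij[OF mor_comp[OF i gen_map_mor[OF M p]] mor_comp[OF g \<pi>] Zm] ZM by blast
    qed
    then show ?thesis unfolding N_def using mor_closed[OF g p] by blast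
  qed
  \<comment> \<open>a Casimir family \<open>v\<close> makes \<open>p \<mapsto> \<Sum>\<^sub>x \<xi> (p x) \<otimes> v\<^sub>x\<close> a bimodule map\<close>
  have sumN: "(\<Oplus>\<^bsub>A\<^esub>x \<in> X. BB.\<iota> (s x) (v x)) \<in> N" if v: "casimir v" and s: "s \<in> coef R M" for v s
    using s
  proof (induction rule: coef.induct)
    case (basic \<xi> p)
    have vc: "v x \<in> carrier R" if "x \<in> X" for x using v that by (simp add: casimir_def)
    define g where "g p = (\<Oplus>\<^bsub>A\<^esub>x \<in> X. BB.\<iota> (\<xi> (p \<odot>\<^sup>r\<^bsub>M\<^esub> x)) (v x))" for p
    have gl: "mor (lops (carrier R)) M A g"
      unfolding g_def
    proof (rule mor_finsum_fun[OF N.opmod_lops AA.opmod_lops _ D.fin])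
      fix x assume x: "x \<in> X"
      show "mor (lops (carrier R)) M A (\<lambda>p. BB.\<iota> (\<xi> (p \<odot>\<^sup>r\<^bsub>M\<^esub> x)) (v x))"
        using mor_comp[OF mor_comp[OF N.mor_act_right[OF X_closed[OF x]] basic(1)] BB.\<iota>_mor_left] vc[OF x] by simp
    qed simp_all
    have gr: "g (p \<odot>\<^sup>r\<^bsub>M\<^esub> b) = g p \<odot>\<^sup>r\<^bsub>A\<^esub> b" if p: "p \<in> carrier M" and b: "b \<in> carrier R" for p b
    proof -
      have \<xi>x: "\<xi> (p \<odot>\<^sup>r\<^bsub>M\<^esub> y) \<in> carrier R" if "y \<in> X" for y
        using mor_closed[OF basic(1) N.rsmult_closed[OF X_closed[OF that] p]] by simp
      have bx: "b \<otimes> x \<in> carrier R" if "x \<in> X" for x using b X_closed[OF that] by simp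
      have \<sigma>c: "\<sigma> y (b \<otimes> x) \<in> carrier R" if "y \<in> X" "x \<in> X" for x y using \<sigma>_closed bx that by blast
      have val: "\<xi> (p \<odot>\<^sup>r\<^bsub>M\<^esub> y) = (\<Oplus>x \<in> X. \<sigma> x y \<otimes> \<xi> (p \<odot>\<^sup>r\<^bsub>M\<^esub> x))" if y: "y \<in> carrier R" for y
      proof -
        have "\<xi> (p \<odot>\<^sup>r\<^bsub>M\<^esub> y) = \<xi> (p \<odot>\<^sup>r\<^bsub>M\<^esub> (\<Oplus>x \<in> X. \<sigma> x y \<otimes> x))" using \<sigma>_expand[OF y] by simp
        also have "\<dots> = \<xi> (\<Oplus>\<^bsub>M\<^esub>x \<in> X. p \<odot>\<^sup>r\<^bsub>M\<^esub> (\<sigma> x y \<otimes> x))"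
          using p y \<sigma>_closed X_closed by (subst N.rsmult_finsum_right) auto
        also have "\<dots> = (\<Oplus>x \<in> X. \<xi> (p \<odot>\<^sup>r\<^bsub>M\<^esub> (\<sigma> x y \<otimes> x)))"
          using mor_finsum[OF basic(1) N.M.abelian_group_axioms abelian_regular, of "\<lambda>x. p \<odot>\<^sup>r\<^bsub>M\<^esub> (\<sigma> x y \<otimes> x)" X]
            p y \<sigma>_closed X_closed by (simp add: Pi_iff N.rsmult_closed)
        also have "\<dots> = (\<Oplus>x \<in> X. \<sigma> x y \<otimes> \<xi> (p \<odot>\<^sup>r\<^bsub>M\<^esub> x))"
        proof (rule csa.finsum_cong'[OF refl])
          fix x assume x: "x \<in> X"
          have "p \<odot>\<^sup>r\<^bsub>M\<^esub> (\<sigma> x y \<otimes> x) = (\<sigma> x y \<odot>\<^bsub>M\<^esub> p) \<odot>\<^sup>r\<^bsub>M\<^esub> x"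
            using M(2) \<sigma>_in[OF x y] p \<sigma>_closed[OF x y] X_closed[OF x] by (simp add: central_def N.rsmult_assoc)
          also have "\<dots> = \<sigma> x y \<odot>\<^bsub>M\<^esub> (p \<odot>\<^sup>r\<^bsub>M\<^esub> x)" by (rule N.lsmult_rsmult[OF \<sigma>_closed[OF x y] X_closed[OF x] p])
          finally show "\<xi> (p \<odot>\<^sup>r\<^bsub>M\<^esub> (\<sigma> x y \<otimes> x)) = \<sigma> x y \<otimes> \<xi> (p \<odot>\<^sup>r\<^bsub>M\<^esub> x)"
            using mor_act[OF basic(1) N.rsmult_closed[OF X_closed[OF x] p], of "Inl (\<sigma> x y)"] \<sigma>_closed[OF x y] by simp
        qed (use \<sigma>_closed y \<xi>x in auto)
        finally show ?thesis .
      qed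
      let ?t = "\<lambda>x y. BB.\<iota> (\<xi> (p \<odot>\<^sup>r\<^bsub>M\<^esub> y)) (\<sigma> y (b \<otimes> x) \<otimes> v x)"
      have tc: "?t x y \<in> carrier A" if "x \<in> X" "y \<in> X" for x y
        using \<xi>x \<sigma>c vc that by (intro BB.\<iota>_closed) simp_all
      have "g (p \<odot>\<^sup>r\<^bsub>M\<^esub> b) = (\<Oplus>\<^bsub>A\<^esub>x \<in> X. \<Oplus>\<^bsub>A\<^esub>y \<in> X. ?t x y)"
        unfolding g_def
      proof (rule AA.M.finsum_cong'[OF refl])
        fix x assume x: "x \<in> X"
        have "BB.\<iota> (\<xi> ((p \<odot>\<^sup>r\<^bsub>M\<^esub> b) \<odot>\<^sup>r\<^bsub>M\<^esub> x)) (v x) = BB.\<iota> (\<Oplus>y \<in> X. \<sigma> y (b \<otimes> x) \<otimes> \<xi> (p \<odot>\<^sup>r\<^bsub>M\<^esub> y)) (v x)"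
          using N.rsmult_assoc[OF b X_closed[OF x] p] val[OF bx[OF x]] by simp
        also have "\<dots> = (\<Oplus>\<^bsub>A\<^esub>y \<in> X. BB.\<iota> (\<sigma> y (b \<otimes> x) \<otimes> \<xi> (p \<odot>\<^sup>r\<^bsub>M\<^esub> y)) (v x))"
          using mor_finsum[OF BB.\<iota>_mor_left abelian_regular AA.M.abelian_group_axioms,
              of "v x" "\<lambda>y. \<sigma> y (b \<otimes> x) \<otimes> \<xi> (p \<odot>\<^sup>r\<^bsub>M\<^esub> y)" X] vc[OF x] \<sigma>c x \<xi>x
          by (simp add: Pi_iff del: tw_simps)
        also have "\<dots> = (\<Oplus>\<^bsub>A\<^esub>y \<in> X. ?t x y)"
        proof (rule AA.M.finsum_cong'[OF refl])
          fix y assume y: "y \<in> X"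
          have "BB.\<iota> (\<xi> (p \<odot>\<^sup>r\<^bsub>M\<^esub> y) \<otimes> \<sigma> y (b \<otimes> x)) (v x) = ?t x y"
            using BB.\<iota>_balanced[of "\<xi> (p \<odot>\<^sup>r\<^bsub>M\<^esub> y)" "\<sigma> y (b \<otimes> x)" "v x"] \<xi>x[OF y] vc[OF x] \<sigma>_in[OF y bx[OF x]] by simp
          then show "BB.\<iota> (\<sigma> y (b \<otimes> x) \<otimes> \<xi> (p \<odot>\<^sup>r\<^bsub>M\<^esub> y)) (v x) = ?t x y"
            using center_comm[OF \<sigma>_in[OF y bx[OF x]] \<xi>x[OF y]] by simp
        qed (use tc x in \<open>auto simp del: tw_simps\<close>)
        finally show "BB.\<iota> (\<xi> ((p \<odot>\<^sup>r\<^bsub>M\<^esub> b) \<odot>\<^sup>r\<^bsub>M\<^esub> x)) (v x) = (\<Oplus>\<^bsub>A\<^esub>y \<in> X. ?t x y)" .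
      qed (intro Pi_I AA.M.finsum_closed tc)
      also have "\<dots> = (\<Oplus>\<^bsub>A\<^esub>y \<in> X. \<Oplus>\<^bsub>A\<^esub>x \<in> X. ?t x y)"
        by (rule AA.M.finsum_swap[OF D.fin D.fin tc])
      also have "\<dots> = (\<Oplus>\<^bsub>A\<^esub>y \<in> X. BB.\<iota> (\<xi> (p \<odot>\<^sup>r\<^bsub>M\<^esub> y)) (v y) \<odot>\<^sup>r\<^bsub>A\<^esub> b)"
      proof (rule AA.M.finsum_cong'[OF refl])
        fix y assume y: "y \<in> X"
        have "(\<Oplus>\<^bsub>A\<^esub>x \<in> X. ?t x y) = BB.\<iota> (\<xi> (p \<odot>\<^sup>r\<^bsub>M\<^esub> y)) (\<Oplus>x \<in> X. \<sigma> y (b \<otimes> x) \<otimes> v x)"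
          using mor_finsum[OF BB.\<iota>_mor_right abelian_regular AA.M.abelian_group_axioms,
              of "\<xi> (p \<odot>\<^sup>r\<^bsub>M\<^esub> y)" "\<lambda>x. \<sigma> y (b \<otimes> x) \<otimes> v x" X] vc \<sigma>c y \<xi>x[OF y]
          by (simp add: Pi_iff del: tw_simps)
        also have "(\<Oplus>x \<in> X. \<sigma> y (b \<otimes> x) \<otimes> v x) = v y \<otimes> b" using v y b by (simp add: casimir_def)
        also have "BB.\<iota> (\<xi> (p \<odot>\<^sup>r\<^bsub>M\<^esub> y)) (v y \<otimes> b) = BB.\<iota> (\<xi> (p \<odot>\<^sup>r\<^bsub>M\<^esub> y)) (v y) \<odot>\<^sup>r\<^bsub>A\<^esub> b"
          using BB.\<iota>_right[OF b, of "\<xi> (p \<odot>\<^sup>r\<^bsub>M\<^esub> y)" "v y"] \<xi>x[OF y] vc[OF y] by (simp del: tw_simps)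
        finally show "(\<Oplus>\<^bsub>A\<^esub>x \<in> X. ?t x y) = BB.\<iota> (\<xi> (p \<odot>\<^sup>r\<^bsub>M\<^esub> y)) (v y) \<odot>\<^sup>r\<^bsub>A\<^esub> b" .
      qed (use \<xi>x vc b in \<open>auto intro!: AA.rsmult_closed simp del: tw_simps\<close>)
      also have "\<dots> = g p \<odot>\<^sup>r\<^bsub>A\<^esub> b"
        unfolding g_def using \<xi>x vc by (intro AA.rsmult_finsum[OF b, symmetric] Pi_I BB.\<iota>_closed) simp_all
      finally show ?thesis .
    qed
    have "mor (bops R) M A g"
    proof (rule morI)
      fix t p assume "t \<in> bops R" "p \<in> carrier M"
      then show "g (act M t p) = act A t (g p)" using mor_act[OF gl] gr by (auto simp del: tw_simps)
    qed (use mor_closed[OF gl] mor_add[OF gl] in auto)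
    from N_mor[OF this basic(2)] show ?case unfolding g_def .
  next
    case (add s t)
    have vc: "v x \<in> carrier R" if "x \<in> X" for x using v that by (simp add: casimir_def)
    have sc: "s x \<in> carrier R" "t x \<in> carrier R" if "x \<in> X" for x
      using N.coef_closed[OF add(1) X_closed[OF that]] N.coef_closed[OF add(2) X_closed[OF that]] .
    have "(\<Oplus>\<^bsub>A\<^esub>x \<in> X. BB.\<iota> (s x \<oplus> t x) (v x)) = (\<Oplus>\<^bsub>A\<^esub>x \<in> X. BB.\<iota> (s x) (v x) \<oplus>\<^bsub>A\<^esub> BB.\<iota> (t x) (v x))"
      using sc vc BB.\<iota>_add_left by (intro AA.M.finsum_cong') (auto simp del: tw_simps)
    also have "\<dots> = (\<Oplus>\<^bsub>A\<^esub>x \<in> X. BB.\<iota> (s x) (v x)) \<oplus>\<^bsub>A\<^esub> (\<Oplus>\<^bsub>A\<^esub>x \<in> X. BB.\<iota> (t x) (v x))"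
      using sc vc by (intro AA.M.finsum_addf Pi_I BB.\<iota>_closed) simp_all
    finally show ?case using N_add[OF add(3,4)] by (simp del: tw_simps)
  next
    case (ext s t)
    have vc: "v x \<in> carrier R" if "x \<in> X" for x using v that by (simp add: casimir_def)
    have "(\<Oplus>\<^bsub>A\<^esub>x \<in> X. BB.\<iota> (t x) (v x)) = (\<Oplus>\<^bsub>A\<^esub>x \<in> X. BB.\<iota> (s x) (v x))"
      using N.coef_closed[OF ext(1) X_closed] vc ext(2) X_closed
      by (intro AA.M.finsum_cong') (auto simp del: tw_simps)
    then show ?case using ext(3) by simp
  qed
  obtain v x0 where v: "casimir v" and x0: "x0 \<in> X" "v x0 \<noteq> \<zero>" using exists_casimir by blast
  have vc: "v x \<in> carrier R" if "x \<in> X" for x using v that by (simp add: casimir_def)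
  \<comment> \<open>\<open>J\<close> contains \<open>v\<^sub>x\<^sub>0\<close> because \<open>\<Sum>\<^sub>x \<sigma>\<^sub>x\<^sub>0 (b' x) \<otimes> b v\<^sub>x = 1 \<otimes> b v\<^sub>x\<^sub>0 b'\<close> by the Casimir relation\<close>
  define J where "J = {u \<in> carrier R. \<forall>b \<in> carrier R. \<forall>b' \<in> carrier R. BB.\<iota> \<one> (b \<otimes> u \<otimes> b') \<in> N}"
  have "v x0 \<in> J"
  proof -
    have "BB.\<iota> \<one> (b \<otimes> v x0 \<otimes> b') \<in> N" if b: "b \<in> carrier R" and b': "b' \<in> carrier R" for b b'
    proof -
      have bv: "casimir (\<lambda>x. b \<otimes> v x)"
        unfolding casimir_def
      proof (intro conjI ballI)
        fix x a assume x: "x \<in> X" and a: "a \<in> carrier R"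
        have ay: "a \<otimes> y \<in> carrier R" if "y \<in> X" for y using a X_closed[OF that] by simp
        note \<sigma>c = \<sigma>_closed[OF x ay]
        have "b \<otimes> v x \<otimes> a = b \<otimes> (\<Oplus>y \<in> X. \<sigma> x (a \<otimes> y) \<otimes> v y)"
          using v x a b vc[OF x] by (simp add: casimir_def csa.m_assoc)
        also have "\<dots> = (\<Oplus>y \<in> X. b \<otimes> (\<sigma> x (a \<otimes> y) \<otimes> v y))"
          using \<sigma>c vc b by (intro csa.finsum_rdistr) auto
        also have "\<dots> = (\<Oplus>y \<in> X. \<sigma> x (a \<otimes> y) \<otimes> (b \<otimes> v y))"
          using \<sigma>c vc b center_comm[OF \<sigma>_in[OF x ay] b] by (intro csa.finsum_cong') (auto simp flip: csa.m_assoc)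
        finally show "b \<otimes> v x \<otimes> a = (\<Oplus>y \<in> X. \<sigma> x (a \<otimes> y) \<otimes> (b \<otimes> v y))" .
      qed (use vc b in simp)
      have b'x: "b' \<otimes> x \<in> carrier R" if "x \<in> X" for x using b' X_closed[OF that] by simp
      note \<sigma>c = \<sigma>_closed[OF x0(1) b'x]
      have "(\<Oplus>\<^bsub>A\<^esub>x \<in> X. BB.\<iota> (\<sigma> x0 (b' \<otimes> x)) (b \<otimes> v x)) = (\<Oplus>\<^bsub>A\<^esub>x \<in> X. BB.\<iota> \<one> (\<sigma> x0 (b' \<otimes> x) \<otimes> (b \<otimes> v x)))"
      proof (rule AA.M.finsum_cong'[OF refl])
        fix x assume x: "x \<in> X"
        show "BB.\<iota> (\<sigma> x0 (b' \<otimes> x)) (b \<otimes> v x) = BB.\<iota> \<one> (\<sigma> x0 (b' \<otimes> x) \<otimes> (b \<otimes> v x))"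
          using BB.\<iota>_balanced[of \<one> "\<sigma> x0 (b' \<otimes> x)" "b \<otimes> v x"] \<sigma>_in[OF x0(1) b'x[OF x]] \<sigma>c[OF x] vc[OF x] b by simp
      qed (use \<sigma>c vc b in \<open>auto simp del: tw_simps\<close>)
      also have "\<dots> = BB.\<iota> \<one> (\<Oplus>x \<in> X. \<sigma> x0 (b' \<otimes> x) \<otimes> (b \<otimes> v x))"
        using mor_finsum[OF BB.\<iota>_mor_right abelian_regular AA.M.abelian_group_axioms,
            of \<one> "\<lambda>x. \<sigma> x0 (b' \<otimes> x) \<otimes> (b \<otimes> v x)" X] \<sigma>c vc b by (simp add: Pi_iff del: tw_simps)
      also have "(\<Oplus>x \<in> X. \<sigma> x0 (b' \<otimes> x) \<otimes> (b \<otimes> v x)) = b \<otimes> v x0 \<otimes> b'"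
        using bv x0(1) b' unfolding casimir_def by simp
      finally show ?thesis using sumN[OF bv N.coef_pre[OF coef[OF x0(1)] b']] by simp
    qed
    then show ?thesis unfolding J_def using vc[OF x0(1)] by blast
  qed
  then have "J = carrier R"
  proof (intro csa.two_sided_full[of J "v x0"])
    show "a \<oplus> b \<in> J" if ab: "a \<in> J" "b \<in> J" for a b
    proof -
      have c: "a \<in> carrier R" "b \<in> carrier R" using ab unfolding J_def by auto
      have "BB.\<iota> \<one> (x \<otimes> (a \<oplus> b) \<otimes> y) \<in> N" if xy: "x \<in> carrier R" "y \<in> carrier R" for x y
      proof -
        have "BB.\<iota> \<one> (x \<otimes> (a \<oplus> b) \<otimes> y) = BB.\<iota> \<one> (x \<otimes> a \<otimes> y) \<oplus>\<^bsub>A\<^esub> BB.\<iota> \<one> (x \<otimes> b \<otimes> y)"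
          using c xy BB.\<iota>_add_right[of \<one> "x \<otimes> a \<otimes> y" "x \<otimes> b \<otimes> y"] by (simp add: csa.r_distr csa.l_distr del: tw_simps)
        then show ?thesis using N_add ab xy unfolding J_def by auto
      qed
      then show ?thesis unfolding J_def using c by auto
    qed
    show "a \<otimes> b \<in> J" "b \<otimes> a \<in> J" if a: "a \<in> carrier R" and b: "b \<in> J" for a b
    proof -
      have bc: "b \<in> carrier R" using b unfolding J_def by blast
      have "x \<otimes> (a \<otimes> b) \<otimes> y = (x \<otimes> a) \<otimes> b \<otimes> y" "x \<otimes> (b \<otimes> a) \<otimes> y = x \<otimes> b \<otimes> (a \<otimes> y)"
        if "x \<in> carrier R" "y \<in> carrier R" for x y using that a bc by (simp_all add: csa.m_assoc)
      then show "a \<otimes> b \<in> J" "b \<otimes> a \<in> J" using a b unfolding J_def by auto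
    qed
  qed (use x0 in \<open>auto simp: J_def\<close>)
  then have "\<one> \<in> J" by simp
  then have "BB.\<iota> \<one> (\<one> \<otimes> \<one> \<otimes> \<one>) \<in> N" unfolding J_def by blast
  then have one: "BB.\<iota> \<one> \<one> \<in> N" by simp
  have "k (BB.\<iota> \<one> \<one>) x = x" if x: "x \<in> carrier Z" for x
  proof -
    note ix = mor_closed[OF i x]
    show ?thesis unfolding k_def gen_map_one[OF ix] by (rule \<pi>i[OF x])
  qed
  then have "bij_betw (k (BB.\<iota> \<one> \<one>)) (carrier Z) (carrier Z)"
    using iffD2[OF bij_betw_cong[of "carrier Z" "k (BB.\<iota> \<one> \<one>)" "\<lambda>x. x"]] bij_betw_id[unfolded id_def] by blast
  then show False using one unfolding N_def by blast
qed

end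

section \<open>A power of the bimodule is free\<close>

lemma (in abelian_group) finsum_Times:
  assumes "finite I" "finite J" "\<And>i j. i \<in> I \<Longrightarrow> j \<in> J \<Longrightarrow> f (i, j) \<in> carrier G"
  shows "(\<Oplus>p \<in> I \<times> J. f p) = (\<Oplus>i \<in> I. \<Oplus>j \<in> J. f (i, j))"
  using assms(1,3)
proof (induction I)
  case empty
  then show ?case by simp
next
  case (insert i I)
  have "insert i I \<times> J = Pair i ` J \<union> I \<times> J" by auto
  then have "(\<Oplus>p \<in> insert i I \<times> J. f p) = (\<Oplus>p \<in> Pair i ` J. f p) \<oplus> (\<Oplus>p \<in> I \<times> J. f p)"
    using insert assms(2) by (simp only:) (intro finsum_Un_disjoint, auto)
  also have "(\<Oplus>p \<in> Pair i ` J. f p) = (\<Oplus>j \<in> J. f (i, j))"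
    using insert.prems by (intro finsum_reindex) (auto simp: inj_on_def)
  also have "(\<Oplus>p \<in> I \<times> J. f p) = (\<Oplus>i \<in> I. \<Oplus>j \<in> J. f (i, j))" using insert by simp
  finally show ?case
    using insert by (subst finsum_insert) (auto intro!: finsum_closed)
qed

text \<open>Among the indecomposable summands of \<open>N\<close> let \<open>Z\<close> be one for which the quotient of its
  multiplicities in \<open>M\<close> and in \<open>N\<close> is least. With these two multiplicities as exponents, the power
  of \<open>N\<close> is a summand of the power of \<open>M\<close>, and \<open>Z\<close> has the same multiplicity in both.\<close>

lemma exists_exhausted_summand:
  fixes M :: "('a, 'b) bimodule" and N :: "('a, 'c) bimodule"
  assumes M: "opmod \<Omega> M" "finite_length \<Omega> M" and N: "opmod \<Omega> N" "finite_length \<Omega> N"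
    and nz: "carrier N \<noteq> {\<zero>\<^bsub>N\<^esub>}"
    and NM: "\<And>Z :: ('a, nat \<Rightarrow> 'c) bimodule. indec \<Omega> Z \<Longrightarrow> Z \<unlhd>\<^bsub>\<Omega>\<^esub> N \<Longrightarrow> Z \<unlhd>\<^bsub>\<Omega>\<^esub> M"
  obtains u v X and Z :: "('a, nat \<Rightarrow> 'c) bimodule"
  where "0 < u" "0 < v" "submod \<Omega> (M ^\<^sub>d v) X" "M ^\<^sub>d v \<simeq>\<^bsub>\<Omega>\<^esub> N ^\<^sub>d u \<oplus>\<^sub>d sub (M ^\<^sub>d v) X"
    "indec \<Omega> Z" "Z \<unlhd>\<^bsub>\<Omega>\<^esub> N" "\<not> Z \<unlhd>\<^bsub>\<Omega>\<^esub> sub (M ^\<^sub>d v) X"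
proof -
  obtain k where k: "len_le \<Omega> N k" using N(2) unfolding finite_length_def by blast
  obtain l where l: "len_le \<Omega> M l" using M(2) unfolding finite_length_def by blast
  define G where "G Z \<longleftrightarrow> indec \<Omega> Z \<and> Z \<unlhd>\<^bsub>\<Omega>\<^esub> N" for Z :: "('a, nat \<Rightarrow> 'c) bimodule"
  have "\<exists>a. has_mult \<Omega> Z N a \<and> a \<le> k" if "indec \<Omega> Z" for Z :: "('a, nat \<Rightarrow> 'c) bimodule"
    using mult_exists[OF that N(1) k] by blast
  then obtain \<alpha> where \<alpha>: "\<And>Z :: ('a, nat \<Rightarrow> 'c) bimodule. indec \<Omega> Z \<Longrightarrow> has_mult \<Omega> Z N (\<alpha> Z) \<and> \<alpha> Z \<le> k" by metis
  have "\<exists>a. has_mult \<Omega> Z M a" if "indec \<Omega> Z" for Z :: "('a, nat \<Rightarrow> 'c) bimodule"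
    using mult_exists[OF that M(1) l] by blast
  then obtain \<mu> where \<mu>: "\<And>Z :: ('a, nat \<Rightarrow> 'c) bimodule. indec \<Omega> Z \<Longrightarrow> has_mult \<Omega> Z M (\<mu> Z)" by metis
  have op: "opmod \<Omega> Z" if "indec \<Omega> Z" for Z :: "('a, nat \<Rightarrow> 'c) bimodule" using that by (simp add: indec_def)
  have \<alpha>0: "\<alpha> Z = 0 \<longleftrightarrow> \<not> Z \<unlhd>\<^bsub>\<Omega>\<^esub> N" if "indec \<Omega> Z" for Z :: "('a, nat \<Rightarrow> 'c) bimodule"
    using mult_zero_iff[OF op[OF that] N(1)] \<alpha>[OF that] mult_unique[OF op[OF that]] by metis
  have \<mu>0: "\<mu> Z = 0 \<longleftrightarrow> \<not> Z \<unlhd>\<^bsub>\<Omega>\<^esub> M" if "indec \<Omega> Z" for Z :: "('a, nat \<Rightarrow> 'c) bimodule"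
    using mult_zero_iff[OF op[OF that] M(1)] \<mu>[OF that] mult_unique[OF op[OF that]] by metis
  have "\<exists>Z. G Z"
  proof -
    have N1: "N ^\<^sub>d 1 \<unlhd>\<^bsub>\<Omega>\<^esub> N"
    proof -
      have "N ^\<^sub>d Suc 0 \<simeq>\<^bsub>\<Omega>\<^esub> N \<oplus>\<^sub>d N ^\<^sub>d 0" by (rule dpow_Suc)
      also have "\<dots> \<simeq>\<^bsub>\<Omega>\<^esub> N ^\<^sub>d 0 \<oplus>\<^sub>d N" by (rule dsum_comm)
      also have "\<dots> \<simeq>\<^bsub>\<Omega>\<^esub> N" by (rule dsum_zero[OF opmod_ipow[OF N(1)] N(1) dpow_zero])
      finally show ?thesis using iso_summand[OF opmod_ipow[OF N(1)]] by (simp only: One_nat_def)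
    qed
    have "carrier (N ^\<^sub>d 1) \<noteq> {\<zero>\<^bsub>N ^\<^sub>d 1\<^esub>}" using dpow_eq_zero[OF N(1) zero_less_one] nz by blast
    moreover obtain n where "len_le \<Omega> (N ^\<^sub>d 1) n"
      using finite_length_ipow[OF N finite_lessThan] unfolding finite_length_def by blast
    ultimately obtain U where "indec \<Omega> (sub (N ^\<^sub>d 1) U)" "sub (N ^\<^sub>d 1) U \<unlhd>\<^bsub>\<Omega>\<^esub> N ^\<^sub>d 1"
      using exists_indec_summand[OF opmod_ipow[OF N(1)]] by blast
    then have "G (sub (N ^\<^sub>d 1) U)" using summand_trans[OF _ N1] unfolding G_def by blast
    then show ?thesis by blast
  qed
  then obtain Z1 where "G Z1" by blast
  \<comment> \<open>the factor \<open>fact k\<close> turns the quotients \<open>\<mu> Z / \<alpha> Z\<close> into natural numbers\<close>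
  from ex_has_least_nat[of G, OF this, of "\<lambda>Z. \<mu> Z * (fact k div \<alpha> Z)"]
  obtain Z where Z: "G Z" and least: "\<And>Y. G Y \<Longrightarrow> \<mu> Z * (fact k div \<alpha> Z) \<le> \<mu> Y * (fact k div \<alpha> Y)" by blast
  have Zi: "indec \<Omega> Z" and ZN: "Z \<unlhd>\<^bsub>\<Omega>\<^esub> N" using Z by (auto simp: G_def)
  have pos: "0 < \<alpha> Z" "0 < \<mu> Z" using \<alpha>0[OF Zi] \<mu>0[OF Zi] ZN NM[OF Zi ZN] by auto
  have ratio: "\<mu> Z * \<alpha> Y \<le> \<mu> Y * \<alpha> Z" if Y: "indec \<Omega> Y" for Y
  proof (cases "Y \<unlhd>\<^bsub>\<Omega>\<^esub> N")
    case True
    then have "0 < \<alpha> Y" using \<alpha>0[OF Y] by auto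
    have dv: "\<alpha> Y dvd fact k" "\<alpha> Z dvd fact k"
      using \<alpha>[OF Y] \<alpha>[OF Zi] \<open>0 < \<alpha> Y\<close> pos(1) by (auto intro!: dvd_fact)
    have "\<mu> Z * \<alpha> Y * fact k = \<mu> Z * (fact k div \<alpha> Z) * (\<alpha> Y * \<alpha> Z)"
      using dv(2) by (simp add: algebra_simps)
    also have "\<dots> \<le> \<mu> Y * (fact k div \<alpha> Y) * (\<alpha> Y * \<alpha> Z)"
      using least[of Y] Y True by (intro mult_right_mono) (auto simp: G_def)
    also have "\<dots> = \<mu> Y * \<alpha> Z * fact k" using dv(1) by (simp add: algebra_simps)
    finally show ?thesis by simp
  next
    case False
    then show ?thesis using \<alpha>0[OF Y] by simp
  qed
  let ?M = "M ^\<^sub>d \<alpha> Z" and ?N = "N ^\<^sub>d \<mu> Z"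
  note Mv = opmod_ipow[OF M(1)] and Nu = opmod_ipow[OF N(1)]
  obtain n where n: "len_le \<Omega> ?N n" using finite_length_ipow[OF N finite_lessThan] unfolding finite_length_def by blast
  have "?N \<unlhd>\<^bsub>\<Omega>\<^esub> ?M"
  proof (rule summand_of_mult_le[OF Nu n Mv finite_length_ipow[OF M finite_lessThan]])
    fix Y :: "('a, nat \<Rightarrow> 'c) bimodule" and i j
    assume Y: "indec \<Omega> Y" and ij: "has_mult \<Omega> Y ?N i" "has_mult \<Omega> Y ?M j"
    have "i = \<mu> Z * \<alpha> Y" using mult_unique[OF op[OF Y] ij(1) mult_dpow[OF Y N(1)]] \<alpha>[OF Y] by blast
    moreover have "j = \<alpha> Z * \<mu> Y" using mult_unique[OF op[OF Y] ij(2) mult_dpow[OF Y M(1) \<mu>[OF Y]]] .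
    ultimately show "i \<le> j" using ratio[OF Y] by (simp add: mult.commute)
  qed
  then obtain f g where fg: "mor \<Omega> ?N ?M f" "mor \<Omega> ?M ?N g" "\<And>x. x \<in> carrier ?N \<Longrightarrow> g (f x) = x"
    using summand_mors by metis
  let ?X = "{x \<in> carrier ?M. g x = \<zero>\<^bsub>?N\<^esub>}"
  have X: "submod \<Omega> ?M ?X" by (rule submod_ker[OF fg(2) Mv Nu])
  note Xm = opmod_sub[OF Mv X]
  have iso: "?M \<simeq>\<^bsub>\<Omega>\<^esub> ?N \<oplus>\<^sub>d sub ?M ?X" by (rule summand_complement[OF Nu Mv fg(1) fg(2)]) (rule fg(3))
  have "finite_length \<Omega> (sub ?M ?X)"
    by (rule finite_length_summand[OF summand_trans[OF summand_dsum(2)[OF Nu Xm] iso_summand'[OF Mv iso]] Xm Mv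
          finite_length_ipow[OF M finite_lessThan]])
  then obtain x where x: "has_mult \<Omega> Z (sub ?M ?X) x" using mult_exists[OF Zi Xm] unfolding finite_length_def by blast
  have "has_mult \<Omega> Z ?M (\<mu> Z * \<alpha> Z + x)"
    using mult_dsum[OF Zi Nu Xm mult_dpow[OF Zi N(1)] x] \<alpha>[OF Zi] mult_iso[OF Mv iso] by blast
  then have "\<mu> Z * \<alpha> Z + x = \<alpha> Z * \<mu> Z" using mult_unique[OF op[OF Zi]] mult_dpow[OF Zi M(1) \<mu>[OF Zi]] by blast
  then have "\<not> Z \<unlhd>\<^bsub>\<Omega>\<^esub> sub ?M ?X" using x mult_zero_iff[OF op[OF Zi] Xm] by (simp add: mult.commute)
  with pos X iso Zi ZN show thesis by (intro that[of "\<mu> Z" "\<alpha> Z"])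
qed

text \<open>If \<open>r\<close> is the multiplicity of \<open>Z\<close> in \<open>Y\<close>, then \<open>v r\<close> and \<open>n\<close> are both the multiplicity of \<open>Z\<close>
  in the given power.\<close>

lemma dpow_indec_exponent:
  assumes Z: "indec \<Omega> Z" and Y: "opmod \<Omega> Y" and v: "0 < v" and iso: "Y ^\<^sub>d v \<simeq>\<^bsub>\<Omega>\<^esub> Z ^\<^sub>d n"
  obtains r where "v * r = n"
proof -
  have Zm: "opmod \<Omega> Z" "finite_length \<Omega> Z" using Z by (auto simp: indec_def)
  have "Y \<unlhd>\<^bsub>\<Omega>\<^esub> Y \<oplus>\<^sub>d Y ^\<^sub>d (v - 1)" by (rule summand_dsum(1)[OF Y opmod_ipow[OF Y]])
  also have "\<dots> \<unlhd>\<^bsub>\<Omega>\<^esub> Y ^\<^sub>d v"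
    using iso_summand'[OF opmod_ipow[OF Y] dpow_Suc[of Y "v - 1"]] v by simp
  also have "\<dots> \<unlhd>\<^bsub>\<Omega>\<^esub> Z ^\<^sub>d n" by (rule iso_summand[OF opmod_ipow[OF Y] iso])
  finally have "finite_length \<Omega> Y"
    by (rule finite_length_summand[OF _ Y opmod_ipow[OF Zm(1)] finite_length_ipow[OF Zm finite_lessThan]])
  then obtain r where r: "has_mult \<Omega> Z Y r" using mult_exists[OF Z Y] unfolding finite_length_def by blast
  have "has_mult \<Omega> Z (Z ^\<^sub>d n) (n * 1)" by (rule mult_dpow[OF Z Zm(1) mult_self[OF Z]])
  moreover have "has_mult \<Omega> Z (Z ^\<^sub>d n) (v * r)"
    using mult_dpow[OF Z Y r] mult_iso[OF opmod_ipow[OF Y] iso] by blast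
  ultimately have "v * r = n" using mult_unique[OF Zm(1)] by fastforce
  then show thesis by (rule that)
qed

lemma (in ring) indec_subfield:
  assumes K: "subfield K R" shows "indec (lops K) (sub (regular_bimodule R) K)"
proof -
  interpret B: bimodule R "regular_bimodule R" by (rule bimodule_regular)
  note KE = subringE[OF subfieldE(1)[OF K]]
  let ?K = "sub (regular_bimodule R) K"
  have Km: "opmod (lops K) ?K"
    by (rule opmod_sub[OF B.opmod_lops[OF KE(1)]]) (use KE in \<open>auto simp: submod_def\<close>)
  have "(\<forall>x \<in> K. e x = \<zero>) \<or> (\<forall>x \<in> K. e x = x)"
    if e: "mor (lops K) ?K ?K e" "\<forall>x \<in> carrier ?K. e (e x) = e x" for e
  proof -
    have lin: "e x = x \<otimes> e \<one>" if "x \<in> K" for x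
      using mor_act[OF e(1), of \<one> "Inl x"] that KE(1,3) by auto
    have e1: "e \<one> \<in> K" using mor_closed[OF e(1)] KE(3) by simp
    have "e \<one> \<otimes> e \<one> = e \<one>" using lin[OF e1] e(2) KE(3) by simp
    show ?thesis
    proof (cases "e \<one> = \<zero>")
      case True
      then show ?thesis using lin KE(1) by auto
    next
      case False
      then have i: "inv (e \<one>) \<in> K" "inv (e \<one>) \<otimes> e \<one> = \<one>" using subfield_m_inv[OF K] e1 by auto
      have "e \<one> = inv (e \<one>) \<otimes> (e \<one> \<otimes> e \<one>)" using i e1 KE(1) by (simp add: subset_iff flip: m_assoc)
      also have "\<dots> = \<one>" using i \<open>e \<one> \<otimes> e \<one> = e \<one>\<close> by simp
      finally show ?thesis using lin KE(1) by auto
    qed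
  qed
  moreover have "\<one> \<noteq> \<zero>" using subfieldE(6)[OF K] by simp
  ultimately show ?thesis unfolding indec_def using Km subfield_finite_length[OF K] KE(3) by auto
qed

subsection \<open>Tensoring with a Galois bimodule preserves freeness\<close>

context galois_dual
begin

text \<open>The functor \<open>T\<close> is \<open>- \<otimes>\<^sub>B P\<close> in the left basis of \<open>P\<close>, for bimodules over arbitrary
  carrier types.\<close>

definition \<Phi> :: "'a \<Rightarrow> nat \<Rightarrow> nat \<Rightarrow> 'a" where
  "\<Phi> b i j = c j (e i \<odot>\<^sup>r\<^bsub>P\<^esub> b)"

abbreviation T :: "('a, 'e) bimodule \<Rightarrow> ('a, nat \<Rightarrow> 'e) bimodule" where
  "T M \<equiv> tw M {..<d} \<Phi>"

lemma \<Phi>_closed: "b \<in> carrier R \<Longrightarrow> i \<in> {..<d} \<Longrightarrow> j \<in> {..<d} \<Longrightarrow> \<Phi> b i j \<in> carrier R"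
  unfolding \<Phi>_def by (intro c_closed rsmult_closed) simp_all

abbreviation I2 :: "(nat \<times> 'a) set" where "I2 \<equiv> {..<d} \<times> X"

text \<open>The bimodule \<open>B \<otimes>\<^sub>K P\<close> can be computed in two bases of \<open>P\<close> over its center \<open>K\<close>: the products of
  the basis of the algebra with the left basis of \<open>P\<close> give \<open>T A\<close>, and the products with the right
  basis give a power of \<open>A\<close>.\<close>

lemma lbasis_left: "lbasis R P K I2 (\<lambda>(k, x). x \<odot>\<^bsub>P\<^esub> e k) (\<lambda>(k, x) p. \<sigma> x (c k p))"
proof (intro lbasis.intro lbasis_axioms.intro bimodule_axioms, goal_cases)
  case 1 show ?case using center_closed by blast
next
  case 2 show ?case by simp
next
  case (3 i) then show ?case using X_closed by (auto intro!: lsmult_closed)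
next
  case (4 i y) then show ?case by (auto intro!: \<sigma>_in)
next
  case (5 i y y') then show ?case using D.c_add by (auto simp: c_add)
next
  case (6 i z y) then show ?case using D.c_smult center_closed by (auto simp: c_smult)
next
  case (7 i j)
  have z: "\<sigma> x \<zero> = \<zero>" if "x \<in> X" for x
    using mor_zero[OF D.c_mor[OF that] abelian_regular abelian_regular] by simp
  from 7 show ?case using \<sigma>_dual X_closed z by (auto simp: c_smult c_e split: if_splits)
next
  case (8 p)
  have mem: "\<sigma> x (c k p) \<odot>\<^bsub>P\<^esub> (x \<odot>\<^bsub>P\<^esub> e k) \<in> carrier P" if "k < d" "x \<in> X" for k x
    using that X_closed 8 \<sigma>_closed by (intro lsmult_closed) auto
  have "finsum P (\<lambda>i. (case i of (k, x) \<Rightarrow> \<lambda>p. \<sigma> x (c k p)) p \<odot>\<^bsub>P\<^esub> (case i of (k, x) \<Rightarrow> x \<odot>\<^bsub>P\<^esub> e k)) I2 =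
      finsum P (\<lambda>k. finsum P (\<lambda>x. \<sigma> x (c k p) \<odot>\<^bsub>P\<^esub> (x \<odot>\<^bsub>P\<^esub> e k)) X) {..<d}"
    using mem by (subst M.finsum_Times) auto
  also have "\<dots> = finsum P (\<lambda>k. c k p \<odot>\<^bsub>P\<^esub> e k) {..<d}"
  proof (rule M.finsum_cong'[OF refl])
    fix k assume k: "k \<in> {..<d}"
    have "finsum P (\<lambda>x. \<sigma> x (c k p) \<odot>\<^bsub>P\<^esub> (x \<odot>\<^bsub>P\<^esub> e k)) X = finsum P (\<lambda>x. (\<sigma> x (c k p) \<otimes> x) \<odot>\<^bsub>P\<^esub> e k) X"
      using k 8 X_closed \<sigma>_closed by (intro M.finsum_cong') (auto simp: lsmult_assoc lsmult_closed)
    also have "\<dots> = (\<Oplus>x \<in> X. \<sigma> x (c k p) \<otimes> x) \<odot>\<^bsub>P\<^esub> e k"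
      using k 8 X_closed \<sigma>_closed by (intro smult_finsum_left[symmetric]) auto
    finally show "finsum P (\<lambda>x. \<sigma> x (c k p) \<odot>\<^bsub>P\<^esub> (x \<odot>\<^bsub>P\<^esub> e k)) X = c k p \<odot>\<^bsub>P\<^esub> e k"
      using \<sigma>_expand k 8 by simp
  qed (use 8 in \<open>auto intro: lsmult_closed\<close>)
  also have "\<dots> = p" by (rule expand[OF 8])
  finally show ?case .
qed

lemma \<beta>_closed: "k < d \<Longrightarrow> p \<in> carrier P \<Longrightarrow> \<beta> k p \<in> carrier R"
  using mor_closed[OF \<beta>_mor] by simp

lemma \<beta>_right: "k < d \<Longrightarrow> p \<in> carrier P \<Longrightarrow> b \<in> carrier R \<Longrightarrow> \<beta> k (p \<odot>\<^sup>r\<^bsub>P\<^esub> b) = \<beta> k p \<otimes> b"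
  using mor_act[OF \<beta>_mor, of k p "Inr b"] by simp

lemma lbasis_right: "lbasis R P K I2 (\<lambda>(k, x). q k \<odot>\<^sup>r\<^bsub>P\<^esub> x) (\<lambda>(k, x) p. \<sigma> x (\<beta> k p))"
proof (intro lbasis.intro lbasis_axioms.intro bimodule_axioms, goal_cases)
  case 1 show ?case using center_closed by blast
next
  case 2 show ?case by simp
next
  case (3 i) then show ?case using X_closed q_closed by (auto intro!: rsmult_closed)
next
  case (4 i y) then show ?case by (auto intro!: \<sigma>_in \<beta>_closed)
next
  case (5 i y y') then show ?case using D.c_add \<beta>_closed mor_add[OF \<beta>_mor] by auto
next
  case (6 i z y)
  then obtain k x where i: "i = (k, x)" "k < d" "x \<in> X" by auto
  have "\<beta> k (z \<odot>\<^bsub>P\<^esub> y) = z \<otimes> \<beta> k y"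
    using 6 i \<beta>_right center_closed center_act center_comm[OF 6(2) \<beta>_closed[OF i(2) 6(3)]] by simp
  then show ?case using D.c_smult[OF i(3) 6(2)] \<beta>_closed[OF i(2) 6(3)] i by simp
next
  case (7 i j)
  have z: "\<sigma> x \<zero> = \<zero>" if "x \<in> X" for x
    using mor_zero[OF D.c_mor[OF that] abelian_regular abelian_regular] by simp
  from 7 show ?case using \<sigma>_dual X_closed z by (auto simp: \<beta>_right q_closed \<beta>_q split: if_splits)
next
  case (8 p)
  have eq: "\<sigma> x (\<beta> k p) \<odot>\<^bsub>P\<^esub> (q k \<odot>\<^sup>r\<^bsub>P\<^esub> x) = q k \<odot>\<^sup>r\<^bsub>P\<^esub> (\<sigma> x (\<beta> k p) \<otimes> x)" if kx: "k < d" "x \<in> X" for k x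
  proof -
    note s = \<sigma>_in[OF kx(2) \<beta>_closed[OF kx(1) 8]]
    have "\<sigma> x (\<beta> k p) \<odot>\<^bsub>P\<^esub> (q k \<odot>\<^sup>r\<^bsub>P\<^esub> x) = (\<sigma> x (\<beta> k p) \<odot>\<^bsub>P\<^esub> q k) \<odot>\<^sup>r\<^bsub>P\<^esub> x"
      using kx X_closed q_closed center_closed[OF s] by (intro lsmult_rsmult[symmetric]) auto
    also have "\<dots> = (q k \<odot>\<^sup>r\<^bsub>P\<^esub> \<sigma> x (\<beta> k p)) \<odot>\<^sup>r\<^bsub>P\<^esub> x" using center_act[OF s q_closed[OF kx(1)]] by simp
    also have "\<dots> = q k \<odot>\<^sup>r\<^bsub>P\<^esub> (\<sigma> x (\<beta> k p) \<otimes> x)"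
      using kx X_closed q_closed center_closed[OF s] by (simp add: rsmult_assoc)
    finally show ?thesis .
  qed
  have mem: "q k \<odot>\<^sup>r\<^bsub>P\<^esub> (\<sigma> x (\<beta> k p) \<otimes> x) \<in> carrier P" if "k < d" "x \<in> X" for k x
    using that X_closed 8 \<sigma>_closed \<beta>_closed q_closed by (intro rsmult_closed) auto
  have "finsum P (\<lambda>i. (case i of (k, x) \<Rightarrow> \<lambda>p. \<sigma> x (\<beta> k p)) p \<odot>\<^bsub>P\<^esub> (case i of (k, x) \<Rightarrow> q k \<odot>\<^sup>r\<^bsub>P\<^esub> x)) I2 =
      finsum P (\<lambda>k. finsum P (\<lambda>x. \<sigma> x (\<beta> k p) \<odot>\<^bsub>P\<^esub> (q k \<odot>\<^sup>r\<^bsub>P\<^esub> x)) X) {..<d}"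
    using mem eq by (subst M.finsum_Times) auto
  also have "\<dots> = finsum P (\<lambda>k. q k \<odot>\<^sup>r\<^bsub>P\<^esub> \<beta> k p) {..<d}"
  proof (rule M.finsum_cong'[OF refl])
    fix k assume k: "k \<in> {..<d}"
    have "finsum P (\<lambda>x. \<sigma> x (\<beta> k p) \<odot>\<^bsub>P\<^esub> (q k \<odot>\<^sup>r\<^bsub>P\<^esub> x)) X = finsum P (\<lambda>x. q k \<odot>\<^sup>r\<^bsub>P\<^esub> (\<sigma> x (\<beta> k p) \<otimes> x)) X"
      using k eq mem by (intro M.finsum_cong') auto
    also have "\<dots> = q k \<odot>\<^sup>r\<^bsub>P\<^esub> (\<Oplus>x \<in> X. \<sigma> x (\<beta> k p) \<otimes> x)"
      using k 8 X_closed \<sigma>_closed \<beta>_closed q_closed by (intro rsmult_finsum_right[symmetric]) auto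
    finally show "finsum P (\<lambda>x. \<sigma> x (\<beta> k p) \<odot>\<^bsub>P\<^esub> (q k \<odot>\<^sup>r\<^bsub>P\<^esub> x)) X = q k \<odot>\<^sup>r\<^bsub>P\<^esub> \<beta> k p"
      using \<sigma>_expand \<beta>_closed k 8 by simp
  qed (use 8 \<beta>_closed q_closed in \<open>auto intro: rsmult_closed\<close>)
  also have "\<dots> = p" by (rule \<beta>_expand[OF 8])
  finally show ?case .
qed

text \<open>The form common to \<open>T A\<close> and the power of \<open>A\<close>: families indexed by \<open>k\<close> of families indexed by
  \<open>x\<close>, as opposed to families indexed by the pairs \<open>(k, x)\<close>.\<close>

lemma curry_iso:
  fixes Q :: "('a, nat \<Rightarrow> 'a \<Rightarrow> 'a) bimodule"
  assumes Q: "carrier Q = {..<d} \<rightarrow>\<^sub>E carrier A" "\<And>f g. f \<oplus>\<^bsub>Q\<^esub> g = (\<lambda>k \<in> {..<d}. f k \<oplus>\<^bsub>A\<^esub> g k)"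
    "\<And>b f. b \<in> carrier R \<Longrightarrow> f \<in> carrier Q \<Longrightarrow> b \<odot>\<^bsub>Q\<^esub> f = (\<lambda>k \<in> {..<d}. b \<odot>\<^bsub>A\<^esub> f k)"
    and r: "\<And>b f l y. b \<in> carrier R \<Longrightarrow> f \<in> carrier Q \<Longrightarrow> l \<in> {..<d} \<Longrightarrow> y \<in> X \<Longrightarrow>
      (f \<odot>\<^sup>r\<^bsub>Q\<^esub> b) l y = (\<Oplus>k \<in> {..<d}. \<Oplus>x \<in> X. f k x \<otimes> \<Psi>' b (k, x) (l, y))"
    and \<Psi>': "\<And>b i j. b \<in> carrier R \<Longrightarrow> i \<in> I2 \<Longrightarrow> j \<in> I2 \<Longrightarrow> \<Psi>' b i j \<in> carrier R"
  shows "Q \<simeq>\<^bsub>bops R\<^esub> tw B I2 \<Psi>'"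
proof (rule bij_mor_witness[where f = "\<lambda>f. \<lambda>i \<in> I2. f (fst i) (snd i)"
      and g = "\<lambda>g. \<lambda>k \<in> {..<d}. \<lambda>x \<in> X. g (k, x)"], goal_cases)
  case 1
  show ?case
  proof (rule morI, goal_cases)
    case (1 f)
    then show ?case using Q(1) by (auto simp: PiE_iff)
  next
    case (2 f g)
    then show ?case unfolding Q(2) by (auto intro!: restrict_ext)
  next
    case (3 t f)
    have fc: "f k x \<in> carrier R" if "k \<in> {..<d}" "x \<in> X" for k x using 3(2) that unfolding Q(1) by auto
    show ?case
    proof (cases t)
      case (Inl b)
      then have b: "b \<in> carrier R" using 3 by auto
      show ?thesis unfolding Inl act_simps Q(3)[OF b 3(2)] by (auto intro!: restrict_ext)
    next
      case (Inr b)
      then have b: "b \<in> carrier R" using 3 by auto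
      have "(f \<odot>\<^sup>r\<^bsub>Q\<^esub> b) l y = (\<Oplus>i \<in> I2. (\<lambda>i \<in> I2. f (fst i) (snd i)) i \<otimes> \<Psi>' b i (l, y))"
        if ly: "l \<in> {..<d}" "y \<in> X" for l y
      proof -
        have "(f \<odot>\<^sup>r\<^bsub>Q\<^esub> b) l y = (\<Oplus>k \<in> {..<d}. \<Oplus>x \<in> X. f k x \<otimes> \<Psi>' b (k, x) (l, y))" by (rule r[OF b 3(2) ly])
        also have "\<dots> = (\<Oplus>i \<in> I2. f (fst i) (snd i) \<otimes> \<Psi>' b i (l, y))"
          using fc \<Psi>'[OF b] ly by (subst csa.finsum_Times) auto
        also have "\<dots> = (\<Oplus>i \<in> I2. (\<lambda>i \<in> I2. f (fst i) (snd i)) i \<otimes> \<Psi>' b i (l, y))"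
          using fc \<Psi>'[OF b] ly by (intro csa.finsum_cong') auto
        finally show ?thesis .
      qed
      then show ?thesis unfolding Inr act_simps by (auto intro!: restrict_ext)
    qed
  qed
next
  case (2 g)
  then show ?case unfolding Q(1) by auto
next
  case (3 f)
  then have f: "f \<in> {..<d} \<rightarrow>\<^sub>E (X \<rightarrow>\<^sub>E carrier R)" unfolding Q(1) by simp
  show ?case
  proof (rule PiE_ext[OF _ f])
    fix k assume k: "k \<in> {..<d}"
    then have "f k \<in> X \<rightarrow>\<^sub>E carrier R" using f by auto
    then show "(\<lambda>k \<in> {..<d}. \<lambda>x \<in> X. (\<lambda>i \<in> I2. f (fst i) (snd i)) (k, x)) k = f k"
      using k by (auto simp: fun_eq_iff PiE_def extensional_def)
  qed (use f in \<open>auto simp: PiE_iff\<close>)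
next
  case (4 g)
  then show ?case by (auto simp: fun_eq_iff PiE_def extensional_def)
qed

lemma T_A: "T A \<simeq>\<^bsub>bops R\<^esub> A ^\<^sub>d d"
proof -
  interpret AA: bimodule R A by (rule BB.bimodule_W)
  interpret L: tensor_basis R B P K I2 "\<lambda>(k, x). x \<odot>\<^bsub>P\<^esub> e k" "\<lambda>(k, x) p. \<sigma> x (c k p)"
    by (intro tensor_basis.intro B.bimodule_axioms lbasis_left)
  interpret Rr: tensor_basis R B P K I2 "\<lambda>(k, x). q k \<odot>\<^sup>r\<^bsub>P\<^esub> x" "\<lambda>(k, x) p. \<sigma> x (\<beta> k p)"
    by (intro tensor_basis.intro B.bimodule_axioms lbasis_right)
  interpret TP: bimodule_pair R B P K
    by (intro bimodule_pair.intro bimodule_pair_axioms.intro B.bimodule_axioms bimodule_axioms)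
      (use center_closed in blast)
  interpret TPb: bimodule R "tensor K B P" by (rule TP.bimodule_tensor)
  have z: "\<sigma> x \<zero> = \<zero>" if "x \<in> X" for x
    using mor_zero[OF D.c_mor[OF that] abelian_regular abelian_regular] by simp
  have Tm: "opmod (bops R) (T A)" by (rule opmod_tw[OF BB.bimodule_W \<Phi>_closed])
  have left: "T A \<simeq>\<^bsub>bops R\<^esub> L.W"
  proof (rule curry_iso)
    fix b f l y assume b: "b \<in> carrier R" and f: "f \<in> carrier (T A)" and l: "l \<in> {..<d}" and y: "y \<in> X"
    have fA: "f k \<in> carrier A" if "k \<in> {..<d}" for k using f that by auto
    note fc = A_closed[OF fA]
    have ev: "mor {} A B (\<lambda>a. a y)" by (rule morI) (use y in auto)
    have "(f \<odot>\<^sup>r\<^bsub>T A\<^esub> b) l y = (\<Oplus>\<^bsub>A\<^esub>k \<in> {..<d}. f k \<odot>\<^sup>r\<^bsub>A\<^esub> \<Phi> b k l) y"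
      using l by (simp only: tw_simps(5) restrict_apply if_True)
    also have "\<dots> = (\<Oplus>k \<in> {..<d}. (f k \<odot>\<^sup>r\<^bsub>A\<^esub> \<Phi> b k l) y)"
      using mor_finsum[OF ev AA.M.abelian_group_axioms abelian_regular, of "\<lambda>k. f k \<odot>\<^sup>r\<^bsub>A\<^esub> \<Phi> b k l" "{..<d}"]
        fA \<Phi>_closed[OF b _ l] AA.rsmult_closed by (simp add: Pi_iff del: tw_simps)
    also have "\<dots> = (\<Oplus>k \<in> {..<d}. \<Oplus>x \<in> X. f k x \<otimes> L.\<Psi> b (k, x) (l, y))"
    proof (rule csa.finsum_cong'[OF refl])
      fix k assume k: "k \<in> {..<d}"
      have "(f k \<odot>\<^sup>r\<^bsub>A\<^esub> \<Phi> b k l) y = (\<Oplus>x \<in> X. f k x \<otimes> BB.\<Psi> (\<Phi> b k l) x y)" using y by simp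
      also have "\<dots> = (\<Oplus>x \<in> X. f k x \<otimes> L.\<Psi> b (k, x) (l, y))"
      proof (rule csa.finsum_cong'[OF refl])
        fix x assume x: "x \<in> X"
        have "c l ((x \<odot>\<^bsub>P\<^esub> e k) \<odot>\<^sup>r\<^bsub>P\<^esub> b) = x \<otimes> \<Phi> b k l"
          using k l b X_closed[OF x] by (simp add: \<Phi>_def lsmult_rsmult c_smult rsmult_closed)
        then show "f k x \<otimes> BB.\<Psi> (\<Phi> b k l) x y = f k x \<otimes> L.\<Psi> b (k, x) (l, y)"
          by (simp add: BB.\<Psi>_def L.\<Psi>_def)
      qed (use fc[OF k] L.\<Psi>_closed[OF b] k l y in auto)
      finally show "(f k \<odot>\<^sup>r\<^bsub>A\<^esub> \<Phi> b k l) y = (\<Oplus>x \<in> X. f k x \<otimes> L.\<Psi> b (k, x) (l, y))" .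
    qed (use fc L.\<Psi>_closed[OF b] l y in \<open>auto intro!: csa.finsum_closed\<close>)
    finally show "(f \<odot>\<^sup>r\<^bsub>T A\<^esub> b) l y = (\<Oplus>k \<in> {..<d}. \<Oplus>x \<in> X. f k x \<otimes> L.\<Psi> b (k, x) (l, y))" .
  qed (use L.\<Psi>_closed in \<open>auto simp del: tw_simps(1) simp add: tw_simps(1)[of A]\<close>)
  have right: "A ^\<^sub>d d \<simeq>\<^bsub>bops R\<^esub> Rr.W"
  proof (rule curry_iso)
    fix b f l y assume b: "b \<in> carrier R" and f: "f \<in> carrier (A ^\<^sub>d d)" and l: "l \<in> {..<d}" and y: "y \<in> X"
    have fA: "f k \<in> carrier A" if "k \<in> {..<d}" for k using f that by auto
    note fc = A_closed[OF fA]
    have \<Psi>: "Rr.\<Psi> b (k, x) (l, y) = (if l = k then \<sigma> y (x \<otimes> b) else \<zero>)" if k: "k \<in> {..<d}" and x: "x \<in> X" for k x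
      using k x l y b X_closed[OF x] q_closed z by (simp add: Rr.\<Psi>_def \<beta>_right rsmult_closed \<beta>_q)
    have "(\<Oplus>k \<in> {..<d}. \<Oplus>x \<in> X. f k x \<otimes> Rr.\<Psi> b (k, x) (l, y)) =
        (\<Oplus>k \<in> {..<d}. if l = k then (\<Oplus>x \<in> X. f k x \<otimes> \<sigma> y (x \<otimes> b)) else \<zero>)"
    proof (rule csa.finsum_cong'[OF refl])
      fix k assume k: "k \<in> {..<d}"
      show "(\<Oplus>x \<in> X. f k x \<otimes> Rr.\<Psi> b (k, x) (l, y)) = (if l = k then (\<Oplus>x \<in> X. f k x \<otimes> \<sigma> y (x \<otimes> b)) else \<zero>)"
      proof (cases "l = k")
        case True
        have "(\<Oplus>x \<in> X. f k x \<otimes> Rr.\<Psi> b (k, x) (l, y)) = (\<Oplus>x \<in> X. f k x \<otimes> \<sigma> y (x \<otimes> b))"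
          using \<Psi>[OF k] True fc[OF k] \<sigma>_closed[OF y] X_closed b by (intro csa.finsum_cong') auto
        then show ?thesis using True by simp
      next
        case False
        have "(\<Oplus>x \<in> X. f k x \<otimes> Rr.\<Psi> b (k, x) (l, y)) = \<zero>"
          using \<Psi>[OF k] False fc[OF k] by (intro csa.add.finprod_one_eqI) auto
        then show ?thesis using False by simp
      qed
    qed (use fc \<sigma>_closed[OF y] X_closed b in \<open>auto intro!: csa.finsum_closed\<close>)
    also have "\<dots> = (\<Oplus>x \<in> X. f l x \<otimes> \<sigma> y (x \<otimes> b))"
      using fc \<sigma>_closed[OF y] X_closed b by (intro csa.finsum_singleton[OF l]) (auto intro!: csa.finsum_closed)
    also have "\<dots> = (f l \<odot>\<^sup>r\<^bsub>A\<^esub> b) y" using y by (simp add: BB.\<Psi>_def)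
    finally show "(f \<odot>\<^sup>r\<^bsub>A ^\<^sub>d d\<^esub> b) l y = (\<Oplus>k \<in> {..<d}. \<Oplus>x \<in> X. f k x \<otimes> Rr.\<Psi> b (k, x) (l, y))"
      using l by (simp del: tw_simps)
  qed (use Rr.\<Psi>_closed in \<open>auto simp del: tw_simps(1) simp add: tw_simps(1)[of A]\<close>)
  have "T A \<simeq>\<^bsub>bops R\<^esub> tensor K B P"
    by (rule iso_trans[OF left iso_sym[OF TPb.opmod_bops L.tensor_iso_tw]])
  also have "tensor K B P \<simeq>\<^bsub>bops R\<^esub> A ^\<^sub>d d"
    by (rule iso_trans[OF Rr.tensor_iso_tw iso_sym[OF opmod_ipow[OF AA.opmod_bops] right]])
  finally show ?thesis .
qed

subsection \<open>Homomorphisms to the algebra\<close>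

text \<open>The bimodule maps from \<open>M\<close> to the algebra form a vector space over the center \<open>L\<close> of the algebra. The
  right action is a placeholder.\<close>

definition homB :: "('a, 'e) bimodule \<Rightarrow> ('a, 'e \<Rightarrow> 'a) bimodule" where
  "homB M = \<lparr>carrier = {f \<in> carrier M \<rightarrow>\<^sub>E carrier R. mor (bops R) M B f}, monoid.mult = undefined,
    one = undefined, ring.zero = (\<lambda>x \<in> carrier M. \<zero>), add = (\<lambda>f g. \<lambda>x \<in> carrier M. f x \<oplus> g x),
    smult = (\<lambda>z f. \<lambda>x \<in> carrier M. z \<otimes> f x), rsmult = (\<lambda>f a. f)\<rparr>"

lemma homB_simps:
  "carrier (homB M) = {f \<in> carrier M \<rightarrow>\<^sub>E carrier R. mor (bops R) M B f}"
  "\<zero>\<^bsub>homB M\<^esub> = (\<lambda>x \<in> carrier M. \<zero>)" "f \<oplus>\<^bsub>homB M\<^esub> g = (\<lambda>x \<in> carrier M. f x \<oplus> g x)"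
  "z \<odot>\<^bsub>homB M\<^esub> f = (\<lambda>x \<in> carrier M. z \<otimes> f x)"
  by (simp_all add: homB_def)

lemma homBI:
  assumes "bimodule R M" "mor (bops R) M B f" shows "(\<lambda>x \<in> carrier M. f x) \<in> carrier (homB M)"
proof -
  interpret N: bimodule R M by fact
  have "mor (bops R) M B (\<lambda>x \<in> carrier M. f x)" by (rule mor_cong[OF N.opmod_bops assms(2)]) simp
  then show ?thesis using mor_closed[OF assms(2)] by (simp add: homB_simps)
qed

lemma homBD:
  assumes "f \<in> carrier (homB M)"
  shows "mor (bops R) M B f" "x \<in> carrier M \<Longrightarrow> f x \<in> carrier R" "f \<in> carrier M \<rightarrow>\<^sub>E carrier R"
  using assms by (auto simp: homB_simps)

lemma homB_eqI:
  assumes "f \<in> carrier (homB M)" "g \<in> carrier (homB M)" "\<And>x. x \<in> carrier M \<Longrightarrow> f x = g x" shows "f = g"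
  using assms by (intro PiE_ext[OF homBD(3) homBD(3)]) auto

lemma L_closed: "z \<in> L \<Longrightarrow> z \<in> carrier R"
  using subfieldE(3)[OF csa.center_subfield] by blast

lemma mor_L: assumes z: "z \<in> L" shows "mor (bops R) B B (\<lambda>x. z \<otimes> x)"
proof (rule morI)
  fix t x assume t: "t \<in> bops R" and x: "x \<in> carrier B"
  show "z \<otimes> act B t x = act B t (z \<otimes> x)"
  proof (cases t)
    case (Inl b)
    then show ?thesis
      using t x L_closed[OF z] L_comm[OF z, of b] csa.m_assoc[of z b x] csa.m_assoc[of b z x] by auto
  next
    case (Inr b)
    then show ?thesis using t x L_closed[OF z] csa.m_assoc[of z x b] by auto
  qed
qed (use L_closed[OF z] in \<open>auto simp: csa.r_distr\<close>)

lemma opmod_homB: assumes M: "bimodule R M" shows "opmod (lops L) (homB M)"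
proof -
  note Bm = B.opmod_bops
  have "abelian_group (homB M)"
  proof (rule abelian_groupI, goal_cases)
    case (1 f g)
    show ?case unfolding homB_simps(3)
      using homBI[OF M mor_plus[OF Bm homBD(1)[OF 1(1)] homBD(1)[OF 1(2)]]] by simp
  next
    case 2
    show ?case unfolding homB_simps(2) using homBI[OF M mor_const_zero[OF Bm]] by simp
  next
    case (3 f g h)
    show ?case unfolding homB_simps(3)
      using homBD(2)[OF 3(1)] homBD(2)[OF 3(2)] homBD(2)[OF 3(3)] by (intro restrict_ext) (simp add: csa.a_assoc)
  next
    case (4 f g)
    show ?case unfolding homB_simps(3)
      using homBD(2)[OF 4(1)] homBD(2)[OF 4(2)] by (intro restrict_ext) (simp add: csa.a_comm)
  next
    case (5 f)
    have "(\<lambda>x \<in> carrier M. (\<lambda>x \<in> carrier M. \<zero>) x \<oplus> f x) = (\<lambda>x \<in> carrier M. f x)"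
      using homBD(2)[OF 5] by (intro restrict_ext) simp
    also have "\<dots> = f" using homBD(3)[OF 5] by (auto simp: PiE_iff extensional_restrict)
    finally show ?case unfolding homB_simps(2,3) .
  next
    case (6 f)
    have "(\<lambda>x \<in> carrier M. \<ominus> f x) \<in> carrier (homB M)"
      using homBI[OF M mor_uminus[OF Bm homBD(1)[OF 6]]] by simp
    moreover have "(\<lambda>x \<in> carrier M. \<ominus> f x) \<oplus>\<^bsub>homB M\<^esub> f = \<zero>\<^bsub>homB M\<^esub>"
      unfolding homB_simps(2,3) using homBD(2)[OF 6] by (intro restrict_ext) (simp add: csa.l_neg)
    ultimately show ?case by blast
  qed
  then show ?thesis
  proof (rule opmodI, goal_cases)
    case (1 t f)
    then obtain z where z: "t = Inl z" "z \<in> L" by auto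
    show ?case using homBI[OF M mor_comp[OF homBD(1)[OF 1(2)] mor_L[OF z(2)]]] z(1) by (simp add: homB_simps(4))
  next
    case (2 t f g)
    then obtain z where z: "t = Inl z" "z \<in> L" by auto
    show ?case unfolding z act_simps homB_simps(3,4)
      using homBD(2)[OF 2(2)] homBD(2)[OF 2(3)] L_closed[OF z(2)] by (intro restrict_ext) (simp add: csa.r_distr)
  qed
qed

lemma homB_pullback:
  assumes M: "bimodule R M" and N: "bimodule R N" and h: "mor (bops R) N M h"
  shows "mor (lops L) (homB M) (homB N) (\<lambda>f. \<lambda>x \<in> carrier N. f (h x))"
proof (rule morI)
  fix f assume "f \<in> carrier (homB M)"
  then show "(\<lambda>x \<in> carrier N. f (h x)) \<in> carrier (homB N)" by (intro homBI[OF N mor_comp[OF h homBD(1)]])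
next
  fix f g
  show "(\<lambda>x \<in> carrier N. (f \<oplus>\<^bsub>homB M\<^esub> g) (h x)) =
      (\<lambda>x \<in> carrier N. f (h x)) \<oplus>\<^bsub>homB N\<^esub> (\<lambda>x \<in> carrier N. g (h x))"
    unfolding homB_simps(3) using mor_closed[OF h] by (intro restrict_ext) simp
next
  fix t f assume "t \<in> lops L"
  then show "(\<lambda>x \<in> carrier N. act (homB M) t f (h x)) = act (homB N) t (\<lambda>x \<in> carrier N. f (h x))"
    using mor_closed[OF h] by (auto simp: homB_simps(4) intro!: restrict_ext)
qed

lemma homB_cong:
  assumes M: "bimodule R M" and N: "bimodule R N" and iso: "M \<simeq>\<^bsub>bops R\<^esub> N"
  shows "homB M \<simeq>\<^bsub>lops L\<^esub> homB N"
proof -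
  interpret Mi: bimodule R M by (rule M)
  obtain h where h: "mor (bops R) M N h" "bij_betw h (carrier M) (carrier N)"
    using iso unfolding mod_iso_def by blast
  obtain g where g: "mor (bops R) N M g" "\<And>x. x \<in> carrier M \<Longrightarrow> g (h x) = x" "\<And>y. y \<in> carrier N \<Longrightarrow> h (g y) = y"
    using mor_inv[OF h Mi.opmod_bops] by metis
  note pg = homB_pullback[OF M N g(1)] and ph = homB_pullback[OF N M h(1)]
  show ?thesis
  proof (rule bij_mor_witness[OF pg mor_closed[OF ph]])
    fix f assume f: "f \<in> carrier (homB M)"
    show "(\<lambda>x \<in> carrier M. (\<lambda>x \<in> carrier N. f (g x)) (h x)) = f"
      by (rule homB_eqI[OF mor_closed[OF ph mor_closed[OF pg f]] f]) (simp add: g(2) mor_closed[OF h(1)])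
  next
    fix f assume f: "f \<in> carrier (homB N)"
    show "(\<lambda>x \<in> carrier N. (\<lambda>x \<in> carrier M. f (h x)) (g x)) = f"
      by (rule homB_eqI[OF mor_closed[OF pg mor_closed[OF ph f]] f]) (simp add: g(3) mor_closed[OF g(1)])
  qed
qed

lemma homB_dsum:
  assumes M: "bimodule R M" and N: "bimodule R N"
  shows "homB (M \<oplus>\<^sub>d N) \<simeq>\<^bsub>lops L\<^esub> homB M \<oplus>\<^sub>d homB N"
proof -
  interpret Mi: bimodule R M by (rule M)
  interpret Ni: bimodule R N by (rule N)
  note MN = bimodule_dsum[OF M N]
  have i: "mor (bops R) M (M \<oplus>\<^sub>d N) (\<lambda>x. (x, \<zero>\<^bsub>N\<^esub>))" "mor (bops R) N (M \<oplus>\<^sub>d N) (\<lambda>y. (\<zero>\<^bsub>M\<^esub>, y))"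
    by (rule morI, auto simp: Mi.smult_zero Ni.smult_zero)+
  have p: "mor (bops R) (M \<oplus>\<^sub>d N) M fst" "mor (bops R) (M \<oplus>\<^sub>d N) N snd" by (rule morI, auto)+
  note i1 = homB_pullback[OF MN M i(1)] and i2 = homB_pullback[OF MN N i(2)]
  note p1 = homB_pullback[OF M MN p(1)] and p2 = homB_pullback[OF N MN p(2)]
  let ?F = "\<lambda>f. (\<lambda>x \<in> carrier M. f (x, \<zero>\<^bsub>N\<^esub>), \<lambda>y \<in> carrier N. f (\<zero>\<^bsub>M\<^esub>, y))"
  let ?G = "\<lambda>w. (\<lambda>x \<in> carrier (M \<oplus>\<^sub>d N). fst w (fst x)) \<oplus>\<^bsub>homB (M \<oplus>\<^sub>d N)\<^esub> (\<lambda>x \<in> carrier (M \<oplus>\<^sub>d N). snd w (snd x))"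
  interpret H: opmod "lops L" "homB (M \<oplus>\<^sub>d N)" by (rule opmod_homB[OF MN])
  have G_eval: "?G w (x, y) = fst w x \<oplus> snd w y" if "x \<in> carrier M" "y \<in> carrier N" for w x y
    using that by (simp add: homB_simps(3))
  have Gc: "?G w \<in> carrier (homB (M \<oplus>\<^sub>d N))" if "w \<in> carrier (homB M \<oplus>\<^sub>d homB N)" for w
    using that mor_closed[OF p1, of "fst w"] mor_closed[OF p2, of "snd w"] by (intro H.add.m_closed) auto
  show ?thesis
  proof (rule bij_mor_witness[where f = ?F and g = ?G])
    show "mor (lops L) (homB (M \<oplus>\<^sub>d N)) (homB M \<oplus>\<^sub>d homB N) ?F"
      by (rule morI) (use mor_closed[OF i1] mor_closed[OF i2] mor_add[OF i1] mor_add[OF i2]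
          mor_act[OF i1] mor_act[OF i2] in \<open>simp_all del: act_simps\<close>)
    show "?G w \<in> carrier (homB (M \<oplus>\<^sub>d N))" if "w \<in> carrier (homB M \<oplus>\<^sub>d homB N)" for w by (rule Gc[OF that])
    show "?G (?F f) = f" if f: "f \<in> carrier (homB (M \<oplus>\<^sub>d N))" for f
    proof (rule homB_eqI[OF Gc f])
      show "?F f \<in> carrier (homB M \<oplus>\<^sub>d homB N)" using mor_closed[OF i1 f] mor_closed[OF i2 f] by simp
      fix w assume "w \<in> carrier (M \<oplus>\<^sub>d N)"
      then obtain x y where w: "w = (x, y)" "x \<in> carrier M" "y \<in> carrier N" by auto
      show "?G (?F f) w = f w" unfolding w(1) G_eval[OF w(2,3)]
        using mor_add[OF homBD(1)[OF f], of "(x, \<zero>\<^bsub>N\<^esub>)" "(\<zero>\<^bsub>M\<^esub>, y)"] w by simp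
    qed
    show "?F (?G w) = w" if w: "w \<in> carrier (homB M \<oplus>\<^sub>d homB N)" for w
    proof -
      have w12: "fst w \<in> carrier (homB M)" "snd w \<in> carrier (homB N)" using w by auto
      have z: "fst w \<zero>\<^bsub>M\<^esub> = \<zero>" "snd w \<zero>\<^bsub>N\<^esub> = \<zero>"
        using mor_zero[OF homBD(1)[OF w12(1)] Mi.M.abelian_group_axioms abelian_regular]
          mor_zero[OF homBD(1)[OF w12(2)] Ni.M.abelian_group_axioms abelian_regular] by simp_all
      have "fst (?F (?G w)) = fst w"
        by (rule homB_eqI[OF _ w12(1)]) (use mor_closed[OF i1 Gc[OF w]] G_eval z homBD(2)[OF w12(1)] in simp_all)
      moreover have "snd (?F (?G w)) = snd w"
        by (rule homB_eqI[OF _ w12(2)]) (use mor_closed[OF i2 Gc[OF w]] G_eval z homBD(2)[OF w12(2)] in simp_all)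
      ultimately show ?thesis by (simp add: prod_eq_iff)
    qed
  qed
qed

lemma homB_dpow:
  assumes M: "bimodule R M" shows "homB (M ^\<^sub>d n) \<simeq>\<^bsub>lops L\<^esub> homB M ^\<^sub>d n"
proof (induction n)
  case 0
  interpret Mi: bimodule R "M ^\<^sub>d 0" by (rule bimodule_dpow[OF M])
  interpret H: opmod "lops L" "homB (M ^\<^sub>d 0)" by (rule opmod_homB[OF bimodule_dpow[OF M]])
  have "f = \<zero>\<^bsub>homB (M ^\<^sub>d 0)\<^esub>" if f: "f \<in> carrier (homB (M ^\<^sub>d 0))" for f
  proof (rule homB_eqI[OF f H.zero_closed])
    fix x assume x: "x \<in> carrier (M ^\<^sub>d 0)"
    then have "x = \<zero>\<^bsub>M ^\<^sub>d 0\<^esub>" using dpow_zero[of M] by blast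
    then show "f x = \<zero>\<^bsub>homB (M ^\<^sub>d 0)\<^esub> x"
      using mor_zero[OF homBD(1)[OF f] Mi.M.abelian_group_axioms abelian_regular] x unfolding homB_simps(2)
      by (simp del: ipow_simps)
  qed
  then have "carrier (homB (M ^\<^sub>d 0)) = {\<zero>\<^bsub>homB (M ^\<^sub>d 0)\<^esub>}" using H.zero_closed by blast
  then show ?case by (rule zero_iso[OF H.opmod_axioms opmod_ipow[OF opmod_homB[OF M]] _ dpow_zero])
next
  case (Suc n)
  note Mn = bimodule_dpow[OF M]
  have "homB (M ^\<^sub>d Suc n) \<simeq>\<^bsub>lops L\<^esub> homB (M \<oplus>\<^sub>d M ^\<^sub>d n)"
    by (rule homB_cong[OF Mn bimodule_dsum[OF M Mn] dpow_Suc])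
  also have "\<dots> \<simeq>\<^bsub>lops L\<^esub> homB M \<oplus>\<^sub>d homB (M ^\<^sub>d n)" by (rule homB_dsum[OF M Mn])
  also have "\<dots> \<simeq>\<^bsub>lops L\<^esub> homB M \<oplus>\<^sub>d homB M ^\<^sub>d n" by (rule dsum_cong[OF iso_refl Suc])
  also have "\<dots> \<simeq>\<^bsub>lops L\<^esub> homB M ^\<^sub>d Suc n"
    by (rule iso_sym[OF opmod_ipow[OF opmod_homB[OF M]] dpow_Suc])
  finally show ?case .
qed

text \<open>A bimodule map on the tensor square is determined by the image of \<open>1 \<otimes> 1\<close>, which is
  arbitrary.\<close>

lemma homB_A: "homB A \<simeq>\<^bsub>lops L\<^esub> B"
proof (rule bij_mor_witness[where f = "\<lambda>f. f (BB.\<iota> \<one> \<one>)" and g = "\<lambda>b. \<lambda>a \<in> carrier A. gen_map B b a"])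
  have t: "BB.\<iota> \<one> \<one> \<in> carrier A" by (rule BB.\<iota>_closed) simp_all
  show "mor (lops L) (homB A) B (\<lambda>f. f (BB.\<iota> \<one> \<one>))"
  proof (rule morI)
    fix f assume "f \<in> carrier (homB A)"
    then show "f (BB.\<iota> \<one> \<one>) \<in> carrier B" unfolding regular_simps by (rule homBD(2)[OF _ t])
  next
    fix f g show "(f \<oplus>\<^bsub>homB A\<^esub> g) (BB.\<iota> \<one> \<one>) = f (BB.\<iota> \<one> \<one>) \<oplus>\<^bsub>B\<^esub> g (BB.\<iota> \<one> \<one>)"
      using t by (simp add: homB_simps(3) del: tw_simps)
  next
    fix s f assume "s \<in> lops L"
    then show "act (homB A) s f (BB.\<iota> \<one> \<one>) = act B s (f (BB.\<iota> \<one> \<one>))"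
      using t by (auto simp: homB_simps(4) simp del: tw_simps)
  qed
  show gc: "(\<lambda>a \<in> carrier A. gen_map B b a) \<in> carrier (homB A)" if b: "b \<in> carrier B" for b
    by (rule homBI[OF BB.bimodule_W gen_map_mor[OF B.bimodule_axioms central_B b]])
  show "(\<lambda>a \<in> carrier A. gen_map B b a) (BB.\<iota> \<one> \<one>) = b" if b: "b \<in> carrier B" for b
    using t gen_map_\<iota>[OF B.bimodule_axioms central_B b, of \<one> \<one>] b by (simp del: tw_simps)
  show "(\<lambda>a \<in> carrier A. gen_map B (f (BB.\<iota> \<one> \<one>)) a) = f" if f: "f \<in> carrier (homB A)" for f
  proof (rule homB_eqI[OF gc f])
    show "f (BB.\<iota> \<one> \<one>) \<in> carrier B" unfolding regular_simps by (rule homBD(2)[OF f t])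
    fix a assume a: "a \<in> carrier A"
    show "(\<lambda>a \<in> carrier A. gen_map B (f (BB.\<iota> \<one> \<one>)) a) a = f a"
      using gen_map_natural[OF BB.bimodule_W B.bimodule_axioms homBD(1)[OF f] t a] gen_map_one[OF a] a
      by (simp del: tw_simps)
  qed
qed

subsection \<open>The main argument\<close>

lemma finite_length_bops_P: "finite_length (bops R) P"
  by (rule finite_length_ops_mono[OF finite_length_P]) auto

lemma finite_length_bops_A: "finite_length (bops R) A"
proof -
  have "finite_length (lops (carrier R)) B"
    by (rule finite_length_ops_mono[OF csa.regular_finite_length[OF csa.center_subfield dim]])
      (use L_closed in auto)
  then have fl: "finite_length (lops (carrier R)) (ipow B X)"
    by (intro finite_length_ipow B.opmod_lops subset_refl D.fin)
  have "finite_length (lops (carrier R)) A"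
  proof (rule finite_length_transfer[OF fl])
    fix U assume U: "submod (lops (carrier R)) A U"
    have "\<ominus>\<^bsub>ipow B X\<^esub> x = \<ominus>\<^bsub>A\<^esub> x" for x by (simp add: a_inv_def m_inv_def)
    then show "submod (lops (carrier R)) (ipow B X) U" using U unfolding submod_def by auto
  qed
  then show ?thesis by (rule finite_length_ops_mono) auto
qed

lemma A_nonzero: "carrier A \<noteq> {\<zero>\<^bsub>A\<^esub>}"
proof
  assume A0: "carrier A = {\<zero>\<^bsub>A\<^esub>}"
  have "X \<noteq> {}" using \<sigma>_expand[OF csa.one_closed] csa.one_not_zero by auto
  then obtain x where x: "x \<in> X" by blast
  have "BB.\<iota> \<one> x \<in> carrier A" using X_closed[OF x] by (intro BB.\<iota>_closed) simp_all
  then have "BB.\<iota> \<one> x x = \<zero>\<^bsub>A\<^esub> x" unfolding A0 by simp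
  then show False using x \<sigma>_dual[OF x x] csa.one_not_zero by (simp add: BB.\<iota>_def)
qed

text \<open>Since \<open>T\<close> multiplies powers of \<open>P\<close> and of \<open>A\<close> by \<open>d\<close>, cancellation shows that it does the same
  with the complement \<open>Y\<close>. The values at \<open>1\<close> of the coefficients of a nonzero \<open>Y\<close> form a nonzero two-sided
  ideal, so some coefficient \<open>s\<close> of \<open>Y\<close> fixes \<open>1\<close>, and hence \<open>K\<close> pointwise. Then \<open>\<sigma>\<^sub>x = s \<circ> \<sigma>\<^sub>x\<close> is a coefficient
  of \<open>T Y\<close>, so every indecomposable summand of \<open>A\<close> occurs in \<open>T Y\<close>, a power of \<open>Y\<close>.\<close>

lemma indec_summand_of_complement:
  fixes Z :: "('a, 'f) bimodule"
  assumes Y: "submod (bops R) (P ^\<^sub>d v) Y" and nz: "Y \<noteq> {\<zero>\<^bsub>P ^\<^sub>d v\<^esub>}"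
    and iso: "P ^\<^sub>d v \<simeq>\<^bsub>bops R\<^esub> A ^\<^sub>d u \<oplus>\<^sub>d sub (P ^\<^sub>d v) Y"
    and Z: "indec (bops R) Z" "Z \<unlhd>\<^bsub>bops R\<^esub> A"
  shows "Z \<unlhd>\<^bsub>bops R\<^esub> sub (P ^\<^sub>d v) Y"
proof -
  let ?Y = "sub (P ^\<^sub>d v) Y"
  note P = bimodule_axioms and Abi = BB.bimodule_W
  have Pv: "bimodule R (P ^\<^sub>d v)" by (rule bimodule_dpow[OF P])
  have Yb: "bimodule R ?Y" by (rule bimodule_sub[OF Pv Y])
  interpret Yb: bimodule R ?Y by (rule Yb)
  interpret Pv: bimodule R "P ^\<^sub>d v" by (rule Pv)
  interpret AA: bimodule R A by (rule Abi)
  interpret TY: tensor_basis R ?Y P "carrier R" "{..<d}" e c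
    by (intro tensor_basis.intro Yb lbasis_axioms)
  have \<Phi>_eq: "PP.\<Psi> = \<Phi>" "TY.\<Psi> = \<Phi>" "(\<lambda>b i j. c j (e i \<odot>\<^sup>r\<^bsub>P\<^esub> b)) = \<Phi>"
    by (intro HOL.ext; simp add: PP.\<Psi>_def TY.\<Psi>_def \<Phi>_def)+
  have TP: "T P \<simeq>\<^bsub>bops R\<^esub> P ^\<^sub>d d" using square unfolding \<Phi>_eq .
  have Tb: "opmod (bops R) (T M)" if "bimodule R M" for M :: "('a, 'g) bimodule"
    by (rule opmod_tw[OF that \<Phi>_closed])
  have TYb: "bimodule R (T ?Y)" using TY.bimodule_W unfolding \<Phi>_eq .
  \<comment> \<open>a coefficient of \<open>Y\<close> that does not vanish at \<open>1\<close>\<close>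
  obtain y0 where y0: "y0 \<in> Y" "y0 \<noteq> \<zero>\<^bsub>P ^\<^sub>d v\<^esub>" using nz submodD(2)[OF Y] by auto
  have y0c: "y0 \<in> carrier (P ^\<^sub>d v)" by (rule submodD(1)[OF Y y0(1)])
  obtain i where i: "i < v" "y0 i \<noteq> \<zero>\<^bsub>P\<^esub>"
  proof -
    have "y0 = \<zero>\<^bsub>P ^\<^sub>d v\<^esub>" if "\<And>i. i < v \<Longrightarrow> y0 i = \<zero>\<^bsub>P\<^esub>"
      using y0c Pv.M.zero_closed that by (intro PiE_ext[where k = "{..<v}" and s = "\<lambda>_. carrier P"]) auto
    then show thesis using y0(2) that by blast
  qed
  have y0i: "y0 i \<in> carrier P" using y0c i(1) by auto
  have c0: "c l \<zero>\<^bsub>P\<^esub> = \<zero>" if "l < d" for l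
    using mor_zero[OF c_mor M.abelian_group_axioms abelian_regular, of l] that by simp
  obtain l where l: "l < d" "c l (y0 i) \<noteq> \<zero>"
    using lbasis.ext[OF lbasis_axioms y0i M.zero_closed] i(2) c0 by auto
  have \<eta>: "mor (lops (carrier R)) ?Y B (\<lambda>y. c l (y i))"
  proof (rule mor_comp[OF _ c_mor])
    show "mor (lops (carrier R)) ?Y P (\<lambda>y. y i)"
      by (rule morI) (use i(1) submodD(1)[OF Y] in auto)
  qed (use l in simp)
  define J where "J = {s \<one> | s. s \<in> coef R ?Y}"
  have J: "c l (y0 i) \<in> J"
  proof -
    have "c l ((y0 \<odot>\<^sup>r\<^bsub>?Y\<^esub> \<one>) i) = c l (y0 i)" using i(1) y0i by (simp add: rsmult_one)
    then show ?thesis unfolding J_def using coef.basic[OF \<eta>, of y0] y0(1)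
      by (intro CollectI exI[of _ "\<lambda>y. c l ((y0 \<odot>\<^sup>r\<^bsub>?Y\<^esub> y) i)"]) simp
  qed
  have "J = carrier R"
  proof (rule csa.two_sided_full[OF _ J l(2)])
    show "a \<oplus> b \<in> J" if ab: "a \<in> J" "b \<in> J" for a b
    proof -
      obtain s t where "s \<in> coef R ?Y" "t \<in> coef R ?Y" "a = s \<one>" "b = t \<one>" using ab unfolding J_def by blast
      then show ?thesis unfolding J_def using coef.add[of s R ?Y t] by (intro CollectI exI[of _ "\<lambda>y. s y \<oplus> t y"]) simp
    qed
    show "a \<otimes> b \<in> J" "b \<otimes> a \<in> J" if a: "a \<in> carrier R" and b: "b \<in> J" for a b
    proof -
      obtain s where s: "s \<in> coef R ?Y" "b = s \<one>" using b unfolding J_def by blast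
      show "a \<otimes> b \<in> J" unfolding J_def using Yb.coef_left[OF s(1) a] s(2)
        by (intro CollectI exI[of _ "\<lambda>y. a \<otimes> s y"]) simp
      show "b \<otimes> a \<in> J" unfolding J_def using Yb.coef_right[OF s(1) a] s(2)
        by (intro CollectI exI[of _ "\<lambda>y. s y \<otimes> a"]) simp
    qed
  qed (use Yb.coef_closed in \<open>auto simp: J_def\<close>)
  then have "\<one> \<in> J" by simp
  then obtain s where s: "s \<in> coef R ?Y" "s \<one> = \<one>" unfolding J_def by force
  have central_Y: "central ?Y"
    unfolding central_def
  proof (intro ballI)
    fix z y assume z: "z \<in> K" and y: "y \<in> carrier ?Y"
    then have "y i \<in> carrier P" if "i < v" for i using submodD(1)[OF Y, of y] that by auto
    then show "z \<odot>\<^bsub>?Y\<^esub> y = y \<odot>\<^sup>r\<^bsub>?Y\<^esub> z" using center_act[OF z] by (auto intro!: restrict_ext)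
  qed
  have lin: "s (z \<otimes> \<one>) = z \<otimes> s \<one>" if "z \<in> K" for z
    using s(1)
  proof (induction rule: coef.induct)
    case (basic \<xi> p)
    note zc = center_closed[OF that]
    have "p \<odot>\<^sup>r\<^bsub>?Y\<^esub> (z \<otimes> \<one>) = z \<odot>\<^bsub>?Y\<^esub> (p \<odot>\<^sup>r\<^bsub>?Y\<^esub> \<one>)"
      using bspec[OF bspec[OF central_Y[unfolded central_def] that] basic(2)]
      by (simp only: csa.r_one[OF zc] Yb.rsmult_one[OF basic(2)])
    then show ?case using mor_act[OF basic(1), of "p \<odot>\<^sup>r\<^bsub>?Y\<^esub> \<one>" "Inl z"] basic(2) zc Yb.rsmult_closed[OF csa.one_closed, of p] by simp
  next
    case (add s t)
    then show ?case using Yb.coef_closed[OF add(1)] Yb.coef_closed[OF add(2)] center_closed[OF that] by (simp add: csa.r_distr)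
  next
    case (ext s t)
    then show ?case using center_closed[OF that] by simp
  qed
  have coef_TY: "\<sigma> x \<in> coef R (T ?Y)" if x: "x \<in> X" for x
  proof -
    have "(\<lambda>y. s (\<sigma> x y)) \<in> coef R (T ?Y)"
      using TY.coef_comp[OF refl s(1) \<sigma>_coef[OF x]] unfolding \<Phi>_eq .
    then show ?thesis
    proof (rule coef.ext)
      fix y assume y: "y \<in> carrier R"
      show "\<sigma> x y = s (\<sigma> x y)" using lin[OF \<sigma>_in[OF x y]] s(2) \<sigma>_closed[OF x y] by simp
    qed
  qed
  have central_TY: "central (T ?Y)"
    unfolding central_def
  proof (intro ballI)
    fix z f assume z: "z \<in> K" and f: "f \<in> carrier (T ?Y)"
    have "z \<odot>\<^bsub>TY.W\<^esub> f = f \<odot>\<^sup>r\<^bsub>TY.W\<^esub> z"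
    proof (rule TY.W_central)
      show "z \<in> carrier R" by (rule center_closed[OF z])
      show "z \<odot>\<^bsub>?Y\<^esub> y = y \<odot>\<^sup>r\<^bsub>?Y\<^esub> z" if "y \<in> carrier ?Y" for y using central_Y z that unfolding central_def by blast
      show "f \<in> carrier TY.W" using f unfolding \<Phi>_eq .
    qed (rule center_act[OF z])
    then show "z \<odot>\<^bsub>T ?Y\<^esub> f = f \<odot>\<^sup>r\<^bsub>T ?Y\<^esub> z" unfolding \<Phi>_eq .
  qed
  have ZT: "Z \<unlhd>\<^bsub>bops R\<^esub> T ?Y"
    by (rule indec_summand_of_coef[OF TYb central_TY coef_TY Z])
  \<comment> \<open>compare two decompositions of \<open>T (P ^ v)\<close> and cancel the power of \<open>A\<close>\<close>
  note Au = bimodule_dpow[OF Abi, of u]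
  note opA = AA.opmod_bops and opY = Yb.opmod_bops
  have "A ^\<^sub>d (d * u) \<oplus>\<^sub>d T ?Y \<simeq>\<^bsub>bops R\<^esub> (A ^\<^sub>d d) ^\<^sub>d u \<oplus>\<^sub>d T ?Y"
  proof (rule dsum_cong[OF _ iso_refl])
    have "(A ^\<^sub>d d) ^\<^sub>d u \<simeq>\<^bsub>bops R\<^esub> A ^\<^sub>d (d * u)" using dpow_mult[OF opA, of d u] by (simp add: mult.commute)
    then show "A ^\<^sub>d (d * u) \<simeq>\<^bsub>bops R\<^esub> (A ^\<^sub>d d) ^\<^sub>d u" by (rule iso_sym[rotated]) (intro opmod_ipow opA)
  qed
  also have "\<dots> \<simeq>\<^bsub>bops R\<^esub> T (A ^\<^sub>d u) \<oplus>\<^sub>d T ?Y"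
  proof (rule dsum_cong[OF _ iso_refl])
    have "T (A ^\<^sub>d u) \<simeq>\<^bsub>bops R\<^esub> T A ^\<^sub>d u" by (rule tw_dpow[OF Abi finite_lessThan \<Phi>_closed])
    also have "\<dots> \<simeq>\<^bsub>bops R\<^esub> (A ^\<^sub>d d) ^\<^sub>d u" by (rule ipow_cong[OF T_A Tb[OF Abi]])
    finally show "(A ^\<^sub>d d) ^\<^sub>d u \<simeq>\<^bsub>bops R\<^esub> T (A ^\<^sub>d u)" by (rule iso_sym[OF Tb[OF Au]])
  qed
  also have "\<dots> \<simeq>\<^bsub>bops R\<^esub> T (A ^\<^sub>d u \<oplus>\<^sub>d ?Y)"
    by (rule iso_sym[OF Tb[OF bimodule_dsum[OF Au Yb]] tw_dsum[OF Au Yb finite_lessThan \<Phi>_closed]])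
  also have "\<dots> \<simeq>\<^bsub>bops R\<^esub> T (P ^\<^sub>d v)"
    by (rule iso_sym[OF Tb[OF Pv] tw_cong_left[OF Pv bimodule_dsum[OF Au Yb] iso finite_lessThan \<Phi>_closed]])
  also have "\<dots> \<simeq>\<^bsub>bops R\<^esub> T P ^\<^sub>d v" by (rule tw_dpow[OF P finite_lessThan \<Phi>_closed])
  also have "\<dots> \<simeq>\<^bsub>bops R\<^esub> (P ^\<^sub>d d) ^\<^sub>d v" by (rule ipow_cong[OF TP Tb[OF P]])
  also have "\<dots> \<simeq>\<^bsub>bops R\<^esub> P ^\<^sub>d (v * d)" by (rule dpow_mult[OF opmod_bops])
  also have "P ^\<^sub>d (v * d) \<simeq>\<^bsub>bops R\<^esub> (P ^\<^sub>d v) ^\<^sub>d d"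
    using iso_sym[OF opmod_ipow[OF opmod_ipow[OF opmod_bops]] dpow_mult[OF opmod_bops, of v d]]
    by (simp only: mult.commute[of d v])
  also have "\<dots> \<simeq>\<^bsub>bops R\<^esub> (A ^\<^sub>d u \<oplus>\<^sub>d ?Y) ^\<^sub>d d" by (rule ipow_cong[OF iso Pv.opmod_bops])
  also have "\<dots> \<simeq>\<^bsub>bops R\<^esub> (A ^\<^sub>d u) ^\<^sub>d d \<oplus>\<^sub>d ?Y ^\<^sub>d d" by (rule dpow_dsum[OF opmod_ipow[OF opA] opY])
  also have "\<dots> \<simeq>\<^bsub>bops R\<^esub> A ^\<^sub>d (d * u) \<oplus>\<^sub>d ?Y ^\<^sub>d d" by (rule dsum_cong[OF dpow_mult[OF opA] iso_refl])
  finally have "T ?Y \<simeq>\<^bsub>bops R\<^esub> ?Y ^\<^sub>d d"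
    by (rule cancel[OF finite_length_ipow[OF opA finite_length_bops_A finite_lessThan] opmod_ipow[OF opA]
          Tb[OF Yb] opmod_ipow[OF opY]])
  then have "Z \<unlhd>\<^bsub>bops R\<^esub> ?Y ^\<^sub>d d" by (rule summand_trans[OF ZT iso_summand[OF Tb[OF Yb]]])
  then show ?thesis by (rule indec_summand_dpow[OF Z(1) opY])
qed

theorem dpow_iso:
  obtains r where "0 < r" "P ^\<^sub>d w \<simeq>\<^bsub>bops R\<^esub> A ^\<^sub>d r"
proof -
  interpret AA: bimodule R A by (rule BB.bimodule_W)
  note P = bimodule_axioms and opP = opmod_bops and opA = AA.opmod_bops
  have ZP: "Z \<unlhd>\<^bsub>bops R\<^esub> P" if "indec (bops R) Z" "Z \<unlhd>\<^bsub>bops R\<^esub> A" for Z :: "('a, nat \<Rightarrow> 'a \<Rightarrow> 'a) bimodule"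
    by (rule indec_summand_of_coef[OF P central_P \<sigma>_coef that])
  obtain u v Y and Z :: "('a, nat \<Rightarrow> 'a \<Rightarrow> 'a) bimodule" where uv: "0 < u" "0 < v"
    and Y: "submod (bops R) (P ^\<^sub>d v) Y" "P ^\<^sub>d v \<simeq>\<^bsub>bops R\<^esub> A ^\<^sub>d u \<oplus>\<^sub>d sub (P ^\<^sub>d v) Y"
    and Z: "indec (bops R) Z" "Z \<unlhd>\<^bsub>bops R\<^esub> A" "\<not> Z \<unlhd>\<^bsub>bops R\<^esub> sub (P ^\<^sub>d v) Y"
    using exists_exhausted_summand[OF opP finite_length_bops_P opA finite_length_bops_A A_nonzero ZP] by blast
  have "Y = {\<zero>\<^bsub>P ^\<^sub>d v\<^esub>}" using indec_summand_of_complement[OF Y(1) _ Y(2) Z(1,2)] Z(3) by blast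
  then have Y0: "carrier (sub (P ^\<^sub>d v) Y) = {\<zero>\<^bsub>sub (P ^\<^sub>d v) Y\<^esub>}" by simp
  have opY: "opmod (bops R) (sub (P ^\<^sub>d v) Y)" by (rule opmod_sub[OF opmod_ipow[OF opP] Y(1)])
  have PA: "P ^\<^sub>d v \<simeq>\<^bsub>bops R\<^esub> A ^\<^sub>d u"
    by (rule iso_trans[OF iso_trans[OF Y(2) dsum_comm] dsum_zero[OF opY opmod_ipow[OF opA] Y0]])
  \<comment> \<open>divisibility, by comparing the homomorphisms to the algebra\<close>
  let ?L = "sub B L"
  note hP = opmod_homB[OF P] and hA = opmod_homB[OF BB.bimodule_W]
  have Ll: "indec (lops L) ?L" by (rule csa.indec_subfield[OF csa.center_subfield])
  have Lm: "opmod (lops L) ?L" using Ll by (simp add: indec_def)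
  have BL: "opmod (lops L) B" by (rule B.opmod_lops) (use L_closed in blast)
  have "?L ^\<^sub>d w \<simeq>\<^bsub>lops L\<^esub> sub B (carrier B)"
    using csa.dimension_iso[OF csa.center_subfield dim] by simp
  then have BLw: "B \<simeq>\<^bsub>lops L\<^esub> ?L ^\<^sub>d w" using iso_sym[OF opmod_ipow[OF Lm]] by (simp only: sub_simps)
  have "homB P ^\<^sub>d v \<simeq>\<^bsub>lops L\<^esub> homB (P ^\<^sub>d v)"
    by (rule iso_sym[OF opmod_homB[OF bimodule_dpow[OF P]] homB_dpow[OF P]])
  also have "\<dots> \<simeq>\<^bsub>lops L\<^esub> homB (A ^\<^sub>d u)"
    by (rule homB_cong[OF bimodule_dpow[OF P] bimodule_dpow[OF BB.bimodule_W] PA])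
  also have "\<dots> \<simeq>\<^bsub>lops L\<^esub> homB A ^\<^sub>d u" by (rule homB_dpow[OF BB.bimodule_W])
  also have "\<dots> \<simeq>\<^bsub>lops L\<^esub> (?L ^\<^sub>d w) ^\<^sub>d u" by (rule ipow_cong[OF iso_trans[OF homB_A BLw] hA])
  also have "\<dots> \<simeq>\<^bsub>lops L\<^esub> ?L ^\<^sub>d (u * w)" by (rule dpow_mult[OF Lm])
  finally obtain r where r: "v * r = u * w" using dpow_indec_exponent[OF Ll hP uv(2)] by blast
  have "w \<noteq> 0"
  proof
    assume "w = 0"
    then have "carrier R = {\<zero>}" using dim csa.dimension_zero[of L "carrier R"] csa.center_subfield by simp
    then show False using csa.one_not_zero csa.one_closed by blast
  qed
  then have "0 < r" using r uv by (cases r) auto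
  have "(P ^\<^sub>d w) ^\<^sub>d v \<simeq>\<^bsub>bops R\<^esub> P ^\<^sub>d (v * w)" by (rule dpow_mult[OF opP])
  also have "P ^\<^sub>d (v * w) \<simeq>\<^bsub>bops R\<^esub> (P ^\<^sub>d v) ^\<^sub>d w"
    using iso_sym[OF opmod_ipow[OF opmod_ipow[OF opP]] dpow_mult[OF opP, of v w]]
    by (simp only: mult.commute[of w v])
  also have "\<dots> \<simeq>\<^bsub>bops R\<^esub> (A ^\<^sub>d u) ^\<^sub>d w" by (rule ipow_cong[OF PA opmod_ipow[OF opP]])
  also have "\<dots> \<simeq>\<^bsub>bops R\<^esub> A ^\<^sub>d (v * r)" using dpow_mult[OF opA, of u w] r by (simp only: mult.commute[of w u])
  also have "A ^\<^sub>d (v * r) \<simeq>\<^bsub>bops R\<^esub> (A ^\<^sub>d r) ^\<^sub>d v"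
    by (rule iso_sym[OF opmod_ipow[OF opmod_ipow[OF opA]] dpow_mult[OF opA]])
  finally have "P ^\<^sub>d w \<simeq>\<^bsub>bops R\<^esub> A ^\<^sub>d r"
    by (rule dpow_root[OF opmod_ipow[OF opP] opmod_ipow[OF opA]
          finite_length_ipow[OF opP finite_length_bops_P finite_lessThan]
          finite_length_ipow[OF opA finite_length_bops_A finite_lessThan] uv(2)])
  with \<open>0 < r\<close> show thesis by (rule that)
qed

end

theorem corollary2p38:
  fixes B :: "('a, 'k) ring_scheme" and L :: "'a set" and P :: "('a, 'b) bimodule"
    and m d :: nat
  assumes "central_simple_algebra L B"
    and "ring.dimension B (m ^ 2) L (carrier B)"
    and "galois_bimodule B P d"
  shows "\<exists>r::nat. 0 < r \<and>
    bimodule_iso B (bimodule_power P (m ^ 2))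
      (bimodule_power
        (tensor (bimodule_center B P) (regular_bimodule B) (regular_bimodule B)) r)"
proof -
  interpret csa: central_simple_algebra L B by fact
  interpret P: galois_bimodule B P d by fact
  interpret reg: bimodule B "regular_bimodule B" by (rule csa.bimodule_regular)
  have reg: "sub (regular_bimodule B) (carrier B) = regular_bimodule B"
    using sub_simps(8)[of "regular_bimodule B"] by simp
  have "ipow (sub (regular_bimodule B) (carrier B)) {..<d} \<simeq>\<^bsub>lops (carrier B)\<^esub> P"
    using P.left_free unfolding left_free_def left_module_iso_iff bimodule_power_eq reg .
  from lbasis_of_iso[OF P.bimodule_axioms csa.carrier_is_subring finite_lessThan this]
  obtain e c where ec: "lbasis B P (carrier B) {..<d} e c" by blast
  interpret ec: lbasis B P "carrier B" "{..<d}" e c by (rule ec)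
  have "ipow (regular_bimodule B) {..<d} \<simeq>\<^bsub>rops (carrier B)\<^esub> P"
    using P.right_free unfolding right_free_def right_module_iso_iff bimodule_power_eq .
  then obtain q \<beta> where q: "\<And>i. i \<in> {..<d} \<Longrightarrow> q i \<in> carrier P"
    "\<And>i. i \<in> {..<d} \<Longrightarrow> mor (rops (carrier B)) P (regular_bimodule B) (\<beta> i)"
    "\<And>i j. i \<in> {..<d} \<Longrightarrow> j \<in> {..<d} \<Longrightarrow> \<beta> i (q j) = (if i = j then \<one>\<^bsub>B\<^esub> else \<zero>\<^bsub>B\<^esub>)"
    "\<And>y. y \<in> carrier P \<Longrightarrow> finsum P (\<lambda>i. q i \<odot>\<^sup>r\<^bsub>P\<^esub> \<beta> i y) {..<d} = y"
    by (rule rbasis_of_iso[OF P.bimodule_axioms finite_lessThan]) (rule that; assumption)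
  interpret PP: tensor_basis B P P "carrier B" "{..<d}" e c
    by (intro tensor_basis.intro P.bimodule_axioms ec)
  have \<Psi>: "PP.\<Psi> = (\<lambda>b i j. c j (e i \<odot>\<^sup>r\<^bsub>P\<^esub> b))" by (intro HOL.ext) (simp add: PP.\<Psi>_def)
  have "PP.W \<simeq>\<^bsub>bops B\<^esub> P ^\<^sub>d d"
  proof (rule iso_trans[OF iso_sym[OF _ PP.tensor_iso_tw]])
    interpret T: bimodule_pair B P P "carrier B" by unfold_locales simp
    show "opmod (bops B) (tensor (carrier B) P P)" by (rule bimodule.opmod_bops[OF T.bimodule_tensor])
    show "tensor (carrier B) P P \<simeq>\<^bsub>bops B\<^esub> P ^\<^sub>d d"
      using P.tensor_self unfolding bimodule_iso_iff bimodule_power_eq .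
  qed
  then have square: "tw P {..<d} (\<lambda>b i j. c j (e i \<odot>\<^sup>r\<^bsub>P\<^esub> b)) \<simeq>\<^bsub>bops B\<^esub> P ^\<^sub>d d" unfolding \<Psi> .
  have coords: "galois_coords L B P d e c q \<beta> (m ^ 2)"
    by (intro galois_coords.intro galois_coords_axioms.intro assms(1,2) ec square)
      (use P.rank_pos q in auto)
  interpret coords: galois_coords L B P d e c q \<beta> "m ^ 2" by (rule coords)
  obtain X \<sigma> where X: "lbasis B (regular_bimodule B) (bimodule_center B P) X (\<lambda>x. x) \<sigma>"
    "\<And>x. x \<in> X \<Longrightarrow> \<sigma> x \<in> coef B P"
    by (rule coords.exists_dual_basis) (rule that)
  interpret D: galois_dual L B P d e c q \<beta> "m ^ 2" X \<sigma>
    by (intro galois_dual.intro galois_dual_axioms.intro coords X)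
  obtain r where r: "0 < r" "P ^\<^sub>d (m ^ 2) \<simeq>\<^bsub>bops B\<^esub> D.A ^\<^sub>d r" by (rule D.dpow_iso)
  interpret T: bimodule_pair B "regular_bimodule B" "regular_bimodule B" "bimodule_center B P"
    by unfold_locales (auto simp: bimodule_center_def)
  let ?A = "tensor (bimodule_center B P) (regular_bimodule B) (regular_bimodule B)"
  have "opmod (bops B) ?A" by (rule bimodule.opmod_bops[OF T.bimodule_tensor])
  then have "D.A ^\<^sub>d r \<simeq>\<^bsub>bops B\<^esub> ?A ^\<^sub>d r"
    by (rule ipow_cong[OF iso_sym[OF _ D.BB.tensor_iso_tw] D.BB.opmod_W])
  from iso_trans[OF r(2) this] show ?thesis
    using r(1) unfolding bimodule_iso_iff bimodule_power_eq by blast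
qed

end
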